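(* There exists a numerical constant $C>0$ such that for every dimension $n$ and any two functions $f,g\in \mathrm{LC}_g(\mathbb{R}^n)$ with center of mass at the origin, one has $$C^{-n}N(g^{*},f^{*})\le N(f,g)\le C^{n}N(g^{*},f^{*}).$$
   Context: $\mathrm{LC}_g(\mathbb{R}^n)$ is the class of geometric log-concave functions: upper semi-continuous $f:\mathbb{R}^n\to[0,1]$ with $-\log f$ convex (values in $[0,\infty]$), $\max f=f(0)=1$, and $0<\int f<\infty$. "Center of mass at the origin" means $\int x f(x)\,dx=0$. For $f=e^{-\varphi}$, the dual is $f^*=e^{-\mathcal{L}\varphi}$ with $\mathcal{L}\varphi(y)=\sup_{x}(\langle y,x\rangle-\varphi(x))$. The functional covering number is $N(f,g)=\inf\{\mu(\mathbb{R}^n)\}$ over all non-negative Borel measures $\mu$ on $\mathbb{R}^n$ such that $(\mu*g)(x)=\int g(x-t)\,d\mu(t)\ge f(x)$ for all $x\in\mathbb{R}^n$. *)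

theory Defs
  imports "HOL-Analysis.Analysis"
begin

text \<open>
  The constant of the theorem does not depend on the dimension, so \<open>n\<close> has to be
  quantified inside the statement and cannot be a type index.  A point of \<open>R^n\<close> is
  therefore an extensional function on the index set \<open>{..<n}\<close>; this is at once the space of
  the product measure and the underlying set of the product topology over \<open>{..<n}\<close>.
  Functions on \<open>R^n\<close> are HOL functions whose values outside \<open>Rn n\<close> are irrelevant.
\<close>

definition Rn :: "nat \<Rightarrow> (nat \<Rightarrow> real) set" where
  "Rn n = {..<n} \<rightarrow>\<^sub>E UNIV"

definition Rn_topology :: "nat \<Rightarrow> (nat \<Rightarrow> real) topology" where
  "Rn_topology n = product_topology (\<lambda>_. euclideanreal) {..<n}"

definition Rn_lborel :: "nat \<Rightarrow> (nat \<Rightarrow> real) measure" where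
  "Rn_lborel n = Pi\<^sub>M {..<n} (\<lambda>_. lborel)"

definition Rn_zero :: "nat \<Rightarrow> nat \<Rightarrow> real" where
  "Rn_zero n = (\<lambda>i\<in>{..<n}. 0)"

definition Rn_diff :: "nat \<Rightarrow> (nat \<Rightarrow> real) \<Rightarrow> (nat \<Rightarrow> real) \<Rightarrow> nat \<Rightarrow> real" where
  "Rn_diff n x y = (\<lambda>i\<in>{..<n}. x i - y i)"

definition Rn_segment :: "nat \<Rightarrow> real \<Rightarrow> (nat \<Rightarrow> real) \<Rightarrow> (nat \<Rightarrow> real) \<Rightarrow> nat \<Rightarrow> real" where
  "Rn_segment n t x y = (\<lambda>i\<in>{..<n}. (1 - t) * x i + t * y i)"

definition Rn_inner :: "nat \<Rightarrow> (nat \<Rightarrow> real) \<Rightarrow> (nat \<Rightarrow> real) \<Rightarrow> real" where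
  "Rn_inner n x y = (\<Sum>i<n. x i * y i)"

text \<open>
  \<open>neg_log\<close> and \<open>exp_neg\<close> are \<open>r \<mapsto> - log r\<close> and \<open>u \<mapsto> e^{-u}\<close>, with
  \<open>- log 0 = \<infinity>\<close> and \<open>e^{-\<infinity>} = 0\<close>.  They are meant for arguments in \<open>[0, 1]\<close> and
  \<open>[0, \<infinity>]\<close>.  In particular the junk value of \<open>exp_neg\<close> at \<open>-\<infinity>\<close> does not
  matter: if \<open>\<phi> 0 = 0\<close>, then the Legendre transform of \<open>\<phi>\<close> is nonnegative.
\<close>

definition neg_log :: "real \<Rightarrow> ereal" where
  "neg_log r = (if r = 0 then \<infinity> else ereal (- ln r))"

definition exp_neg :: "ereal \<Rightarrow> real" where
  "exp_neg u = (if u = \<infinity> then 0 else exp (- real_of_ereal u))"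

definition convex_Rn :: "nat \<Rightarrow> ((nat \<Rightarrow> real) \<Rightarrow> ereal) \<Rightarrow> bool" where
  "convex_Rn n \<phi> \<longleftrightarrow>
     (\<forall>x\<in>Rn n. \<forall>y\<in>Rn n. \<forall>t\<in>{0<..<1}.
        \<phi> (Rn_segment n t x y) \<le> ereal (1 - t) * \<phi> x + ereal t * \<phi> y)"

definition usc_Rn :: "nat \<Rightarrow> ((nat \<Rightarrow> real) \<Rightarrow> real) \<Rightarrow> bool" where
  "usc_Rn n f \<longleftrightarrow> (\<forall>a. closedin (Rn_topology n) {x \<in> Rn n. a \<le> f x})"

definition LC_g :: "nat \<Rightarrow> ((nat \<Rightarrow> real) \<Rightarrow> real) set" where
  "LC_g n = {f. f \<in> Rn n \<rightarrow> {0..1} \<and> usc_Rn n f \<and> convex_Rn n (\<lambda>x. neg_log (f x)) \<and>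
      (\<forall>x\<in>Rn n. f x \<le> f (Rn_zero n)) \<and> f (Rn_zero n) = 1 \<and>
      0 < (\<integral>\<^sup>+x. ennreal (f x) \<partial>Rn_lborel n) \<and> (\<integral>\<^sup>+x. ennreal (f x) \<partial>Rn_lborel n) < \<infinity>}"

definition centered :: "nat \<Rightarrow> ((nat \<Rightarrow> real) \<Rightarrow> real) \<Rightarrow> bool" where
  "centered n f \<longleftrightarrow> (\<forall>i<n. has_bochner_integral (Rn_lborel n) (\<lambda>x. x i * f x) 0)"

definition legendre :: "nat \<Rightarrow> ((nat \<Rightarrow> real) \<Rightarrow> ereal) \<Rightarrow> (nat \<Rightarrow> real) \<Rightarrow> ereal" where
  "legendre n \<phi> y = (SUP x\<in>Rn n. ereal (Rn_inner n y x) - \<phi> x)"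

definition dual_fun :: "nat \<Rightarrow> ((nat \<Rightarrow> real) \<Rightarrow> real) \<Rightarrow> (nat \<Rightarrow> real) \<Rightarrow> real" where
  "dual_fun n f y = exp_neg (legendre n (\<lambda>x. neg_log (f x)) y)"

text \<open>
  The Borel sets of \<open>R^n\<close> are the sets of \<open>Rn_lborel n\<close>.  A covering measure need not be
  finite or sigma-finite; its total mass may be \<open>\<infinity>\<close>.
\<close>

definition covering_measures ::
    "nat \<Rightarrow> ((nat \<Rightarrow> real) \<Rightarrow> real) \<Rightarrow> ((nat \<Rightarrow> real) \<Rightarrow> real) \<Rightarrow> (nat \<Rightarrow> real) measure set" where
  "covering_measures n f g =
     {\<mu>. sets \<mu> = sets (Rn_lborel n) \<and>
         (\<forall>x\<in>Rn n. ennreal (f x) \<le> (\<integral>\<^sup>+t. ennreal (g (Rn_diff n x t)) \<partial>\<mu>))}"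

definition covering_number ::
    "nat \<Rightarrow> ((nat \<Rightarrow> real) \<Rightarrow> real) \<Rightarrow> ((nat \<Rightarrow> real) \<Rightarrow> real) \<Rightarrow> ennreal" where
  "covering_number n f g = (INF \<mu>\<in>covering_measures n f g. emeasure \<mu> (Rn n))"

end

theory Submission
  imports Defs "HOL-Probability.Probability" "HOL-Complex_Analysis.Complex_Analysis"
begin

text \<open>
  Comparing a covering of \<open>u\<close> by translates of \<open>v\<close> with volumes gives
  \<open>\<integral> (u \<star> v) \<le> 2^n (\<integral> v) N(u, v)\<close> and \<open>N(u, v) (\<integral> v) \<le> 2^n \<integral> (u \<star> v_-)\<close>, where \<open>\<star>\<close> is the
  sup-convolution and \<open>v_-(x) = v(-x)\<close>. A Rogers--Shephard inequality trades \<open>u \<star> v\<close> for the product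
  \<open>u v_-\<close>, and duality \<open>u \<mapsto> u\<^sup>\<circ>\<close> turns \<open>u \<star> v\<close> into \<open>u\<^sup>\<circ> v\<^sup>\<circ>\<close>. Hence \<open>N(v\<^sup>\<circ>, u\<^sup>\<circ>) \<le> C^n N(u, v)\<close> follows from the
  Santalo inequality for \<open>v\<close> (\<open>\<integral> v \<integral> v\<^sup>\<circ> \<le> 400^n\<close>) and the inverse Santalo inequality for \<open>u \<star> v\<close>. It is
  applied to \<open>(f, g)\<close> and, as \<open>f\<^sup>\<circ>\<^sup>\<circ> = f\<close>, to \<open>(g\<^sup>\<circ>, f\<^sup>\<circ>)\<close>.

  The Santalo inequality is proved by induction on the dimension (Lehec): a hyperplane halving the mass and
  a shear reduce it to a one-dimensional inequality of Prekopa--Leindler type.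

  The inverse Santalo inequality follows Berndtsson. For a smooth strongly convex even \<open>\<phi>\<close> with gradient
  \<open>V\<close>, let \<open>D\<close> be the Jacobian of \<open>(x, x') \<mapsto> (x - t x', V x + t V x')\<close> divided by \<open>t^n\<close>; it does not
  depend on \<open>t\<close>. The Gaussian integral of the phase \<open>x u\<close> pulled back by this map is therefore an explicit
  function of \<open>t > 0\<close>; continued analytically to \<open>t = \<i>\<close>, where the phase becomes real, it yields
  \<open>(2\<pi>)^n \<le> \<integral>\<integral> exp(- (x V x + x' V x')) D dx dx'\<close>, and the right-hand side is at most
  \<open>4^n \<integral> exp(-\<phi>) \<integral> exp(-\<L>\<phi>)\<close> by convexity.
\<close>

text \<open>The constant is \<open>204800 = 32 * 2 * 8 * 400\<close>: 400 from the Santalo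
  inequality (two halves of equal mass, each costing 100 on the half line), 32 from the inverse
  inequality, 2 from the lower volume bound for coverings, 8 from the upper one combined with
  Rogers--Shephard. Centers of mass enter only through the Santalo inequality. The Jacobian matrix
  in Berndtsson's argument has the blocks I, -tI, V'(x), tV'(x'), so its determinant is t^n det
  (V'(x) + V'(x')); this is why one density \<open>D\<close> serves all t. For real t the phase
  merely oscillates and the integral does not converge absolutely. A Gaussian term is therefore
  added whose coefficient 1 + t^2 vanishes at t = \<i>, and absolute convergence has to be secured
  along the whole path from 1 to \<i>. A general log-concave function is far from smooth and
  strongly convex. Even functions are reached by log-cosh soft maxima of affine minorants plus a
  small multiple of |x|^2. Evenness is obtained by passing from h to h \<star> h_-, which by
  Rogers--Shephard enlarges the integral only by an exponential factor.\<close>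

definition comb :: "nat \<Rightarrow> real \<Rightarrow> (nat \<Rightarrow> real) \<Rightarrow> real \<Rightarrow> (nat \<Rightarrow> real) \<Rightarrow> nat \<Rightarrow> real" where
  "comb n a x b y = (\<lambda>i\<in>{..<n}. a * x i + b * y i)"

definition mass :: "nat \<Rightarrow> ((nat \<Rightarrow> real) \<Rightarrow> real) \<Rightarrow> ennreal" where
  "mass n f = (\<integral>\<^sup>+x. ennreal (f x) \<partial>Rn_lborel n)"

text \<open>Log-concavity is recorded in multiplicative midpoint form, so that no logarithm of 0
  occurs; the weights 1/2 and their dyadic iterates are those used below. \<open>closed\<close>
  refers to the space of all functions from \<open>nat\<close> to \<open>real\<close>, in which
  \<open>Rn n\<close> is a closed subset.\<close>

definition lcf :: "nat \<Rightarrow> ((nat \<Rightarrow> real) \<Rightarrow> real) \<Rightarrow> bool" where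
  "lcf n f \<longleftrightarrow> (\<forall>x\<in>Rn n. 0 \<le> f x \<and> f x \<le> 1) \<and> (\<forall>a. closed {x \<in> Rn n. a \<le> f x}) \<and>
     f (Rn_zero n) = 1 \<and>
     (\<forall>x\<in>Rn n. \<forall>y\<in>Rn n. f x * f y \<le> (f (comb n (1/2) x (1/2) y))\<^sup>2)"

text \<open>The arguments may be arbitrary functions: the restriction in \<open>comb\<close> always
  produces an extensional one. Thus \<open>comb n (-1) x 0 x\<close> serves as negation and
  \<open>comb n 1 a 1 x\<close> as a shift by any coefficient function \<open>a\<close>.\<close>

lemma comb_in_Rn [simp]: "comb n a x b y \<in> Rn n"
  by (auto simp: comb_def Rn_def)

lemma comb_apply [simp]: "i < n \<Longrightarrow> comb n a x b y i = a * x i + b * y i"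
  by (auto simp: comb_def)

lemma Rn_zero_in [simp]: "Rn_zero n \<in> Rn n"
  by (auto simp: Rn_zero_def Rn_def)

lemma Rn_zero_apply [simp]: "i < n \<Longrightarrow> Rn_zero n i = 0"
  by (auto simp: Rn_zero_def)

lemma Rn_ext: "x \<in> Rn n \<Longrightarrow> y \<in> Rn n \<Longrightarrow> (\<And>i. i < n \<Longrightarrow> x i = y i) \<Longrightarrow> x = y"
  unfolding Rn_def by (rule PiE_ext) auto

lemma Rn_undefined: "x \<in> Rn n \<Longrightarrow> \<not> i < n \<Longrightarrow> x i = undefined"
  unfolding Rn_def by (auto simp: PiE_def extensional_def)

lemma Rn_diff_comb: "Rn_diff n x y = comb n 1 x (-1) y"
  by (auto simp: Rn_diff_def comb_def)

lemma Rn_upd: "x \<in> Rn n \<Longrightarrow> x(n := t) \<in> Rn (Suc n)"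
  unfolding Rn_def by (auto simp: lessThan_Suc PiE_def extensional_def)

lemma Rn_inner_commute: "Rn_inner n x y = Rn_inner n y x"
  by (simp add: Rn_inner_def mult.commute)

lemma Rn_inner_comb: "Rn_inner n (comb n a x b y) z = a * Rn_inner n x z + b * Rn_inner n y z"
  by (simp add: Rn_inner_def sum_distrib_left sum.distrib algebra_simps)

lemma Rn_inner_comb': "Rn_inner n z (comb n a x b y) = a * Rn_inner n z x + b * Rn_inner n z y"
  by (simp add: Rn_inner_def sum_distrib_left sum.distrib algebra_simps)

lemma Rn_inner_zero [simp]: "Rn_inner n (Rn_zero n) x = 0" "Rn_inner n x (Rn_zero n) = 0"
  by (simp_all add: Rn_inner_def)

lemma Rn_inner_Suc: "Rn_inner (Suc n) x y = Rn_inner n x y + x n * y n"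
  by (simp add: Rn_inner_def)

lemma Rn_inner_upd [simp]: "Rn_inner n (x(n := s)) y = Rn_inner n x y" "Rn_inner n x (y(n := s)) = Rn_inner n x y"
  by (simp_all add: Rn_inner_def)

lemma Rn_inner_nonneg [simp]: "0 \<le> Rn_inner n x x"
  by (simp add: Rn_inner_def sum_nonneg)

section \<open>Lebesgue integration on R^n, one coordinate at a time\<close>

lemma space_Rn [simp]: "space (Rn_lborel n) = Rn n"
  by (simp add: Rn_lborel_def Rn_def space_PiM)

lemma Rn_in_sets [simp]: "Rn n \<in> sets (Rn_lborel n)"
  using sets.top[of "Rn_lborel n"] by simp

interpretation lb: product_sigma_finite "\<lambda>_::nat. lborel :: real measure"
  by standard

interpretation Rn: sigma_finite_measure "Rn_lborel n" for n
  unfolding Rn_lborel_def by (rule lb.sigma_finite) auto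

lemma measurable_coord: "i < n \<Longrightarrow> (\<lambda>x. x i) \<in> borel_measurable (Rn_lborel n)"
  unfolding Rn_lborel_def by measurable

lemma measurable_inner [measurable]: "(\<lambda>x. Rn_inner n y x) \<in> borel_measurable (Rn_lborel n)"
  unfolding Rn_inner_def by (intro borel_measurable_sum borel_measurable_times measurable_coord) auto

lemma measurable_into_Rn:
  assumes "\<And>i. i < n \<Longrightarrow> (\<lambda>x. g x i) \<in> borel_measurable M" "\<And>x. x \<in> space M \<Longrightarrow> g x \<in> Rn n"
  shows "g \<in> M \<rightarrow>\<^sub>M Rn_lborel n"
  unfolding Rn_lborel_def
  by (rule measurable_PiM_single') (use assms in \<open>auto simp: Rn_def\<close>)

lemma measurable_comb [measurable]: "(\<lambda>x. comb n a x b y) \<in> Rn_lborel n \<rightarrow>\<^sub>M Rn_lborel n"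
    "(\<lambda>y. comb n a x b y) \<in> Rn_lborel n \<rightarrow>\<^sub>M Rn_lborel n"
  by (rule measurable_into_Rn; auto intro!: borel_measurable_add borel_measurable_times measurable_coord)+

lemma measurable_comb2 [measurable (raw)]:
  assumes "f \<in> M \<rightarrow>\<^sub>M Rn_lborel n" "g \<in> M \<rightarrow>\<^sub>M Rn_lborel n"
  shows "(\<lambda>x. comb n a (f x) b (g x)) \<in> M \<rightarrow>\<^sub>M Rn_lborel n"
proof (rule measurable_into_Rn)
  fix i assume "i < n"
  note [measurable] = measurable_compose[OF assms(1) measurable_coord[OF \<open>i < n\<close>]] measurable_compose[OF assms(2) measurable_coord[OF \<open>i < n\<close>]]
  show "(\<lambda>x. comb n a (f x) b (g x) i) \<in> borel_measurable M"
    using \<open>i < n\<close> by simp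
qed simp

lemma measurable_upd [measurable]: "(\<lambda>(x, t). x(n := t)) \<in> Rn_lborel n \<Otimes>\<^sub>M lborel \<rightarrow>\<^sub>M Rn_lborel (Suc n)"
  unfolding Rn_lborel_def lessThan_Suc by (rule measurable_add_dim)

lemma measurable_upd2: "x \<in> Rn n \<Longrightarrow> (\<lambda>t. x(n := t)) \<in> borel \<rightarrow>\<^sub>M Rn_lborel (Suc n)"
  by (rule measurable_into_Rn) (auto intro: Rn_upd)

lemma nn_integral_Rn_Suc:
  assumes "f \<in> borel_measurable (Rn_lborel (Suc n))"
  shows "(\<integral>\<^sup>+x. f x \<partial>Rn_lborel (Suc n)) = (\<integral>\<^sup>+x. (\<integral>\<^sup>+t. f (x(n := t)) \<partial>lborel) \<partial>Rn_lborel n)"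
  using assms unfolding Rn_lborel_def lessThan_Suc
  by (intro lb.product_nn_integral_insert) auto

lemma nn_integral_Rn_0: "(\<integral>\<^sup>+x. f x \<partial>Rn_lborel 0) = f (Rn_zero 0)"
proof -
  have "(\<lambda>i\<in>{}. 0) = (\<lambda>_::nat. undefined::real)" by auto
  then show ?thesis
    unfolding Rn_lborel_def Rn_zero_def
    by (simp add: lessThan_0 lb.nn_integral_empty)
qed

text \<open>Induction on the coordinates from the one-dimensional affine substitution. The
  reflection, translation and halving formulas below are instances.\<close>

lemma nn_integral_affine:
  assumes "f \<in> borel_measurable (Rn_lborel n)" and c: "c \<noteq> 0"
  shows "(\<integral>\<^sup>+x. f x \<partial>Rn_lborel n) = ennreal (\<bar>c\<bar> ^ n) * (\<integral>\<^sup>+x. f (comb n 1 a c x) \<partial>Rn_lborel n)"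
  using assms(1)
proof (induction n arbitrary: f)
  case 0
  have "comb 0 1 a c (Rn_zero 0) = Rn_zero 0"
    by (rule Rn_ext[of _ 0]) auto
  then show ?case by (simp add: nn_integral_Rn_0)
next
  case (Suc n)
  note [measurable] = Suc.prems
  have *: "(comb n 1 a c x)(n := a n + c * t) = comb (Suc n) 1 a c (x(n := t))" for x t
    by (rule ext) (auto simp: comb_def restrict_def less_Suc_eq)
  define G where "G x = (\<integral>\<^sup>+t. f (x(n := a n + c * t)) \<partial>lborel)" for x
  have m: "(\<lambda>(x, t). f (x(n := t))) \<in> borel_measurable (Rn_lborel n \<Otimes>\<^sub>M lborel)"
    using measurable_compose[OF measurable_upd Suc.prems] by (simp add: case_prod_beta')
  have m': "(\<lambda>p. (fst p)(n := a n + c * snd p)) \<in> Rn_lborel n \<Otimes>\<^sub>M lborel \<rightarrow>\<^sub>M Rn_lborel (Suc n)"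
    using measurable_compose[of "\<lambda>p. (fst p, a n + c * snd p)" "Rn_lborel n \<Otimes>\<^sub>M lborel" "Rn_lborel n \<Otimes>\<^sub>M lborel", OF _ measurable_upd]
    by (simp add: case_prod_beta')
  have [measurable]: "G \<in> borel_measurable (Rn_lborel n)"
    unfolding G_def
    by (rule lborel.borel_measurable_nn_integral)
       (use measurable_compose[OF m' Suc.prems] in \<open>simp add: case_prod_beta'\<close>)
  have "(\<integral>\<^sup>+x. f x \<partial>Rn_lborel (Suc n)) = (\<integral>\<^sup>+x. (\<integral>\<^sup>+t. f (x(n := t)) \<partial>lborel) \<partial>Rn_lborel n)"
    by (rule nn_integral_Rn_Suc) fact
  also have "\<dots> = (\<integral>\<^sup>+x. ennreal \<bar>c\<bar> * G x \<partial>Rn_lborel n)"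
    unfolding G_def
    by (intro nn_integral_cong nn_integral_real_affine[OF _ c])
       (use measurable_compose[OF measurable_upd2 Suc.prems] in simp)
  also have "\<dots> = ennreal \<bar>c\<bar> * (\<integral>\<^sup>+x. G x \<partial>Rn_lborel n)"
    by (rule nn_integral_cmult) simp
  also have "(\<integral>\<^sup>+x. G x \<partial>Rn_lborel n) = ennreal (\<bar>c\<bar> ^ n) * (\<integral>\<^sup>+x. G (comb n 1 a c x) \<partial>Rn_lborel n)"
    by (rule Suc.IH) simp
  also have "(\<integral>\<^sup>+x. G (comb n 1 a c x) \<partial>Rn_lborel n) = (\<integral>\<^sup>+x. f (comb (Suc n) 1 a c x) \<partial>Rn_lborel (Suc n))"
    unfolding G_def *
    by (rule nn_integral_Rn_Suc[symmetric]) measurable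
  finally show ?case
    by (simp add: ennreal_mult mult.assoc)
qed

section \<open>R^n as a closed subset of the function space\<close>

lemma closed_Rn: "closed (Rn n)"
proof -
  have "Rn n = (\<Inter>i\<in>{i. \<not> i < n}. {x. x i = undefined})"
    unfolding Rn_def by (auto simp: PiE_def extensional_def)
  moreover have "closed {x :: nat \<Rightarrow> real. x i = undefined}" for i
    by (intro closed_Collect_eq continuous_intros) simp
  ultimately show ?thesis by auto
qed

text \<open>Coordinates from \<open>n\<close> on are constantly \<open>undefined\<close> on
  \<open>Rn n\<close>, so the Borel sets of the full function space leave measurable traces on the
  finite product.\<close>

lemma measurable_Rn_id: "(\<lambda>x. x) \<in> Rn_lborel n \<rightarrow>\<^sub>M (borel :: (nat \<Rightarrow> real) measure)"
proof (rule measurable_coordinatewise_then_product)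
  fix i show "(\<lambda>x. x i) \<in> borel_measurable (Rn_lborel n)"
  proof (cases "i < n")
    case False
    then have "(\<lambda>x. x i) \<in> borel_measurable (Rn_lborel n) \<longleftrightarrow> (\<lambda>x. undefined :: real) \<in> borel_measurable (Rn_lborel n)"
      by (intro measurable_cong) (auto intro: Rn_undefined)
    then show ?thesis by simp
  qed (rule measurable_coord)
qed

lemma closed_in_sets_Rn: "closed S \<Longrightarrow> S \<subseteq> Rn n \<Longrightarrow> S \<in> sets (Rn_lborel n)"
  using measurable_sets[OF measurable_Rn_id, of S n] by (auto simp: Int_absorb2)

lemma measurable_continuous_Rn:
  fixes f :: "(nat \<Rightarrow> real) \<Rightarrow> 'b::topological_space"
  assumes "continuous_on (Rn n) f" shows "f \<in> borel_measurable (Rn_lborel n)"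
  by (rule measurable_compose[OF measurable_restrict_space2[OF _ measurable_Rn_id] borel_measurable_continuous_on_restrict[OF assms]])
     auto

lemma measurable_continuous_Rn_real:
  fixes f :: "(nat \<Rightarrow> real) \<times> real \<Rightarrow> 'b::topological_space"
  assumes "continuous_on (Rn n \<times> UNIV) f" shows "f \<in> borel_measurable (Rn_lborel n \<Otimes>\<^sub>M lborel)"
proof -
  have "(\<lambda>p. (fst p, snd p)) \<in> Rn_lborel n \<Otimes>\<^sub>M lborel \<rightarrow>\<^sub>M (borel :: ((nat \<Rightarrow> real) \<times> real) measure)"
    by (intro borel_measurable_Pair measurable_compose[OF measurable_fst measurable_Rn_id]) simp
  then have "(\<lambda>p. p) \<in> Rn_lborel n \<Otimes>\<^sub>M lborel \<rightarrow>\<^sub>M (borel :: ((nat \<Rightarrow> real) \<times> real) measure)"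
    by simp
  from measurable_compose[OF measurable_restrict_space2[OF _ this] borel_measurable_continuous_on_restrict[OF assms]]
  show ?thesis by (auto simp: space_pair_measure)
qed

section \<open>Log-concave functions and their duals\<close>

lemma lcfD:
  assumes "lcf n f"
  shows "x \<in> Rn n \<Longrightarrow> 0 \<le> f x" "x \<in> Rn n \<Longrightarrow> f x \<le> 1" "closed {x \<in> Rn n. a \<le> f x}" "f (Rn_zero n) = 1"
    "x \<in> Rn n \<Longrightarrow> y \<in> Rn n \<Longrightarrow> f x * f y \<le> (f (comb n (1/2) x (1/2) y))\<^sup>2"
  using assms unfolding lcf_def by auto

lemma usc_measurable:
  fixes f :: "(nat \<Rightarrow> real) \<Rightarrow> real"
  assumes "\<And>a. closed {x \<in> Rn n. a \<le> f x}"
  shows "f \<in> borel_measurable (Rn_lborel n)"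
  using closed_in_sets_Rn[OF assms] by (simp add: borel_measurable_iff_ge)

lemma lcf_measurable: "lcf n f \<Longrightarrow> f \<in> borel_measurable (Rn_lborel n)"
  by (rule usc_measurable) (auto dest: lcfD)

text \<open>Carries upper semicontinuity from the topology of the statement to that of the function
  space: the identity is continuous from \<open>Rn n\<close> as a subspace, and \<open>Rn n\<close>
  is closed.\<close>

lemma closedin_Rn_topology: "closedin (Rn_topology n) S \<Longrightarrow> closed S"
proof -
  assume S: "closedin (Rn_topology n) S"
  have c: "continuous_map (top_of_set (Rn n)) (Rn_topology n) (\<lambda>x. x)"
    unfolding Rn_topology_def continuous_map_componentwise
    by (auto simp: Rn_def PiE_def intro!: continuous_on_subset[OF continuous_on_product_coordinates])
  have "S \<subseteq> Rn n"
    using closedin_subset[OF S] by (auto simp: Rn_topology_def Rn_def)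
  then have "{x \<in> topspace (top_of_set (Rn n)). x \<in> S} = S" by auto
  then have "closedin (top_of_set (Rn n)) S"
    using closedin_continuous_map_preimage[OF c S] by simp
  then show ?thesis
    using closedin_closed_trans closed_Rn by blast
qed

text \<open>Convexity of the negative logarithm is applied with weight 1/2; if one of the two values
  is 0, the product inequality is trivial.\<close>

lemma LC_g_lcf:
  assumes "f \<in> LC_g n" shows "lcf n f" "0 < mass n f" "mass n f < \<infinity>"
proof -
  have f01: "\<And>x. x \<in> Rn n \<Longrightarrow> 0 \<le> f x \<and> f x \<le> 1"
    and usc: "usc_Rn n f" and cv: "convex_Rn n (\<lambda>x. neg_log (f x))" and f0: "f (Rn_zero n) = 1"
    and m: "0 < mass n f" "mass n f < \<infinity>"
    using assms by (auto simp: LC_g_def mass_def)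
  have "f x * f y \<le> (f (comb n (1/2) x (1/2) y))\<^sup>2" if "x \<in> Rn n" "y \<in> Rn n" for x y
  proof (cases "f x = 0 \<or> f y = 0")
    case False
    have s: "Rn_segment n (1/2) x y = comb n (1/2) x (1/2) y"
      by (simp add: Rn_segment_def comb_def)
    have "neg_log (f (Rn_segment n (1/2) x y)) \<le> ereal (1 - 1/2) * neg_log (f x) + ereal (1/2) * neg_log (f y)"
      using cv[unfolded convex_Rn_def, rule_format, OF that, of "1/2"] by simp
    then have "neg_log (f (comb n (1/2) x (1/2) y)) \<le> ereal (- (ln (f x) + ln (f y)) / 2)"
      unfolding s using False by (simp add: neg_log_def field_simps)
    then have *: "f (comb n (1/2) x (1/2) y) \<noteq> 0" "(ln (f x) + ln (f y)) / 2 \<le> ln (f (comb n (1/2) x (1/2) y))"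
      unfolding neg_log_def by (cases "f (comb n (1/2) x (1/2) y) = 0"; simp)+
    have pos: "f x > 0" "f y > 0" "f (comb n (1/2) x (1/2) y) > 0"
      using f01[OF that(1)] f01[OF that(2)] f01[OF comb_in_Rn, of "1/2" x "1/2" y] False * by auto
    have "ln (f x * f y) \<le> ln ((f (comb n (1/2) x (1/2) y))\<^sup>2)"
      using pos * by (simp add: ln_mult ln_realpow)
    then show ?thesis using pos by (subst (asm) ln_le_cancel_iff) auto
  qed auto
  then show "lcf n f" "0 < mass n f" "mass n f < \<infinity>"
    unfolding lcf_def using f01 f0 m usc by (auto simp: usc_Rn_def intro: closedin_Rn_topology)
qed

lemma legendre_term:
  "0 \<le> r \<Longrightarrow> ereal c - neg_log r = (if r = 0 then -\<infinity> else ereal (c + ln r))"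
  by (simp add: neg_log_def)

lemma dual_nonneg: "0 \<le> dual_fun n f y"
  by (simp add: dual_fun_def exp_neg_def)

text \<open>Together with \<open>dual_ge\<close> this describes \<open>dual_fun n f y\<close> as the
  greatest \<open>a \<ge> 0\<close> such that \<open>a * f x \<le> exp (- Rn_inner n y x)\<close>
  for all \<open>x\<close>. Later arguments about duals rest on this pair and avoid extended
  reals.\<close>

lemma dual_le:
  assumes f: "\<And>x. x \<in> Rn n \<Longrightarrow> 0 \<le> f x" and "f (Rn_zero n) = 1" and x: "x \<in> Rn n"
  shows "dual_fun n f y * f x \<le> exp (- Rn_inner n y x)"
proof (cases "f x = 0 \<or> legendre n (\<lambda>x. neg_log (f x)) y = \<infinity>")
  case False
  define L where "L = legendre n (\<lambda>x. neg_log (f x)) y"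
  have 1: "ereal (Rn_inner n y x + ln (f x)) \<le> L"
    unfolding L_def legendre_def using False f[OF x]
    by (intro SUP_upper2[OF x]) (simp add: legendre_term)
  with False obtain r where r: "L = ereal r" unfolding L_def[symmetric] by (cases L) auto
  have "dual_fun n f y * f x = exp (- r) * exp (ln (f x))"
    using False f[OF x] r by (simp add: dual_fun_def L_def exp_neg_def)
  also have "\<dots> \<le> exp (- Rn_inner n y x)"
    using 1 r by (simp add: exp_add[symmetric])
  finally show ?thesis .
qed (auto simp: dual_fun_def exp_neg_def)

lemma dual_ge:
  assumes f: "\<And>x. x \<in> Rn n \<Longrightarrow> 0 \<le> f x" and f0: "f (Rn_zero n) = 1" and a: "0 \<le> a"
    and le: "\<And>x. x \<in> Rn n \<Longrightarrow> a * f x \<le> exp (- Rn_inner n y x)"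
  shows "a \<le> dual_fun n f y"
proof (cases "a = 0")
  case False
  with a have a: "a > 0" by simp
  define L where "L = legendre n (\<lambda>x. neg_log (f x)) y"
  have "L \<le> ereal (- ln a)"
    unfolding L_def legendre_def
  proof (rule SUP_least)
    fix x assume x: "x \<in> Rn n"
    show "ereal (Rn_inner n y x) - neg_log (f x) \<le> ereal (- ln a)"
    proof (cases "f x = 0")
      case False
      then have p: "f x > 0" using f[OF x] by simp
      have "ln (a * f x) \<le> - Rn_inner n y x"
        using le[OF x] a p by (subst ln_ge_iff[symmetric] | simp add: ln_le_cancel_iff[symmetric])+
      then show ?thesis using p a by (simp add: legendre_term ln_mult)
    qed (simp add: legendre_term)
  qed
  \<comment> \<open>The point 0 contributes 0 to the supremum. This excludes
    \<open>-\<infinity>\<close>, where \<open>exp_neg\<close> would return a default value.\<close>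
  moreover have "ereal 0 \<le> L"
    unfolding L_def legendre_def
    by (rule SUP_upper2[OF Rn_zero_in]) (simp add: legendre_term f0)
  ultimately obtain r where r: "L = ereal r" "r \<le> - ln a" by (cases L) auto
  then have "a \<le> exp (- r)"
    using a by (metis exp_le_cancel_iff exp_ln le_minus_iff)
  then show ?thesis using r by (simp add: dual_fun_def L_def exp_neg_def)
qed (simp add: dual_nonneg)

section \<open>Sup-convolution\<close>

definition supconv :: "nat \<Rightarrow> ((nat \<Rightarrow> real) \<Rightarrow> real) \<Rightarrow> ((nat \<Rightarrow> real) \<Rightarrow> real) \<Rightarrow> (nat \<Rightarrow> real) \<Rightarrow> real" where
  "supconv n u v x = (SUP a\<in>Rn n. u a * v (comb n 1 x (-1) a))"

definition refl_fun :: "nat \<Rightarrow> ((nat \<Rightarrow> real) \<Rightarrow> real) \<Rightarrow> (nat \<Rightarrow> real) \<Rightarrow> real" where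
  "refl_fun n f x = f (comb n (-1) x 0 x)"

definition unit_fun :: "nat \<Rightarrow> ((nat \<Rightarrow> real) \<Rightarrow> real) \<Rightarrow> bool" where
  "unit_fun n f \<longleftrightarrow> (\<forall>x\<in>Rn n. 0 \<le> f x \<and> f x \<le> 1) \<and> f (Rn_zero n) = 1"

lemma lcf_unit: "lcf n f \<Longrightarrow> unit_fun n f"
  by (auto simp: lcf_def unit_fun_def)

lemma unit_funD:
  assumes "unit_fun n f"
  shows "x \<in> Rn n \<Longrightarrow> 0 \<le> f x" "x \<in> Rn n \<Longrightarrow> f x \<le> 1" "f (Rn_zero n) = 1"
  using assms by (auto simp: unit_fun_def)

lemma supconv_ge:
  assumes "unit_fun n u" "unit_fun n v" "a \<in> Rn n"
  shows "u a * v (comb n 1 x (-1) a) \<le> supconv n u v x"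
  unfolding supconv_def
proof (rule cSUP_upper[OF assms(3)])
  show "bdd_above ((\<lambda>a. u a * v (comb n 1 x (- 1) a)) ` Rn n)"
    using assms(1,2) by (intro bdd_aboveI[of _ 1]) (auto intro!: mult_le_one simp: unit_fun_def)
qed

lemma supconv_least:
  assumes "\<And>a. a \<in> Rn n \<Longrightarrow> u a * v (comb n 1 x (-1) a) \<le> c"
  shows "supconv n u v x \<le> c"
  unfolding supconv_def using Rn_zero_in by (intro cSUP_least assms) blast+

lemma comb_diff_zero [simp]: "x \<in> Rn n \<Longrightarrow> comb n 1 x (-1) (Rn_zero n) = x"
  "x \<in> Rn n \<Longrightarrow> comb n 1 x (-1) x = Rn_zero n"
  by (simp_all add: Rn_ext[of _ n])

lemma comb_neg_neg [simp]: "x \<in> Rn n \<Longrightarrow> comb n (-1) (comb n (-1) x 0 x) 0 (comb n (-1) x 0 x) = x"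
  "comb n (-1) (Rn_zero n) 0 (Rn_zero n) = Rn_zero n"
  by (simp_all add: Rn_ext[of _ n])

lemma supconv_ge_left:
  assumes "unit_fun n u" "unit_fun n v" "x \<in> Rn n"
  shows "u x \<le> supconv n u v x"
  using supconv_ge[OF assms, of x] assms by (simp add: unit_funD)

lemma supconv_unit:
  assumes "unit_fun n u" "unit_fun n v"
  shows "unit_fun n (supconv n u v)"
proof -
  have le1: "supconv n u v x \<le> 1" for x
    using assms by (intro supconv_least) (auto intro!: mult_le_one simp: unit_fun_def)
  have ge: "x \<in> Rn n \<Longrightarrow> 0 \<le> supconv n u v x" for x
    using supconv_ge_left[OF assms, of x] unit_funD(1)[OF assms(1), of x] by linarith
  have "supconv n u v (Rn_zero n) = 1"
    using supconv_ge_left[OF assms, of "Rn_zero n"] le1[of "Rn_zero n"] assms by (simp add: unit_funD)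
  then show ?thesis using le1 ge by (auto simp: unit_fun_def)
qed

lemma supconv_commute:
  "supconv n u v x = supconv n v u x"
proof -
  have "(\<lambda>a. u a * v (comb n 1 x (-1) a)) ` Rn n = (\<lambda>a. v a * u (comb n 1 x (-1) a)) ` Rn n"
  proof -
    have *: "comb n 1 x (-1) (comb n 1 x (-1) a) = a" if "a \<in> Rn n" for a
      using that by (intro Rn_ext[of _ n]) auto
    have **: "(\<lambda>a. f a * g (comb n 1 x (-1) a)) ` Rn n \<subseteq> (\<lambda>a. g a * f (comb n 1 x (-1) a)) ` Rn n" for f g :: "(nat \<Rightarrow> real) \<Rightarrow> real"
      by (rule image_subsetI, rule_tac x="comb n 1 x (-1) xa" in image_eqI) (auto simp: * mult.commute)
    show ?thesis using ** by (intro equalityI)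
  qed
  then show ?thesis by (simp add: supconv_def)
qed

text \<open>The supremum need not be attained, so an inequality is shown for every \<open>a\<close>
  and then passed to the supremum after division by \<open>k\<close>.\<close>

lemma supconv_mult_le:
  assumes k: "0 \<le> k" and "unit_fun n u" "unit_fun n v" and c: "\<And>a. a \<in> Rn n \<Longrightarrow> u a * v (comb n 1 x (-1) a) * k \<le> c"
  shows "supconv n u v x * k \<le> c"
proof (cases "k = 0")
  case True
  then show ?thesis using c[OF Rn_zero_in] by simp
next
  case False
  then have "supconv n u v x \<le> c / k"
    using k c by (intro supconv_least) (simp add: field_simps)
  then show ?thesis using False k by (simp add: field_simps)
qed

lemma supconv_midpoint:
  assumes u: "lcf n u" and v: "lcf n v" and x: "x \<in> Rn n" and y: "y \<in> Rn n"
  shows "supconv n u v x * supconv n u v y \<le> (supconv n u v (comb n (1/2) x (1/2) y))\<^sup>2"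
proof -
  note uu = lcf_unit[OF u] lcf_unit[OF v]
  let ?m = "comb n (1/2) x (1/2) y"
  have base: "u a * v (comb n 1 x (-1) a) * (u b * v (comb n 1 y (-1) b)) \<le> (supconv n u v ?m)\<^sup>2"
    if a: "a \<in> Rn n" and b: "b \<in> Rn n" for a b
  proof -
    let ?c = "comb n (1/2) a (1/2) b"
    have e: "comb n 1 ?m (-1) ?c = comb n (1/2) (comb n 1 x (-1) a) (1/2) (comb n 1 y (-1) b)"
      by (rule Rn_ext[of _ n]) (auto simp: field_simps)
    have "u a * v (comb n 1 x (-1) a) * (u b * v (comb n 1 y (-1) b))
        = (u a * u b) * (v (comb n 1 x (-1) a) * v (comb n 1 y (-1) b))" by simp
    also have "\<dots> \<le> (u ?c)\<^sup>2 * (v (comb n 1 ?m (-1) ?c))\<^sup>2"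
      unfolding e by (intro mult_mono lcfD(5)[OF u] lcfD(5)[OF v] a b) (auto simp: a b lcfD(1)[OF u] lcfD(1)[OF v])
    also have "\<dots> = (u ?c * v (comb n 1 ?m (-1) ?c))\<^sup>2" by (simp add: power_mult_distrib)
    also have "\<dots> \<le> (supconv n u v ?m)\<^sup>2"
      by (intro power_mono supconv_ge uu mult_nonneg_nonneg) (auto simp: lcfD(1)[OF u] lcfD(1)[OF v])
    finally show ?thesis .
  qed
  \<comment> \<open>The suprema are taken one after the other, over \<open>b\<close> for fixed
    \<open>a\<close> and then over \<open>a\<close>.\<close>
  have 1: "u a * v (comb n 1 x (-1) a) * supconv n u v y \<le> (supconv n u v ?m)\<^sup>2" if "a \<in> Rn n" for a
    using supconv_mult_le[OF _ uu, of "u a * v (comb n 1 x (-1) a)" y] base[OF that]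
    by (simp add: mult.commute lcfD(1)[OF u] lcfD(1)[OF v] that)
  show ?thesis
    by (rule supconv_mult_le[OF _ uu 1]) (use unit_funD[OF supconv_unit[OF uu]] y in auto)
qed

section \<open>Upper semicontinuity of sup-convolutions\<close>

definition cube :: "nat \<Rightarrow> real \<Rightarrow> (nat \<Rightarrow> real) set" where
  "cube n R = {x \<in> Rn n. \<forall>i<n. \<bar>x i\<bar> \<le> R}"

text \<open>Tychonoff's theorem: coordinates below \<open>n\<close> range over an interval, the
  others over the single point \<open>undefined\<close>.\<close>

lemma compact_cube: "compact (cube n R)"
proof -
  have "cube n R = PiE UNIV (\<lambda>i. if i < n then {-R..R} else {undefined})"
    unfolding cube_def Rn_def by (auto simp: PiE_def Pi_def extensional_def abs_le_iff split: if_splits)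
  moreover have "compactin (product_topology (\<lambda>_::nat. euclidean) UNIV) (PiE UNIV (\<lambda>i. if i < n then {-R..R::real} else {undefined}))"
    by (subst compactin_PiE) auto
  ultimately show ?thesis by (simp add: euclidean_product_topology)
qed

lemma cube_sets [measurable]: "cube n R \<in> sets (Rn_lborel n)"
  by (intro closed_in_sets_Rn compact_imp_closed compact_cube) (auto simp: cube_def)

lemma usc_seq:
  fixes f :: "(nat \<Rightarrow> real) \<Rightarrow> real"
  assumes "closed {x \<in> Rn n. p \<le> f x}" "y \<longlonglongrightarrow> l" "\<And>j. y j \<in> Rn n" "l \<in> Rn n" "f l < p"
  shows "\<forall>\<^sub>F j in sequentially. f (y j) < p"
proof -
  have "\<forall>\<^sub>F j in sequentially. y j \<in> - {x \<in> Rn n. p \<le> f x}"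
    by (rule topological_tendstoD[OF assms(2)]) (use assms in auto)
  then show ?thesis by eventually_elim (use assms(3) in auto)
qed

lemma tendsto_fun_iff:
  fixes f :: "nat \<Rightarrow> nat \<Rightarrow> real"
  shows "f \<longlonglongrightarrow> l \<longleftrightarrow> (\<forall>i. (\<lambda>k. f k i) \<longlonglongrightarrow> l i)"
proof -
  have "f \<longlonglongrightarrow> l \<longleftrightarrow> limitin (product_topology (\<lambda>_::nat. euclidean) UNIV) f l sequentially"
    by (simp add: euclidean_product_topology)
  also have "\<dots> \<longleftrightarrow> (\<forall>i. (\<lambda>k. f k i) \<longlonglongrightarrow> l i)"
    by (subst limitin_componentwise) auto
  finally show ?thesis .
qed

text \<open>Near-maximizers of the supremum lie in a bounded superlevel set of \<open>u\<close>,
  hence have a convergent subsequence; upper semicontinuity of both factors shows that its limit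
  realizes at least the value \<alpha>.\<close>

lemma supconv_usc:
  assumes u: "unit_fun n u" "\<And>a. closed {x \<in> Rn n. a \<le> u x}" and v: "unit_fun n v" "\<And>a. closed {x \<in> Rn n. a \<le> v x}"
    and bd: "\<And>a. a > 0 \<Longrightarrow> \<exists>R. \<forall>x\<in>Rn n. a \<le> u x \<longrightarrow> (\<forall>i<n. \<bar>x i\<bar> \<le> R)"
  shows "closed {x \<in> Rn n. \<alpha> \<le> supconv n u v x}"
proof (cases "\<alpha> > 0")
  case False
  then have "{x \<in> Rn n. \<alpha> \<le> supconv n u v x} = Rn n"
    using unit_funD(1)[OF supconv_unit[OF u(1) v(1)]] by force
  then show ?thesis by (simp add: closed_Rn)
next
  case pos: True
  show ?thesis
    unfolding closed_sequential_limits
  proof (intro allI impI; elim conjE)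
    fix x l assume x: "\<forall>j. x j \<in> {x \<in> Rn n. \<alpha> \<le> supconv n u v x}" and lim: "x \<longlonglongrightarrow> l"
    have l: "l \<in> Rn n" using closed_Rn[of n] x lim unfolding closed_sequential_limits by blast
    \<comment> \<open>The shift by 2 keeps the error at most \<open>\<alpha> / 2\<close>, so every
      near-maximizer satisfies \<open>\<alpha> / 2 \<le> u (a j)\<close> and all of them lie in one
      cube.\<close>
    have "\<exists>a\<in>Rn n. \<alpha> - \<alpha> / real (j + 2) < u a * v (comb n 1 (x j) (-1) a)" for j
    proof (rule ccontr)
      assume "\<not> ?thesis"
      then have "supconv n u v (x j) \<le> \<alpha> - \<alpha> / real (j + 2)"
        by (intro supconv_least) (auto simp: not_less)
      moreover have "\<alpha> \<le> supconv n u v (x j)" using x by auto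
      moreover have "\<alpha> / real (j + 2) > 0" using pos by simp
      ultimately show False by linarith
    qed
    then obtain a where a: "\<And>j. a j \<in> Rn n" "\<And>j. \<alpha> - \<alpha> / real (j + 2) < u (a j) * v (comb n 1 (x j) (-1) (a j))"
      by metis
    have half: "\<alpha> / 2 \<le> u (a j)" for j
    proof -
      have "\<alpha> / real (j + 2) \<le> \<alpha> / 2" using pos by (intro divide_left_mono) auto
      moreover have "u (a j) * v (comb n 1 (x j) (-1) (a j)) \<le> u (a j)"
        using unit_funD(1)[OF u(1) a(1)] unit_funD(2)[OF v(1)] by (simp add: mult_left_le)
      ultimately show ?thesis using a(2)[of j] by linarith
    qed
    obtain R where R: "\<And>x. x\<in>Rn n \<Longrightarrow> \<alpha> / 2 \<le> u x \<Longrightarrow> (\<forall>i<n. \<bar>x i\<bar> \<le> R)"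
      using bd[of "\<alpha> / 2"] pos by auto
    have "\<forall>j. a j \<in> cube n R" using R a(1) half by (auto simp: cube_def)
    moreover have "seq_compact (cube n R)" using compact_cube compact_imp_seq_compact by blast
    ultimately obtain b r where b: "b \<in> cube n R" and r: "strict_mono r" "(a \<circ> r) \<longlonglongrightarrow> b"
      unfolding seq_compact_def by metis
    have bR: "b \<in> Rn n" using b by (simp add: cube_def)
    have xr: "(x \<circ> r) \<longlonglongrightarrow> l" using lim r(1) by (rule LIMSEQ_subseq_LIMSEQ)
    have comb_lim: "(\<lambda>j. comb n 1 (x (r j)) (-1) (a (r j))) \<longlonglongrightarrow> comb n 1 l (-1) b"
      unfolding tendsto_fun_iff
    proof
      fix i show "(\<lambda>j. comb n 1 (x (r j)) (-1) (a (r j)) i) \<longlonglongrightarrow> comb n 1 l (-1) b i"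
      proof (cases "i < n")
        case True
        have "(\<lambda>j. x (r j) i) \<longlonglongrightarrow> l i" "(\<lambda>j. a (r j) i) \<longlonglongrightarrow> b i"
          using xr r(2) by (auto simp: tendsto_fun_iff o_def)
        from tendsto_diff[OF this] show ?thesis using True by simp
      qed (simp add: comb_def)
    qed
    have "\<alpha> \<le> u b * v (comb n 1 l (-1) b)"
    proof (rule ccontr)
      assume "\<not> ?thesis"
      then have lt: "u b * v (comb n 1 l (-1) b) < \<alpha>" by simp
      \<comment> \<open>Semicontinuity bounds each factor eventually by its limit value plus
        \<open>e\<close>; the strict inequality leaves room for such an \<open>e\<close>.\<close>
      have "((\<lambda>e. (u b + e) * (v (comb n 1 l (-1) b) + e)) \<longlongrightarrow> (u b + 0) * (v (comb n 1 l (-1) b) + 0)) (at_right 0)"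
        by (intro tendsto_intros)
      then have "\<forall>\<^sub>F e in at_right 0. (u b + e) * (v (comb n 1 l (-1) b) + e) < \<alpha>"
        using lt by (intro order_tendstoD(2)) auto
      then obtain e where e: "e > 0" "(u b + e) * (v (comb n 1 l (-1) b) + e) < \<alpha>"
        unfolding eventually_at_right_field by (metis dense)
      define p where "p = (u b + e) * (v (comb n 1 l (-1) b) + e)"
      have 1: "\<forall>\<^sub>F j in sequentially. u (a (r j)) < u b + e"
        by (rule usc_seq[OF u(2), of _ b]) (use r(2) a(1) bR e in \<open>auto simp: o_def\<close>)
      have 2: "\<forall>\<^sub>F j in sequentially. v (comb n 1 (x (r j)) (-1) (a (r j))) < v (comb n 1 l (-1) b) + e"
        by (rule usc_seq[OF v(2) comb_lim]) (use e in auto)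
      have "(\<lambda>j. \<alpha> - \<alpha> / real (j + 2)) \<longlonglongrightarrow> \<alpha>" by real_asymp
      then have "\<forall>\<^sub>F j in sequentially. p < \<alpha> - \<alpha> / real (j + 2)"
        using e(2) unfolding p_def by (intro order_tendstoD(1)) auto
      then have 3: "\<forall>\<^sub>F j in sequentially. p < \<alpha> - \<alpha> / real (r j + 2)"
        using eventually_subseq[OF r(1)] by fastforce
      have "\<forall>\<^sub>F j in sequentially. False"
        using 1 2 3
      proof eventually_elim
        case (elim j)
        have "u (a (r j)) * v (comb n 1 (x (r j)) (-1) (a (r j))) \<le> p"
          unfolding p_def using elim(1,2) unit_funD(1)[OF u(1) a(1), of "r j"] unit_funD(1)[OF v(1), of "comb n 1 (x (r j)) (-1) (a (r j))"]
          by (intro mult_mono) auto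
        then show ?case using elim(3) a(2)[of "r j"] by linarith
      qed
      then show False by simp
    qed
    then show "l \<in> {x \<in> Rn n. \<alpha> \<le> supconv n u v x}"
      using l supconv_ge[OF u(1) v(1) bR, of l] by auto
  qed
qed

lemma refl_unit: "unit_fun n f \<Longrightarrow> unit_fun n (refl_fun n f)"
  by (auto simp: unit_fun_def refl_fun_def)

lemma refl_usc:
  assumes "\<And>a. closed {x \<in> Rn n. a \<le> f x}"
  shows "closed {x \<in> Rn n. a \<le> refl_fun n f x}"
proof -
  have c: "continuous_on UNIV (\<lambda>x. comb n (-1) x 0 x)"
  proof (rule continuous_on_coordinatewise_then_product)
    fix i show "continuous_on UNIV (\<lambda>x. comb n (-1) x 0 x i)"
      by (cases "i < n") (auto simp: comb_def intro!: continuous_intros)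
  qed
  have "{x \<in> Rn n. a \<le> refl_fun n f x} = Rn n \<inter> (\<lambda>x. comb n (-1) x 0 x) -` {x \<in> Rn n. a \<le> f x}"
    by (auto simp: refl_fun_def)
  moreover have "closed ((\<lambda>x. comb n (-1) x 0 x) -` {x \<in> Rn n. a \<le> f x})"
    by (rule closed_vimage[OF assms c])
  ultimately show ?thesis using closed_Rn by auto
qed

lemma refl_lcf: assumes "lcf n f" shows "lcf n (refl_fun n f)"
proof -
  have "f (comb n (-1) x 0 x) * f (comb n (-1) y 0 y) \<le> (f (comb n (-1) (comb n (1/2) x (1/2) y) 0 (comb n (1/2) x (1/2) y)))\<^sup>2" for x y
  proof -
    have "comb n (-1) (comb n (1/2) x (1/2) y) 0 (comb n (1/2) x (1/2) y) = comb n (1/2) (comb n (-1) x 0 x) (1/2) (comb n (-1) y 0 y)"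
      by (rule Rn_ext[of _ n]) auto
    then show ?thesis using lcfD(5)[OF assms] by simp
  qed
  then show ?thesis
    using refl_unit[OF lcf_unit[OF assms]] refl_usc[OF lcfD(3)[OF assms]]
    unfolding lcf_def unit_fun_def by (auto simp: refl_fun_def)
qed

lemma nn_integral_refl:
  assumes "f \<in> borel_measurable (Rn_lborel n)"
  shows "(\<integral>\<^sup>+x. f (comb n (-1) x 0 x) \<partial>Rn_lborel n) = (\<integral>\<^sup>+x. f x \<partial>Rn_lborel n)"
proof -
  have "comb n 1 (\<lambda>_. 0) (-1) x = comb n (-1) x 0 x" for x by (auto simp: comb_def)
  with nn_integral_affine[OF assms, of "-1" "\<lambda>_. 0"] show ?thesis by simp
qed

lemma mass_refl: "f \<in> borel_measurable (Rn_lborel n) \<Longrightarrow> mass n (refl_fun n f) = mass n f"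
  unfolding mass_def refl_fun_def using nn_integral_refl[of "\<lambda>x. ennreal (f x)" n] by simp

lemma nn_integral_translate:
  assumes "f \<in> borel_measurable (Rn_lborel n)"
  shows "(\<integral>\<^sup>+x. f (comb n 1 x (-1) a) \<partial>Rn_lborel n) = (\<integral>\<^sup>+x. f x \<partial>Rn_lborel n)"
proof -
  have "comb n 1 (\<lambda>i. - a i) 1 x = comb n 1 x (-1) a" for x by (auto simp: comb_def)
  with nn_integral_affine[OF assms, of 1 "\<lambda>i. - a i"] show ?thesis by simp
qed

lemma nn_integral_half:
  assumes "f \<in> borel_measurable (Rn_lborel n)"
  shows "(\<integral>\<^sup>+x. f (comb n (1/2) x a y) \<partial>Rn_lborel n) = 2^n * (\<integral>\<^sup>+x. f x \<partial>Rn_lborel n)"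
proof -
  have "comb n 1 (\<lambda>i. a * y i) (1/2) x = comb n (1/2) x a y" for x by (auto simp: comb_def)
  with nn_integral_affine[OF assms, of "1/2" "\<lambda>i. a * y i"]
  have "(\<integral>\<^sup>+x. f x \<partial>Rn_lborel n) = ennreal ((1/2)^n) * (\<integral>\<^sup>+x. f (comb n (1/2) x a y) \<partial>Rn_lborel n)" by simp
  then have "2^n * (\<integral>\<^sup>+x. f x \<partial>Rn_lborel n) = (ennreal (2^n) * ennreal ((1/2)^n)) * (\<integral>\<^sup>+x. f (comb n (1/2) x a y) \<partial>Rn_lborel n)"
    by (simp add: mult.assoc ennreal_power[symmetric])
  also have "ennreal (2^n) * ennreal ((1/2)^n) = 1"
    by (simp add: ennreal_mult[symmetric] power_mult_distrib[symmetric])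
  finally show ?thesis by simp
qed

section \<open>The Rogers--Shephard inequality and volume bounds for coverings\<close>

lemma ennreal_mult_divide_eq': "c \<noteq> 0 \<Longrightarrow> c \<noteq> \<infinity> \<Longrightarrow> c * a / c = (a::ennreal)"
  by (metis ennreal_mult_divide_eq infinity_ennreal_def mult.commute)

lemma lcf_half: "lcf n f \<Longrightarrow> x \<in> Rn n \<Longrightarrow> f x \<le> (f (comb n (1/2) x (1/2) (Rn_zero n)))\<^sup>2"
  using lcfD(5)[of n f x "Rn_zero n"] lcfD(4)[of n f] by simp

lemma sqrt_le_of_le_square: "a \<le> b\<^sup>2 \<Longrightarrow> 0 \<le> b \<Longrightarrow> sqrt a \<le> (b::real)"
  by (rule real_le_lsqrt) auto

lemma nn_integral_half2:
  assumes "f \<in> borel_measurable (Rn_lborel n)"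
  shows "(\<integral>\<^sup>+x. f (comb n (1/2) y (1/2) x) \<partial>Rn_lborel n) = 2^n * (\<integral>\<^sup>+x. f x \<partial>Rn_lborel n)"
proof -
  have "comb n (1/2) y (1/2) x = comb n (1/2) x (1/2) y" for x by (auto simp: comb_def)
  then show ?thesis using nn_integral_half[OF assms, of "1/2" y] by simp
qed

lemma tail_small:
  fixes f :: "(nat \<Rightarrow> real) \<Rightarrow> real"
  assumes [measurable]: "f \<in> borel_measurable (Rn_lborel n)" and fin: "mass n f < \<infinity>" and e: "e > 0"
  shows "\<exists>R>0. (\<integral>\<^sup>+x. ennreal (f x) * indicator (- cube n R) x \<partial>Rn_lborel n) < e"
proof -
  have "(\<lambda>k. \<integral>\<^sup>+x. ennreal (f x) * indicator (- cube n (real k)) x \<partial>Rn_lborel n) \<longlonglongrightarrow> (\<integral>\<^sup>+x. 0 \<partial>Rn_lborel n)"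
  proof (rule nn_integral_dominated_convergence[where w="\<lambda>x. ennreal (f x)"])
    show "(\<integral>\<^sup>+x. ennreal (f x) \<partial>Rn_lborel n) < \<infinity>" using fin by (simp add: mass_def)
    show "AE x in Rn_lborel n. (\<lambda>k. ennreal (f x) * indicator (- cube n (real k)) x) \<longlonglongrightarrow> 0"
    proof (rule AE_I2)
      fix x assume x: "x \<in> space (Rn_lborel n)"
      obtain K :: nat where K: "(\<Sum>i<n. \<bar>x i\<bar>) \<le> real K" using real_arch_simple by blast
      have "\<forall>k\<ge>K. ennreal (f x) * indicator (- cube n (real k)) x = 0"
      proof (intro allI impI)
        fix k assume "K \<le> k"
        have "\<bar>x i\<bar> \<le> real k" if "i < n" for i
        proof -
          have "\<bar>x i\<bar> \<le> (\<Sum>i<n. \<bar>x i\<bar>)" using that by (intro member_le_sum) auto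
          then show ?thesis using K \<open>K \<le> k\<close> by linarith
        qed
        then show "ennreal (f x) * indicator (- cube n (real k)) x = 0"
          using x by (auto simp: indicator_def cube_def)
      qed
      then show "(\<lambda>k. ennreal (f x) * indicator (- cube n (real k)) x) \<longlonglongrightarrow> 0"
        by (intro tendsto_eventually) (auto simp: eventually_sequentially)
    qed
    show "(\<lambda>x. ennreal (f x) * indicator (- cube n (real k)) x) \<in> borel_measurable (Rn_lborel n)" for k
      by measurable
  qed (auto simp: indicator_def)
  then have "\<forall>\<^sub>F k in sequentially. (\<integral>\<^sup>+x. ennreal (f x) * indicator (- cube n (real k)) x \<partial>Rn_lborel n) < e"
    using e by (intro order_tendstoD(2)) auto
  then obtain k where k: "k > 0" "(\<integral>\<^sup>+x. ennreal (f x) * indicator (- cube n (real k)) x \<partial>Rn_lborel n) < e"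
    using eventually_conj[OF eventually_gt_at_top[of 0]] eventually_happens' sequentially_bot by blast
  then show ?thesis by (intro exI[of _ "real k"]) auto
qed

text \<open>The correlation \<open>\<integral> f(y) f(y - x/2) dy\<close> tends to 0 as \<open>x\<close> tends to infinity, but log-concavity bounds it
  from below in terms of \<open>f x\<close>.\<close>

lemma lcf_bounded:
  assumes f: "lcf n f" and m: "0 < mass n f" "mass n f < \<infinity>" and a: "a > 0"
  shows "\<exists>R. \<forall>x\<in>Rn n. a \<le> f x \<longrightarrow> (\<forall>i<n. \<bar>x i\<bar> \<le> R)"
proof -
  note [measurable] = lcf_measurable[OF f]
  define e where "e = ennreal (sqrt a) * mass n f"
  \<comment> \<open>Log-concavity will give \<open>e \<le> 2^n * \<rho>\<close> for the correlation
    \<rho>, while two tails smaller than \<eta> give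
    \<open>2^n * \<rho> < 2^n * (\<eta> + \<eta>) = e\<close>.\<close>
  define \<eta> where "\<eta> = e / (2 * 2^n)"
  have two: "(2::ennreal) * 2^n \<noteq> 0" "(2::ennreal) * 2^n \<noteq> \<infinity>"
    by (simp_all add: ennreal_mult_eq_top_iff power_eq_top_ennreal)
  have e0: "e > 0" "e < \<infinity>" using m a by (auto simp: e_def ennreal_mult_less_top ennreal_zero_less_mult_iff)
  have \<eta>0: "\<eta> > 0" using e0 two unfolding \<eta>_def by (simp add: ennreal_zero_less_divide less_top)
  obtain R where R: "R > 0" "(\<integral>\<^sup>+x. ennreal (f x) * indicator (- cube n R) x \<partial>Rn_lborel n) < \<eta>"
    using tail_small[OF _ m(2) \<eta>0] by auto
  have "\<bar>x i\<bar> \<le> 4 * R" if x: "x \<in> Rn n" "a \<le> f x" and i: "i < n" for x i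
  proof (rule ccontr)
    assume big: "\<not> \<bar>x i\<bar> \<le> 4 * R"
    \<comment> \<open>\<open>h\<close> is half of \<open>x\<close>. If
      \<open>\<bar>x i\<bar> > 4 * R\<close>, then \<open>y\<close> and \<open>y - h\<close> differ
      by more than \<open>2 * R\<close> in coordinate \<open>i\<close>, so they cannot both lie in
      the cube.\<close>
    define h where "h = comb n (1/2) x 0 x"
    define \<rho> where "\<rho> = (\<integral>\<^sup>+y. ennreal (f y * f (comb n 1 y (-1) h)) \<partial>Rn_lborel n)"
    have "e \<le> (\<integral>\<^sup>+w. ennreal (f (comb n (1/2) x (1/2) w) * f (comb n 1 (comb n (1/2) x (1/2) w) (-1) h)) \<partial>Rn_lborel n)"
    proof -
      have "ennreal (sqrt a) * ennreal (f w) \<le> ennreal (f (comb n (1/2) x (1/2) w) * f (comb n 1 (comb n (1/2) x (1/2) w) (-1) h))"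
        if w: "w \<in> Rn n" for w
      proof -
        have e: "comb n 1 (comb n (1/2) x (1/2) w) (-1) h = comb n (1/2) w (1/2) (Rn_zero n)"
          by (rule Rn_ext[of _ n]) (auto simp: h_def)
        have 1: "sqrt (a * f w) \<le> f (comb n (1/2) x (1/2) w)"
          using lcfD(5)[OF f x(1) w] lcfD(1)[OF f w] lcfD(1)[OF f, of "comb n (1/2) x (1/2) w"] x(2) a
          by (intro sqrt_le_of_le_square) (auto intro: order_trans[OF mult_right_mono])
        have 2: "sqrt (f w) \<le> f (comb n (1/2) w (1/2) (Rn_zero n))"
          using lcf_half[OF f w] lcfD(1)[OF f] by (intro sqrt_le_of_le_square) auto
        have "sqrt a * f w = sqrt (a * f w) * sqrt (f w)"
          using lcfD(1)[OF f w] a by (simp add: real_sqrt_mult)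
        also have "\<dots> \<le> f (comb n (1/2) x (1/2) w) * f (comb n (1/2) w (1/2) (Rn_zero n))"
          using 1 2 lcfD(1)[OF f w] lcfD(1)[OF f] a by (intro mult_mono) auto
        finally show ?thesis
          using a lcfD(1)[OF f w] unfolding e by (simp add: ennreal_mult[symmetric] ennreal_leI)
      qed
      then show ?thesis
        unfolding e_def mass_def by (subst nn_integral_cmult[symmetric]) (auto intro!: nn_integral_mono)
    qed
    also have "\<dots> = 2^n * \<rho>"
      unfolding \<rho>_def by (rule nn_integral_half2) measurable
    finally have e_le: "e \<le> 2^n * \<rho>" .
    have "\<rho> \<le> (\<integral>\<^sup>+y. ennreal (f y) * indicator (- cube n R) y +
         ennreal (f (comb n 1 y (-1) h)) * indicator (- cube n R) (comb n 1 y (-1) h) \<partial>Rn_lborel n)"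
      unfolding \<rho>_def
    proof (rule nn_integral_mono)
      fix y assume "y \<in> space (Rn_lborel n)"
      then have y: "y \<in> Rn n" by simp
      have b: "f y * f (comb n 1 y (-1) h) \<le> f y" "f y * f (comb n 1 y (-1) h) \<le> f (comb n 1 y (-1) h)"
        using lcfD(1,2)[OF f y] lcfD(1,2)[OF f, of "comb n 1 y (-1) h"] by (simp_all add: mult_left_le mult_left_le_one_le)
      have "y \<notin> cube n R \<or> comb n 1 y (-1) h \<notin> cube n R"
      proof (rule ccontr)
        assume "\<not> ?thesis"
        then have "\<bar>y i\<bar> \<le> R" "\<bar>y i - x i / 2\<bar> \<le> R" using i by (auto simp: cube_def h_def)
        then show False using big R(1) by linarith
      qed
      then show "ennreal (f y * f (comb n 1 y (-1) h)) \<le> ennreal (f y) * indicator (- cube n R) y +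
         ennreal (f (comb n 1 y (-1) h)) * indicator (- cube n R) (comb n 1 y (-1) h)"
        using b by (auto simp: ennreal_leI add_increasing add_increasing2)
    qed
    also have "\<dots> = (\<integral>\<^sup>+y. ennreal (f y) * indicator (- cube n R) y \<partial>Rn_lborel n) +
      (\<integral>\<^sup>+y. ennreal (f (comb n 1 y (-1) h)) * indicator (- cube n R) (comb n 1 y (-1) h) \<partial>Rn_lborel n)"
      by (rule nn_integral_add) measurable
    also have "(\<integral>\<^sup>+y. ennreal (f (comb n 1 y (-1) h)) * indicator (- cube n R) (comb n 1 y (-1) h) \<partial>Rn_lborel n)
       = (\<integral>\<^sup>+y. ennreal (f y) * indicator (- cube n R) y \<partial>Rn_lborel n)"
      by (rule nn_integral_translate) measurable
    also have "(\<integral>\<^sup>+y. ennreal (f y) * indicator (- cube n R) y \<partial>Rn_lborel n) + (\<integral>\<^sup>+y. ennreal (f y) * indicator (- cube n R) y \<partial>Rn_lborel n) < \<eta> + \<eta>"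
      using R(2) by (intro add_strict_mono) auto
    finally have "\<rho> < \<eta> + \<eta>" .
    moreover have "(0::ennreal) < 2^n" using two(1) by (metis mult_zero_right not_gr_zero)
    ultimately have "2^n * \<rho> < 2^n * (\<eta> + \<eta>)"
      using two by (intro ennreal_mult_strict_left_mono) (auto simp: less_top[symmetric] power_eq_top_ennreal)
    also have "2^n * (\<eta> + \<eta>) = (2 * 2^n) * \<eta>" by (simp add: algebra_simps mult_2)
    also have "\<dots> = e" unfolding \<eta>_def ennreal_times_divide by (rule ennreal_mult_divide_eq'[OF two])
    finally show False using e_le by simp
  qed
  then show ?thesis by blast
qed

lemma supconv_lcf:
  assumes u: "lcf n u" "0 < mass n u" "mass n u < \<infinity>" and v: "lcf n v"
  shows "lcf n (supconv n u v)"
  using supconv_unit[OF lcf_unit[OF u(1)] lcf_unit[OF v]]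
    supconv_usc[OF lcf_unit[OF u(1)] lcfD(3)[OF u(1)] lcf_unit[OF v] lcfD(3)[OF v] lcf_bounded[OF u]]
    supconv_midpoint[OF u(1) v]
  unfolding lcf_def unit_fun_def by auto

lemma ennreal_supconv_mult_le:
  assumes "unit_fun n u" "unit_fun n v" and c: "\<And>a. a \<in> Rn n \<Longrightarrow> ennreal (u a * v (comb n 1 x (-1) a)) * k \<le> c"
    and k: "k < \<infinity>"
  shows "ennreal (supconv n u v x) * k \<le> c"
proof (cases "c = \<infinity>")
  case False
  obtain k' where k': "k = ennreal k'" "k' \<ge> 0" using k by (cases k) auto
  obtain c' where c': "c = ennreal c'" "c' \<ge> 0" using False by (cases c) auto
  have "supconv n u v x * k' \<le> c'"
  proof (rule supconv_mult_le[OF k'(2) assms(1,2)])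
    fix a assume a: "a \<in> Rn n"
    then have "ennreal (u a * v (comb n 1 x (-1) a) * k') \<le> ennreal c'"
      using c[OF a] k' c' assms(1,2) by (simp add: ennreal_mult' unit_fun_def)
    then show "u a * v (comb n 1 x (-1) a) * k' \<le> c'" using c' by simp
  qed
  then have "ennreal (supconv n u v x * k') \<le> ennreal c'" by (rule ennreal_leI)
  then show ?thesis using k' c' by (simp add: ennreal_mult'')
qed simp

lemma mass_le_one_mult: assumes "unit_fun n u" "unit_fun n v" shows "mass n (\<lambda>x. u x * v x) \<le> mass n u"
  unfolding mass_def using assms
  by (intro nn_integral_mono ennreal_leI) (auto simp: unit_fun_def mult_left_le)

text \<open>For a fixed decomposition x = a + b, the substitution y = (a + w) / 2 places x/2 - y
  midway between b and -w. Log-concavity then bounds u(a) v(b) times the integral of u(w) v(-w) by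
  2^n times the integral of u(y) v(x/2 - y) over y. The supremum over the decompositions and
  integration over x finish the proof.\<close>

lemma rogers_shephard:
  assumes u: "lcf n u" "mass n u < \<infinity>" and v: "lcf n v"
    and S: "supconv n u v \<in> borel_measurable (Rn_lborel n)"
  shows "mass n (supconv n u v) * mass n (\<lambda>x. u x * refl_fun n v x) \<le> 4^n * (mass n u * mass n v)"
proof -
  note [measurable] = lcf_measurable[OF u(1)] lcf_measurable[OF v] lcf_measurable[OF refl_lcf[OF v]] S
  note uu = lcf_unit[OF u(1)] lcf_unit[OF v]
  define m where "m = mass n (\<lambda>x. u x * refl_fun n v x)"
  have m: "m < \<infinity>"
    using mass_le_one_mult[OF uu(1) refl_unit[OF uu(2)]] u(2) unfolding m_def by (rule le_less_trans)
  define \<rho> where "\<rho> x = (\<integral>\<^sup>+y. ennreal (u y * v (comb n (1/2) x (-1) y)) \<partial>Rn_lborel n)" for x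
  have \<rho>_meas: "\<rho> \<in> borel_measurable (Rn_lborel n)"
    unfolding \<rho>_def by measurable
  have key: "ennreal (supconv n u v x) * m \<le> 2^n * \<rho> x" if x: "x \<in> Rn n" for x
  proof (rule ennreal_supconv_mult_le[OF uu _ m])
    fix a assume a: "a \<in> Rn n"
    let ?b = "comb n 1 x (-1) a"
    have pt: "u a * v ?b * (u w * refl_fun n v w) \<le> u (comb n (1/2) a (1/2) w) * v (comb n (1/2) x (-1) (comb n (1/2) a (1/2) w))"
      if w: "w \<in> Rn n" for w
    proof -
      let ?w = "comb n (-1) w 0 w"
      have e: "comb n (1/2) x (-1) (comb n (1/2) a (1/2) w) = comb n (1/2) ?b (1/2) ?w"
        by (rule Rn_ext[of _ n]) (auto simp: field_simps)
      \<comment> \<open>Log-concavity bounds \<open>?p\<close> by the square of the desired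
        right-hand side. As \<open>?p \<le> 1\<close>, the square of \<open>?p\<close> obeys the
        same bound, and roots can be taken.\<close>
      let ?p = "u a * v ?b * (u w * v ?w)"
      have p01: "0 \<le> ?p" "?p \<le> 1"
        using unit_funD(1,2)[OF uu(1) a] unit_funD(1,2)[OF uu(1) w] unit_funD(1,2)[OF uu(2) comb_in_Rn]
        by (auto intro!: mult_le_one mult_nonneg_nonneg)
      have "?p\<^sup>2 \<le> ?p" using p01 by (simp add: power2_eq_square mult_left_le)
      also have "?p = (u a * u w) * (v ?b * v ?w)" by simp
      also have "\<dots> \<le> (u (comb n (1/2) a (1/2) w))\<^sup>2 * (v (comb n (1/2) ?b (1/2) ?w))\<^sup>2"
        by (intro mult_mono lcfD(5) u v a w) (auto simp: a w lcfD(1)[OF u(1)] lcfD(1)[OF v])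
      finally have "?p\<^sup>2 \<le> (u (comb n (1/2) a (1/2) w) * v (comb n (1/2) ?b (1/2) ?w))\<^sup>2"
        by (simp add: power_mult_distrib)
      then show ?thesis
        unfolding e refl_fun_def
        by (rule power2_le_imp_le) (auto simp: lcfD(1)[OF u(1)] lcfD(1)[OF v])
    qed
    have "ennreal (u a * v ?b) * m = (\<integral>\<^sup>+w. ennreal (u a * v ?b * (u w * refl_fun n v w)) \<partial>Rn_lborel n)"
      unfolding m_def mass_def using a
      by (subst nn_integral_cmult[symmetric]) (auto simp: ennreal_mult' lcfD(1)[OF u(1)] lcfD(1)[OF v])
    also have "\<dots> \<le> (\<integral>\<^sup>+w. ennreal (u (comb n (1/2) a (1/2) w) * v (comb n (1/2) x (-1) (comb n (1/2) a (1/2) w))) \<partial>Rn_lborel n)"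
      using pt by (intro nn_integral_mono ennreal_leI) auto
    also have "\<dots> = 2^n * \<rho> x"
      unfolding \<rho>_def by (rule nn_integral_half2) measurable
    finally show "ennreal (u a * v ?b) * m \<le> 2^n * \<rho> x" .
  qed
  have "mass n (supconv n u v) * m = (\<integral>\<^sup>+x. ennreal (supconv n u v x) * m \<partial>Rn_lborel n)"
    unfolding mass_def by (rule nn_integral_multc[symmetric]) measurable
  also have "\<dots> \<le> (\<integral>\<^sup>+x. 2^n * \<rho> x \<partial>Rn_lborel n)"
    using key by (intro nn_integral_mono) auto
  also have "\<dots> = 2^n * (\<integral>\<^sup>+x. \<rho> x \<partial>Rn_lborel n)"
    by (rule nn_integral_cmult) (rule \<rho>_meas)
  also have "(\<integral>\<^sup>+x. \<rho> x \<partial>Rn_lborel n) = (\<integral>\<^sup>+y. (\<integral>\<^sup>+x. ennreal (u y * v (comb n (1/2) x (-1) y)) \<partial>Rn_lborel n) \<partial>Rn_lborel n)"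
    unfolding \<rho>_def
    by (rule pair_sigma_finite.Fubini') (auto intro: pair_sigma_finite.intro Rn.sigma_finite_measure_axioms simp: case_prod_beta')
  also have "\<dots> = (\<integral>\<^sup>+y. ennreal (u y) * (2^n * mass n v) \<partial>Rn_lborel n)"
  proof (rule nn_integral_cong)
    fix y assume y: "y \<in> space (Rn_lborel n)"
    have "(\<integral>\<^sup>+x. ennreal (u y * v (comb n (1/2) x (-1) y)) \<partial>Rn_lborel n) =
      ennreal (u y) * (\<integral>\<^sup>+x. ennreal (v (comb n (1/2) x (-1) y)) \<partial>Rn_lborel n)"
      using y by (subst nn_integral_cmult[symmetric]) (auto simp: ennreal_mult' lcfD(1)[OF u(1)])
    also have "(\<integral>\<^sup>+x. ennreal (v (comb n (1/2) x (-1) y)) \<partial>Rn_lborel n) = 2^n * mass n v"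
      unfolding mass_def by (rule nn_integral_half) measurable
    finally show "(\<integral>\<^sup>+x. ennreal (u y * v (comb n (1/2) x (-1) y)) \<partial>Rn_lborel n) = ennreal (u y) * (2^n * mass n v)" .
  qed
  also have "\<dots> = mass n u * (2^n * mass n v)"
    unfolding mass_def by (rule nn_integral_multc) measurable
  also have "2^n * (mass n u * (2^n * mass n v)) = 4^n * (mass n u * mass n v)"
  proof -
    have "(4::ennreal)^n = 2^n * 2^n" by (simp add: power_mult_distrib[symmetric])
    then show ?thesis by (simp add: mult_ac)
  qed
  finally show ?thesis unfolding m_def .
qed

text \<open>Since v(0) = 1, midpoint log-concavity gives v(x) \<le> v(x/2)^2; the dilation costs
  2^n.\<close>

lemma mass_square:
  assumes "lcf n v" shows "mass n v \<le> 2^n * mass n (\<lambda>x. (v x)\<^sup>2)"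
proof -
  note [measurable] = lcf_measurable[OF assms]
  have "mass n v \<le> (\<integral>\<^sup>+x. ennreal ((v (comb n (1/2) x (1/2) (Rn_zero n)))\<^sup>2) \<partial>Rn_lborel n)"
    unfolding mass_def using lcf_half[OF assms] by (intro nn_integral_mono ennreal_leI) auto
  also have "\<dots> = 2^n * mass n (\<lambda>x. (v x)\<^sup>2)"
    unfolding mass_def by (rule nn_integral_half) measurable
  finally show ?thesis .
qed

lemma mass_square_le: assumes "unit_fun n v" shows "mass n (\<lambda>x. (v x)\<^sup>2) \<le> mass n v"
  unfolding power2_eq_square by (rule mass_le_one_mult[OF assms assms])

text \<open>The covering measure has density S/k with S = u \<star> v_- and k the integral of v^2.
  From u(x) v(x - t) \<le> S(t), multiplication by v(x - t) and integration over t give u(x) k \<le>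
  (S * v)(x). Its total mass is the integral of S divided by k, and \<open>mass_square\<close>
  replaces k by the integral of v.\<close>

lemma covering_upper:
  assumes u: "unit_fun n u" and v: "lcf n v" "0 < mass n v" "mass n v < \<infinity>"
    and S[measurable]: "supconv n u (refl_fun n v) \<in> borel_measurable (Rn_lborel n)"
  shows "covering_number n u v * mass n v \<le> 2^n * mass n (supconv n u (refl_fun n v))"
proof -
  note [measurable] = lcf_measurable[OF v(1)]
  note vu = lcf_unit[OF v(1)]
  define S where "S = supconv n u (refl_fun n v)"
  have [measurable]: "S \<in> borel_measurable (Rn_lborel n)" using S by (simp add: S_def)
  have S0: "x \<in> Rn n \<Longrightarrow> 0 \<le> S x" for x
    unfolding S_def by (rule unit_funD(1)[OF supconv_unit[OF u refl_unit[OF vu]]])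
  define k where "k = mass n (\<lambda>x. (v x)\<^sup>2)"
  have k1: "k < \<infinity>" using mass_square_le[OF vu] v(3) by (simp add: k_def le_less_trans)
  have k2: "mass n v \<le> 2^n * k" using mass_square[OF v(1)] by (simp add: k_def)
  have k3: "k \<noteq> 0" using k2 v(2) by (metis mult_zero_right not_less)
  define \<mu> where "\<mu> = density (Rn_lborel n) (\<lambda>t. ennreal (S t) / k)"
  have "\<mu> \<in> covering_measures n u v"
    unfolding covering_measures_def
  proof (intro CollectI conjI ballI)
    show "sets \<mu> = sets (Rn_lborel n)" by (simp add: \<mu>_def)
    fix x assume x: "x \<in> Rn n"
    have pt: "u x * (v (comb n 1 x (-1) t))\<^sup>2 \<le> S t * v (comb n 1 x (-1) t)" if t: "t \<in> Rn n" for t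
    proof -
      have "comb n (-1) (comb n 1 t (-1) x) 0 (comb n 1 t (-1) x) = comb n 1 x (-1) t"
        by (rule Rn_ext[of _ n]) auto
      then have "u x * v (comb n 1 x (-1) t) \<le> S t"
        using supconv_ge[OF u refl_unit[OF vu] x, of t] by (simp add: S_def refl_fun_def)
      then show ?thesis
        using unit_funD(1)[OF vu, of "comb n 1 x (-1) t"] by (simp add: power2_eq_square mult.assoc[symmetric] mult_right_mono)
    qed
    have refl: "(\<integral>\<^sup>+t. ennreal ((v (comb n 1 x (-1) t))\<^sup>2) \<partial>Rn_lborel n) = k"
    proof -
      have "comb n 1 x (-1) t = comb n 1 (comb n (-1) t 0 t) (-1) (comb n (-1) x 0 x)" for t
        by (rule Rn_ext[of _ n]) auto
      then have "(\<integral>\<^sup>+t. ennreal ((v (comb n 1 x (-1) t))\<^sup>2) \<partial>Rn_lborel n) =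
         (\<integral>\<^sup>+t. (\<lambda>t. ennreal ((v (comb n 1 t (-1) (comb n (-1) x 0 x)))\<^sup>2)) (comb n (-1) t 0 t) \<partial>Rn_lborel n)" by simp
      also have "\<dots> = (\<integral>\<^sup>+t. ennreal ((v (comb n 1 t (-1) (comb n (-1) x 0 x)))\<^sup>2) \<partial>Rn_lborel n)"
        by (rule nn_integral_refl) measurable
      also have "\<dots> = (\<integral>\<^sup>+t. ennreal ((v t)\<^sup>2) \<partial>Rn_lborel n)"
        by (rule nn_integral_translate) measurable
      finally show ?thesis by (simp add: k_def mass_def)
    qed
    have "ennreal (u x) = ennreal (u x) * (k / k)"
      using k1 k3 by (simp add: ennreal_divide_self less_top)
    also have "\<dots> = (\<integral>\<^sup>+t. ennreal (u x) * ennreal ((v (comb n 1 x (-1) t))\<^sup>2) / k \<partial>Rn_lborel n)"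
      by (simp add: divide_ennreal_def nn_integral_multc nn_integral_cmult refl mult.assoc)
    also have "\<dots> \<le> (\<integral>\<^sup>+t. ennreal (S t) / k * ennreal (v (Rn_diff n x t)) \<partial>Rn_lborel n)"
    proof (rule nn_integral_mono)
      fix t assume t: "t \<in> space (Rn_lborel n)"
      have "ennreal (u x) * ennreal ((v (comb n 1 x (-1) t))\<^sup>2) \<le> ennreal (S t) * ennreal (v (comb n 1 x (-1) t))"
        using pt[of t] t unit_funD(1)[OF u x] unit_funD(1)[OF vu] S0[of t]
        by (simp add: ennreal_mult[symmetric] ennreal_leI)
      from mult_left_mono[OF this, of "inverse k"]
      show "ennreal (u x) * ennreal ((v (comb n 1 x (-1) t))\<^sup>2) / k \<le> ennreal (S t) / k * ennreal (v (Rn_diff n x t))"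
        by (simp add: Rn_diff_comb divide_ennreal_def mult_ac)
    qed
    also have "\<dots> = (\<integral>\<^sup>+t. ennreal (v (Rn_diff n x t)) \<partial>\<mu>)"
      unfolding \<mu>_def by (rule nn_integral_density[symmetric]) (auto simp: Rn_diff_comb)
    finally show "ennreal (u x) \<le> (\<integral>\<^sup>+t. ennreal (v (Rn_diff n x t)) \<partial>\<mu>)" .
  qed
  then have "covering_number n u v \<le> emeasure \<mu> (Rn n)"
    unfolding covering_number_def by (rule INF_lower)
  also have "\<dots> = (\<integral>\<^sup>+t. ennreal (S t) / k * indicator (Rn n) t \<partial>Rn_lborel n)"
    unfolding \<mu>_def by (rule emeasure_density) auto
  also have "\<dots> = (\<integral>\<^sup>+t. ennreal (S t) / k \<partial>Rn_lborel n)"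
    by (rule nn_integral_cong) auto
  also have "\<dots> = mass n S / k"
    by (simp add: divide_ennreal_def nn_integral_multc mass_def)
  finally have "covering_number n u v * mass n v \<le> (mass n S / k) * (2^n * k)"
    using k2 by (intro mult_mono) auto
  also have "\<dots> = 2^n * mass n S * (k / k)" by (simp add: divide_ennreal_def mult_ac)
  also have "k / k = 1" using k1 k3 by (simp add: ennreal_divide_self less_top)
  finally show ?thesis by (simp add: S_def)
qed

text \<open>In u(a) v(t - a) \<le> \<integral> v(a - r) v(t - a) d\<mu>(r), the midpoint of a - r
  and t - a is (t - r) / 2, which does not involve a. So u \<star> v at t is at most \<integral>
  v((t - r) / 2) d\<mu>(r), and integration over t yields the factor 2^n.\<close>

lemma covering_lower:
  assumes u: "unit_fun n u" and v: "lcf n v" "0 < mass n v" "mass n v < \<infinity>"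
  shows "mass n (supconv n u v) \<le> 2^n * mass n v * covering_number n u v"
proof -
  note [measurable] = lcf_measurable[OF v(1)]
  note vu = lcf_unit[OF v(1)]
  define c where "c = 2^n * mass n v"
  have c: "c \<noteq> 0" "c \<noteq> \<infinity>" using v by (auto simp: c_def ennreal_mult_eq_top_iff power_eq_top_ennreal)
  have "mass n (supconv n u v) / c \<le> emeasure \<mu> (Rn n)" if "\<mu> \<in> covering_measures n u v" for \<mu>
  proof (cases "emeasure \<mu> (Rn n) = \<infinity>")
    case False
    have s: "sets \<mu> = sets (Rn_lborel n)" and cov: "\<And>x. x \<in> Rn n \<Longrightarrow> ennreal (u x) \<le> (\<integral>\<^sup>+t. ennreal (v (Rn_diff n x t)) \<partial>\<mu>)"
      using that by (auto simp: covering_measures_def)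
    have sp: "space \<mu> = Rn n" using sets_eq_imp_space_eq[OF s] by simp
    interpret \<mu>: finite_measure \<mu> by (rule finite_measureI) (use sp False in auto)
    note [measurable_cong] = s
    have "mass n (supconv n u v) \<le> (\<integral>\<^sup>+t. (\<integral>\<^sup>+r. ennreal (v (comb n (1/2) t (-1/2) r)) \<partial>\<mu>) \<partial>Rn_lborel n)"
      unfolding mass_def
    proof (rule nn_integral_mono)
      fix t assume "t \<in> space (Rn_lborel n)"
      then have t: "t \<in> Rn n" by simp
      have "ennreal (supconv n u v t) * 1 \<le> (\<integral>\<^sup>+r. ennreal (v (comb n (1/2) t (-1/2) r)) \<partial>\<mu>)"
      proof (rule ennreal_supconv_mult_le[OF u vu])
        fix a assume a: "a \<in> Rn n"
        let ?d = "comb n 1 t (-1) a"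
        have "ennreal (u a * v ?d) \<le> (\<integral>\<^sup>+r. ennreal (v (comb n 1 a (-1) r)) \<partial>\<mu>) * ennreal (v ?d)"
          using cov[OF a] unit_funD(1)[OF u a] unit_funD(1)[OF vu, of ?d]
          by (simp add: ennreal_mult Rn_diff_comb mult_right_mono)
        also have "\<dots> = (\<integral>\<^sup>+r. ennreal (v (comb n 1 a (-1) r)) * ennreal (v ?d) \<partial>\<mu>)"
          by (rule nn_integral_multc[symmetric]) measurable
        also have "\<dots> \<le> (\<integral>\<^sup>+r. ennreal (v (comb n (1/2) t (-1/2) r)) \<partial>\<mu>)"
        proof (rule nn_integral_mono)
          fix r assume "r \<in> space \<mu>"
          let ?h = "comb n (1/2) t (-1/2) r"
          have "comb n (1/2) (comb n 1 a (-1) r) (1/2) ?d = ?h"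
            by (rule Rn_ext[of _ n]) (auto simp: field_simps)
          then have "v (comb n 1 a (-1) r) * v ?d \<le> (v ?h)\<^sup>2"
            using lcfD(5)[OF v(1), of "comb n 1 a (-1) r" ?d] by simp
          also have "\<dots> \<le> v ?h"
            using unit_funD(1,2)[OF vu, of ?h] by (simp add: power2_eq_square mult_left_le)
          finally show "ennreal (v (comb n 1 a (-1) r)) * ennreal (v ?d) \<le> ennreal (v ?h)"
            by (simp add: ennreal_mult[symmetric] unit_funD(1)[OF vu] ennreal_leI)
        qed
        finally show "ennreal (u a * v ?d) * 1 \<le> (\<integral>\<^sup>+r. ennreal (v (comb n (1/2) t (-1/2) r)) \<partial>\<mu>)" by simp
      qed simp
      then show "ennreal (supconv n u v t) \<le> (\<integral>\<^sup>+r. ennreal (v (comb n (1/2) t (-1/2) r)) \<partial>\<mu>)" by simp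
    qed
    also have "\<dots> = (\<integral>\<^sup>+r. (\<integral>\<^sup>+t. ennreal (v (comb n (1/2) t (-1/2) r)) \<partial>Rn_lborel n) \<partial>\<mu>)"
      by (rule pair_sigma_finite.Fubini')
         (auto intro: pair_sigma_finite.intro Rn.sigma_finite_measure_axioms \<mu>.sigma_finite_measure_axioms simp: case_prod_beta')
    also have "\<dots> = (\<integral>\<^sup>+r. c \<partial>\<mu>)"
      unfolding c_def mass_def by (intro nn_integral_cong nn_integral_half) measurable
    also have "\<dots> = c * emeasure \<mu> (Rn n)" by (simp add: sp)
    finally have "mass n (supconv n u v) / c \<le> c * emeasure \<mu> (Rn n) / c" by (rule divide_right_mono_ennreal)
    also have "\<dots> = emeasure \<mu> (Rn n)"
      by (rule ennreal_mult_divide_eq'[OF c])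
    finally show ?thesis .
  qed simp
  then have "mass n (supconv n u v) / c \<le> covering_number n u v"
    unfolding covering_number_def by (rule INF_greatest)
  then have "c * (mass n (supconv n u v) / c) \<le> c * covering_number n u v" by (rule mult_left_mono) simp
  also have "c * (mass n (supconv n u v) / c) = mass n (supconv n u v)"
    unfolding ennreal_times_divide by (rule ennreal_mult_divide_eq'[OF c])
  finally show ?thesis by (simp add: c_def)
qed

section \<open>A Prekopa--Leindler inequality on the half line\<close>

text \<open>Haar measure ds/s of the multiplicative half line; the logarithm carries it to Lebesgue
  measure.\<close>

definition inv_weight :: "real \<Rightarrow> ennreal" where
  "inv_weight s = ennreal (1 / s) * indicator {0<..} s"

lemma inv_weight_measurable [measurable]: "inv_weight \<in> borel_measurable borel"
  unfolding inv_weight_def by measurable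

lemma inv_weight_interval:
  assumes "p \<le> q"
  shows "(\<integral>\<^sup>+s. inv_weight s * indicator {exp p..exp q} s \<partial>lborel) = ennreal (q - p)"
proof -
  have "(\<integral>\<^sup>+s. inv_weight s * indicator {exp p..exp q} s \<partial>lborel) = (\<integral>\<^sup>+s. ennreal (1 / s) * indicator {exp p..exp q} s \<partial>lborel)"
    unfolding inv_weight_def
    by (rule nn_integral_cong) (auto simp: indicator_def split: if_splits intro: less_le_trans[OF exp_gt_zero])
  also have "\<dots> = ennreal (ln (exp q) - ln (exp p))"
  proof (rule nn_integral_FTC_Icc)
    fix x assume "x \<in> {exp p..exp q}"
    then have "x > 0" by (auto intro: less_le_trans[OF exp_gt_zero])
    then show "(ln has_real_derivative 1 / x) (at x)" by (rule DERIV_ln_divide)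
    show "0 \<le> 1 / x" using \<open>x > 0\<close> by simp
  qed (use assms in auto)
  finally show ?thesis by simp
qed

text \<open>In logarithmic coordinates, the two sets have sumset of length at most \<open>h - l\<close>.\<close>

lemma inv_weight_sum_le:
  assumes A: "A \<subseteq> {0<..}" "A \<noteq> {}" and B: "B \<subseteq> {0<..}" "B \<noteq> {}"
    and lh: "\<And>s t. s \<in> A \<Longrightarrow> t \<in> B \<Longrightarrow> l \<le> ln s + ln t \<and> ln s + ln t \<le> h"
  shows "(\<integral>\<^sup>+s. inv_weight s * indicator A s \<partial>lborel) + (\<integral>\<^sup>+s. inv_weight s * indicator B s \<partial>lborel) \<le> ennreal (h - l)"
proof -
  define p where "p = Inf (ln ` A)" define q where "q = Sup (ln ` A)"
  obtain s0 t0 where s0: "s0 \<in> A" and t0: "t0 \<in> B" using A B by auto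
  have bb: "bdd_below (ln ` A)" using lh[OF _ t0] by (intro bdd_belowI[of _ "l - ln t0"]) force
  have ba: "bdd_above (ln ` A)" using lh[OF _ t0] by (intro bdd_aboveI[of _ "h - ln t0"]) force
  have pq: "p \<le> ln s" "ln s \<le> q" if "s \<in> A" for s
    using that unfolding p_def q_def by (auto intro!: cInf_lower cSup_upper bb ba)
  have B1: "l - p \<le> ln t" "ln t \<le> h - q" if t: "t \<in> B" for t
  proof -
    have "l - ln t \<le> p" unfolding p_def using A lh[OF _ t] by (intro cInf_greatest) force+
    then show "l - p \<le> ln t" by simp
    have "q \<le> h - ln t" unfolding q_def using A lh[OF _ t] by (intro cSup_least) force+
    then show "ln t \<le> h - q" by simp
  qed
  have AA: "A \<subseteq> {exp p..exp q}"
  proof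
    fix s assume s: "s \<in> A"
    then have "s = exp (ln s)" using A(1) by auto
    then show "s \<in> {exp p..exp q}" using pq[OF s] by (metis atLeastAtMost_iff exp_le_cancel_iff)
  qed
  have BB: "B \<subseteq> {exp (l - p)..exp (h - q)}"
  proof
    fix s assume s: "s \<in> B"
    then have "s = exp (ln s)" using B(1) by auto
    then show "s \<in> {exp (l - p)..exp (h - q)}" using B1[OF s] by (metis atLeastAtMost_iff exp_le_cancel_iff)
  qed
  have le: "p \<le> q" "l - p \<le> h - q" using pq[OF s0] B1[OF t0] by linarith+
  have "(\<integral>\<^sup>+s. inv_weight s * indicator A s \<partial>lborel) \<le> (\<integral>\<^sup>+s. inv_weight s * indicator {exp p..exp q} s \<partial>lborel)"
    using AA by (intro nn_integral_mono mult_left_mono) (auto simp: indicator_def)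
  moreover have "(\<integral>\<^sup>+s. inv_weight s * indicator B s \<partial>lborel) \<le> (\<integral>\<^sup>+s. inv_weight s * indicator {exp (l - p)..exp (h - q)} s \<partial>lborel)"
    using BB by (intro nn_integral_mono mult_left_mono) (auto simp: indicator_def)
  ultimately have "(\<integral>\<^sup>+s. inv_weight s * indicator A s \<partial>lborel) + (\<integral>\<^sup>+s. inv_weight s * indicator B s \<partial>lborel)
     \<le> ennreal (q - p) + ennreal ((h - q) - (l - p))"
    unfolding inv_weight_interval[OF le(1)] inv_weight_interval[OF le(2)] by (rule add_mono)
  also have "\<dots> = ennreal (h - l)" using le by (simp add: ennreal_plus[symmetric] del: ennreal_plus)
  finally show ?thesis .
qed

text \<open>Tonelli's theorem for the region under the graph. Levels are scaled by \<alpha> so that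
  two functions with different suprema can be compared at the same \<open>l\<close> between 0 and
  1.\<close>

lemma inv_weight_layer_cake:
  assumes [measurable]: "F \<in> borel_measurable borel" and F: "\<And>s. s > 0 \<Longrightarrow> 0 \<le> F s \<and> F s \<le> \<alpha>" and \<alpha>: "\<alpha> > 0"
  shows "(\<integral>\<^sup>+s. inv_weight s * ennreal (F s) \<partial>lborel) =
    ennreal \<alpha> * (\<integral>\<^sup>+l. indicator {0<..<1} l * (\<integral>\<^sup>+s. inv_weight s * indicator {s. 0 < s \<and> \<alpha> * l < F s} s \<partial>lborel) \<partial>lborel)"
proof -
  have inner: "(\<integral>\<^sup>+l. indicator {0<..<1} l * (inv_weight s * indicator {s. 0 < s \<and> \<alpha> * l < F s} s) \<partial>lborel) = inv_weight s * ennreal (F s / \<alpha>)" for s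
  proof (cases "s > 0")
    case True
    have "(\<integral>\<^sup>+l. indicator {0<..<1} l * (inv_weight s * indicator {s. 0 < s \<and> \<alpha> * l < F s} s) \<partial>lborel) =
       (\<integral>\<^sup>+l. inv_weight s * indicator {0<..<F s / \<alpha>} l \<partial>lborel)"
    proof (rule nn_integral_cong)
      fix l :: real
      have "F s / \<alpha> \<le> 1" using F[OF True] \<alpha> by simp
      moreover have "\<alpha> * l < F s \<longleftrightarrow> l < F s / \<alpha>" using \<alpha> by (simp add: field_simps)
      ultimately show "indicator {0<..<1} l * (inv_weight s * indicator {s. 0 < s \<and> \<alpha> * l < F s} s) = inv_weight s * indicator {0<..<F s / \<alpha>} l"
        using True by (auto simp: indicator_def)
    qed
    also have "\<dots> = inv_weight s * ennreal (F s / \<alpha>)"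
      using F[OF True] \<alpha> by (simp add: nn_integral_cmult)
    finally show ?thesis .
  qed (simp add: inv_weight_def)
  have meas: "(\<lambda>(l, s). indicator {0<..<1} l * (inv_weight s * indicator {s. 0 < s \<and> \<alpha> * l < F s} s)) \<in> borel_measurable (lborel \<Otimes>\<^sub>M lborel)"
    by measurable
  have "(\<integral>\<^sup>+l. indicator {0<..<1} l * (\<integral>\<^sup>+s. inv_weight s * indicator {s. 0 < s \<and> \<alpha> * l < F s} s \<partial>lborel) \<partial>lborel) =
    (\<integral>\<^sup>+l. (\<integral>\<^sup>+s. indicator {0<..<1} l * (inv_weight s * indicator {s. 0 < s \<and> \<alpha> * l < F s} s) \<partial>lborel) \<partial>lborel)"
    by (intro nn_integral_cong nn_integral_cmult[symmetric]) measurable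
  also have "\<dots> = (\<integral>\<^sup>+s. (\<integral>\<^sup>+l. indicator {0<..<1} l * (inv_weight s * indicator {s. 0 < s \<and> \<alpha> * l < F s} s) \<partial>lborel) \<partial>lborel)"
    using lborel_pair.Fubini'[OF meas] by simp
  also have "\<dots> = (\<integral>\<^sup>+s. inv_weight s * ennreal (F s / \<alpha>) \<partial>lborel)" by (simp only: inner)
  finally have "ennreal \<alpha> * (\<integral>\<^sup>+l. indicator {0<..<1} l * (\<integral>\<^sup>+s. inv_weight s * indicator {s. 0 < s \<and> \<alpha> * l < F s} s \<partial>lborel) \<partial>lborel)
     = (\<integral>\<^sup>+s. ennreal \<alpha> * (inv_weight s * ennreal (F s / \<alpha>)) \<partial>lborel)"
    by (simp add: nn_integral_cmult)
  also have "\<dots> = (\<integral>\<^sup>+s. inv_weight s * ennreal (F s) \<partial>lborel)"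
  proof (rule nn_integral_cong)
    fix s
    show "ennreal \<alpha> * (inv_weight s * ennreal (F s / \<alpha>)) = inv_weight s * ennreal (F s)"
    proof (cases "s > 0")
      case True
      have "ennreal \<alpha> * ennreal (F s / \<alpha>) = ennreal (F s)"
        using F[OF True] \<alpha> by (simp add: ennreal_mult[symmetric])
      then show ?thesis by (metis mult.left_commute)
    qed (simp add: inv_weight_def)
  qed
  finally show ?thesis by simp
qed

lemma exp_half_bound: "r \<ge> 0 \<Longrightarrow> r * exp (- r) \<le> exp (- r / 2)" for r :: real
proof -
  assume "r \<ge> 0"
  have "r / 2 \<le> exp (r / 2)" using exp_ge_add_one_self[of "r / 2"] by linarith
  moreover have "r \<le> exp (r / 2)"
  proof -
    have "r / 4 + 1 \<le> exp (r / 4)" using exp_ge_add_one_self[of "r / 4"] by linarith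
    then have "(r / 4 + 1)\<^sup>2 \<le> (exp (r / 4))\<^sup>2" using \<open>r \<ge> 0\<close> by (intro power_mono) auto
    also have "(exp (r / 4))\<^sup>2 = exp (r / 2)" by (simp add: exp_double[symmetric])
    finally have "(r / 4 + 1)\<^sup>2 \<le> exp (r / 2)" .
    moreover have "r \<le> (r / 4 + 1)\<^sup>2"
      using zero_le_power2[of "r / 4 - 1"] by (simp add: power2_eq_square algebra_simps)
    ultimately show ?thesis by linarith
  qed
  then have "r * exp (- r) \<le> exp (r / 2) * exp (- r)" by (intro mult_right_mono) auto
  then show ?thesis by (simp add: exp_add[symmetric])
qed

lemma mult_exp_minus_le_one: "r \<ge> 0 \<Longrightarrow> r * exp (- r) \<le> 1" for r :: real
  using exp_half_bound[of r] by (rule order_trans) simp_all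

lemma ln_le_fourth_root: "x > 0 \<Longrightarrow> ln x \<le> 4 * x powr (1/4)" for x :: real
proof -
  assume x: "x > 0"
  have "ln (x powr (1/4)) \<le> x powr (1/4)" using x ln_le_minus_one[of "x powr (1/4)"] by simp
  then show ?thesis using x by (simp add: ln_powr)
qed

text \<open>One-dimensional multiplicative Prekopa--Leindler inequality for the kernel \<open>exp (- s t)\<close>, with a
  non-sharp constant. It applies to the level sets of \<open>s f(s)\<close> and \<open>t g(t)\<close> with respect to \<open>ds/s\<close>.\<close>

lemma half_line_normalized:
  assumes [measurable]: "F \<in> borel_measurable borel" "G \<in> borel_measurable borel"
    and F: "\<And>s. s > 0 \<Longrightarrow> 0 \<le> F s \<and> F s \<le> \<alpha>" "\<And>a. a < \<alpha> \<Longrightarrow> \<exists>s>0. a < F s" "\<alpha> > 0"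
    and G: "\<And>s. s > 0 \<Longrightarrow> 0 \<le> G s \<and> G s \<le> \<beta>" "\<And>a. a < \<beta> \<Longrightarrow> \<exists>s>0. a < G s" "\<beta> > 0"
    and FG: "\<And>s t. s > 0 \<Longrightarrow> t > 0 \<Longrightarrow> F s * G t \<le> c * (s * t * exp (- (s * t)))" and c: "c > 0"
  shows "(\<integral>\<^sup>+s. inv_weight s * ennreal (F s) \<partial>lborel) * (\<integral>\<^sup>+s. inv_weight s * ennreal (G s) \<partial>lborel) \<le> ennreal (100 * c)"
proof -
  \<comment> \<open>The scale-invariant constant: after division of \<open>F\<close> and
    \<open>G\<close> by their suprema, the hypothesis holds with \<open>k\<close> in place of
    \<open>c\<close>.\<close>
  define k where "k = c / (\<alpha> * \<beta>)"
  have k0: "k > 0" using F G c by (simp add: k_def)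
  define A where "A l = {s. 0 < s \<and> \<alpha> * l < F s}" for l
  define B where "B l = {s. 0 < s \<and> \<beta> * l < G s}" for l
  have AB: "l\<^sup>2 < k * (s * t * exp (- (s * t)))" if l: "0 < l" "l < 1" and s: "s \<in> A l" and t: "t \<in> B l" for s t l
  proof -
    have "(\<alpha> * l) * (\<beta> * l) < F s * G t"
      using s t l F(3) G(3) by (intro mult_strict_mono) (auto simp: A_def B_def intro: less_trans[of 0 "\<alpha> * l"])
    also have "\<dots> \<le> c * (s * t * exp (- (s * t)))" using FG s t by (auto simp: A_def B_def)
    finally show ?thesis
      using F G by (simp add: k_def field_simps power2_eq_square)
  qed
  have ne: "A l \<noteq> {}" "B l \<noteq> {}" if "0 < l" "l < 1" for l
    using F(2)[of "\<alpha> * l"] G(2)[of "\<beta> * l"] F(3) G(3) that by (auto simp: A_def B_def)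
  \<comment> \<open>For \<open>k < 1\<close> the level \<open>l = sqrt k\<close> would give
    \<open>k < k * (r * exp (- r))\<close> with \<open>r = s * t\<close>, although
    \<open>r * exp (- r) \<le> 1\<close>.\<close>
  have k1: "k \<ge> 1"
  proof (rule ccontr)
    assume "\<not> k \<ge> 1"
    then have l: "0 < sqrt k" "sqrt k < 1" using k0 by auto
    obtain s t where st: "s \<in> A (sqrt k)" "t \<in> B (sqrt k)" using ne[OF l] by blast
    then have pos: "s * t > 0" by (auto simp: A_def B_def)
    have "k < k * (s * t * exp (- (s * t)))" using AB[OF l st] k0 by simp
    moreover have "k * (s * t * exp (- (s * t))) \<le> k * 1"
      using mult_exp_minus_le_one[of "s * t"] pos k0 by (intro mult_left_mono) auto
    ultimately show False by linarith
  qed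
  have level: "(\<integral>\<^sup>+s. inv_weight s * indicator (A l) s \<partial>lborel) + (\<integral>\<^sup>+s. inv_weight s * indicator (B l) s \<partial>lborel)
      \<le> ennreal (10 * k powr (1/4) * l powr (- 1/2))" if l: "0 < l" "l < 1" for l
  proof -
    \<comment> \<open>On the two level sets, \<open>r = s * t\<close> satisfies
      \<open>1 / x < r * exp (- r)\<close>. This confines \<open>r\<close> to the range from
      \<open>1 / x\<close> to \<open>2 * ln x\<close>, of logarithmic length
      \<open>ln (2 * ln x) + ln x\<close>.\<close>
    define x where "x = k / l\<^sup>2"
    have l2: "l\<^sup>2 < 1" using l by (simp add: power_less_one_iff)
    have x: "x > 1" using k1 l l2 by (simp add: x_def field_simps)
    have st: "- ln x \<le> ln s + ln t \<and> ln s + ln t \<le> ln (2 * ln x)" if s: "s \<in> A l" and t: "t \<in> B l" for s t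
    proof -
      have pos: "s > 0" "t > 0" using s t by (auto simp: A_def B_def)
      have r: "1 / x < s * t * exp (- (s * t))"
        using AB[OF l s t] k0 l by (simp add: x_def field_simps)
      have "s * t * exp (- (s * t)) \<le> s * t" using pos by (simp add: mult_left_le)
      with r have "1 / x \<le> s * t" by linarith
      then have "ln (1 / x) \<le> ln (s * t)" using x pos by (subst ln_le_cancel_iff) auto
      then have 1: "- ln x \<le> ln s + ln t" using x pos by (simp add: ln_div ln_mult)
      have "1 / x < exp (- (s * t) / 2)" using r exp_half_bound[of "s * t"] pos by simp
      then have "ln (1 / x) < ln (exp (- (s * t) / 2))" using x by (subst ln_less_cancel_iff) auto
      then have "s * t \<le> 2 * ln x" using x by (simp add: ln_div)
      then have "ln (s * t) \<le> ln (2 * ln x)" using x pos by (subst ln_le_cancel_iff) auto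
      then show ?thesis using 1 pos by (simp add: ln_mult)
    qed
    have "(\<integral>\<^sup>+s. inv_weight s * indicator (A l) s \<partial>lborel) + (\<integral>\<^sup>+s. inv_weight s * indicator (B l) s \<partial>lborel)
      \<le> ennreal (ln (2 * ln x) - (- ln x))"
      by (rule inv_weight_sum_le[OF _ ne(1)[OF l] _ ne(2)[OF l] st]) (auto simp: A_def B_def)
    also have "\<dots> \<le> ennreal (10 * k powr (1/4) * l powr (- 1/2))"
    proof (rule ennreal_leI)
      \<comment> \<open>The fourth root turns the length into a multiple of
        \<open>l powr (- 1/2)\<close>, which is integrable at 0.\<close>
      have "ln (2 * ln x) \<le> ln (2 * x)" using x ln_le_minus_one[of x] by (subst ln_le_cancel_iff) auto
      also have "\<dots> = ln 2 + ln x" using x by (simp add: ln_mult)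
      finally have "ln (2 * ln x) - (- ln x) \<le> 1 + 2 * ln x" using ln_2_less_1 by linarith
      also have "\<dots> \<le> 1 + 8 * x powr (1/4)" using ln_le_fourth_root[of x] x by simp
      also have "\<dots> \<le> 10 * x powr (1/4)" using ge_one_powr_ge_zero[of x "1/4"] x by simp
      also have "x powr (1/4) = k powr (1/4) * l powr (- 1/2)"
      proof -
        have "(l\<^sup>2) powr (1/4) = l powr (1/2)"
        proof -
          have "l\<^sup>2 = l powr 2" using l by simp
          then show ?thesis by (simp only: powr_powr) simp
        qed
        then have "x powr (1/4) = k powr (1/4) / l powr (1/2)"
          unfolding x_def using k0 l by (subst powr_divide) auto
        moreover have "l powr (- 1/2) = inverse (l powr (1/2))" using powr_minus[of l "1/2"] by simp
        ultimately show ?thesis by (simp only: divide_inverse)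
      qed
      finally show "ln (2 * ln x) - (- ln x) \<le> 10 * k powr (1/4) * l powr (- 1/2)" by simp
    qed
    finally show ?thesis .
  qed
  define IF where "IF = (\<integral>\<^sup>+l. indicator {0<..<1} l * (\<integral>\<^sup>+s. inv_weight s * indicator (A l) s \<partial>lborel) \<partial>lborel)"
  define IG where "IG = (\<integral>\<^sup>+l. indicator {0<..<1} l * (\<integral>\<^sup>+s. inv_weight s * indicator (B l) s \<partial>lborel) \<partial>lborel)"
  have half: "(\<integral>\<^sup>+l. ennreal (l powr (- 1/2)) * indicator {0<..<1} l \<partial>lborel) \<le> 2"
  proof -
    have "((\<lambda>x::real. x powr (-1/2)) has_integral 2) {0..1}"
      using has_integral_powr_from_0[of "-1/2" 1] by simp
    then have "(\<integral>\<^sup>+l. ennreal (l powr (- 1/2)) * indicator {0..1} l \<partial>lborel) = ennreal 2"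
      by (intro nn_integral_has_integral_lebesgue') auto
    moreover have "(\<integral>\<^sup>+l. ennreal (l powr (- 1/2)) * indicator {0<..<1} l \<partial>lborel) \<le> (\<integral>\<^sup>+l. ennreal (l powr (- 1/2)) * indicator {0..1::real} l \<partial>lborel)"
      by (intro nn_integral_mono) (auto simp: indicator_def)
    ultimately show ?thesis by simp
  qed
  have "IF + IG = (\<integral>\<^sup>+l. indicator {0<..<1} l * ((\<integral>\<^sup>+s. inv_weight s * indicator (A l) s \<partial>lborel) + (\<integral>\<^sup>+s. inv_weight s * indicator (B l) s \<partial>lborel)) \<partial>lborel)"
    unfolding IF_def IG_def A_def B_def distrib_left
    by (rule nn_integral_add[symmetric]) measurable
  also have "\<dots> \<le> (\<integral>\<^sup>+l. ennreal (10 * k powr (1/4)) * (ennreal (l powr (- 1/2)) * indicator {0<..<1} l) \<partial>lborel)"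
    using level by (intro nn_integral_mono) (auto simp: indicator_def ennreal_mult[symmetric])
  also have "\<dots> = ennreal (10 * k powr (1/4)) * (\<integral>\<^sup>+l. ennreal (l powr (- 1/2)) * indicator {0<..<1} l \<partial>lborel)"
    by (rule nn_integral_cmult) measurable
  also have "\<dots> \<le> ennreal (10 * k powr (1/4)) * 2" using half by (rule mult_left_mono) simp
  also have "\<dots> = ennreal (20 * k powr (1/4))"
    using ennreal_mult[of "10 * k powr (1/4)" 2] by simp
  finally have sum: "IF + IG \<le> ennreal (20 * k powr (1/4))" .
  then have "IF \<noteq> \<infinity>" "IG \<noteq> \<infinity>" by (auto simp: top_unique)
  then obtain a b where ab: "IF = ennreal a" "IG = ennreal b" "a \<ge> 0" "b \<ge> 0"
    by (metis ennreal_cases infinity_ennreal_def)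
  \<comment> \<open>From \<open>4 * (a * b) \<le> (a + b)^2\<close> the bound on the sum yields
    \<open>a * b \<le> 100 * k powr (1/2)\<close>, which is at most \<open>100 * k\<close> because
    \<open>k \<ge> 1\<close>. The constant 100 arises here.\<close>
  have "a + b \<le> 20 * k powr (1/4)" using sum ab by (simp add: ennreal_plus[symmetric] del: ennreal_plus)
  then have "(a + b)\<^sup>2 \<le> (20 * k powr (1/4))\<^sup>2" using ab by (intro power_mono) auto
  also have "\<dots> = 400 * k powr (1/2)"
    by (simp add: power2_eq_square powr_add[symmetric])
  finally have "4 * (a * b) \<le> 400 * k powr (1/2)"
    using zero_le_power2[of "a - b"] by (simp add: power2_eq_square algebra_simps)
  then have ab2: "a * b \<le> 100 * k" using powr_mono[of "1/2" 1 k] k1 by simp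
  have "(\<integral>\<^sup>+s. inv_weight s * ennreal (F s) \<partial>lborel) * (\<integral>\<^sup>+s. inv_weight s * ennreal (G s) \<partial>lborel) = (ennreal \<alpha> * IF) * (ennreal \<beta> * IG)"
    unfolding IF_def IG_def A_def B_def
    using inv_weight_layer_cake[OF _ F(1) F(3)] inv_weight_layer_cake[OF _ G(1) G(3)] by simp
  also have "\<dots> = ennreal (\<alpha> * \<beta> * (a * b))"
    using ab F G by (simp add: ennreal_mult mult_ac)
  also have "\<dots> \<le> ennreal (\<alpha> * \<beta> * (100 * k))"
    using ab2 F G by (intro ennreal_leI mult_left_mono) auto
  also have "\<alpha> * \<beta> * (100 * k) = 100 * c" using F G by (simp add: k_def)
  finally show ?thesis .
qed

text \<open>Multiplying \<open>f\<close> and \<open>g\<close> by their variables turns ds and dt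
  into the invariant measure and the kernel into \<open>s * t * exp (- (s * t))\<close>. The bound
  and the bounded support of \<open>f\<close> make the supremum of \<open>s * f s\<close> finite; a
  point with \<open>f s0 > 0\<close> makes \<open>g\<close> finite and bounds
  \<open>t * g t\<close>.\<close>

lemma half_line:
  fixes f :: "real \<Rightarrow> real" and g :: "real \<Rightarrow> ennreal"
  assumes [measurable]: "f \<in> borel_measurable borel" "g \<in> borel_measurable borel"
    and f: "\<And>s. 0 \<le> f s" "\<And>s. f s \<le> M" "\<And>s. s > R \<Longrightarrow> f s = 0"
    and fg: "\<And>s t. s > 0 \<Longrightarrow> t > 0 \<Longrightarrow> ennreal (f s) * g t \<le> ennreal (c * exp (- (s * t)))" and c: "c > 0"
  shows "(\<integral>\<^sup>+s. ennreal (f s) * indicator {0<..} s \<partial>lborel) * (\<integral>\<^sup>+t. g t * indicator {0<..} t \<partial>lborel) \<le> ennreal (100 * c)"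
proof (cases "\<forall>s>0. f s = 0")
  case True
  then have "(\<integral>\<^sup>+s. ennreal (f s) * indicator {0<..} s \<partial>lborel) = (\<integral>\<^sup>+s. 0 \<partial>(lborel :: real measure))"
    by (intro nn_integral_cong) (auto simp: indicator_def)
  then show ?thesis by simp
next
  case False
  then obtain s0 where s0: "s0 > 0" "f s0 > 0" using f(1) by (metis less_eq_real_def)
  have gfin: "g t \<noteq> \<infinity>" if "t > 0" for t
    using fg[OF s0(1) that] s0 by (auto simp: ennreal_mult_eq_top_iff top_unique)
  define F where "F s = s * f s" for s
  define G where "G t = t * enn2real (g t)" for t
  have [measurable]: "F \<in> borel_measurable borel" "G \<in> borel_measurable borel" unfolding F_def G_def by measurable
  have eF: "(\<integral>\<^sup>+s. ennreal (f s) * indicator {0<..} s \<partial>lborel) = (\<integral>\<^sup>+s. inv_weight s * ennreal (F s) \<partial>lborel)"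
    using f(1) by (intro nn_integral_cong) (auto simp: F_def inv_weight_def indicator_def ennreal_mult[symmetric])
  have eG: "(\<integral>\<^sup>+s. g s * indicator {0<..} s \<partial>lborel) = (\<integral>\<^sup>+s. inv_weight s * ennreal (G s) \<partial>lborel)"
    using gfin by (intro nn_integral_cong) (auto simp: G_def inv_weight_def indicator_def ennreal_mult'[symmetric] less_top)
  have fg': "f s * enn2real (g t) \<le> c * exp (- (s * t))" if "s > 0" "t > 0" for s t
  proof -
    have "ennreal (f s * enn2real (g t)) \<le> ennreal (c * exp (- (s * t)))"
      using fg[OF that] gfin[OF that(2)] f(1) by (simp add: ennreal_mult' less_top)
    then show ?thesis using c by simp
  qed
  have FG: "F s * G t \<le> c * (s * t * exp (- (s * t)))" if "s > 0" "t > 0" for s t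
    using mult_left_mono[OF fg'[OF that], of "s * t"] that by (simp add: F_def G_def mult_ac)
  show ?thesis
  proof (cases "\<forall>t>0. G t = 0")
    case True
    then have "(\<integral>\<^sup>+s. inv_weight s * ennreal (G s) \<partial>lborel) = (\<integral>\<^sup>+s. 0 \<partial>(lborel :: real measure))"
      by (intro nn_integral_cong) (auto simp: inv_weight_def indicator_def)
    then show ?thesis by (simp add: eG)
  next
    case False
    then obtain t0 where t0: "t0 > 0" "G t0 \<noteq> 0" by auto
    define \<alpha> where "\<alpha> = (SUP s\<in>{0<..}. F s)"
    define \<beta> where "\<beta> = (SUP s\<in>{0<..}. G s)"
    have M: "M \<ge> 0" using f(1,2) order_trans by blast
    have "F s \<le> \<bar>R\<bar> * M" if "s > 0" for s
    proof (cases "s > R")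
      case False
      then show ?thesis unfolding F_def using that f(1,2)[of s] by (intro mult_mono) auto
    qed (use M f(3) in \<open>simp add: F_def\<close>)
    then have bF: "bdd_above (F ` {0<..})" by (intro bdd_aboveI[of _ "\<bar>R\<bar> * M"]) auto
    have "G t \<le> c / F s0" if "t > 0" for t
    proof -
      have p: "F s0 > 0" using s0 by (simp add: F_def)
      have "s0 * t * exp (- (s0 * t)) \<le> 1"
        using mult_exp_minus_le_one[of "s0 * t"] that s0 by simp
      then have "c * (s0 * t * exp (- (s0 * t))) \<le> c" using c by (simp add: mult_left_le)
      then have "F s0 * G t \<le> c" using FG[OF s0(1) that] by linarith
      then show ?thesis using p by (simp add: field_simps)
    qed
    then have bG: "bdd_above (G ` {0<..})" by (intro bdd_aboveI[of _ "c / F s0"]) auto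
    have nn: "s > 0 \<Longrightarrow> 0 \<le> F s" "s > 0 \<Longrightarrow> 0 \<le> G s" for s using f(1) by (auto simp: F_def G_def)
    have F1: "F s \<le> \<alpha>" if "s > 0" for s unfolding \<alpha>_def using that bF by (intro cSUP_upper) auto
    have G1: "G s \<le> \<beta>" if "s > 0" for s unfolding \<beta>_def using that bG by (intro cSUP_upper) auto
    have "\<alpha> > 0" using F1[OF s0(1)] s0 by (smt (verit) F_def mult_pos_pos)
    moreover have "\<beta> > 0" using G1[OF t0(1)] t0 nn(2)[OF t0(1)] by linarith
    moreover have "\<exists>s>0. a < F s" if "a < \<alpha>" for a
      using that less_cSUP_iff[OF _ bF, of a] unfolding \<alpha>_def by auto
    moreover have "\<exists>s>0. a < G s" if "a < \<beta>" for a
      using that less_cSUP_iff[OF _ bG, of a] unfolding \<beta>_def by auto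
    ultimately show ?thesis
      unfolding eF eG using F1 G1 nn FG c by (intro half_line_normalized[where \<alpha>=\<alpha> and \<beta>=\<beta>]) auto
  qed
qed

section \<open>The Santalo inequality\<close>

text \<open>Stated for pairs linked by a pairing inequality with constant \<open>c\<close> instead
  of for a function and its dual, because the induction produces marginals of both functions, which
  are such pairs.\<close>

definition santalo :: "nat \<Rightarrow> bool" where
  "santalo n \<longleftrightarrow> (\<forall>f (g :: (nat \<Rightarrow> real) \<Rightarrow> ennreal) c. integrable (Rn_lborel n) f \<longrightarrow> (\<forall>x\<in>Rn n. 0 \<le> f x) \<longrightarrow>
     (\<forall>i<n. has_bochner_integral (Rn_lborel n) (\<lambda>x. x i * f x) 0) \<longrightarrow>
     g \<in> borel_measurable (Rn_lborel n) \<longrightarrow> 0 < (c::real) \<longrightarrow>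
     (\<forall>x\<in>Rn n. \<forall>y\<in>Rn n. ennreal (f x) * g y \<le> ennreal (c * exp (- Rn_inner n x y))) \<longrightarrow>
     (\<integral>\<^sup>+x. ennreal (f x) \<partial>Rn_lborel n) * (\<integral>\<^sup>+y. g y \<partial>Rn_lborel n) \<le> ennreal (c * 400^n))"

text \<open>The uncentered variant for bounded functions with bounded support: a translation
  \<open>z\<close>, chosen before \<open>g\<close> and \<open>c\<close>, takes over the role of the
  center of mass. The induction alternates between the two forms.\<close>

definition santalo_at :: "nat \<Rightarrow> bool" where
  "santalo_at n \<longleftrightarrow> (\<forall>f M R. f \<in> borel_measurable (Rn_lborel n) \<longrightarrow> (\<forall>x\<in>Rn n. 0 \<le> f x \<and> f x \<le> (M::real)) \<longrightarrow>
     (\<forall>x\<in>Rn n - cube n R. f x = 0) \<longrightarrow>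
     (\<exists>z\<in>Rn n. \<forall>(g :: (nat \<Rightarrow> real) \<Rightarrow> ennreal) c.
       g \<in> borel_measurable (Rn_lborel n) \<longrightarrow> 0 < (c::real) \<longrightarrow>
       (\<forall>x\<in>Rn n. \<forall>y\<in>Rn n. ennreal (f (comb n 1 z 1 x)) * g y \<le> ennreal (c * exp (- Rn_inner n x y))) \<longrightarrow>
       (\<integral>\<^sup>+x. ennreal (f x) \<partial>Rn_lborel n) * (\<integral>\<^sup>+y. g y \<partial>Rn_lborel n) \<le> ennreal (c * 400^n)))"

text \<open>Integrate \<open>1 + r \<le> exp r\<close> with \<open>r = Rn_inner n z x\<close>
  against \<open>f\<close>; the linear term vanishes because \<open>f\<close> is centered. If the
  tilted function is not integrable, its integral is infinite.\<close>

lemma nn_integral_tilt: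
  assumes f: "integrable (Rn_lborel n) f" "\<And>x. x \<in> Rn n \<Longrightarrow> 0 \<le> f x"
    and ctr: "\<And>i. i < n \<Longrightarrow> has_bochner_integral (Rn_lborel n) (\<lambda>x. x i * f x) 0"
  shows "(\<integral>\<^sup>+x. ennreal (f x) \<partial>Rn_lborel n) \<le> (\<integral>\<^sup>+x. ennreal (f x * exp (Rn_inner n z x)) \<partial>Rn_lborel n)"
proof (cases "integrable (Rn_lborel n) (\<lambda>x. f x * exp (Rn_inner n z x))")
  case True
  have "has_bochner_integral (Rn_lborel n) (\<lambda>x. \<Sum>i<n. z i * (x i * f x)) (\<Sum>i<n. z i * 0)"
    by (intro has_bochner_integral_sum has_bochner_integral_mult_right ctr) auto
  also have "(\<lambda>x. \<Sum>i<n. z i * (x i * f x)) = (\<lambda>x. Rn_inner n z x * f x)"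
    by (auto simp: Rn_inner_def sum_distrib_right sum_distrib_left mult_ac)
  finally have "has_bochner_integral (Rn_lborel n) (\<lambda>x. f x + Rn_inner n z x * f x) (integral\<^sup>L (Rn_lborel n) f + 0)"
    using f(1) by (intro has_bochner_integral_add) (auto simp: has_bochner_integral_iff)
  then have i: "integrable (Rn_lborel n) (\<lambda>x. f x + Rn_inner n z x * f x)"
    "integral\<^sup>L (Rn_lborel n) f = (\<integral>x. f x + Rn_inner n z x * f x \<partial>Rn_lborel n)"
    by (auto simp: has_bochner_integral_iff)
  have "(\<integral>x. f x + Rn_inner n z x * f x \<partial>Rn_lborel n) \<le> (\<integral>x. f x * exp (Rn_inner n z x) \<partial>Rn_lborel n)"
  proof (rule integral_mono[OF i(1) True])
    fix x assume "x \<in> space (Rn_lborel n)"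
    then have "f x * (1 + Rn_inner n z x) \<le> f x * exp (Rn_inner n z x)"
      using f(2) by (intro mult_left_mono exp_ge_add_one_self) auto
    then show "f x + Rn_inner n z x * f x \<le> f x * exp (Rn_inner n z x)" by (simp add: algebra_simps)
  qed
  then have "integral\<^sup>L (Rn_lborel n) f \<le> (\<integral>x. f x * exp (Rn_inner n z x) \<partial>Rn_lborel n)" using i(2) by simp
  then show ?thesis
    using f by (subst (1 2) nn_integral_eq_integral) (auto intro!: True AE_I2 ennreal_leI)
next
  case False
  have [measurable]: "f \<in> borel_measurable (Rn_lborel n)" using f(1) by simp
  have "(\<integral>\<^sup>+x. ennreal (f x * exp (Rn_inner n z x)) \<partial>Rn_lborel n) = \<infinity>"
  proof (rule ccontr)
    assume "\<not> ?thesis"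
    then have "integrable (Rn_lborel n) (\<lambda>x. f x * exp (Rn_inner n z x))"
      using f(2) by (intro integrableI_nonneg) (auto simp: less_top)
    then show False using False by simp
  qed
  then show ?thesis by simp
qed

text \<open>The roles are exchanged: \<open>santalo_at\<close> is applied to truncations of
  \<open>g\<close>, which are bounded with bounded support. Translating them by \<open>z\<close> is
  paid for by the factor \<open>exp (Rn_inner n z y)\<close> on \<open>f\<close>, which by
  \<open>nn_integral_tilt\<close> does not decrease the integral of the centered \<open>f\<close>.
  Monotone convergence removes the truncation.\<close>

lemma santalo_at_imp: assumes "santalo_at n" shows "santalo n"
  unfolding santalo_def
proof (intro allI impI)
  fix f :: "(nat \<Rightarrow> real) \<Rightarrow> real" and g :: "(nat \<Rightarrow> real) \<Rightarrow> ennreal" and c :: real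
  assume f: "integrable (Rn_lborel n) f" "\<forall>x\<in>Rn n. 0 \<le> f x"
    and ctr: "\<forall>i<n. has_bochner_integral (Rn_lborel n) (\<lambda>x. x i * f x) 0"
    and g[measurable]: "g \<in> borel_measurable (Rn_lborel n)" and c: "0 < c"
    and fg: "\<forall>x\<in>Rn n. \<forall>y\<in>Rn n. ennreal (f x) * g y \<le> ennreal (c * exp (- Rn_inner n x y))"
  have [measurable]: "f \<in> borel_measurable (Rn_lborel n)" using f(1) by simp
  define h where "h k y = min (g y) (of_nat k) * indicator (cube n (real k)) y" for k y
  have [measurable]: "h k \<in> borel_measurable (Rn_lborel n)" for k unfolding h_def by measurable
  have h_fin: "h k y \<le> of_nat k" for k y by (auto simp: h_def indicator_def)
  have h_real: "ennreal (enn2real (h k y)) = h k y" for k y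
  proof -
    have "h k y < top" using h_fin[of k y] by (metis le_less_trans of_nat_less_top)
    then show ?thesis by simp
  qed
  have hg: "h k y \<le> g y" for k y by (auto simp: h_def indicator_def)
  have le: "(\<integral>\<^sup>+x. ennreal (f x) \<partial>Rn_lborel n) * (\<integral>\<^sup>+y. h k y \<partial>Rn_lborel n) \<le> ennreal (c * 400^n)" for k
  proof -
    have "enn2real (h k y) \<le> real k" for y
    proof -
      have "ennreal (enn2real (h k y)) \<le> ennreal (real k)" using h_fin[of k y] unfolding h_real by (simp add: ennreal_of_nat_eq_real_of_nat)
      then show ?thesis by simp
    qed
    moreover have "enn2real (h k y) = 0" if "y \<notin> cube n (real k)" for y using that by (simp add: h_def)
    ultimately obtain z where z: "z \<in> Rn n" and zz: "\<And>(g :: (nat \<Rightarrow> real) \<Rightarrow> ennreal) c.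
       g \<in> borel_measurable (Rn_lborel n) \<Longrightarrow> 0 < c \<Longrightarrow>
       (\<forall>x\<in>Rn n. \<forall>y\<in>Rn n. ennreal (enn2real (h k (comb n 1 z 1 x))) * g y \<le> ennreal (c * exp (- Rn_inner n x y))) \<Longrightarrow>
       (\<integral>\<^sup>+x. ennreal (enn2real (h k x)) \<partial>Rn_lborel n) * (\<integral>\<^sup>+y. g y \<partial>Rn_lborel n) \<le> ennreal (c * 400^n)"
      using assms[unfolded santalo_at_def, rule_format, of "\<lambda>y. enn2real (h k y)" "real k" "real k"] by auto
    have "(\<integral>\<^sup>+x. ennreal (enn2real (h k x)) \<partial>Rn_lborel n) * (\<integral>\<^sup>+y. ennreal (f y * exp (Rn_inner n z y)) \<partial>Rn_lborel n) \<le> ennreal (c * 400^n)"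
    proof (rule zz)
      show "\<forall>x\<in>Rn n. \<forall>y\<in>Rn n. ennreal (enn2real (h k (comb n 1 z 1 x))) * ennreal (f y * exp (Rn_inner n z y)) \<le> ennreal (c * exp (- Rn_inner n x y))"
      proof (intro ballI)
        fix x y assume x: "x \<in> Rn n" and y: "y \<in> Rn n"
        have "ennreal (enn2real (h k (comb n 1 z 1 x))) * ennreal (f y * exp (Rn_inner n z y)) =
           (ennreal (f y) * h k (comb n 1 z 1 x)) * ennreal (exp (Rn_inner n z y))"
          unfolding h_real using f(2) y by (simp add: ennreal_mult mult_ac)
        also have "\<dots> \<le> (ennreal (f y) * g (comb n 1 z 1 x)) * ennreal (exp (Rn_inner n z y))"
          using hg by (intro mult_right_mono mult_left_mono) auto
        also have "\<dots> \<le> ennreal (c * exp (- Rn_inner n y (comb n 1 z 1 x))) * ennreal (exp (Rn_inner n z y))"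
          using fg y by (intro mult_right_mono) auto
        also have "\<dots> = ennreal (c * exp (- Rn_inner n x y))"
          using c by (simp add: ennreal_mult[symmetric] Rn_inner_comb' Rn_inner_commute[of n y] exp_add[symmetric] mult.assoc)
        finally show "ennreal (enn2real (h k (comb n 1 z 1 x))) * ennreal (f y * exp (Rn_inner n z y)) \<le> ennreal (c * exp (- Rn_inner n x y))" .
      qed
    qed (use c in auto)
    then have *: "(\<integral>\<^sup>+x. h k x \<partial>Rn_lborel n) * (\<integral>\<^sup>+y. ennreal (f y * exp (Rn_inner n z y)) \<partial>Rn_lborel n) \<le> ennreal (c * 400^n)"
      by (simp only: h_real)
    have "(\<integral>\<^sup>+x. ennreal (f x) \<partial>Rn_lborel n) \<le> (\<integral>\<^sup>+y. ennreal (f y * exp (Rn_inner n z y)) \<partial>Rn_lborel n)"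
      by (rule nn_integral_tilt) (use f ctr in auto)
    then show ?thesis using * by (subst mult.commute) (rule order_trans[OF mult_left_mono], auto)
  qed
  have inc: "incseq h"
  proof (rule monoI, rule le_funI)
    fix k l :: nat and y assume kl: "k \<le> l"
    have "cube n (real k) \<subseteq> cube n (real l)" using kl by (auto simp: cube_def intro: order_trans)
    moreover have "min (g y) (of_nat k) \<le> min (g y) (of_nat l)"
      using kl by (intro min.mono) (auto simp: ennreal_of_nat_eq_real_of_nat)
    ultimately show "h k y \<le> h l y" unfolding h_def by (intro mult_mono) (auto simp: indicator_def)
  qed
  have sup: "(SUP k. h k y) = g y" if y: "y \<in> Rn n" for y
  proof (rule antisym)
    show "(SUP k. h k y) \<le> g y" by (intro SUP_least hg)
    obtain K :: nat where K: "(\<Sum>i<n. \<bar>y i\<bar>) \<le> real K" using real_arch_simple by blast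
    have inc: "y \<in> cube n (real k)" if "K \<le> k" for k
    proof -
      have "\<bar>y i\<bar> \<le> (\<Sum>i<n. \<bar>y i\<bar>)" if "i < n" for i using that by (intro member_le_sum) auto
      then show ?thesis using K \<open>K \<le> k\<close> y by (force simp: cube_def)
    qed
    show "g y \<le> (SUP k. h k y)"
    proof (rule dense_le)
      fix w assume w: "w < g y"
      then obtain w' where w': "w = ennreal w'" "w' \<ge> 0" by (cases w) (auto simp: top_unique)
      obtain m :: nat where m: "w' \<le> real m" using real_arch_simple by blast
      have "w \<le> of_nat (max m K)" unfolding w' using m by (simp add: ennreal_of_nat_eq_real_of_nat)
      then have "w \<le> h (max m K) y" using w inc[of "max m K"] by (simp add: h_def)
      then show "w \<le> (SUP k. h k y)" by (rule SUP_upper2[OF UNIV_I])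
    qed
  qed
  have "(\<integral>\<^sup>+y. g y \<partial>Rn_lborel n) = (\<integral>\<^sup>+y. (SUP k. h k y) \<partial>Rn_lborel n)"
    by (intro nn_integral_cong) (simp add: sup)
  also have "\<dots> = (SUP k. \<integral>\<^sup>+y. h k y \<partial>Rn_lborel n)"
    by (rule nn_integral_monotone_convergence_SUP[OF inc]) measurable
  finally have "(\<integral>\<^sup>+x. ennreal (f x) \<partial>Rn_lborel n) * (\<integral>\<^sup>+y. g y \<partial>Rn_lborel n) =
     (SUP k. (\<integral>\<^sup>+x. ennreal (f x) \<partial>Rn_lborel n) * (\<integral>\<^sup>+y. h k y \<partial>Rn_lborel n))"
    by (simp add: SUP_mult_left_ennreal)
  also have "\<dots> \<le> ennreal (c * 400^n)" by (intro SUP_least le)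
  finally show "(\<integral>\<^sup>+x. ennreal (f x) \<partial>Rn_lborel n) * (\<integral>\<^sup>+y. g y \<partial>Rn_lborel n) \<le> ennreal (c * 400^n)" .
qed

lemma santalo_0: "santalo 0"
  unfolding santalo_def
  by (auto simp: nn_integral_Rn_0 Rn_inner_def dest!: bspec[OF _ Rn_zero_in])

text \<open>The sign \<sigma> selects the side of the hyperplane and positive \<open>s\<close> is
  the distance from it. For fixed \<open>s\<close> the first \<open>n\<close> coordinates are merely
  translated, so the map preserves Lebesgue measure.\<close>

definition shear :: "nat \<Rightarrow> (nat \<Rightarrow> real) \<Rightarrow> (nat \<Rightarrow> real) \<Rightarrow> real \<Rightarrow> real \<Rightarrow> (nat \<Rightarrow> real) \<Rightarrow> real \<Rightarrow> nat \<Rightarrow> real" where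
  "shear n z a m \<sigma> x s = (comb n 1 (\<lambda>i. z i + \<sigma> * s * a i) 1 x)(n := m + \<sigma> * s)"

lemma shear_in [simp]: "shear n z a m \<sigma> x s \<in> Rn (Suc n)"
  unfolding shear_def by (rule Rn_upd) simp

lemma shear_measurable: "(\<lambda>p. shear n z a m \<sigma> (fst p) (snd p)) \<in> Rn_lborel n \<Otimes>\<^sub>M lborel \<rightarrow>\<^sub>M Rn_lborel (Suc n)"
proof (rule measurable_into_Rn)
  fix i assume "i < Suc n"
  then consider "i < n" | "i = n" by linarith
  then show "(\<lambda>p. shear n z a m \<sigma> (fst p) (snd p) i) \<in> borel_measurable (Rn_lborel n \<Otimes>\<^sub>M lborel)"
  proof cases
    case 1
    have [measurable]: "(\<lambda>p. fst p i) \<in> borel_measurable (Rn_lborel n \<Otimes>\<^sub>M lborel)"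
      by (rule measurable_compose[OF measurable_fst measurable_coord[OF 1]])
    show ?thesis using 1 by (simp add: shear_def)
  qed (simp add: shear_def)
qed simp

lemma nn_integral_shear:
  assumes h: "h \<in> borel_measurable (Rn_lborel (Suc n))" and \<sigma>: "\<bar>\<sigma>\<bar> = 1"
  shows "(\<integral>\<^sup>+p. h (shear n z a m \<sigma> (fst p) (snd p)) \<partial>(Rn_lborel n \<Otimes>\<^sub>M lborel)) = (\<integral>\<^sup>+x. h x \<partial>Rn_lborel (Suc n))"
proof -
  interpret P: pair_sigma_finite "Rn_lborel n" lborel
    by (intro pair_sigma_finite.intro Rn.sigma_finite_measure_axioms lborel.sigma_finite_measure_axioms)
  note hs = measurable_compose[OF shear_measurable h]
  have hu: "(\<lambda>p. h ((fst p)(n := snd p))) \<in> borel_measurable (Rn_lborel n \<Otimes>\<^sub>M lborel)"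
    using measurable_compose[OF measurable_upd h] by (simp add: case_prod_beta')
  define H where "H t = (\<integral>\<^sup>+x. h (x(n := t)) \<partial>Rn_lborel n)" for t
  have Hm: "H \<in> borel_measurable borel"
    unfolding H_def using hu by (intro Rn.borel_measurable_nn_integral) (simp add: case_prod_beta' measurable_pair_swap_iff[of _ borel])
  have hx: "(\<lambda>x. h (x(n := t))) \<in> borel_measurable (Rn_lborel n)" for t
    using measurable_compose[OF measurable_Pair[of "\<lambda>x. x" "Rn_lborel n" "Rn_lborel n" "\<lambda>_. t" lborel] hu] by simp
  have "(\<integral>\<^sup>+p. h (shear n z a m \<sigma> (fst p) (snd p)) \<partial>(Rn_lborel n \<Otimes>\<^sub>M lborel)) =
     (\<integral>\<^sup>+s. (\<integral>\<^sup>+x. h (shear n z a m \<sigma> x s) \<partial>Rn_lborel n) \<partial>lborel)"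
    using P.nn_integral_snd[of "\<lambda>p. h (shear n z a m \<sigma> (fst p) (snd p))"] hs by simp
  also have "\<dots> = (\<integral>\<^sup>+s. H (m + \<sigma> * s) \<partial>lborel)"
  proof (rule nn_integral_cong)
    fix s :: real
    show "(\<integral>\<^sup>+x. h (shear n z a m \<sigma> x s) \<partial>Rn_lborel n) = H (m + \<sigma> * s)"
      using nn_integral_affine[OF hx, of 1 "m + \<sigma> * s" "\<lambda>i. z i + \<sigma> * s * a i"]
      unfolding H_def shear_def by simp
  qed
  also have "\<dots> = (\<integral>\<^sup>+t. H t \<partial>lborel)"
    using nn_integral_real_affine[OF Hm, of \<sigma> m] \<sigma> by auto
  also have "\<dots> = (\<integral>\<^sup>+x. (\<integral>\<^sup>+t. h (x(n := t)) \<partial>lborel) \<partial>Rn_lborel n)"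
    unfolding H_def using P.Fubini'[of "\<lambda>x t. h (x(n := t))"] hu by (simp add: case_prod_beta')
  also have "\<dots> = (\<integral>\<^sup>+x. h x \<partial>Rn_lborel (Suc n))"
    by (rule nn_integral_Rn_Suc[OF h, symmetric])
  finally show ?thesis .
qed

lemma distr_shear:
  assumes \<sigma>: "\<bar>\<sigma>\<bar> = 1"
  shows "distr (Rn_lborel n \<Otimes>\<^sub>M lborel) (Rn_lborel (Suc n)) (\<lambda>p. shear n z a m \<sigma> (fst p) (snd p)) = Rn_lborel (Suc n)"
proof (rule measure_eqI)
  fix A assume "A \<in> sets (distr (Rn_lborel n \<Otimes>\<^sub>M lborel) (Rn_lborel (Suc n)) (\<lambda>p. shear n z a m \<sigma> (fst p) (snd p)))"
  then have A: "A \<in> sets (Rn_lborel (Suc n))" by simp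
  have "emeasure (distr (Rn_lborel n \<Otimes>\<^sub>M lborel) (Rn_lborel (Suc n)) (\<lambda>p. shear n z a m \<sigma> (fst p) (snd p))) A =
     (\<integral>\<^sup>+x. indicator A x \<partial>distr (Rn_lborel n \<Otimes>\<^sub>M lborel) (Rn_lborel (Suc n)) (\<lambda>p. shear n z a m \<sigma> (fst p) (snd p)))"
    using A by simp
  also have "\<dots> = (\<integral>\<^sup>+p. indicator A (shear n z a m \<sigma> (fst p) (snd p)) \<partial>(Rn_lborel n \<Otimes>\<^sub>M lborel))"
    using A by (intro nn_integral_distr shear_measurable) simp
  also have "\<dots> = (\<integral>\<^sup>+x. indicator A x \<partial>Rn_lborel (Suc n))"
    using A by (intro nn_integral_shear \<sigma>) simp
  finally show "emeasure (distr (Rn_lborel n \<Otimes>\<^sub>M lborel) (Rn_lborel (Suc n)) (\<lambda>p. shear n z a m \<sigma> (fst p) (snd p))) A = emeasure (Rn_lborel (Suc n)) A"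
    using A by simp
qed simp

lemma has_bochner_integral_shear:
  fixes q :: "(nat \<Rightarrow> real) \<Rightarrow> real"
  assumes q: "integrable (Rn_lborel (Suc n)) q" and \<sigma>: "\<bar>\<sigma>\<bar> = 1"
  shows "has_bochner_integral (Rn_lborel n) (\<lambda>x. \<integral>s. q (shear n z a m \<sigma> x s) \<partial>lborel) (\<integral>x. q x \<partial>Rn_lborel (Suc n))"
proof -
  interpret P: pair_sigma_finite "Rn_lborel n" lborel
    by (intro pair_sigma_finite.intro Rn.sigma_finite_measure_axioms lborel.sigma_finite_measure_axioms)
  have qm: "q \<in> borel_measurable (Rn_lborel (Suc n))" using q by simp
  have i: "integrable (Rn_lborel n \<Otimes>\<^sub>M lborel) (\<lambda>p. q (shear n z a m \<sigma> (fst p) (snd p)))"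
    using q by (subst integrable_distr_eq[OF shear_measurable qm, symmetric]) (simp add: distr_shear[OF \<sigma>])
  have e: "(\<integral>x. q x \<partial>Rn_lborel (Suc n)) = (\<integral>p. q (shear n z a m \<sigma> (fst p) (snd p)) \<partial>(Rn_lborel n \<Otimes>\<^sub>M lborel))"
    using integral_distr[OF shear_measurable qm, of z a m \<sigma>] by (simp add: distr_shear[OF \<sigma>])
  show ?thesis
    unfolding has_bochner_integral_iff e
    using P.integrable_fst'[OF i] P.integral_fst'[OF i] by simp
qed

lemma emeasure_cube: "emeasure (Rn_lborel n) (cube n R) < \<infinity>"
proof -
  have "cube n R = PiE {..<n} (\<lambda>_. {-R..R})"
    unfolding cube_def Rn_def by (auto simp: PiE_def Pi_def extensional_def abs_le_iff)
  then have "emeasure (Rn_lborel n) (cube n R) = (\<Prod>i<n. emeasure lborel {-R..R})"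
    unfolding Rn_lborel_def by (simp add: lb.emeasure_PiM)
  also have "\<dots> = emeasure lborel {-R..R} ^ n" by simp
  also have "\<dots> < \<infinity>" by (cases "-R \<le> R") (auto simp: power_less_top_ennreal)
  finally show ?thesis .
qed

lemma integrable_on_cube:
  fixes q :: "(nat \<Rightarrow> real) \<Rightarrow> real"
  assumes [measurable]: "q \<in> borel_measurable (Rn_lborel n)" and B: "\<And>x. x \<in> cube n R \<Longrightarrow> \<bar>q x\<bar> \<le> B"
    and z: "\<And>x. x \<in> Rn n - cube n R \<Longrightarrow> q x = 0"
  shows "integrable (Rn_lborel n) q"
proof (rule Bochner_Integration.integrable_bound[of _ "\<lambda>x. B * indicator (cube n R) x"])
  show "integrable (Rn_lborel n) (\<lambda>x. B * indicator (cube n R) x)"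
    using emeasure_cube[of n R] by (intro integrable_mult_right integrable_real_indicator) auto
  show "AE x in Rn_lborel n. norm (q x) \<le> norm (B * indicator (cube n R) x)"
    using B z by (intro AE_I2) (force simp: indicator_def)
qed simp

lemma hyperplane_null: "AE x in Rn_lborel (Suc n). x n \<noteq> t"
proof -
  note [measurable] = measurable_coord[of n "Suc n"]
  have "emeasure (Rn_lborel (Suc n)) {x \<in> space (Rn_lborel (Suc n)). \<not> x n \<noteq> t} = (\<integral>\<^sup>+x. indicator {x \<in> space (Rn_lborel (Suc n)). \<not> x n \<noteq> t} x \<partial>Rn_lborel (Suc n))"
    by (rule nn_integral_indicator[symmetric]) measurable
  also have "\<dots> = (\<integral>\<^sup>+x. (\<integral>\<^sup>+s. indicator {x \<in> space (Rn_lborel (Suc n)). \<not> x n \<noteq> t} (x(n := s)) \<partial>lborel) \<partial>Rn_lborel n)"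
    by (rule nn_integral_Rn_Suc) measurable
  also have "\<dots> = (\<integral>\<^sup>+x. (\<integral>\<^sup>+s. indicator {t} s \<partial>lborel) \<partial>Rn_lborel n)"
    by (intro nn_integral_cong) (auto simp: indicator_def Rn_upd)
  also have "\<dots> = 0" by simp
  finally have e: "emeasure (Rn_lborel (Suc n)) {x \<in> space (Rn_lborel (Suc n)). \<not> x n \<noteq> t} = 0" .
  show ?thesis
    by (rule AE_I[OF subset_refl e]) measurable
qed

text \<open>The integral of \<open>f\<close> against the sign of \<open>t - x n\<close> is
  continuous in \<open>t\<close>, since hyperplanes are null sets, and has opposite weak signs at
  the two ends of the support. The intermediate value theorem gives a zero.\<close>

lemma median_exists:
  fixes f :: "(nat \<Rightarrow> real) \<Rightarrow> real"
  assumes [measurable]: "f \<in> borel_measurable (Rn_lborel (Suc n))" and f0: "\<And>x. x \<in> Rn (Suc n) \<Longrightarrow> 0 \<le> f x"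
    and i: "integrable (Rn_lborel (Suc n)) f" and z: "\<And>x. x \<in> Rn (Suc n) - cube (Suc n) R \<Longrightarrow> f x = 0"
  shows "\<exists>m. (\<integral>x. f x * indicator {x. x n > m} x \<partial>Rn_lborel (Suc n)) = (\<integral>x. f x * indicator {x. x n < m} x \<partial>Rn_lborel (Suc n))"
proof -
  let ?N = "Rn_lborel (Suc n)"
  note [measurable] = measurable_coord[of n "Suc n"]
  define L where "L t = (\<integral>x. f x * sgn (t - x n) \<partial>?N)" for t
  have cont: "continuous_on UNIV L"
    unfolding continuous_on_sequentially
  proof (intro allI ballI impI)
    fix u :: "nat \<Rightarrow> real" and t assume "(\<forall>k. u k \<in> UNIV) \<and> u \<longlonglongrightarrow> t"
    then have u: "u \<longlonglongrightarrow> t" by simp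
    show "(L \<circ> u) \<longlonglongrightarrow> L t"
      unfolding L_def o_def
    proof (rule integral_dominated_convergence[where w=f])
      show "AE x in ?N. (\<lambda>k. f x * sgn (u k - x n)) \<longlonglongrightarrow> f x * sgn (t - x n)"
        using hyperplane_null[of n t]
      proof eventually_elim
        case (elim x)
        then have "t - x n \<noteq> 0" by simp
        then show ?case by (intro tendsto_intros u)
      qed
      show "AE x in ?N. norm (f x * sgn (u k - x n)) \<le> f x" for k
        using f0 by (intro AE_I2) (auto simp: sgn_if abs_mult)
    qed (use i in auto)
  qed
  have 1: "L (- \<bar>R\<bar>) \<le> 0"
  proof -
    have "0 \<le> (\<integral>x. - (f x * sgn (- \<bar>R\<bar> - x n)) \<partial>?N)"
  proof (rule Bochner_Integration.integral_nonneg)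
    fix x assume x: "x \<in> space ?N"
    show "0 \<le> - (f x * sgn (- \<bar>R\<bar> - x n))"
    proof (cases "x \<in> cube (Suc n) R")
      case True
      then have "\<bar>x n\<bar> \<le> R" by (simp add: cube_def)
      then have "sgn (- \<bar>R\<bar> - x n) \<le> 0" by (simp add: sgn_if)
      then show ?thesis using f0 x by (simp add: mult_nonneg_nonpos)
    qed (use z x in auto)
  qed
    then show ?thesis by (simp add: L_def)
  qed
  have 2: "0 \<le> L \<bar>R\<bar>"
    unfolding L_def
  proof (rule Bochner_Integration.integral_nonneg)
    fix x assume x: "x \<in> space ?N"
    show "0 \<le> f x * sgn (\<bar>R\<bar> - x n)"
    proof (cases "x \<in> cube (Suc n) R")
      case True
      then have "\<bar>x n\<bar> \<le> R" by (simp add: cube_def)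
      then have "sgn (\<bar>R\<bar> - x n) \<ge> 0" by (simp add: sgn_if)
      then show ?thesis using f0 x by simp
    qed (use z x in auto)
  qed
  obtain m where m: "L m = 0"
    using IVT'[of L "- \<bar>R\<bar>" 0 "\<bar>R\<bar>"] 1 2 continuous_on_subset[OF cont] by auto
  have ii: "integrable ?N (\<lambda>x. f x * indicator {x. x n < m} x)" "integrable ?N (\<lambda>x. f x * indicator {x. x n > m} x)"
    using i by (auto intro!: Bochner_Integration.integrable_bound[OF i] AE_I2 simp: indicator_def)
  have "L m = (\<integral>x. f x * indicator {x. x n < m} x - f x * indicator {x. x n > m} x \<partial>?N)"
    unfolding L_def by (intro Bochner_Integration.integral_cong) (auto simp: sgn_if indicator_def)
  also have "\<dots> = (\<integral>x. f x * indicator {x. x n < m} x \<partial>?N) - (\<integral>x. f x * indicator {x. x n > m} x \<partial>?N)"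
    by (rule Bochner_Integration.integral_diff[OF ii])
  finally show ?thesis using m by (intro exI[of _ m]) simp
qed

lemma nn_integral_split_sign:
  fixes g :: "real \<Rightarrow> ennreal"
  assumes [measurable]: "g \<in> borel_measurable borel"
  shows "(\<integral>\<^sup>+t. g t \<partial>lborel) = (\<integral>\<^sup>+t. g t * indicator {0<..} t \<partial>lborel) + (\<integral>\<^sup>+t. g (- t) * indicator {0<..} t \<partial>lborel)"
proof -
  have "(\<integral>\<^sup>+t. g t \<partial>lborel) = (\<integral>\<^sup>+t. g t * indicator {0<..} t + g t * indicator {..<0} t \<partial>lborel)"
  proof (rule nn_integral_cong_AE)
    show "AE t in lborel. g t = g t * indicator {0<..} t + g t * indicator {..<0} t"
      using AE_lborel_singleton[of 0] by eventually_elim (auto simp: indicator_def)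
  qed
  also have "\<dots> = (\<integral>\<^sup>+t. g t * indicator {0<..} t \<partial>lborel) + (\<integral>\<^sup>+t. g t * indicator {..<0} t \<partial>lborel)"
    by (rule nn_integral_add) measurable
  also have "(\<integral>\<^sup>+t. g t * indicator {..<0} t \<partial>lborel) = (\<integral>\<^sup>+t. g (- t) * indicator {..<0} (- t) \<partial>lborel)"
    using nn_integral_real_affine[of "\<lambda>t. g t * indicator {..<0} t" "-1" 0] by simp
  also have "\<dots> = (\<integral>\<^sup>+t. g (- t) * indicator {0<..} t \<partial>lborel)"
    by (intro nn_integral_cong) (auto simp: indicator_def)
  finally show ?thesis .
qed

text \<open>The hyperplane \<open>x n = m\<close> halves the mass of \<open>f\<close>, and a shear moves the centers of mass of
  the two halves onto the last coordinate axis. The half-line inequality integrates out the last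
  coordinate, and the induction hypothesis applies to the two centered marginals.\<close>

lemma santalo_step:
  assumes IH: "santalo n" shows "santalo_at (Suc n)"
  unfolding santalo_at_def
proof (intro allI impI)
  fix f :: "(nat \<Rightarrow> real) \<Rightarrow> real" and M R :: real
  let ?N = "Rn_lborel (Suc n)"
  assume fm[measurable]: "f \<in> borel_measurable ?N" and fb: "\<forall>x\<in>Rn (Suc n). 0 \<le> f x \<and> f x \<le> M"
    and fz: "\<forall>x\<in>Rn (Suc n) - cube (Suc n) R. f x = 0"
  note [measurable] = measurable_coord[of n "Suc n"]
  have f_int: "integrable ?N f"
    by (rule integrable_on_cube[of _ _ R M]) (use fb fz in \<open>auto simp: cube_def\<close>)
  show "\<exists>z\<in>Rn (Suc n). \<forall>(g :: (nat \<Rightarrow> real) \<Rightarrow> ennreal) c.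
       g \<in> borel_measurable ?N \<longrightarrow> 0 < (c::real) \<longrightarrow>
       (\<forall>x\<in>Rn (Suc n). \<forall>y\<in>Rn (Suc n). ennreal (f (comb (Suc n) 1 z 1 x)) * g y \<le> ennreal (c * exp (- Rn_inner (Suc n) x y))) \<longrightarrow>
       (\<integral>\<^sup>+x. ennreal (f x) \<partial>?N) * (\<integral>\<^sup>+y. g y \<partial>?N) \<le> ennreal (c * 400 ^ Suc n)"
  proof (cases "(\<integral>\<^sup>+x. ennreal (f x) \<partial>?N) = 0")
    case True
    then show ?thesis by (intro bexI[of _ "Rn_zero (Suc n)"]) auto
  next
    case False
    obtain m where med: "(\<integral>x. f x * indicator {x. x n > m} x \<partial>?N) = (\<integral>x. f x * indicator {x. x n < m} x \<partial>?N)"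
      using median_exists[of f n R] f_int fb fz by auto
    define w where "w \<sigma> x = f x * indicator {x. \<sigma> * (x n - m) > 0} x" for \<sigma> and x :: "nat \<Rightarrow> real"
    have wm[measurable]: "w \<sigma> \<in> borel_measurable ?N" for \<sigma> unfolding w_def by measurable
    have w0: "0 \<le> w \<sigma> x" "w \<sigma> x \<le> M" if "x \<in> Rn (Suc n)" for \<sigma> x
      using that fb by (auto simp: w_def indicator_def intro: order_trans)
    have wz: "w \<sigma> x = 0" if "x \<in> Rn (Suc n) - cube (Suc n) R" for \<sigma> x
      using that fz by (auto simp: w_def)
    have w_int: "integrable ?N (w \<sigma>)" for \<sigma>
      by (rule integrable_on_cube[of _ _ R M]) (use w0 wz in \<open>auto simp: cube_def\<close>)
    have xw_int: "integrable ?N (\<lambda>x. x i * w \<sigma> x)" if "i < Suc n" for i \<sigma>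
    proof (rule integrable_on_cube[of _ _ R "\<bar>R\<bar> * M"])
      have [measurable]: "(\<lambda>x. x i) \<in> borel_measurable ?N" by (rule measurable_coord[OF that])
      show "(\<lambda>x. x i * w \<sigma> x) \<in> borel_measurable ?N" by measurable
      fix x assume x: "x \<in> cube (Suc n) R"
      then have "\<bar>x i\<bar> \<le> \<bar>R\<bar>" "x \<in> Rn (Suc n)" using that by (force simp: cube_def)+
      then show "\<bar>x i * w \<sigma> x\<bar> \<le> \<bar>R\<bar> * M"
        using w0[of x \<sigma>] by (simp add: abs_mult mult_mono)
    qed (simp add: wz)
    define h where "h = (\<integral>x. w 1 x \<partial>?N)"
    have h_eq: "(\<integral>x. w \<sigma> x \<partial>?N) = h" if "\<sigma> = 1 \<or> \<sigma> = -1" for \<sigma>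
      using that med by (auto simp: h_def w_def)
    have "(\<integral>x. f x \<partial>?N) = (\<integral>x. w 1 x + w (-1) x \<partial>?N)"
    proof (rule integral_cong_AE)
      show "AE x in ?N. f x = w 1 x + w (-1) x"
        using hyperplane_null[of n m] by eventually_elim (auto simp: w_def indicator_def)
    qed measurable
    also have "\<dots> = 2 * h" using w_int h_eq by (simp add: Bochner_Integration.integral_add)
    finally have f2h: "(\<integral>x. f x \<partial>?N) = 2 * h" .
    have nf: "(\<integral>\<^sup>+x. ennreal (f x) \<partial>?N) = ennreal (2 * h)"
      using f_int fb by (subst nn_integral_eq_integral) (auto simp: f2h)
    have hpos: "h > 0" using False nf by (metis ennreal_neg mult_pos_pos not_le mult_le_0_iff zero_less_numeral less_eq_real_def)
    define S where "S \<sigma> = (\<integral>x. (x n - m) * w \<sigma> x \<partial>?N)" for \<sigma>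
    have S_int: "integrable ?N (\<lambda>x. (x n - m) * w \<sigma> x)" for \<sigma>
      using Bochner_Integration.integrable_diff[OF xw_int[of n \<sigma>] integrable_mult_right[OF w_int[of \<sigma>], of m]]
      by (simp add: algebra_simps)
    have S1: "S 1 > 0"
    proof -
      have nonneg: "AE x in ?N. 0 \<le> (x n - m) * w 1 x"
        using fb by (intro AE_I2) (auto simp: w_def indicator_def)
      have "S 1 \<noteq> 0"
      proof
        assume "S 1 = 0"
        then have "AE x in ?N. (x n - m) * w 1 x = 0"
          using integral_nonneg_eq_0_iff_AE[OF S_int nonneg] by (simp add: S_def)
        then have "AE x in ?N. w 1 x = 0"
          by eventually_elim (auto simp: w_def indicator_def)
        then have "h = 0" unfolding h_def by (simp add: integral_eq_zero_AE)
        then show False using hpos by simp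
      qed
      moreover have "S 1 \<ge> 0" unfolding S_def by (rule integral_nonneg_AE[OF nonneg])
      ultimately show ?thesis by simp
    qed
    have S2: "S (-1) \<le> 0"
    proof -
      have "0 \<le> (\<integral>x. - ((x n - m) * w (-1) x) \<partial>?N)"
        using fb by (intro Bochner_Integration.integral_nonneg) (auto simp: w_def indicator_def mult_nonpos_nonneg)
      then show ?thesis by (simp add: S_def)
    qed
    define X where "X i \<sigma> = (\<integral>x. x i * w \<sigma> x \<partial>?N)" for i \<sigma>
    \<comment> \<open>The slope \<open>a\<close> and the base point \<open>z0\<close> solve
      \<open>X i \<sigma> = z0 i * h + a i * S \<sigma>\<close> for both signs \<sigma>; the signs
      of \<open>S 1\<close> and \<open>S (-1)\<close> make the denominator positive. These equations
      state that both sheared halves have centered marginals.\<close>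
    define a where "a i = (X i 1 - X i (-1)) / (S 1 - S (-1))" for i
    define z0 where "z0 i = (X i 1 - a i * S 1) / h" for i
    have lin: "X i \<sigma> - z0 i * h - a i * S \<sigma> = 0" if "\<sigma> = 1 \<or> \<sigma> = -1" for i \<sigma>
    proof -
      have "a i * (S 1 - S (-1)) = X i 1 - X i (-1)" using S1 S2 by (simp add: a_def)
      moreover have "z0 i * h = X i 1 - a i * S 1" using hpos by (simp add: z0_def)
      ultimately show ?thesis using that by (auto simp: algebra_simps)
    qed
    define z where "z = (comb n 1 z0 0 z0)(n := m)"
    have z: "z \<in> Rn (Suc n)" unfolding z_def by (rule Rn_upd) simp
    show ?thesis
    proof (intro bexI[OF _ z] allI impI)
      fix g :: "(nat \<Rightarrow> real) \<Rightarrow> ennreal" and c :: real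
      assume gm[measurable]: "g \<in> borel_measurable ?N" and c: "0 < c"
        and fg: "\<forall>x\<in>Rn (Suc n). \<forall>y\<in>Rn (Suc n). ennreal (f (comb (Suc n) 1 z 1 x)) * g y \<le> ennreal (c * exp (- Rn_inner (Suc n) x y))"
      \<comment> \<open>The dual variable is moved by the inverse transpose of the shear, so that
        the pairing splits into \<open>Rn_inner n x y + s * t\<close>.\<close>
      define G where "G \<sigma> y = (\<integral>\<^sup>+t. g (y(n := \<sigma> * t - Rn_inner n y a)) * indicator {0<..} t \<partial>lborel)" for \<sigma> and y :: "nat \<Rightarrow> real"
      have yt: "(\<lambda>p. (fst p)(n := \<sigma> * snd p - Rn_inner n (fst p) a)) \<in> Rn_lborel n \<Otimes>\<^sub>M lborel \<rightarrow>\<^sub>M ?N" for \<sigma>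
      proof (rule measurable_into_Rn)
        fix i assume "i < Suc n"
        then consider "i < n" | "i = n" by linarith
        then show "(\<lambda>p. ((fst p)(n := \<sigma> * snd p - Rn_inner n (fst p) a)) i) \<in> borel_measurable (Rn_lborel n \<Otimes>\<^sub>M lborel)"
        proof cases
          case 1
          then show ?thesis using measurable_compose[OF measurable_fst measurable_coord[OF 1]] by simp
        next
          case 2
          have [measurable]: "(\<lambda>p. Rn_inner n (fst p) a) \<in> borel_measurable (Rn_lborel n \<Otimes>\<^sub>M lborel)"
            using measurable_compose[OF measurable_fst measurable_inner[of n a]] by (simp add: Rn_inner_commute)
          show ?thesis using 2 by simp
        qed
      qed (auto intro: Rn_upd simp: space_pair_measure)
      have Gm: "G \<sigma> \<in> borel_measurable (Rn_lborel n)" for \<sigma>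
      proof -
        note [measurable] = measurable_compose[OF yt[of \<sigma>] gm]
        have "(\<lambda>p. g ((fst p)(n := \<sigma> * snd p - Rn_inner n (fst p) a)) * indicator {0<..} (snd p)) \<in> borel_measurable (Rn_lborel n \<Otimes>\<^sub>M lborel)"
          by measurable
        then show ?thesis unfolding G_def by (intro lborel.borel_measurable_nn_integral) (simp add: case_prod_beta')
      qed
      have gt: "(\<lambda>t. g (y(n := \<sigma> * t - Rn_inner n y a))) \<in> borel_measurable borel" if "y \<in> Rn n" for \<sigma> y
        by (rule measurable_compose[OF _ gm], rule measurable_compose[OF _ measurable_upd2[OF that]]) measurable
      have part: "ennreal h * (\<integral>\<^sup>+y. G \<sigma> y \<partial>Rn_lborel n) \<le> ennreal (100 * c * 400^n)" if \<sigma>: "\<sigma> = 1 \<or> \<sigma> = -1" for \<sigma>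
      proof -
        have \<sigma>1: "\<bar>\<sigma>\<bar> = 1" "\<sigma> * \<sigma> = 1" using \<sigma> by auto
        define F where "F x = (\<integral>s. w \<sigma> (shear n z0 a m \<sigma> x s) \<partial>lborel)" for x
        have w_shear: "w \<sigma> (shear n z0 a m \<sigma> x s) = f (shear n z0 a m \<sigma> x s) * indicator {0<..} s" for x s
          using \<sigma>1 by (auto simp: w_def shear_def indicator_def mult.assoc[symmetric])
        have hF: "has_bochner_integral (Rn_lborel n) F h"
          unfolding F_def using has_bochner_integral_shear[OF w_int[of \<sigma>] \<sigma>1(1), of z0 a m] h_eq[OF \<sigma>] by simp
        have F0: "0 \<le> F x" for x
          unfolding F_def by (intro Bochner_Integration.integral_nonneg w0) simp
        have nF: "(\<integral>\<^sup>+x. ennreal (F x) \<partial>Rn_lborel n) = ennreal h"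
          using hF F0 by (subst nn_integral_eq_integral) (auto simp: has_bochner_integral_iff)
        have ctr: "has_bochner_integral (Rn_lborel n) (\<lambda>x. x i * F x) 0" if i: "i < n" for i
        proof -
          define q where "q x = x i * w \<sigma> x - z0 i * w \<sigma> x - a i * ((x n - m) * w \<sigma> x)" for x
          have q_int: "integrable ?N q"
            unfolding q_def using i by (intro Bochner_Integration.integrable_diff integrable_mult_right xw_int w_int S_int) auto
          have "(\<integral>x. q x \<partial>?N) = X i \<sigma> - z0 i * h - a i * S \<sigma>"
            unfolding q_def using i h_eq[OF \<sigma>]
            by (simp add: Bochner_Integration.integral_diff Bochner_Integration.integrable_diff integrable_mult_right xw_int w_int S_int X_def S_def)
          then have q0: "(\<integral>x. q x \<partial>?N) = 0" using lin[OF \<sigma>] by simp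
          have "q (shear n z0 a m \<sigma> x s) = x i * w \<sigma> (shear n z0 a m \<sigma> x s)" for x s
          proof -
            have "shear n z0 a m \<sigma> x s i = z0 i + \<sigma> * s * a i + x i" "shear n z0 a m \<sigma> x s n = m + \<sigma> * s"
              using i by (auto simp: shear_def)
            then show ?thesis by (simp add: q_def algebra_simps)
          qed
          then have "(\<lambda>x. \<integral>s. q (shear n z0 a m \<sigma> x s) \<partial>lborel) = (\<lambda>x. x i * F x)"
            by (simp add: F_def)
          then show ?thesis using has_bochner_integral_shear[OF q_int \<sigma>1(1), of z0 a m] q0 by simp
        qed
        have FG: "ennreal (F x) * G \<sigma> y \<le> ennreal (100 * c * exp (- Rn_inner n x y))" if x: "x \<in> Rn n" and y: "y \<in> Rn n" for x y
        proof -
          let ?f = "\<lambda>s. f (shear n z0 a m \<sigma> x s)"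
          have shm: "(\<lambda>s. shear n z0 a m \<sigma> x s) \<in> borel \<rightarrow>\<^sub>M ?N"
            using measurable_compose[OF measurable_Pair1'[of x "Rn_lborel n" lborel] shear_measurable] x by simp
          have [measurable]: "?f \<in> borel_measurable borel"
            by (rule measurable_compose[OF shm fm])
          have fz': "?f s = 0" if "\<bar>s\<bar> > \<bar>R\<bar> + \<bar>m\<bar>" for s
          proof -
            have "\<bar>\<sigma> * s\<bar> > \<bar>R\<bar> + \<bar>m\<bar>" using that \<sigma> by auto
            then have "\<not> \<bar>m + \<sigma> * s\<bar> \<le> R" by linarith
            then have "shear n z0 a m \<sigma> x s \<notin> cube (Suc n) R" by (auto simp: cube_def shear_def)
            then show ?thesis using fz by simp
          qed
          have Fi: "integrable lborel (\<lambda>s. w \<sigma> (shear n z0 a m \<sigma> x s))"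
            unfolding w_shear
          proof (rule Bochner_Integration.integrable_bound[of _ "\<lambda>s. M * indicator {- (\<bar>R\<bar> + \<bar>m\<bar>)..\<bar>R\<bar> + \<bar>m\<bar>} s"])
            show "AE s in lborel. norm (?f s * indicator {0<..} s) \<le> norm (M * indicator {- (\<bar>R\<bar> + \<bar>m\<bar>)..\<bar>R\<bar> + \<bar>m\<bar>} s)"
            proof (rule AE_I2)
              fix s :: real
              show "norm (?f s * indicator {0<..} s) \<le> norm (M * indicator {- (\<bar>R\<bar> + \<bar>m\<bar>)..\<bar>R\<bar> + \<bar>m\<bar>} s)"
              proof (cases "\<bar>s\<bar> > \<bar>R\<bar> + \<bar>m\<bar>")
                case False
                then have "s \<in> {- (\<bar>R\<bar> + \<bar>m\<bar>)..\<bar>R\<bar> + \<bar>m\<bar>}" by auto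
                moreover have "0 \<le> ?f s" "?f s \<le> M" using fb by auto
                ultimately show ?thesis by (auto simp: indicator_def)
              qed (simp add: fz')
            qed
          qed (auto intro!: integrable_mult_right integrable_real_indicator)
          have "ennreal (F x) = (\<integral>\<^sup>+s. ennreal (w \<sigma> (shear n z0 a m \<sigma> x s)) \<partial>lborel)"
            unfolding F_def using w0 by (intro nn_integral_eq_integral[symmetric] Fi) auto
          also have "\<dots> = (\<integral>\<^sup>+s. ennreal (?f s) * indicator {0<..} s \<partial>lborel)"
            by (intro nn_integral_cong) (auto simp: w_shear indicator_def)
          finally have "ennreal (F x) * G \<sigma> y = (\<integral>\<^sup>+s. ennreal (?f s) * indicator {0<..} s \<partial>lborel) * (\<integral>\<^sup>+t. g (y(n := \<sigma> * t - Rn_inner n y a)) * indicator {0<..} t \<partial>lborel)"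
            by (simp add: G_def)
          also have "\<dots> \<le> ennreal (100 * (c * exp (- Rn_inner n x y)))"
          proof (rule half_line[where M=M and R="\<bar>R\<bar> + \<bar>m\<bar>"])
            fix s t :: real
            let ?\<xi> = "(comb n 1 x (\<sigma> * s) a)(n := \<sigma> * s)"
            let ?y = "y(n := \<sigma> * t - Rn_inner n y a)"
            have xi: "?\<xi> \<in> Rn (Suc n)" "?y \<in> Rn (Suc n)" using y by (auto intro: Rn_upd)
            have e: "comb (Suc n) 1 z 1 ?\<xi> = shear n z0 a m \<sigma> x s"
              by (rule Rn_ext[of _ "Suc n"]) (auto simp: z_def shear_def less_Suc_eq intro!: Rn_upd)
            have "Rn_inner (Suc n) ?\<xi> ?y = Rn_inner n x y + \<sigma> * s * Rn_inner n a y + \<sigma> * s * (\<sigma> * t - Rn_inner n y a)"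
              by (simp add: Rn_inner_Suc Rn_inner_comb)
            also have "\<dots> = Rn_inner n x y + (\<sigma> * \<sigma>) * (s * t)"
              by (simp add: Rn_inner_commute[of n y a] algebra_simps)
            finally have inn: "Rn_inner (Suc n) ?\<xi> ?y = Rn_inner n x y + s * t" using \<sigma>1 by simp
            have "ennreal (?f s) * g ?y \<le> ennreal (c * exp (- (Rn_inner n x y + s * t)))"
              using fg[rule_format, OF xi] unfolding e inn .
            then show "ennreal (?f s) * g ?y \<le> ennreal (c * exp (- Rn_inner n x y) * exp (- (s * t)))"
              by (simp add: exp_add[symmetric] mult.assoc)
          qed (use fb fz' c gt[OF y] in auto)
          finally show ?thesis by (simp add: mult.assoc)
        qed
        have "(\<integral>\<^sup>+x. ennreal (F x) \<partial>Rn_lborel n) * (\<integral>\<^sup>+y. G \<sigma> y \<partial>Rn_lborel n) \<le> ennreal (100 * c * 400^n)"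
          by (rule IH[unfolded santalo_def, rule_format, of F "G \<sigma>" "100 * c"])
             (use hF F0 ctr Gm c FG in \<open>auto simp: has_bochner_integral_iff\<close>)
        then show ?thesis unfolding nF .
      qed
      have split: "(\<integral>\<^sup>+y. g y \<partial>?N) = (\<integral>\<^sup>+y. G 1 y \<partial>Rn_lborel n) + (\<integral>\<^sup>+y. G (-1) y \<partial>Rn_lborel n)"
      proof -
        have "(\<integral>\<^sup>+y. g y \<partial>?N) = (\<integral>\<^sup>+y. (\<integral>\<^sup>+t. g (y(n := t)) \<partial>lborel) \<partial>Rn_lborel n)"
          by (rule nn_integral_Rn_Suc[OF gm])
        also have "\<dots> = (\<integral>\<^sup>+y. G 1 y + G (-1) y \<partial>Rn_lborel n)"
        proof (rule nn_integral_cong)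
          fix y assume "y \<in> space (Rn_lborel n)"
          then have y: "y \<in> Rn n" by simp
          have [measurable]: "(\<lambda>t. g (y(n := t))) \<in> borel_measurable borel"
            by (rule measurable_compose[OF measurable_upd2[OF y] gm])
          define gy where "gy t = g (y(n := t - Rn_inner n y a))" for t
          have [measurable]: "gy \<in> borel_measurable borel" unfolding gy_def using gt[OF y, of 1] by simp
          have "(\<integral>\<^sup>+t. g (y(n := t)) \<partial>lborel) = (\<integral>\<^sup>+t. gy t \<partial>lborel)"
            using nn_integral_real_affine[of "\<lambda>t. g (y(n := t))" 1 "- Rn_inner n y a"] by (simp add: gy_def)
          also have "\<dots> = (\<integral>\<^sup>+t. gy t * indicator {0<..} t \<partial>lborel) + (\<integral>\<^sup>+t. gy (- t) * indicator {0<..} t \<partial>lborel)"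
            by (rule nn_integral_split_sign) fact
          finally show "(\<integral>\<^sup>+t. g (y(n := t)) \<partial>lborel) = G 1 y + G (-1) y" by (simp add: G_def gy_def)
        qed
        also have "\<dots> = (\<integral>\<^sup>+y. G 1 y \<partial>Rn_lborel n) + (\<integral>\<^sup>+y. G (-1) y \<partial>Rn_lborel n)"
          by (rule nn_integral_add[OF Gm Gm])
        finally show ?thesis .
      qed
      have "(\<integral>\<^sup>+x. ennreal (f x) \<partial>?N) * (\<integral>\<^sup>+y. g y \<partial>?N) =
          2 * (ennreal h * (\<integral>\<^sup>+y. G 1 y \<partial>Rn_lborel n) + ennreal h * (\<integral>\<^sup>+y. G (-1) y \<partial>Rn_lborel n))"
        unfolding nf split using hpos by (simp add: ennreal_mult distrib_left mult.assoc)
      \<comment> \<open>Each half of \<open>f\<close> has mass \<open>h\<close>, half of the total.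
        The factor 2 and the two terms with 100 produce the 400 of the new dimension.\<close>
      also have "\<dots> \<le> 2 * (ennreal (100 * c * 400^n) + ennreal (100 * c * 400^n))"
        by (intro mult_left_mono add_mono part) auto
      also have "\<dots> = ennreal 2 * ennreal (200 * c * 400^n)"
        using c by (simp add: ennreal_plus[symmetric] mult.assoc del: ennreal_plus)
      also have "\<dots> = ennreal (c * 400 ^ Suc n)"
        using c by (subst ennreal_mult[symmetric]) auto
      finally show "(\<integral>\<^sup>+x. ennreal (f x) \<partial>?N) * (\<integral>\<^sup>+y. g y \<partial>?N) \<le> ennreal (c * 400 ^ Suc n)" .
    qed
  qed
qed

lemma santalo: "santalo n"
proof (induction n)
  case (Suc n)
  then show ?case by (rule santalo_at_imp[OF santalo_step])
qed (rule santalo_0)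

text \<open>By \<open>dual_le\<close> and \<open>dual_ge\<close> a superlevel set with positive
  level is an intersection of closed conditions, one for each \<open>x\<close>.\<close>

lemma dual_measurable:
  assumes "unit_fun n f" shows "closed {y \<in> Rn n. a \<le> dual_fun n f y}"
proof (cases "a \<le> 0")
  case True
  then have "{y \<in> Rn n. a \<le> dual_fun n f y} = Rn n" using dual_nonneg[of n f] by (auto intro: order_trans)
  then show ?thesis using closed_Rn by simp
next
  case False
  have "{y \<in> Rn n. a \<le> dual_fun n f y} = Rn n \<inter> (\<Inter>x\<in>Rn n. {y. a * f x \<le> exp (- (\<Sum>i<n. y i * x i))})"
  proof safe
    fix x y assume y: "a \<le> dual_fun n f y" and x: "x \<in> Rn n"
    have "a * f x \<le> dual_fun n f y * f x" using y unit_funD(1)[OF assms x] by (rule mult_right_mono)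
    also have "\<dots> \<le> exp (- Rn_inner n y x)"
      using assms x by (intro dual_le) (auto simp: unit_fun_def)
    finally show "a * f x \<le> exp (- (\<Sum>i<n. y i * x i))" by (simp add: Rn_inner_def)
  next
    fix y assume "y \<in> Rn n" "y \<in> (\<Inter>x\<in>Rn n. {y. a * f x \<le> exp (- (\<Sum>i<n. y i * x i))})"
    then show "a \<le> dual_fun n f y"
      using assms False by (intro dual_ge) (auto simp: unit_fun_def Rn_inner_def)
  qed
  moreover have "closed {y :: nat \<Rightarrow> real. a * f x \<le> exp (- (\<Sum>i<n. y i * x i))}" for x
    by (intro closed_Collect_le continuous_intros continuous_on_product_coordinates)
  ultimately show ?thesis using closed_Rn by (auto intro!: closed_Int closed_INT)
qed

text \<open>The geometric mean of the dual values at \<open>x\<close> and \<open>y\<close> satisfies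
  all the constraints that define the dual at their midpoint, as one sees by multiplying the
  constraints at \<open>x\<close> and \<open>y\<close>; \<open>dual_ge\<close> concludes.\<close>

lemma dual_lcf:
  assumes "unit_fun n f" shows "lcf n (dual_fun n f)"
proof -
  have f: "\<And>x. x \<in> Rn n \<Longrightarrow> 0 \<le> f x" "f (Rn_zero n) = 1" using assms by (auto simp: unit_fun_def)
  have le1: "dual_fun n f y \<le> 1" for y
    using dual_le[of n f "Rn_zero n" y] f by simp
  have d0: "dual_fun n f (Rn_zero n) = 1"
    using assms le1[of "Rn_zero n"] by (intro antisym dual_ge) (auto simp: unit_fun_def)
  have mid: "dual_fun n f x * dual_fun n f y \<le> (dual_fun n f (comb n (1/2) x (1/2) y))\<^sup>2" for x y
  proof -
    have "sqrt (dual_fun n f x * dual_fun n f y) \<le> dual_fun n f (comb n (1/2) x (1/2) y)"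
    proof (rule dual_ge[of n f])
      fix w assume w: "w \<in> Rn n"
      have "(dual_fun n f x * f w) * (dual_fun n f y * f w) \<le> exp (- Rn_inner n x w) * exp (- Rn_inner n y w)"
        using f w dual_nonneg by (intro mult_mono dual_le) auto
      also have "\<dots> = (exp (- Rn_inner n (comb n (1/2) x (1/2) y) w))\<^sup>2"
        by (simp add: Rn_inner_comb exp_add[symmetric] exp_double[symmetric] field_simps)
      finally have "(dual_fun n f x * dual_fun n f y) * (f w)\<^sup>2 \<le> (exp (- Rn_inner n (comb n (1/2) x (1/2) y) w))\<^sup>2"
        by (simp add: power2_eq_square mult_ac)
      then have "sqrt ((dual_fun n f x * dual_fun n f y) * (f w)\<^sup>2) \<le> exp (- Rn_inner n (comb n (1/2) x (1/2) y) w)"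
        by (rule sqrt_le_of_le_square) simp
      then show "sqrt (dual_fun n f x * dual_fun n f y) * f w \<le> exp (- Rn_inner n (comb n (1/2) x (1/2) y) w)"
        using f(1)[OF w] by (simp add: real_sqrt_mult)
    qed (use f in \<open>auto simp: dual_nonneg\<close>)
    then show ?thesis
      by (metis dual_nonneg mult_nonneg_nonneg real_sqrt_ge_0_iff real_sqrt_le_iff real_sqrt_pow2 power_mono)
  qed
  show ?thesis
    unfolding lcf_def using dual_nonneg le1 d0 mid dual_measurable[OF assms] by auto
qed

lemma santalo_centered:
  assumes f: "lcf n f" "mass n f < \<infinity>" and ctr: "centered n f"
  shows "mass n f * mass n (dual_fun n f) \<le> 400^n"
proof -
  note [measurable] = lcf_measurable[OF f(1)] lcf_measurable[OF dual_lcf[OF lcf_unit[OF f(1)]]]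
  have "(\<integral>\<^sup>+x. ennreal (f x) \<partial>Rn_lborel n) * (\<integral>\<^sup>+y. ennreal (dual_fun n f y) \<partial>Rn_lborel n) \<le> ennreal (1 * 400^n)"
  proof (rule santalo[unfolded santalo_def, rule_format])
    show "integrable (Rn_lborel n) f"
      using f(2) lcfD(1)[OF f(1)] by (intro integrableI_nonneg) (auto simp: mass_def)
    fix x y assume x: "x \<in> Rn n" and y: "y \<in> Rn n"
    have "dual_fun n f y * f x \<le> exp (- Rn_inner n y x)"
      using lcfD[OF f(1)] x by (intro dual_le) auto
    then show "ennreal (f x) * ennreal (dual_fun n f y) \<le> ennreal (1 * exp (- Rn_inner n x y))"
      using lcfD(1)[OF f(1) x] dual_nonneg
      by (simp add: ennreal_mult[symmetric] mult.commute Rn_inner_commute[of n x] ennreal_leI)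
  qed (use ctr lcfD(1)[OF f(1)] in \<open>auto simp: centered_def\<close>)
  then show ?thesis by (simp add: mass_def ennreal_power[symmetric])
qed

section \<open>Change of variables for monotone maps\<close>

declare continuous_on_coordinatewise_then_product [continuous_intros del]

lemma measurable_upd_pair:
  "H \<in> borel_measurable (Rn_lborel (Suc n)) \<Longrightarrow> (\<lambda>p. H ((fst p)(n := snd p))) \<in> borel_measurable (Rn_lborel n \<Otimes>\<^sub>M lborel)"
  using measurable_compose[OF measurable_upd, of H n] by (simp add: case_prod_beta' fun_upd_def)

definition schur :: "nat \<Rightarrow> (nat \<Rightarrow> nat \<Rightarrow> real) \<Rightarrow> nat \<Rightarrow> nat \<Rightarrow> real" where
  "schur n M i j = M i j - M i n * M n j / M n n"

text \<open>The product of the pivots of Gaussian elimination, i.e. the determinant of a matrix of size \<open>n\<close>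
  whose trailing principal minors do not vanish. No other property of determinants is needed.\<close>

primrec pivots :: "nat \<Rightarrow> (nat \<Rightarrow> nat \<Rightarrow> real) \<Rightarrow> real" where
  "pivots 0 M = 1"
| "pivots (Suc n) M = M n n * pivots n (schur n M)"

definition pos_form :: "nat \<Rightarrow> real \<Rightarrow> (nat \<Rightarrow> nat \<Rightarrow> real) \<Rightarrow> bool" where
  "pos_form n d M \<longleftrightarrow> (\<forall>h. d * (\<Sum>i<n. (h i)\<^sup>2) \<le> (\<Sum>i<n. \<Sum>j<n. M i j * h i * h j))"

lemma pos_form_diag:
  assumes "pos_form (Suc n) d M" shows "d \<le> M n n"
proof -
  have "d * (\<Sum>i<Suc n. (if i = n then 1 else 0)\<^sup>2) \<le> (\<Sum>i<Suc n. \<Sum>j<Suc n. M i j * (if i = n then 1 else 0) * (if j = n then 1 else 0))"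
    using assms[unfolded pos_form_def, THEN spec, of "\<lambda>i. if i = n then 1 else 0"] .
  then show ?thesis by simp
qed

text \<open>Extend \<open>h\<close> by the last coordinate \<open>s\<close> for which the last row
  of \<open>M\<close> annihilates the extended vector. The form of \<open>M\<close> at this vector
  equals the form of the Schur complement at \<open>h\<close>, so the same \<open>d\<close>
  survives. The row rather than a minimization determines \<open>s\<close>, as \<open>M\<close> is
  not assumed symmetric.\<close>

lemma pos_form_schur:
  assumes M: "pos_form (Suc n) d M" and d: "d > 0" shows "pos_form n d (schur n M)"
  unfolding pos_form_def
proof
  fix h :: "nat \<Rightarrow> real"
  define p where "p = M n n"
  have p: "p > 0" using pos_form_diag[OF M] d by (simp add: p_def)
  define r where "r = (\<Sum>j<n. M n j * h j)"
  define c where "c = (\<Sum>i<n. M i n * h i)"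
  define A where "A = (\<Sum>i<n. \<Sum>j<n. M i j * h i * h j)"
  define s where "s = - r / p"
  have "(\<Sum>i<n. \<Sum>j<n. schur n M i j * h i * h j) = (\<Sum>i<n. \<Sum>j<n. M i j * h i * h j - (M i n * h i) * (M n j * h j) / p)"
    by (simp add: schur_def p_def algebra_simps)
  also have "\<dots> = A - c * r / p"
    by (simp add: sum_subtractf A_def c_def r_def sum_product sum_divide_distrib[symmetric])
  also have "A - c * r / p = A + s * c + (s * r + s\<^sup>2 * p)"
    using p by (simp add: s_def field_simps power2_eq_square)
  also have "\<dots> = (\<Sum>i<Suc n. \<Sum>j<Suc n. M i j * (h(n := s)) i * (h(n := s)) j)"
    by (simp add: A_def c_def r_def p_def sum.distrib sum_distrib_left power2_eq_square mult_ac)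
  finally have e: "(\<Sum>i<n. \<Sum>j<n. schur n M i j * h i * h j) = \<dots>" .
  have "d * (\<Sum>i<Suc n. ((h(n := s)) i)\<^sup>2) \<le> (\<Sum>i<Suc n. \<Sum>j<Suc n. M i j * (h(n := s)) i * (h(n := s)) j)"
    using M[unfolded pos_form_def, THEN spec, of "h(n := s)"] .
  moreover have "d * (\<Sum>i<n. (h i)\<^sup>2) \<le> d * (\<Sum>i<Suc n. ((h(n := s)) i)\<^sup>2)"
    using d by (intro mult_left_mono) simp_all
  ultimately show "d * (\<Sum>i<n. (h i)\<^sup>2) \<le> (\<Sum>i<n. \<Sum>j<n. schur n M i j * h i * h j)"
    unfolding e by linarith
qed

lemma pivots_nonneg:
  "pos_form n d M \<Longrightarrow> d > 0 \<Longrightarrow> 0 \<le> pivots n M"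
proof (induction n arbitrary: M)
  case (Suc n)
  then show ?case using pos_form_diag[of n d M] pos_form_schur[of n d M] by simp
qed simp

text \<open>Positivity keeps every diagonal entry at least \<open>d\<close>, so the divisions in the
  elimination are continuous.\<close>

lemma pivots_continuous:
  assumes "\<And>i j. i < n \<Longrightarrow> j < n \<Longrightarrow> continuous_on S (\<lambda>x. M x i j)" "\<And>x. x \<in> S \<Longrightarrow> pos_form n d (M x)" "d > 0"
  shows "continuous_on S (\<lambda>x. pivots n (M x))"
  using assms
proof (induction n arbitrary: M)
  case (Suc n)
  have nz: "M x n n \<noteq> 0" if "x \<in> S" for x
    using pos_form_diag[OF Suc.prems(2)[OF that]] Suc.prems(3) by simp
  have "continuous_on S (\<lambda>x. pivots n (schur n (M x)))"
  proof (rule Suc.IH)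
    fix i j assume "i < n" "j < n"
    then show "continuous_on S (\<lambda>x. schur n (M x) i j)"
      unfolding schur_def using nz by (intro continuous_intros Suc.prems) auto
  qed (use Suc.prems pos_form_schur in auto)
  then show ?case by (auto intro!: continuous_intros Suc.prems)
qed simp

text \<open>Here the derivative enters in Caratheodory's form, through a continuous slope.\<close>

lemma nn_integral_subst_real:
  fixes H :: "real \<Rightarrow> ennreal"
  assumes H[measurable]: "H \<in> borel_measurable borel" and d: "d > 0"
    and q: "\<And>s t. v t - v s = q t s * (t - s)" "\<And>s t. d \<le> q t s"
    and cont: "\<And>t. isCont (\<lambda>s. q s t) t" "continuous_on UNIV (\<lambda>t. q t t)"
  shows "(\<integral>\<^sup>+t. H (v t) * ennreal (q t t) \<partial>lborel) = (\<integral>\<^sup>+w. H w \<partial>lborel)"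
proof -
  have deriv: "(v has_real_derivative q t t) (at t)" for t
    unfolding CARAT_DERIV using q(1) cont(1) by (intro exI[of _ "\<lambda>s. q s t"]) auto
  have vc: "continuous_on UNIV v"
    by (intro continuous_at_imp_continuous_on) (auto intro: DERIV_isCont deriv)
  have [measurable]: "v \<in> borel_measurable borel" "(\<lambda>t. q t t) \<in> borel_measurable borel"
    using vc cont(2) by (auto intro: borel_measurable_continuous_onI)
  have q0: "0 \<le> q t s" for s t using q(2)[where t=t and s=s] d by linarith
  \<comment> \<open>Substitution is carried out on compact intervals; slope at least
    \<open>d\<close> makes their images exhaust the line, and monotone convergence yields the full
    integrals.\<close>
  have sub: "(\<integral>\<^sup>+w. H w * indicator {v (- real (Suc k))..v (real (Suc k))} w \<partial>lborel) =
    (\<integral>\<^sup>+t. H (v t) * ennreal (q t t) * indicator {- real (Suc k)..real (Suc k)} t \<partial>lborel)" for k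
    by (rule nn_integral_substitution_aux) (auto intro: deriv q0 continuous_on_subset[OF cont(2)])
  have mono: "mono v"
  proof (rule monoI)
    fix s t :: real assume "s \<le> t"
    then have "0 \<le> q t s * (t - s)" using q(2)[of t s] d by (intro mult_nonneg_nonneg) auto
    then show "v s \<le> v t" using q(1)[of t s] by simp
  qed
  have ge: "v 0 + d * t \<le> v t" if "t \<ge> 0" for t
    using mult_right_mono[OF q(2)[of t 0], of t] q(1)[of t 0] that by simp
  have le: "v (- t) \<le> v 0 - d * t" if "t \<ge> 0" for t
    using mult_right_mono[OF q(2)[of 0 "- t"], of t] q(1)[of 0 "- t"] that by simp
  have "(SUP k. H w * indicator {v (- real (Suc k))..v (real (Suc k))} w) = H w" for w
  proof (rule antisym)
    show "(SUP k. H w * indicator {v (- real (Suc k))..v (real (Suc k))} w) \<le> H w"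
      by (intro SUP_least) (auto simp: indicator_def)
    obtain k :: nat where k: "\<bar>w - v 0\<bar> / d \<le> real k" using real_arch_simple by blast
    then have "\<bar>w - v 0\<bar> \<le> d * real (Suc k)" using d by (simp add: field_simps)
    then have "w \<in> {v (- real (Suc k))..v (real (Suc k))}"
      using ge[of "real (Suc k)"] le[of "real (Suc k)"] by auto
    then show "H w \<le> (SUP k. H w * indicator {v (- real (Suc k))..v (real (Suc k))} w)"
      by (intro SUP_upper2[of k]) auto
  qed
  then have "(\<integral>\<^sup>+w. H w \<partial>lborel) = (\<integral>\<^sup>+w. (SUP k. H w * indicator {v (- real (Suc k))..v (real (Suc k))} w) \<partial>lborel)" by simp
  also have "\<dots> = (SUP k. \<integral>\<^sup>+w. H w * indicator {v (- real (Suc k))..v (real (Suc k))} w \<partial>lborel)"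
  proof (rule nn_integral_monotone_convergence_SUP)
    show "incseq (\<lambda>k w. H w * indicator {v (- real (Suc k))..v (real (Suc k))} w)"
    proof (rule monoI, rule le_funI)
      fix k l :: nat and w assume "k \<le> l"
      then have "v (- real (Suc l)) \<le> v (- real (Suc k))" "v (real (Suc k)) \<le> v (real (Suc l))"
        by (auto intro!: monoD[OF mono])
      then show "H w * indicator {v (- real (Suc k))..v (real (Suc k))} w \<le> H w * indicator {v (- real (Suc l))..v (real (Suc l))} w"
        by (auto simp: indicator_def)
    qed
  qed measurable
  also have "\<dots> = (SUP k. \<integral>\<^sup>+t. H (v t) * ennreal (q t t) * indicator {- real (Suc k)..real (Suc k)} t \<partial>lborel)"
    by (simp only: sub)
  also have "\<dots> = (\<integral>\<^sup>+t. (SUP k. H (v t) * ennreal (q t t) * indicator {- real (Suc k)..real (Suc k)} t) \<partial>lborel)"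
    by (rule nn_integral_monotone_convergence_SUP[symmetric])
       (auto simp: incseq_def le_fun_def indicator_def)
  also have "\<dots> = (\<integral>\<^sup>+t. H (v t) * ennreal (q t t) \<partial>lborel)"
  proof (rule nn_integral_cong, rule antisym)
    fix t :: real
    show "(SUP k. H (v t) * ennreal (q t t) * indicator {- real (Suc k)..real (Suc k)} t) \<le> H (v t) * ennreal (q t t)"
      by (intro SUP_least) (auto simp: indicator_def)
    obtain k :: nat where "\<bar>t\<bar> \<le> real k" using real_arch_simple by blast
    then have "t \<in> {- real (Suc k)..real (Suc k)}" by auto
    then show "H (v t) * ennreal (q t t) \<le> (SUP k. H (v t) * ennreal (q t t) * indicator {- real (Suc k)..real (Suc k)} t)"
      by (intro SUP_upper2[of k]) auto
  qed
  finally show ?thesis by simp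
qed

lemma continuous_on_upd:
  assumes "continuous_on S f" "continuous_on S g"
  shows "continuous_on S (\<lambda>p. (f p)(n := g p) :: nat \<Rightarrow> real)"
proof (rule continuous_on_coordinatewise_then_product)
  fix i show "continuous_on S (\<lambda>p. ((f p)(n := g p)) i)"
    using assms(2) continuous_on_product_then_coordinatewise[OF assms(1), of i] by (cases "i = n") auto
qed

text \<open>Change of variables for a strongly monotone map, one coordinate at a time: solving the last
  equation for the last variable turns the matrix of slopes into its Schur complement.\<close>

theorem nn_integral_monotone_map:
  assumes d: "d > 0"
    and V: "\<And>i. i < n \<Longrightarrow> continuous_on (Rn n) (\<lambda>x. V x i)"
    and Q: "\<And>i j. i < n \<Longrightarrow> j < n \<Longrightarrow> continuous_on (Rn n \<times> Rn n) (\<lambda>p. Q (fst p) (snd p) i j)"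
    and slope: "\<And>x y i. x \<in> Rn n \<Longrightarrow> y \<in> Rn n \<Longrightarrow> i < n \<Longrightarrow> V x i - V y i = (\<Sum>j<n. Q x y i j * (x j - y j))"
    and pos: "\<And>x y. x \<in> Rn n \<Longrightarrow> y \<in> Rn n \<Longrightarrow> pos_form n d (Q x y)"
    and H: "H \<in> borel_measurable (Rn_lborel n)"
  shows "(\<integral>\<^sup>+x. H (\<lambda>i\<in>{..<n}. V x i) * ennreal (pivots n (Q x x)) \<partial>Rn_lborel n) = (\<integral>\<^sup>+x. H x \<partial>Rn_lborel n)"
  using V Q slope pos H
proof (induction n arbitrary: V Q H)
  case 0
  have "(\<lambda>i\<in>{..<0::nat}. V x i) = Rn_zero 0" for x
    by (auto simp: Rn_zero_def)
  then show ?case by (subst (1 2) nn_integral_Rn_0) simp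
next
  case (Suc n)
  note V = Suc.prems(1) and Q = Suc.prems(2) and slope = Suc.prems(3) and pos = Suc.prems(4) and H = Suc.prems(5)
  interpret P: pair_sigma_finite "Rn_lborel n" lborel
    by (intro pair_sigma_finite.intro Rn.sigma_finite_measure_axioms lborel.sigma_finite_measure_axioms)
  have Vc: "continuous_on S (\<lambda>p. V (f p) i)" if "continuous_on S f" "f ` S \<subseteq> Rn (Suc n)" "i < Suc n" for S :: "'z::topological_space set" and f i
    by (rule continuous_on_compose2[OF V[OF that(3)] that(1,2)])
  have Qc: "continuous_on S (\<lambda>p. Q (f p) (g p) i j)" if "continuous_on S f" "continuous_on S g" "f ` S \<subseteq> Rn (Suc n)" "g ` S \<subseteq> Rn (Suc n)" "i < Suc n" "j < Suc n"
    for S :: "'z::topological_space set" and f g i j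
    using continuous_on_compose2[OF Q[OF that(5,6)] continuous_on_Pair[OF that(1,2)]] that(3,4) by auto
  define v where "v x t = V (x(n := t)) n" for x t
  define q where "q x t s = Q (x(n := t)) (x(n := s)) n n" for x t s
  have vq: "v x t - v x s = q x t s * (t - s)" "d \<le> q x t s" if x: "x \<in> Rn n" for x t s
  proof -
    have "V (x(n := t)) n - V (x(n := s)) n = (\<Sum>j<Suc n. Q (x(n := t)) (x(n := s)) n j * ((x(n := t)) j - (x(n := s)) j))"
      by (rule slope[OF Rn_upd[OF x] Rn_upd[OF x]]) simp
    also have "\<dots> = Q (x(n := t)) (x(n := s)) n n * (t - s)" by simp
    finally show "v x t - v x s = q x t s * (t - s)" by (simp only: v_def q_def)
    show "d \<le> q x t s" unfolding q_def by (intro pos_form_diag pos Rn_upd x)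
  qed
  have mono: "v x s < v x t" if "s < t" "x \<in> Rn n" for x s t
    using vq(1)[OF that(2), of t s] vq(2)[OF that(2), of t s] d that(1)
    by (metis diff_gt_0_iff_gt less_le_trans mult_pos_pos)
  have vcont: "continuous_on UNIV (v x)" if x: "x \<in> Rn n" for x
    unfolding v_def using x by (intro Vc continuous_on_upd continuous_intros) (auto intro: Rn_upd)
  have ex: "\<exists>t. v x t = w" if x: "x \<in> Rn n" for x w
  proof -
    define r where "r = \<bar>w - v x 0\<bar> / d"
    have r: "r \<ge> 0" "d * r = \<bar>w - v x 0\<bar>" using d by (simp_all add: r_def)
    have "w \<le> v x r"
      using mult_right_mono[OF vq(2)[OF x, of r 0], of r] vq(1)[OF x, of r 0] r by simp
    moreover have "v x (- r) \<le> w"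
      using mult_right_mono[OF vq(2)[OF x, of 0 "- r"], of r] vq(1)[OF x, of 0 "- r"] r by simp
    ultimately show ?thesis
      using IVT'[of "v x" "- r" w r] r continuous_on_subset[OF vcont[OF x]] by auto
  qed
  define T where "T x w = (THE t. v x t = w)" for x w
  have T: "v x t = w \<longleftrightarrow> t = T x w" if x: "x \<in> Rn n" for x t w
  proof -
    obtain t' where t': "v x t' = w" using ex[OF x] by blast
    have u: "v x s = w \<longleftrightarrow> s = t'" for s
      using mono[OF _ x, of s t'] mono[OF _ x, of t' s] t' by (metis linorder_neqE_linordered_idom less_irrefl)
    then have "T x w = t'" unfolding T_def by simp
    then show ?thesis using u by simp
  qed
  have vT: "v x (T x w) = w" if "x \<in> Rn n" for x w using T[OF that, of "T x w" w] by simp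
  \<comment> \<open>Monotonicity turns a comparison of the solution \<open>T x w\<close> with
    \<open>c\<close> into a comparison of \<open>w\<close> with \<open>v x c\<close>. Joint
    continuity of \<open>T\<close> thus follows from that of \<open>v\<close>.\<close>
  have T_less: "T x w < c \<longleftrightarrow> w < v x c" if "x \<in> Rn n" for x w c
    using mono[OF _ that, of "T x w" c] mono[OF _ that, of c "T x w"] vT[OF that, of w]
    by (metis linorder_neqE_linordered_idom less_asym)
  have T_gr: "c < T x w \<longleftrightarrow> v x c < w" if "x \<in> Rn n" for x w c
    using mono[OF _ that, of "T x w" c] mono[OF _ that, of c "T x w"] vT[OF that, of w]
    by (metis linorder_neqE_linordered_idom less_asym)
  have vc: "continuous_on (Rn n \<times> UNIV) (\<lambda>p. v (fst p) c)" for c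
    unfolding v_def by (intro Vc continuous_on_upd continuous_intros) (auto intro: Rn_upd)
  have Tc: "continuous_on (Rn n \<times> UNIV) (\<lambda>p. T (fst p) (snd p))"
    unfolding continuous_on_def
  proof
    fix p :: "(nat \<Rightarrow> real) \<times> real" assume p: "p \<in> Rn n \<times> UNIV"
    then have p1: "fst p \<in> Rn n" by auto
    have c1: "((\<lambda>q. snd q - v (fst q) c) \<longlongrightarrow> snd p - v (fst p) c) (at p within Rn n \<times> UNIV)" for c
      by (intro tendsto_intros bspec[OF vc[of c, unfolded continuous_on_def] p])
    have inn: "\<forall>\<^sub>F q in at p within Rn n \<times> UNIV. fst q \<in> Rn n"
      by (auto simp: eventually_at_filter intro!: always_eventually)
    show "((\<lambda>q. T (fst q) (snd q)) \<longlongrightarrow> T (fst p) (snd p)) (at p within Rn n \<times> UNIV)"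
    proof (rule order_tendstoI)
      fix c assume "c < T (fst p) (snd p)"
      then have "0 < snd p - v (fst p) c" using T_gr[OF p1] by simp
      from order_tendstoD(1)[OF c1 this] inn
      show "\<forall>\<^sub>F q in at p within Rn n \<times> UNIV. c < T (fst q) (snd q)"
        by eventually_elim (simp add: T_gr)
    next
      fix c assume "T (fst p) (snd p) < c"
      then have "snd p - v (fst p) c < 0" using T_less[OF p1] by simp
      from order_tendstoD(2)[OF c1 this] inn
      show "\<forall>\<^sub>F q in at p within Rn n \<times> UNIV. T (fst q) (snd q) < c"
        by eventually_elim (simp add: T_less)
    qed
  qed
  define X where "X x w = x(n := T x w)" for x w
  have XR: "X x w \<in> Rn (Suc n)" if "x \<in> Rn n" for x w unfolding X_def using that by (rule Rn_upd)
  have Xc: "continuous_on (Rn n \<times> UNIV) (\<lambda>p. X (fst p) (snd p))"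
    unfolding X_def by (intro continuous_on_upd Tc continuous_intros)
  have Xcw: "continuous_on (Rn n) (\<lambda>x. X x w)" for w
  proof -
    have "continuous_on (Rn n) (\<lambda>x. (x, w))" by (intro continuous_on_Pair continuous_on_id continuous_on_const)
    from continuous_on_compose2[OF Xc this] show ?thesis by auto
  qed
  define W where "W x w i = V (X x w) i" for x w i
  define S where "S x y w = schur n (Q (X x w) (X y w))" for x y w
  define \<Phi> where "\<Phi> x w = H ((\<lambda>i\<in>{..<n}. W x w i)(n := w)) * ennreal (pivots n (S x x w))" for x w
  have Sc: "continuous_on A (\<lambda>p. S (f p) (g p) (h p) i j)"
    if "i < n" "j < n" "continuous_on A (\<lambda>p. X (f p) (h p))" "continuous_on A (\<lambda>p. X (g p) (h p))" "f ` A \<subseteq> Rn n" "g ` A \<subseteq> Rn n"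
    for A :: "'z::topological_space set" and f g h i j
  proof -
    have r: "(\<lambda>p. X (f p) (h p)) ` A \<subseteq> Rn (Suc n)" "(\<lambda>p. X (g p) (h p)) ` A \<subseteq> Rn (Suc n)" using that(5,6) by (auto intro: XR)
    have "Q (X (f p) (h p)) (X (g p) (h p)) n n \<noteq> 0" if "p \<in> A" for p
    proof -
      have "X (f p) (h p) \<in> Rn (Suc n)" "X (g p) (h p) \<in> Rn (Suc n)" using r that by auto
      from pos_form_diag[OF pos[OF this]] show ?thesis using d by simp
    qed
    then show ?thesis
      unfolding S_def schur_def using that r by (intro continuous_intros Qc) auto
  qed
  have Spos: "pos_form n d (S x y w)" if "x \<in> Rn n" "y \<in> Rn n" for x y w
    unfolding S_def by (intro pos_form_schur pos XR that d)
  have IH: "(\<integral>\<^sup>+x. H ((\<lambda>i\<in>{..<n}. W x w i)(n := w)) * ennreal (pivots n (S x x w)) \<partial>Rn_lborel n) = (\<integral>\<^sup>+y. H (y(n := w)) \<partial>Rn_lborel n)" for w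
  proof (rule Suc.IH[where V="\<lambda>x. W x w" and Q="\<lambda>x y. S x y w" and H="\<lambda>y. H (y(n := w))"])
    show "continuous_on (Rn n) (\<lambda>x. W x w i)" if "i < n" for i
      unfolding W_def using that by (intro Vc Xcw) (auto intro: XR)
    show "continuous_on (Rn n \<times> Rn n) (\<lambda>p. S (fst p) (snd p) w i j)" if "i < n" "j < n" for i j
      using that by (intro Sc continuous_on_compose2[OF Xcw] continuous_intros) auto
    show "W x w i - W y w i = (\<Sum>j<n. S x y w i j * (x j - y j))" if x: "x \<in> Rn n" and y: "y \<in> Rn n" and i: "i < n" for x y i
    proof -
      let ?Q = "Q (X x w) (X y w)"
      define D where "D = T x w - T y w"
      have nn: "?Q n n \<noteq> 0" using pos_form_diag[OF pos[OF XR[OF x] XR[OF y]], of w w] d by simp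
      have s: "V (X x w) i - V (X y w) i = (\<Sum>j<n. ?Q i j * (x j - y j)) + ?Q i n * D" if "i < Suc n" for i
      proof -
        have "V (X x w) i - V (X y w) i = (\<Sum>j<Suc n. ?Q i j * (X x w j - X y w j))"
          by (rule slope[OF XR[OF x] XR[OF y] that])
        moreover have "X x w n - X y w n = D" "\<And>j. j < n \<Longrightarrow> X x w j - X y w j = x j - y j"
          by (simp_all add: X_def D_def)
        ultimately show ?thesis by simp
      qed
      have "V (X x w) n - V (X y w) n = 0"
        using vT[OF x, of w] vT[OF y, of w] by (simp add: v_def X_def)
      then have "D = - (\<Sum>j<n. ?Q n j * (x j - y j)) / ?Q n n"
        using s[of n] nn by (simp add: field_simps)
      then have "W x w i - W y w i = (\<Sum>j<n. ?Q i j * (x j - y j)) - ?Q i n * (\<Sum>j<n. ?Q n j * (x j - y j)) / ?Q n n"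
        using s[of i] i by (simp add: W_def)
      also have "\<dots> = (\<Sum>j<n. S x y w i j * (x j - y j))"
      proof -
        have "(\<Sum>j<n. S x y w i j * (x j - y j)) = (\<Sum>j<n. ?Q i j * (x j - y j) - ?Q i n / ?Q n n * (?Q n j * (x j - y j)))"
          unfolding S_def schur_def by (intro sum.cong refl) (simp add: field_simps nn)
        also have "\<dots> = (\<Sum>j<n. ?Q i j * (x j - y j)) - ?Q i n / ?Q n n * (\<Sum>j<n. ?Q n j * (x j - y j))"
          by (simp only: sum_subtractf sum_distrib_left)
        finally show ?thesis by simp
      qed
      finally show ?thesis .
    qed
    show "pos_form n d (S x y w)" if "x \<in> Rn n" "y \<in> Rn n" for x y using Spos[OF that] .
    show "(\<lambda>y. H (y(n := w))) \<in> borel_measurable (Rn_lborel n)"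
    proof -
      have "(\<lambda>p. H ((fst p)(n := snd p))) \<in> borel_measurable (Rn_lborel n \<Otimes>\<^sub>M lborel)"
        by (rule measurable_upd_pair[OF H])
      from measurable_compose[OF measurable_Pair[of "\<lambda>x. x" "Rn_lborel n" "Rn_lborel n" "\<lambda>_. w" lborel] this]
      show ?thesis by simp
    qed
  qed
  have Wm: "(\<lambda>p. (\<lambda>i\<in>{..<n}. W (fst p) (snd p) i)(n := snd p)) \<in> Rn_lborel n \<Otimes>\<^sub>M lborel \<rightarrow>\<^sub>M Rn_lborel (Suc n)"
  proof (rule measurable_into_Rn)
    fix i assume "i < Suc n"
    then consider "i < n" | "i = n" by linarith
    then show "(\<lambda>p. ((\<lambda>i\<in>{..<n}. W (fst p) (snd p) i)(n := snd p)) i) \<in> borel_measurable (Rn_lborel n \<Otimes>\<^sub>M lborel)"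
    proof cases
      case 1
      have "continuous_on (Rn n \<times> UNIV) (\<lambda>p. W (fst p) (snd p) i)"
        unfolding W_def using 1 by (intro Vc Xc) (auto intro: XR)
      from measurable_continuous_Rn_real[OF this] show ?thesis using 1 by simp
    qed simp
  qed (rule Rn_upd, simp add: Rn_def)
  have pm: "(\<lambda>p. pivots n (S (fst p) (fst p) (snd p))) \<in> borel_measurable (Rn_lborel n \<Otimes>\<^sub>M lborel)"
  proof (rule measurable_continuous_Rn_real, rule pivots_continuous[OF _ _ d])
    show "continuous_on (Rn n \<times> UNIV) (\<lambda>p. S (fst p) (fst p) (snd p) i j)" if "i < n" "j < n" for i j
      using that by (intro Sc Xc) auto
    show "pos_form n d (S (fst p) (fst p) (snd p))" if "p \<in> Rn n \<times> UNIV" for p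
      using that by (intro Spos) auto
  qed
  have \<Phi>m: "(\<lambda>p. \<Phi> (fst p) (snd p)) \<in> borel_measurable (Rn_lborel n \<Otimes>\<^sub>M lborel)"
    unfolding \<Phi>_def using measurable_compose[OF Wm H] pm by measurable
  have Vm: "(\<lambda>x. \<lambda>i\<in>{..<Suc n}. V x i) \<in> Rn_lborel (Suc n) \<rightarrow>\<^sub>M Rn_lborel (Suc n)"
    by (rule measurable_into_Rn) (auto intro: measurable_continuous_Rn V simp: Rn_def)
  have Dm: "(\<lambda>x. pivots (Suc n) (Q x x)) \<in> borel_measurable (Rn_lborel (Suc n))"
  proof (rule measurable_continuous_Rn, rule pivots_continuous[OF _ _ d])
    show "continuous_on (Rn (Suc n)) (\<lambda>x. Q x x i j)" if "i < Suc n" "j < Suc n" for i j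
      using that by (intro Qc continuous_intros) auto
  qed (rule pos)
  have "(\<integral>\<^sup>+x. H (\<lambda>i\<in>{..<Suc n}. V x i) * ennreal (pivots (Suc n) (Q x x)) \<partial>Rn_lborel (Suc n)) =
    (\<integral>\<^sup>+x. (\<integral>\<^sup>+t. H (\<lambda>i\<in>{..<Suc n}. V (x(n := t)) i) * ennreal (pivots (Suc n) (Q (x(n := t)) (x(n := t)))) \<partial>lborel) \<partial>Rn_lborel n)"
    by (intro nn_integral_Rn_Suc borel_measurable_times_ennreal measurable_compose[OF Vm H] measurable_compose[OF Dm measurable_ennreal])
  \<comment> \<open>For fixed \<open>x\<close>, the substitution \<open>w = v x t\<close> uses up
    the pivot \<open>q x t t\<close>. The other pivots are those of the Schur complement and are
    left to the induction hypothesis at fixed \<open>w\<close>.\<close>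
  also have "\<dots> = (\<integral>\<^sup>+x. (\<integral>\<^sup>+w. \<Phi> x w \<partial>lborel) \<partial>Rn_lborel n)"
  proof (rule nn_integral_cong)
    fix x assume "x \<in> space (Rn_lborel n)"
    then have x: "x \<in> Rn n" by simp
    have "(\<integral>\<^sup>+t. H (\<lambda>i\<in>{..<Suc n}. V (x(n := t)) i) * ennreal (pivots (Suc n) (Q (x(n := t)) (x(n := t)))) \<partial>lborel)
      = (\<integral>\<^sup>+t. \<Phi> x (v x t) * ennreal (q x t t) \<partial>lborel)"
    proof (rule nn_integral_cong)
      fix t :: real
      have "T x (v x t) = t" using T[OF x, of t "v x t"] by simp
      then have X: "X x (v x t) = x(n := t)" by (simp add: X_def)
      have e: "(\<lambda>i\<in>{..<Suc n}. V (x(n := t)) i) = (\<lambda>i\<in>{..<n}. W x (v x t) i)(n := v x t)"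
      proof
        have vt: "V (x(n := t)) n = v x t" by (simp only: v_def)
        fix i show "(\<lambda>i\<in>{..<Suc n}. V (x(n := t)) i) i = ((\<lambda>i\<in>{..<n}. W x (v x t) i)(n := v x t)) i"
          by (cases "i = n") (simp_all only: restrict_def W_def X vt less_Suc_eq lessThan_iff fun_upd_apply if_True if_False simp_thms)
      qed
      have "0 \<le> q x t t" using vq(2)[OF x, of t t] d by linarith
      moreover have "0 \<le> pivots n (S x x (v x t))" by (rule pivots_nonneg[OF Spos[OF x x] d])
      ultimately show "H (\<lambda>i\<in>{..<Suc n}. V (x(n := t)) i) * ennreal (pivots (Suc n) (Q (x(n := t)) (x(n := t)))) = \<Phi> x (v x t) * ennreal (q x t t)"
        unfolding e \<Phi>_def by (simp add: S_def X q_def ennreal_mult mult_ac)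
    qed
    also have "\<dots> = (\<integral>\<^sup>+w. \<Phi> x w \<partial>lborel)"
    proof (rule nn_integral_subst_real[OF _ d vq(1)[OF x] vq(2)[OF x]])
      show "\<Phi> x \<in> borel_measurable borel"
        using measurable_compose[OF measurable_Pair1'[of x "Rn_lborel n" lborel] \<Phi>m] x by simp
      show "isCont (\<lambda>s. q x s t) t" for t
      proof -
        have "continuous_on UNIV (\<lambda>s. q x s t)"
          unfolding q_def using x by (intro Qc continuous_on_upd continuous_intros) (auto intro: Rn_upd)
        then show ?thesis by (simp add: continuous_on_eq_continuous_at)
      qed
      show "continuous_on UNIV (\<lambda>t. q x t t)"
        unfolding q_def using x by (intro Qc continuous_on_upd continuous_intros) (auto intro: Rn_upd)
    qed
    finally show "(\<integral>\<^sup>+t. H (\<lambda>i\<in>{..<Suc n}. V (x(n := t)) i) * ennreal (pivots (Suc n) (Q (x(n := t)) (x(n := t)))) \<partial>lborel) = (\<integral>\<^sup>+w. \<Phi> x w \<partial>lborel)" .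
  qed
  also have "\<dots> = (\<integral>\<^sup>+w. (\<integral>\<^sup>+x. \<Phi> x w \<partial>Rn_lborel n) \<partial>lborel)"
    using P.Fubini'[of \<Phi>] \<Phi>m by (simp add: case_prod_beta')
  also have "\<dots> = (\<integral>\<^sup>+w. (\<integral>\<^sup>+y. H (y(n := w)) \<partial>Rn_lborel n) \<partial>lborel)"
    unfolding \<Phi>_def by (simp only: IH)
  also have "\<dots> = (\<integral>\<^sup>+y. (\<integral>\<^sup>+w. H (y(n := w)) \<partial>lborel) \<partial>Rn_lborel n)"
    by (rule P.Fubini', unfold case_prod_beta', rule measurable_upd_pair[OF H])
  also have "\<dots> = (\<integral>\<^sup>+y. H y \<partial>Rn_lborel (Suc n))"
    by (rule nn_integral_Rn_Suc[OF H, symmetric])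
  finally show ?case .
qed

section \<open>Analytic dependence on parameters and Gaussian integrals\<close>

text \<open>The half plane is convex, and there the derivative of \<open>exp (- z)\<close> has
  modulus at most \<open>exp (- m)\<close>.\<close>

lemma norm_exp_diff_le:
  fixes a b :: complex
  assumes "m \<le> Re a" "m \<le> Re b"
  shows "norm (exp (- a) - exp (- b)) \<le> exp (- m) * norm (a - b)"
proof -
  have "norm (exp (- a) - exp (- b)) \<le> exp (- m) * norm (a - b)"
  proof (rule field_differentiable_bound[of "{z. m \<le> Re z}" "\<lambda>z. exp (- z)" "\<lambda>z. - exp (- z)"])
    show "convex {z. m \<le> Re z}" using convex_halfspace_Re_ge[of m] by simp
    show "((\<lambda>z. exp (- z)) has_field_derivative - exp (- z)) (at z within {z. m \<le> Re z})" for z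
      by (auto intro!: derivative_eq_intros)
  qed (use assms in auto)
  then show ?thesis .
qed

text \<open>Half of the exponential decay pays for the factor \<open>E\<close> that differentiation
  under the integral produces.\<close>

lemma mult_exp_half_le:
  fixes c E :: real
  assumes "c > 0" shows "E * exp (- (c * E)) \<le> (2 / c) * exp (- (c / 2 * E))"
proof -
  have "c / 2 * E \<le> exp (c / 2 * E)" using exp_ge_add_one_self[of "c / 2 * E"] by linarith
  then have "E \<le> (2 / c) * exp (c / 2 * E)" using assms by (simp add: field_simps)
  then have "E * exp (- (c * E)) \<le> (2 / c) * exp (c / 2 * E) * exp (- (c * E))" by (intro mult_right_mono) auto
  also have "\<dots> = (2 / c) * (exp (c / 2 * E) * exp (- (c * E)))" by simp
  also have "exp (c / 2 * E) * exp (- (c * E)) = exp (- (c / 2 * E))" by (simp add: exp_add[symmetric] field_simps)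
  finally show ?thesis .
qed

text \<open>Holomorphic dependence on the parameter of \<open>\<integral> exp (- S \<zeta> \<omega>) d\<omega>\<close>, where \<open>S\<close> is a finite sum of
  holomorphic coefficients times real functions dominated by \<open>E\<close>, on the set of all \<open>\<zeta>\<close> for which
  the real part of \<open>S \<zeta>\<close> is bounded below by a positive multiple of \<open>E\<close>.\<close>

locale holomorphic_exponent =
  fixes M :: "'w measure" and K :: nat and \<kappa> :: "nat \<Rightarrow> complex \<Rightarrow> complex" and q :: "nat \<Rightarrow> 'w \<Rightarrow> real"
    and E :: "'w \<Rightarrow> real" and D :: "complex set"
  assumes D: "open D" and \<kappa>: "\<And>m. m < K \<Longrightarrow> \<kappa> m holomorphic_on D"
    and q_meas: "\<And>m. m < K \<Longrightarrow> q m \<in> borel_measurable M"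
    and E_meas: "E \<in> borel_measurable M"
    and qE: "\<And>m w. m < K \<Longrightarrow> w \<in> space M \<Longrightarrow> \<bar>q m w\<bar> \<le> E w"
    and E0: "\<And>w. w \<in> space M \<Longrightarrow> 0 \<le> E w"
    and E_int: "\<And>c. c > 0 \<Longrightarrow> integrable M (\<lambda>w. exp (- (c * E w)))"
begin

definition S :: "complex \<Rightarrow> 'w \<Rightarrow> complex" where
  "S \<zeta> w = (\<Sum>m<K. \<kappa> m \<zeta> * of_real (q m w))"

definition J :: "complex \<Rightarrow> complex" where
  "J \<zeta> = (\<integral>w. exp (- S \<zeta> w) \<partial>M)"

definition U :: "complex set" where
  "U = {\<zeta> \<in> D. \<exists>c>0. \<forall>w\<in>space M. c * E w \<le> Re (S \<zeta> w)}"

lemma S_meas [measurable]: "S \<zeta> \<in> borel_measurable M"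
  unfolding S_def
proof (rule borel_measurable_sum)
  fix m assume "m \<in> {..<K}"
  then have [measurable]: "q m \<in> borel_measurable M" using q_meas by simp
  show "(\<lambda>w. \<kappa> m \<zeta> * complex_of_real (q m w)) \<in> borel_measurable M" by measurable
qed

lemma S_diff: "w \<in> space M \<Longrightarrow> norm (S \<zeta> w - S \<xi> w) \<le> (\<Sum>m<K. norm (\<kappa> m \<zeta> - \<kappa> m \<xi>)) * E w"
proof -
  assume w: "w \<in> space M"
  have "S \<zeta> w - S \<xi> w = (\<Sum>m<K. (\<kappa> m \<zeta> - \<kappa> m \<xi>) * of_real (q m w))"
    by (simp add: S_def sum_subtractf algebra_simps)
  also have "norm \<dots> \<le> (\<Sum>m<K. norm ((\<kappa> m \<zeta> - \<kappa> m \<xi>) * of_real (q m w)))" by (rule norm_sum)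
  also have "\<dots> \<le> (\<Sum>m<K. norm (\<kappa> m \<zeta> - \<kappa> m \<xi>) * E w)"
    using qE[OF _ w] by (intro sum_mono) (simp add: norm_mult mult_left_mono)
  finally show ?thesis by (simp add: sum_distrib_right)
qed

text \<open>All terms of \<open>S\<close> are dominated by \<open>E\<close>, so a small change of
  the coefficients changes \<open>S\<close> by at most \<open>c / 2 * E\<close>. The lower bound
  therefore persists on a ball with half the constant.\<close>

lemma nbhd:
  assumes "\<zeta> \<in> U"
  obtains c r where "c > 0" "r > 0" "ball \<zeta> r \<subseteq> D" "\<And>\<xi> w. \<xi> \<in> ball \<zeta> r \<Longrightarrow> w \<in> space M \<Longrightarrow> c * E w \<le> Re (S \<xi> w)"
proof -
  obtain c where c: "c > 0" "\<And>w. w \<in> space M \<Longrightarrow> c * E w \<le> Re (S \<zeta> w)" and \<zeta>: "\<zeta> \<in> D"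
    using assms by (auto simp: U_def)
  have "((\<lambda>\<xi>. \<Sum>m<K. norm (\<kappa> m \<xi> - \<kappa> m \<zeta>)) \<longlongrightarrow> (\<Sum>m<K. norm (\<kappa> m \<zeta> - \<kappa> m \<zeta>))) (at \<zeta>)"
  proof (intro tendsto_intros)
    fix m assume "m \<in> {..<K}"
    then have "continuous_on D (\<kappa> m)" using \<kappa> by (intro holomorphic_on_imp_continuous_on) auto
    then show "(\<kappa> m \<longlongrightarrow> \<kappa> m \<zeta>) (at \<zeta>)"
      using D \<zeta> by (simp add: continuous_on_eq_continuous_at isCont_def)
  qed
  then have "\<forall>\<^sub>F \<xi> in at \<zeta>. (\<Sum>m<K. norm (\<kappa> m \<xi> - \<kappa> m \<zeta>)) < c / 2"
    using c(1) by (intro order_tendstoD(2)) auto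
  moreover have "\<forall>\<^sub>F \<xi> in at \<zeta>. \<xi> \<in> D"
    using D \<zeta> by (intro eventually_at_in_open') auto
  ultimately have "\<forall>\<^sub>F \<xi> in at \<zeta>. (\<Sum>m<K. norm (\<kappa> m \<xi> - \<kappa> m \<zeta>)) < c / 2 \<and> \<xi> \<in> D"
    by (rule eventually_conj)
  then obtain r where r: "r > 0" "\<And>\<xi>. \<xi> \<noteq> \<zeta> \<Longrightarrow> dist \<xi> \<zeta> < r \<Longrightarrow> (\<Sum>m<K. norm (\<kappa> m \<xi> - \<kappa> m \<zeta>)) < c / 2 \<and> \<xi> \<in> D"
    unfolding eventually_at by auto
  have r': "(\<Sum>m<K. norm (\<kappa> m \<xi> - \<kappa> m \<zeta>)) \<le> c / 2" "\<xi> \<in> D" if "\<xi> \<in> ball \<zeta> r" for \<xi>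
    using r(2)[of \<xi>] that \<zeta> c(1) by (cases "\<xi> = \<zeta>"; auto simp: dist_commute)+
  show ?thesis
  proof (rule that[of "c / 2" r])
    show "c / 2 * E w \<le> Re (S \<xi> w)" if "\<xi> \<in> ball \<zeta> r" and w: "w \<in> space M" for \<xi> w
    proof -
      have "\<bar>Re (S \<xi> w - S \<zeta> w)\<bar> \<le> (\<Sum>m<K. norm (\<kappa> m \<xi> - \<kappa> m \<zeta>)) * E w"
        using S_diff[OF w, of \<xi> \<zeta>] abs_Re_le_cmod[of "S \<xi> w - S \<zeta> w"] by linarith
      also have "\<dots> \<le> c / 2 * E w" using r'(1)[OF that(1)] E0[OF w] by (rule mult_right_mono)
      finally have "\<bar>Re (S \<xi> w) - Re (S \<zeta> w)\<bar> \<le> c / 2 * E w" by simp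
      then have "Re (S \<zeta> w) - Re (S \<xi> w) \<le> c / 2 * E w" by linarith
      then show ?thesis using c(2)[OF w] by (simp add: field_simps)
    qed
  qed (use c r r' in auto)
qed

lemma open_U: "open U"
proof (rule openI)
  fix \<zeta> assume \<zeta>: "\<zeta> \<in> U"
  obtain c r where cr: "c > 0" "r > 0" "ball \<zeta> r \<subseteq> D" "\<And>\<xi> w. \<xi> \<in> ball \<zeta> r \<Longrightarrow> w \<in> space M \<Longrightarrow> c * E w \<le> Re (S \<xi> w)"
    using nbhd[OF \<zeta>] by blast
  then have "ball \<zeta> r \<subseteq> U" unfolding U_def by blast
  then show "\<exists>e>0. ball \<zeta> e \<subseteq> U" using cr(2) by blast
qed

lemma integrable_exp_S:
  assumes "\<zeta> \<in> U" shows "integrable M (\<lambda>w. exp (- S \<zeta> w))"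
proof -
  obtain c where c: "c > 0" "\<And>w. w \<in> space M \<Longrightarrow> c * E w \<le> Re (S \<zeta> w)"
    using assms by (auto simp: U_def)
  show ?thesis
    by (rule Bochner_Integration.integrable_bound[OF E_int[OF c(1)]]) (use c(2) in auto)
qed

lemma J_deriv:
  assumes \<zeta>: "\<zeta> \<in> U" shows "\<exists>J'. (J has_field_derivative J') (at \<zeta>)"
proof -
  obtain c r where cr: "c > 0" "r > 0" "ball \<zeta> r \<subseteq> D" "\<And>\<xi> w. \<xi> \<in> ball \<zeta> r \<Longrightarrow> w \<in> space M \<Longrightarrow> c * E w \<le> Re (S \<xi> w)"
    using nbhd[OF \<zeta>] by blast
  have \<zeta>D: "\<zeta> \<in> D" using \<zeta> by (simp add: U_def)
  have ballU: "ball \<zeta> r \<subseteq> U" unfolding U_def using cr by blast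
  define k' where "k' m = deriv (\<kappa> m) \<zeta>" for m
  have k': "(\<kappa> m has_field_derivative k' m) (at \<zeta>)" if "m < K" for m
    unfolding k'_def using \<kappa>[OF that] D \<zeta>D by (rule holomorphic_derivI)
  define S' where "S' w = (\<Sum>m<K. k' m * of_real (q m w))" for w
  have S': "((\<lambda>\<xi>. S \<xi> w) has_field_derivative S' w) (at \<zeta>)" for w
    unfolding S_def S'_def by (auto intro!: derivative_eq_intros k')
  have k_lim: "((\<lambda>\<xi>. \<Sum>m<K. norm ((\<kappa> m \<xi> - \<kappa> m \<zeta>) / (\<xi> - \<zeta>))) \<longlongrightarrow> (\<Sum>m<K. norm (k' m))) (at \<zeta>)"
    using k' by (intro tendsto_intros) (simp add: has_field_derivative_iff)
  \<comment> \<open>\<open>B\<close> bounds the summed difference quotients of the coefficients near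
    \<zeta>. Multiplied by \<open>E w * exp (- (c * E w))\<close> it dominates the difference
    quotients of the integrand.\<close>
  define B where "B = (\<Sum>m<K. norm (k' m)) + 1"
  have "\<forall>\<^sub>F \<xi> in at \<zeta>. (\<Sum>m<K. norm ((\<kappa> m \<xi> - \<kappa> m \<zeta>) / (\<xi> - \<zeta>))) < B"
    using k_lim by (rule order_tendstoD(2)) (simp add: B_def)
  moreover have "\<forall>\<^sub>F \<xi> in at \<zeta>. \<xi> \<in> ball \<zeta> r" using cr(2) by (intro eventually_at_in_open') auto
  ultimately have ev: "\<forall>\<^sub>F \<xi> in at \<zeta>. (\<Sum>m<K. norm ((\<kappa> m \<xi> - \<kappa> m \<zeta>) / (\<xi> - \<zeta>))) < B \<and> \<xi> \<in> ball \<zeta> r"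
    by (rule eventually_conj)
  have "((\<lambda>\<xi>. (J \<xi> - J \<zeta>) / (\<xi> - \<zeta>)) \<longlongrightarrow> (\<integral>w. - S' w * exp (- S \<zeta> w) \<partial>M)) (at \<zeta>)"
    unfolding tendsto_at_iff_sequentially
  proof (intro allI impI)
    fix X :: "nat \<Rightarrow> complex" assume X0: "\<forall>i. X i \<in> UNIV - {\<zeta>}" and X: "X \<longlonglongrightarrow> \<zeta>"
    have "filterlim X (at \<zeta>) sequentially"
      using X0 X by (simp add: filterlim_at)
    then have "\<forall>\<^sub>F i in sequentially. (\<Sum>m<K. norm ((\<kappa> m (X i) - \<kappa> m \<zeta>) / (X i - \<zeta>))) < B \<and> X i \<in> ball \<zeta> r"
      using ev by (rule eventually_compose_filterlim[rotated])
    then obtain N where N: "\<And>i. N \<le> i \<Longrightarrow> (\<Sum>m<K. norm ((\<kappa> m (X i) - \<kappa> m \<zeta>) / (X i - \<zeta>))) < B" "\<And>i. N \<le> i \<Longrightarrow> X i \<in> ball \<zeta> r"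
      unfolding eventually_sequentially by auto
    have quot: "(J (X i) - J \<zeta>) / (X i - \<zeta>) = (\<integral>w. (exp (- S (X i) w) - exp (- S \<zeta> w)) / (X i - \<zeta>) \<partial>M)" if "N \<le> i" for i
      using integrable_exp_S[OF \<zeta>] integrable_exp_S[of "X i"] N(2)[OF that] ballU
      by (simp add: J_def Bochner_Integration.integral_diff subset_iff)
    have "(\<lambda>i. \<integral>w. (exp (- S (X (i + N)) w) - exp (- S \<zeta> w)) / (X (i + N) - \<zeta>) \<partial>M) \<longlonglongrightarrow> (\<integral>w. - S' w * exp (- S \<zeta> w) \<partial>M)"
    proof (rule integral_dominated_convergence[where w="\<lambda>w. (2 * B / c) * exp (- (c / 2 * E w))"])
      show "integrable M (\<lambda>w. (2 * B / c) * exp (- (c / 2 * E w)))"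
        using E_int[of "c / 2"] cr(1) by (intro integrable_mult_right) auto
      have [measurable]: "S' \<in> borel_measurable M"
        unfolding S'_def
      proof (rule borel_measurable_sum)
        fix m assume "m \<in> {..<K}"
        then have [measurable]: "q m \<in> borel_measurable M" using q_meas by simp
        show "(\<lambda>w. k' m * complex_of_real (q m w)) \<in> borel_measurable M" by measurable
      qed
      show "(\<lambda>w. - S' w * exp (- S \<zeta> w)) \<in> borel_measurable M" by measurable
      show "(\<lambda>w. (exp (- S (X (i + N)) w) - exp (- S \<zeta> w)) / (X (i + N) - \<zeta>)) \<in> borel_measurable M" for i by measurable
      show "AE w in M. (\<lambda>i. (exp (- S (X (i + N)) w) - exp (- S \<zeta> w)) / (X (i + N) - \<zeta>)) \<longlonglongrightarrow> - S' w * exp (- S \<zeta> w)"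
      proof (rule AE_I2)
        fix w
        have "((\<lambda>\<xi>. exp (- S \<xi> w)) has_field_derivative - S' w * exp (- S \<zeta> w)) (at \<zeta>)"
          by (auto intro!: derivative_eq_intros S')
        then have "((\<lambda>\<xi>. (exp (- S \<xi> w) - exp (- S \<zeta> w)) / (\<xi> - \<zeta>)) \<longlongrightarrow> - S' w * exp (- S \<zeta> w)) (at \<zeta>)"
          by (simp add: has_field_derivative_iff)
        then have "(\<lambda>i. (exp (- S (X i) w) - exp (- S \<zeta> w)) / (X i - \<zeta>)) \<longlonglongrightarrow> - S' w * exp (- S \<zeta> w)"
          using X0 X unfolding tendsto_at_iff_sequentially by (auto simp: o_def)
        then show "(\<lambda>i. (exp (- S (X (i + N)) w) - exp (- S \<zeta> w)) / (X (i + N) - \<zeta>)) \<longlonglongrightarrow> - S' w * exp (- S \<zeta> w)"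
          by (rule LIMSEQ_ignore_initial_segment)
      qed
      show "AE w in M. norm ((exp (- S (X (i + N)) w) - exp (- S \<zeta> w)) / (X (i + N) - \<zeta>)) \<le> (2 * B / c) * exp (- (c / 2 * E w))" for i
      proof (rule AE_I2)
        fix w assume w: "w \<in> space M"
        let ?x = "X (i + N)"
        have xb: "?x \<in> ball \<zeta> r" "\<zeta> \<in> ball \<zeta> r" using N(2)[of "i + N"] cr(2) by auto
        have xz: "norm (?x - \<zeta>) > 0" using X0 by auto
        have "norm (exp (- S ?x w) - exp (- S \<zeta> w)) \<le> exp (- (c * E w)) * norm (S ?x w - S \<zeta> w)"
          by (rule norm_exp_diff_le) (use cr(4) xb w in auto)
        also have "\<dots> \<le> exp (- (c * E w)) * ((\<Sum>m<K. norm (\<kappa> m ?x - \<kappa> m \<zeta>)) * E w)"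
          using S_diff[OF w] by (intro mult_left_mono) auto
        finally have "norm ((exp (- S ?x w) - exp (- S \<zeta> w)) / (?x - \<zeta>)) \<le> exp (- (c * E w)) * ((\<Sum>m<K. norm (\<kappa> m ?x - \<kappa> m \<zeta>)) * E w) / norm (?x - \<zeta>)"
          using xz by (simp add: norm_divide divide_right_mono)
        also have "\<dots> = (\<Sum>m<K. norm ((\<kappa> m ?x - \<kappa> m \<zeta>) / (?x - \<zeta>))) * (E w * exp (- (c * E w)))"
          by (simp add: norm_divide sum_divide_distrib[symmetric])
        also have "\<dots> \<le> B * ((2 / c) * exp (- (c / 2 * E w)))"
        proof (rule mult_mono)
          show "(\<Sum>m<K. norm ((\<kappa> m ?x - \<kappa> m \<zeta>) / (?x - \<zeta>))) \<le> B" using N(1)[of "i + N"] by simp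
          show "0 \<le> B" by (simp add: B_def sum_nonneg add_nonneg_nonneg)
        qed (use E0[OF w] mult_exp_half_le[OF cr(1), of "E w"] in auto)
        finally show "norm ((exp (- S ?x w) - exp (- S \<zeta> w)) / (?x - \<zeta>)) \<le> (2 * B / c) * exp (- (c / 2 * E w))" by (simp add: mult_ac)
      qed
    qed
    then have "(\<lambda>i. (J (X (i + N)) - J \<zeta>) / (X (i + N) - \<zeta>)) \<longlonglongrightarrow> (\<integral>w. - S' w * exp (- S \<zeta> w) \<partial>M)"
      by (simp add: quot)
    then show "((\<lambda>\<xi>. (J \<xi> - J \<zeta>) / (\<xi> - \<zeta>)) \<circ> X) \<longlonglongrightarrow> (\<integral>w. - S' w * exp (- S \<zeta> w) \<partial>M)"
      unfolding o_def by (rule LIMSEQ_offset)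
  qed
  then show ?thesis unfolding has_field_derivative_iff by blast
qed

lemma holomorphic_J: "J holomorphic_on U"
  unfolding holomorphic_on_def field_differentiable_def
  using J_deriv by (blast intro: has_field_derivative_at_within)

end

section \<open>Gaussian integrals and their Fourier transforms\<close>

lemma gaussian_fourier:
  fixes e b :: real assumes e: "e > 0"
  shows "integrable lborel (\<lambda>v. exp (- (of_real (e * v\<^sup>2) + \<i> * of_real (b * v))))"
    and "(\<integral>v. exp (- (of_real (e * v\<^sup>2) + \<i> * of_real (b * v))) \<partial>lborel) = complex_of_real (sqrt (pi / e) * exp (- (b\<^sup>2 / (4 * e))))"
proof -
  \<comment> \<open>Scaling by \<open>s\<close> turns the Gaussian into the standard normal density
    and the integral into its characteristic function at \<open>- b / s\<close>.\<close>
  define s where "s = sqrt (2 * e)"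
  have s: "s > 0" "s\<^sup>2 = 2 * e" using e by (simp_all add: s_def)
  define f where "f v = exp (- (complex_of_real (e * v\<^sup>2) + \<i> * of_real (b * v)))" for v
  have norm_f: "norm (f v) = exp (- (e * v\<^sup>2))" for v by (simp add: f_def)
  define g where "g x = complex_of_real (std_normal_density x) * exp (\<i> * of_real ((- b / s) * x))" for x
  have std: "integrable lborel (\<lambda>x. std_normal_density x)"
    using integrable_std_normal_moment[of 0] by simp
  have [measurable]: "g \<in> borel_measurable borel" unfolding g_def by measurable
  have g_int: "integrable lborel g"
    by (rule Bochner_Integration.integrable_bound[OF std]) (auto simp: g_def norm_mult norm_exp_eq_Re)
  have g_val: "(\<integral>x. g x \<partial>lborel) = complex_of_real (exp (- ((- b / s)\<^sup>2) / 2))"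
  proof -
    have "char std_normal_distribution (- b / s) = (\<integral>x. g x \<partial>lborel)"
      unfolding char_def g_def
      by (subst integral_density) (auto simp: normal_density_nonneg scaleR_conv_of_real)
    then show ?thesis by (simp add: char_std_normal_distribution)
  qed
  have fg: "f v = of_real (sqrt (2 * pi)) * g (0 + s * v)" for v
  proof -
    have "e * v\<^sup>2 = (s * v)\<^sup>2 / 2" by (simp add: power_mult_distrib s)
    then have "f v = exp (of_real (- ((s * v)\<^sup>2 / 2))) * exp (\<i> * of_real ((- b / s) * (s * v)))"
      using s by (simp add: f_def exp_add[symmetric] algebra_simps)
    then have "f v = of_real (exp (- ((s * v)\<^sup>2 / 2))) * exp (\<i> * of_real ((- b / s) * (s * v)))"
      by (simp only: exp_of_real)
    also have "exp (- ((s * v)\<^sup>2 / 2)) = sqrt (2 * pi) * std_normal_density (0 + s * v)"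
      by (simp add: std_normal_density_def)
    finally show ?thesis by (simp only: g_def of_real_mult mult.assoc add_0)
  qed
  have "integrable lborel (\<lambda>v. g (0 + s * v))"
    using lborel_integrable_real_affine[OF g_int, of s 0] s by simp
  then have "integrable lborel f" unfolding fg by (rule integrable_mult_right)
  then show "integrable lborel (\<lambda>v. exp (- (of_real (e * v\<^sup>2) + \<i> * of_real (b * v))))" by (simp only: f_def[abs_def])
  have "(\<integral>x. g x \<partial>lborel) = \<bar>s\<bar> *\<^sub>R (\<integral>v. g (0 + s * v) \<partial>lborel)"
    by (rule lborel_integral_real_affine) (use s in auto)
  then have "(\<integral>v. g (0 + s * v) \<partial>lborel) = of_real (exp (- ((- b / s)\<^sup>2) / 2) / s)"
    using s by (simp add: g_val scaleR_conv_of_real field_simps)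
  then have "(\<integral>v. f v \<partial>lborel) = of_real (sqrt (2 * pi) * (exp (- ((- b / s)\<^sup>2) / 2) / s))"
    unfolding fg by simp
  also have "sqrt (2 * pi) * (exp (- ((- b / s)\<^sup>2) / 2) / s) = sqrt (pi / e) * exp (- (b\<^sup>2 / (4 * e)))"
  proof -
    have "sqrt (2 * pi) / s = sqrt (pi / e)" unfolding s_def by (simp add: real_sqrt_divide[symmetric])
    moreover have "- ((- b / s)\<^sup>2) / 2 = - (b\<^sup>2 / (4 * e))" by (simp add: power_divide s)
    ultimately show ?thesis by (metis times_divide_eq_left times_divide_eq_right mult.commute)
  qed
  finally show "(\<integral>v. exp (- (of_real (e * v\<^sup>2) + \<i> * of_real (b * v))) \<partial>lborel) = complex_of_real (sqrt (pi / e) * exp (- (b\<^sup>2 / (4 * e))))"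
    by (simp add: f_def)
qed

lemma gaussian_real:
  fixes e :: real assumes e: "e > 0"
  shows "integrable lborel (\<lambda>v. exp (- (e * v\<^sup>2)))" "(\<integral>v. exp (- (e * v\<^sup>2)) \<partial>lborel) = sqrt (pi / e)"
proof -
  have "(\<lambda>v. exp (- (complex_of_real (e * v\<^sup>2) + \<i> * of_real (0 * v)))) = (\<lambda>v. complex_of_real (exp (- (e * v\<^sup>2))))"
    by (auto simp: exp_of_real[symmetric])
  with gaussian_fourier[OF e, of 0] show "integrable lborel (\<lambda>v. exp (- (e * v\<^sup>2)))" "(\<integral>v. exp (- (e * v\<^sup>2)) \<partial>lborel) = sqrt (pi / e)"
    by (simp_all add: complex_of_real_integrable_eq del: of_real_exp)
qed

lemma gaussian_Rn:
  assumes e: "e > 0"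
  shows "integrable (Rn_lborel n) (\<lambda>v. exp (- (e * Rn_inner n v v)))"
    and "(\<integral>v. exp (- (e * Rn_inner n v v)) \<partial>Rn_lborel n) = sqrt (pi / e) ^ n"
proof -
  have f: "(\<lambda>v. exp (- (e * Rn_inner n v v))) = (\<lambda>v. \<Prod>i<n. exp (- (e * (v i)\<^sup>2)))"
    by (auto simp: Rn_inner_def exp_sum[symmetric] sum_distrib_left sum_negf power2_eq_square)
  show "integrable (Rn_lborel n) (\<lambda>v. exp (- (e * Rn_inner n v v)))"
    unfolding f Rn_lborel_def by (intro lb.product_integrable_prod gaussian_real e) auto
  show "(\<integral>v. exp (- (e * Rn_inner n v v)) \<partial>Rn_lborel n) = sqrt (pi / e) ^ n"
    unfolding f Rn_lborel_def by (subst lb.product_integral_prod) (auto simp: gaussian_real e)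
qed

lemma gaussian_fourier_Rn:
  assumes e: "e > 0"
  shows "(\<integral>v. exp (- (of_real (e * Rn_inner n v v) + \<i> * of_real (Rn_inner n u v))) \<partial>Rn_lborel n)
    = complex_of_real (sqrt (pi / e) ^ n * exp (- (Rn_inner n u u / (4 * e))))"
proof -
  have f: "(\<lambda>v. exp (- (complex_of_real (e * Rn_inner n v v) + \<i> * of_real (Rn_inner n u v)))) =
    (\<lambda>v. \<Prod>i<n. exp (- (of_real (e * (v i)\<^sup>2) + \<i> * of_real (u i * v i))))"
    by (auto simp: Rn_inner_def exp_sum[symmetric] sum_distrib_left sum_negf sum_subtractf power2_eq_square)
  have "(\<integral>v. exp (- (of_real (e * Rn_inner n v v) + \<i> * of_real (Rn_inner n u v))) \<partial>Rn_lborel n) =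
    (\<Prod>i<n. complex_of_real (sqrt (pi / e) * exp (- ((u i)\<^sup>2 / (4 * e)))))"
    unfolding f Rn_lborel_def
    by (subst lb.product_integral_prod, simp, rule gaussian_fourier(1)[OF e], simp only: gaussian_fourier(2)[OF e])
  also have "\<dots> = complex_of_real (\<Prod>i<n. sqrt (pi / e) * exp (- ((u i)\<^sup>2 / (4 * e))))" by simp
  also have "(\<Prod>i<n. sqrt (pi / e) * exp (- ((u i)\<^sup>2 / (4 * e)))) = sqrt (pi / e) ^ n * exp (- (Rn_inner n u u / (4 * e)))"
    by (simp add: prod.distrib exp_sum[symmetric] sum_negf sum_divide_distrib[symmetric] Rn_inner_def power2_eq_square)
  finally show ?thesis .
qed

section \<open>The complexified gradient map\<close>

lemma continuous_on_comb:
  assumes "continuous_on S f" "continuous_on S g"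
  shows "continuous_on S (\<lambda>x. comb n a (f x) b (g x))"
proof (rule continuous_on_coordinatewise_then_product)
  fix i show "continuous_on S (\<lambda>x. comb n a (f x) b (g x) i)"
    using continuous_on_product_then_coordinatewise[OF assms(1), of i] continuous_on_product_then_coordinatewise[OF assms(2), of i]
    by (cases "i < n") (auto simp: comb_def intro!: continuous_intros)
qed

lemma measurable_continuous_Rn_Rn:
  fixes f :: "(nat \<Rightarrow> real) \<times> (nat \<Rightarrow> real) \<Rightarrow> 'b::topological_space"
  assumes "continuous_on (Rn n \<times> Rn n) f" shows "f \<in> borel_measurable (Rn_lborel n \<Otimes>\<^sub>M Rn_lborel n)"
proof -
  have "(\<lambda>p. (fst p, snd p)) \<in> Rn_lborel n \<Otimes>\<^sub>M Rn_lborel n \<rightarrow>\<^sub>M (borel :: ((nat \<Rightarrow> real) \<times> (nat \<Rightarrow> real)) measure)"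
    by (intro borel_measurable_Pair measurable_compose[OF measurable_fst measurable_Rn_id] measurable_compose[OF measurable_snd measurable_Rn_id])
  then have "(\<lambda>p. p) \<in> Rn_lborel n \<Otimes>\<^sub>M Rn_lborel n \<rightarrow>\<^sub>M (borel :: ((nat \<Rightarrow> real) \<times> (nat \<Rightarrow> real)) measure)"
    by simp
  from measurable_compose[OF measurable_restrict_space2[OF _ this] borel_measurable_continuous_on_restrict[OF assms]]
  show ?thesis by (auto simp: space_pair_measure)
qed

interpretation RR: pair_sigma_finite "Rn_lborel n" "Rn_lborel n" for n
  by (intro pair_sigma_finite.intro Rn.sigma_finite_measure_axioms)

lemma inner_abs_le: "\<bar>Rn_inner n x y\<bar> \<le> (Rn_inner n x x + Rn_inner n y y) / 2"
proof -
  have "0 \<le> Rn_inner n (comb n 1 x 1 y) (comb n 1 x 1 y)" "0 \<le> Rn_inner n (comb n 1 x (-1) y) (comb n 1 x (-1) y)"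
    by (rule Rn_inner_nonneg)+
  then show ?thesis
    by (simp add: Rn_inner_comb Rn_inner_comb' Rn_inner_commute[of n y x] abs_le_iff)
qed

lemma pos_form_add:
  assumes "pos_form n d M" "pos_form n d N" "d > 0" shows "pos_form n d (\<lambda>i j. M i j + N i j)"
  unfolding pos_form_def
proof
  fix h :: "nat \<Rightarrow> real"
  have "d * (\<Sum>i<n. (h i)\<^sup>2) \<le> (\<Sum>i<n. \<Sum>j<n. M i j * h i * h j)" "d * (\<Sum>i<n. (h i)\<^sup>2) \<le> (\<Sum>i<n. \<Sum>j<n. N i j * h i * h j)"
    using assms by (auto simp: pos_form_def)
  moreover have "0 \<le> d * (\<Sum>i<n. (h i)\<^sup>2)" using assms(3) by (intro mult_nonneg_nonneg sum_nonneg) auto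
  ultimately show "d * (\<Sum>i<n. (h i)\<^sup>2) \<le> (\<Sum>i<n. \<Sum>j<n. (M i j + N i j) * h i * h j)"
    by (simp add: algebra_simps sum.distrib)
qed

lemma le_of_le_average: "a \<le> (a + b) / 2 \<Longrightarrow> a \<le> (b :: real)"
  by simp

text \<open>Models the gradient \<open>V\<close> of a strongly convex potential with bounded
  Hessian: \<open>Q x y\<close> is a matrix of slopes between \<open>x\<close> and \<open>y\<close>,
  \<open>d\<close> makes \<open>V\<close> strongly monotone, and \<open>L\<close> makes it
  Lipschitz.\<close>

locale monotone_field =
  fixes n :: nat and V :: "(nat \<Rightarrow> real) \<Rightarrow> nat \<Rightarrow> real"
    and Q :: "(nat \<Rightarrow> real) \<Rightarrow> (nat \<Rightarrow> real) \<Rightarrow> nat \<Rightarrow> nat \<Rightarrow> real" and d L :: real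
  assumes d: "d > 0"
    and V_cont: "\<And>i. i < n \<Longrightarrow> continuous_on (Rn n) (\<lambda>x. V x i)"
    and Q_cont: "\<And>i j. i < n \<Longrightarrow> j < n \<Longrightarrow> continuous_on (Rn n \<times> Rn n) (\<lambda>p. Q (fst p) (snd p) i j)"
    and slope: "\<And>x y i. x \<in> Rn n \<Longrightarrow> y \<in> Rn n \<Longrightarrow> i < n \<Longrightarrow> V x i - V y i = (\<Sum>j<n. Q x y i j * (x j - y j))"
    and pos: "\<And>x y. x \<in> Rn n \<Longrightarrow> y \<in> Rn n \<Longrightarrow> pos_form n d (Q x y)"
    and Q_bound: "\<And>x y i j. x \<in> Rn n \<Longrightarrow> y \<in> Rn n \<Longrightarrow> i < n \<Longrightarrow> j < n \<Longrightarrow> \<bar>Q x y i j\<bar> \<le> L"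
    and V_zero: "\<And>i. i < n \<Longrightarrow> V (Rn_zero n) i = 0"
begin

text \<open>As \<open>Q x x\<close> is the derivative of \<open>V\<close> at \<open>x\<close>, this
  is the determinant of V'(x) + V'(x').\<close>

definition D :: "(nat \<Rightarrow> real) \<times> (nat \<Rightarrow> real) \<Rightarrow> real" where
  "D p = pivots n (\<lambda>i j. Q (fst p) (fst p) i j + Q (snd p) (snd p) i j)"

definition \<mu> :: "((nat \<Rightarrow> real) \<times> (nat \<Rightarrow> real)) measure" where
  "\<mu> = density (Rn_lborel n \<Otimes>\<^sub>M Rn_lborel n) (\<lambda>p. ennreal (D p))"

definition F :: "real \<Rightarrow> (nat \<Rightarrow> real) \<times> (nat \<Rightarrow> real) \<Rightarrow> (nat \<Rightarrow> real) \<times> (nat \<Rightarrow> real)" where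
  "F t p = (comb n 1 (fst p) (- t) (snd p), comb n 1 (V (fst p)) t (V (snd p)))"

lemma Vc: "continuous_on S f \<Longrightarrow> f ` S \<subseteq> Rn n \<Longrightarrow> i < n \<Longrightarrow> continuous_on S (\<lambda>p. V (f p) i)"
  by (rule continuous_on_compose2[OF V_cont])

lemma Qc: "continuous_on S f \<Longrightarrow> continuous_on S g \<Longrightarrow> f ` S \<subseteq> Rn n \<Longrightarrow> g ` S \<subseteq> Rn n \<Longrightarrow> i < n \<Longrightarrow> j < n \<Longrightarrow>
    continuous_on S (\<lambda>p. Q (f p) (g p) i j)"
  using continuous_on_compose2[OF Q_cont continuous_on_Pair, of i j S f g] by auto

lemma D_meas [measurable]: "D \<in> borel_measurable (Rn_lborel n \<Otimes>\<^sub>M Rn_lborel n)"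
  unfolding D_def[abs_def]
proof (rule measurable_continuous_Rn_Rn, rule pivots_continuous[OF _ _ d])
  show "continuous_on (Rn n \<times> Rn n) (\<lambda>p. Q (fst p) (fst p) i j + Q (snd p) (snd p) i j)" if "i < n" "j < n" for i j
    using that by (intro continuous_intros Qc) auto
  show "pos_form n d (\<lambda>i j. Q (fst p) (fst p) i j + Q (snd p) (snd p) i j)" if "p \<in> Rn n \<times> Rn n" for p
    using that d by (intro pos_form_add pos) auto
qed

lemma V_meas: "i < n \<Longrightarrow> (\<lambda>x. V x i) \<in> borel_measurable (Rn_lborel n)"
  by (intro measurable_continuous_Rn V_cont)

lemma sets_\<mu> [measurable_cong]: "sets \<mu> = sets (Rn_lborel n \<Otimes>\<^sub>M Rn_lborel n)"
  by (simp add: \<mu>_def)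

lemma space_\<mu>: "space \<mu> = Rn n \<times> Rn n"
  by (simp add: \<mu>_def space_pair_measure)

lemma F_meas [measurable]: "F t \<in> Rn_lborel n \<Otimes>\<^sub>M Rn_lborel n \<rightarrow>\<^sub>M Rn_lborel n \<Otimes>\<^sub>M Rn_lborel n"
  unfolding F_def[abs_def]
proof (rule measurable_Pair)
  show "(\<lambda>p. comb n 1 (V (fst p)) t (V (snd p))) \<in> Rn_lborel n \<Otimes>\<^sub>M Rn_lborel n \<rightarrow>\<^sub>M Rn_lborel n"
  proof (rule measurable_into_Rn)
    fix i assume i: "i < n"
    note [measurable] = measurable_compose[OF measurable_fst V_meas[OF i]] measurable_compose[OF measurable_snd V_meas[OF i]]
    show "(\<lambda>p. comb n 1 (V (fst p)) t (V (snd p)) i) \<in> borel_measurable (Rn_lborel n \<Otimes>\<^sub>M Rn_lborel n)"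
      using i by simp
  qed simp
qed measurable

text \<open>The key observation: the Jacobian of \<open>F t\<close> is \<open>t^n D\<close> for every \<open>t > 0\<close>, so \<open>\<mu>\<close> is, up to the
  factor \<open>t^n\<close>, the pullback of Lebesgue measure under all the maps \<open>F t\<close> at once.\<close>

lemma nn_integral_F:
  assumes t: "t > 0" and G[measurable]: "G \<in> borel_measurable (Rn_lborel n \<Otimes>\<^sub>M Rn_lborel n)"
  shows "(\<integral>\<^sup>+p. G (F t p) \<partial>\<mu>) = ennreal ((1 / t) ^ n) * (\<integral>\<^sup>+p. G p \<partial>(Rn_lborel n \<Otimes>\<^sub>M Rn_lborel n))"
proof -
  let ?N = "Rn_lborel n"
  \<comment> \<open>\<open>Y x u\<close> solves u = x - t x' for x'. At fixed \<open>u\<close>, the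
    factor \<open>t\<close> before \<open>V\<close> cancels the factor \<open>1 / t\<close> in
    \<open>Y\<close>, so the map sending \<open>x\<close> to \<open>V x + t * V (Y x u)\<close> has
    slopes \<open>Q x y + Q (Y x u) (Y y u)\<close>. The power of \<open>1 / t\<close> is the
    Jacobian of replacing x' by \<open>u\<close>.\<close>
  define Y where "Y x u = comb n (1 / t) x (- 1 / t) u" for x u
  have Y_in[simp]: "Y x u \<in> Rn n" for x u by (simp add: Y_def)
  define h where "h x y = ennreal (D (x, y)) * G (F t (x, y))" for x y
  have hm: "(\<lambda>p. h (fst p) (snd p)) \<in> borel_measurable (?N \<Otimes>\<^sub>M ?N)"
    unfolding h_def by simp
  have hm1: "h x \<in> borel_measurable ?N" if "x \<in> Rn n" for x
    using measurable_compose[OF measurable_Pair1'[of x ?N ?N] hm] that by simp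
  have Ym: "(\<lambda>p. (fst p, Y (fst p) (snd p))) \<in> ?N \<Otimes>\<^sub>M ?N \<rightarrow>\<^sub>M ?N \<Otimes>\<^sub>M ?N"
    unfolding Y_def by measurable
  have hY: "(\<lambda>p. h (fst p) (Y (fst p) (snd p))) \<in> borel_measurable (?N \<Otimes>\<^sub>M ?N)"
    using measurable_compose[OF Ym hm] by simp
  have inner: "(\<integral>\<^sup>+x. h x (Y x u) \<partial>?N) = (\<integral>\<^sup>+v. G (u, v) \<partial>?N)" if u: "u \<in> Rn n" for u
  proof -
    have Yc: "continuous_on (Rn n) (\<lambda>x. Y x u)"
      unfolding Y_def by (intro continuous_on_comb continuous_intros)
    have Yc1: "continuous_on (Rn n \<times> Rn n) (\<lambda>p. Y (fst p) u)" "continuous_on (Rn n \<times> Rn n) (\<lambda>p. Y (snd p) u)"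
      unfolding Y_def by (intro continuous_on_comb continuous_intros)+
    have "(\<integral>\<^sup>+x. (\<lambda>v. G (u, v)) (\<lambda>i\<in>{..<n}. V x i + t * V (Y x u) i) * ennreal (pivots n (\<lambda>i j. Q x x i j + Q (Y x u) (Y x u) i j)) \<partial>?N)
        = (\<integral>\<^sup>+v. G (u, v) \<partial>?N)"
    proof (rule nn_integral_monotone_map[OF d, where Q="\<lambda>x y i j. Q x y i j + Q (Y x u) (Y y u) i j" and V="\<lambda>x i. V x i + t * V (Y x u) i"])
      show "continuous_on (Rn n) (\<lambda>x. V x i + t * V (Y x u) i)" if "i < n" for i
        using that by (intro continuous_intros Vc Yc) auto
      show "continuous_on (Rn n \<times> Rn n) (\<lambda>p. Q (fst p) (snd p) i j + Q (Y (fst p) u) (Y (snd p) u) i j)" if "i < n" "j < n" for i j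
        using that by (intro continuous_intros Qc Yc1) auto
      show "V x i + t * V (Y x u) i - (V y i + t * V (Y y u) i) = (\<Sum>j<n. (Q x y i j + Q (Y x u) (Y y u) i j) * (x j - y j))"
        if x: "x \<in> Rn n" and y: "y \<in> Rn n" and i: "i < n" for x y i
      proof -
        have "t * (V (Y x u) i - V (Y y u) i) = t * (\<Sum>j<n. Q (Y x u) (Y y u) i j * (Y x u j - Y y u j))"
          using i by (subst slope) auto
        also have "\<dots> = (\<Sum>j<n. Q (Y x u) (Y y u) i j * (x j - y j))"
          unfolding sum_distrib_left using t by (intro sum.cong refl) (simp add: Y_def field_simps)
        finally have e: "t * (V (Y x u) i - V (Y y u) i) = (\<Sum>j<n. Q (Y x u) (Y y u) i j * (x j - y j))" .
        have "(\<Sum>j<n. (Q x y i j + Q (Y x u) (Y y u) i j) * (x j - y j)) = (V x i - V y i) + t * (V (Y x u) i - V (Y y u) i)"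
          unfolding e slope[OF x y i] by (simp only: distrib_right sum.distrib)
        then show ?thesis by (simp add: right_diff_distrib)
      qed
      show "pos_form n d (\<lambda>i j. Q x y i j + Q (Y x u) (Y y u) i j)" if "x \<in> Rn n" "y \<in> Rn n" for x y
        using that d by (intro pos_form_add pos) auto
      show "(\<lambda>v. G (u, v)) \<in> borel_measurable ?N"
        using measurable_compose[OF measurable_Pair1'[of u ?N ?N] G] u by simp
    qed
    moreover have hx: "h x (Y x u) = (\<lambda>v. G (u, v)) (\<lambda>i\<in>{..<n}. V x i + t * V (Y x u) i) * ennreal (pivots n (\<lambda>i j. Q x x i j + Q (Y x u) (Y x u) i j))"
      if "x \<in> Rn n" for x
    proof -
      have "comb n 1 x (- t) (Y x u) = u"
        using u t by (intro Rn_ext[of _ n]) (auto simp: Y_def field_simps)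
      moreover have "comb n 1 (V x) t (V (Y x u)) = (\<lambda>i\<in>{..<n}. V x i + t * V (Y x u) i)" by (simp add: comb_def)
      ultimately show ?thesis by (simp add: h_def F_def D_def mult.commute)
    qed
    moreover have "(\<integral>\<^sup>+x. h x (Y x u) \<partial>?N) = (\<integral>\<^sup>+x. (\<lambda>v. G (u, v)) (\<lambda>i\<in>{..<n}. V x i + t * V (Y x u) i) * ennreal (pivots n (\<lambda>i j. Q x x i j + Q (Y x u) (Y x u) i j)) \<partial>?N)"
      by (intro nn_integral_cong hx) simp
    ultimately show ?thesis by simp
  qed
  have "(\<integral>\<^sup>+p. G (F t p) \<partial>\<mu>) = (\<integral>\<^sup>+p. h (fst p) (snd p) \<partial>(?N \<Otimes>\<^sub>M ?N))"
    unfolding \<mu>_def h_def by (subst nn_integral_density) auto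
  also have "\<dots> = (\<integral>\<^sup>+x. (\<integral>\<^sup>+y. h x y \<partial>?N) \<partial>?N)"
    using Rn.nn_integral_fst[OF hm] by simp
  also have "\<dots> = (\<integral>\<^sup>+x. ennreal ((1 / t) ^ n) * (\<integral>\<^sup>+u. h x (Y x u) \<partial>?N) \<partial>?N)"
  proof (rule nn_integral_cong)
    fix x assume "x \<in> space ?N"
    then have x: "x \<in> Rn n" by simp
    have "comb n 1 (\<lambda>i. x i / t) (- 1 / t) u = Y x u" for u
      by (auto simp: Y_def comb_def)
    then show "(\<integral>\<^sup>+y. h x y \<partial>?N) = ennreal ((1 / t) ^ n) * (\<integral>\<^sup>+u. h x (Y x u) \<partial>?N)"
      using nn_integral_affine[OF hm1[OF x], of "- 1 / t" "\<lambda>i. x i / t"] t by (simp add: power_divide)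
  qed
  also have "\<dots> = ennreal ((1 / t) ^ n) * (\<integral>\<^sup>+x. (\<integral>\<^sup>+u. h x (Y x u) \<partial>?N) \<partial>?N)"
    by (rule nn_integral_cmult) (use hY in \<open>auto intro!: Rn.borel_measurable_nn_integral simp: case_prod_beta'\<close>)
  also have "(\<integral>\<^sup>+x. (\<integral>\<^sup>+u. h x (Y x u) \<partial>?N) \<partial>?N) = (\<integral>\<^sup>+u. (\<integral>\<^sup>+x. h x (Y x u) \<partial>?N) \<partial>?N)"
    by (rule RR.Fubini'[symmetric], unfold case_prod_beta', rule hY)
  also have "\<dots> = (\<integral>\<^sup>+u. (\<integral>\<^sup>+v. G (u, v) \<partial>?N) \<partial>?N)"
    by (intro nn_integral_cong inner) simp
  also have "\<dots> = (\<integral>\<^sup>+p. G p \<partial>(?N \<Otimes>\<^sub>M ?N))"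
    by (rule Rn.nn_integral_fst[OF G])
  finally show ?thesis .
qed

lemma distr_F:
  assumes t: "t > 0"
  shows "distr \<mu> (Rn_lborel n \<Otimes>\<^sub>M Rn_lborel n) (F t) = density (Rn_lborel n \<Otimes>\<^sub>M Rn_lborel n) (\<lambda>_. ennreal ((1 / t) ^ n))"
proof (rule measure_eqI)
  fix A assume "A \<in> sets (distr \<mu> (Rn_lborel n \<Otimes>\<^sub>M Rn_lborel n) (F t))"
  then have A[measurable]: "A \<in> sets (Rn_lborel n \<Otimes>\<^sub>M Rn_lborel n)" by simp
  have [measurable]: "F t \<in> \<mu> \<rightarrow>\<^sub>M Rn_lborel n \<Otimes>\<^sub>M Rn_lborel n" by measurable
  have "emeasure (distr \<mu> (Rn_lborel n \<Otimes>\<^sub>M Rn_lborel n) (F t)) A = (\<integral>\<^sup>+x. indicator A x \<partial>distr \<mu> (Rn_lborel n \<Otimes>\<^sub>M Rn_lborel n) (F t))"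
    by simp
  also have "\<dots> = (\<integral>\<^sup>+p. indicator A (F t p) \<partial>\<mu>)"
    by (rule nn_integral_distr) simp_all
  also have "\<dots> = ennreal ((1 / t) ^ n) * (\<integral>\<^sup>+p. indicator A p \<partial>(Rn_lborel n \<Otimes>\<^sub>M Rn_lborel n))"
    by (rule nn_integral_F[OF t]) measurable
  also have "\<dots> = emeasure (density (Rn_lborel n \<Otimes>\<^sub>M Rn_lborel n) (\<lambda>_. ennreal ((1 / t) ^ n))) A"
    by (simp add: emeasure_density nn_integral_cmult)
  finally show "emeasure (distr \<mu> (Rn_lborel n \<Otimes>\<^sub>M Rn_lborel n) (F t)) A = emeasure (density (Rn_lborel n \<Otimes>\<^sub>M Rn_lborel n) (\<lambda>_. ennreal ((1 / t) ^ n))) A" .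
qed simp

lemma inner_V_ge:
  assumes x: "x \<in> Rn n" shows "d * Rn_inner n x x \<le> Rn_inner n x (V x)"
proof -
  have "V x i = (\<Sum>j<n. Q x (Rn_zero n) i j * x j)" if "i < n" for i
    using slope[OF x Rn_zero_in that] V_zero[OF that] by simp
  then have "Rn_inner n x (V x) = (\<Sum>i<n. \<Sum>j<n. Q x (Rn_zero n) i j * x i * x j)"
    by (simp add: Rn_inner_def sum_distrib_left mult_ac)
  also have "\<dots> \<ge> d * (\<Sum>i<n. (x i)\<^sup>2)"
    using pos[OF x Rn_zero_in] by (simp add: pos_form_def)
  finally show ?thesis by (simp add: Rn_inner_def power2_eq_square)
qed

lemma inner_V_V_le:
  assumes x: "x \<in> Rn n" shows "Rn_inner n (V x) (V x) \<le> (real n * L)\<^sup>2 * Rn_inner n x x"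
proof -
  have "(V x i)\<^sup>2 \<le> L\<^sup>2 * (real n * Rn_inner n x x)" if i: "i < n" for i
  proof -
    have "\<bar>V x i\<bar> = \<bar>\<Sum>j<n. Q x (Rn_zero n) i j * x j\<bar>"
      using slope[OF x Rn_zero_in i] V_zero[OF i] by simp
    also have "\<dots> \<le> (\<Sum>j<n. \<bar>Q x (Rn_zero n) i j * x j\<bar>)" by (rule sum_abs)
    also have "\<dots> \<le> (\<Sum>j<n. L * \<bar>x j\<bar>)"
      using Q_bound[OF x Rn_zero_in i] by (intro sum_mono) (auto simp: abs_mult intro: mult_right_mono)
    finally have "\<bar>V x i\<bar> \<le> L * (\<Sum>j<n. \<bar>x j\<bar> * 1)" by (simp add: sum_distrib_left)
    then have "(\<bar>V x i\<bar>)\<^sup>2 \<le> (L * (\<Sum>j<n. \<bar>x j\<bar> * 1))\<^sup>2" by (rule power_mono) simp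
    also have "\<dots> = L\<^sup>2 * (\<Sum>j<n. \<bar>x j\<bar> * 1)\<^sup>2" by (simp add: power_mult_distrib)
    also have "\<dots> \<le> L\<^sup>2 * ((\<Sum>j<n. \<bar>x j\<bar>\<^sup>2) * (\<Sum>j<n. 1\<^sup>2))"
      by (intro mult_left_mono Cauchy_Schwarz_ineq_sum) simp
    finally show ?thesis by (simp add: Rn_inner_def power2_eq_square mult.commute)
  qed
  then have "(\<Sum>i<n. (V x i)\<^sup>2) \<le> (\<Sum>i<n. L\<^sup>2 * (real n * Rn_inner n x x))" by (intro sum_mono) auto
  then show ?thesis by (simp add: Rn_inner_def power2_eq_square mult_ac)
qed

text \<open>The Lipschitz bound gives |x|^2 + |V x|^2 \<le> (1 + (nL)^2) |x|^2, and strong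
  monotonicity bounds d |x|^2 by the pairing of x with V x. The quotient \<open>c\<close> combines
  the two estimates.\<close>

definition c :: real where "c = d / (1 + (real n * L)\<^sup>2)"

lemma c_pos: "c > 0"
  using d unfolding c_def by (intro divide_pos_pos) (auto intro: add_pos_nonneg)

lemma inner_V_ge_c:
  assumes x: "x \<in> Rn n" shows "c * (Rn_inner n x x + Rn_inner n (V x) (V x)) \<le> Rn_inner n x (V x)"
proof -
  have p: "1 + (real n * L)\<^sup>2 > 0" by (auto intro: add_pos_nonneg)
  have "c * (Rn_inner n x x + Rn_inner n (V x) (V x)) \<le> c * ((1 + (real n * L)\<^sup>2) * Rn_inner n x x)"
    using inner_V_V_le[OF x] c_pos by (intro mult_left_mono) (auto simp: algebra_simps)
  also have "\<dots> = d * Rn_inner n x x" using p by (simp add: c_def)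
  also have "\<dots> \<le> Rn_inner n x (V x)" by (rule inner_V_ge[OF x])
  finally show ?thesis .
qed

definition E1 :: "(nat \<Rightarrow> real) \<Rightarrow> real" where "E1 x = Rn_inner n x x + Rn_inner n (V x) (V x)"
definition E :: "(nat \<Rightarrow> real) \<times> (nat \<Rightarrow> real) \<Rightarrow> real" where "E p = E1 (fst p) + E1 (snd p)"
text \<open>\<open>R\<close> is the coefficient of \<open>t\<close> in the pairing of the two
  components of \<open>F t p\<close>, and \<open>2 * T p\<close> the one in their squared norm; both
  are controlled by \<open>E\<close>.\<close>

definition R :: "(nat \<Rightarrow> real) \<times> (nat \<Rightarrow> real) \<Rightarrow> real" where
  "R p = Rn_inner n (fst p) (V (snd p)) - Rn_inner n (snd p) (V (fst p))"
definition T :: "(nat \<Rightarrow> real) \<times> (nat \<Rightarrow> real) \<Rightarrow> real" where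
  "T p = Rn_inner n (V (fst p)) (V (snd p)) - Rn_inner n (fst p) (snd p)"

lemma E1_nonneg: "0 \<le> E1 x" by (simp add: E1_def)
lemma E_nonneg: "0 \<le> E p" by (simp add: E_def E1_nonneg)

lemma T_le: "\<bar>T p\<bar> \<le> E p / 2"
  using order_trans[OF abs_triangle_ineq4 add_mono[OF inner_abs_le[of n "V (fst p)" "V (snd p)"] inner_abs_le[of n "fst p" "snd p"]]]
  unfolding T_def E_def E1_def by (simp add: add_divide_distrib)

lemma R_le: "\<bar>R p\<bar> \<le> E p / 2"
  using order_trans[OF abs_triangle_ineq4 add_mono[OF inner_abs_le[of n "fst p" "V (snd p)"] inner_abs_le[of n "snd p" "V (fst p)"]]]
  unfolding R_def E_def E1_def by (simp add: add_divide_distrib)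

lemma P_le: "\<bar>Rn_inner n x (V x)\<bar> \<le> E1 x / 2"
  using inner_abs_le[of n x "V x"] by (simp add: E1_def)

lemma norm_F:
  "Rn_inner n (fst (F t p)) (fst (F t p)) + Rn_inner n (snd (F t p)) (snd (F t p)) = E1 (fst p) + t\<^sup>2 * E1 (snd p) + 2 * t * T p"
  by (simp add: F_def E1_def T_def Rn_inner_comb Rn_inner_comb' Rn_inner_commute[of n "snd p" "fst p"]
      Rn_inner_commute[of n "V (snd p)" "V (fst p)"] power2_eq_square algebra_simps)

lemma inner_F:
  "Rn_inner n (fst (F t p)) (snd (F t p)) = Rn_inner n (fst p) (V (fst p)) - t\<^sup>2 * Rn_inner n (snd p) (V (snd p)) + t * R p"
  by (simp add: F_def R_def Rn_inner_comb Rn_inner_comb' power2_eq_square algebra_simps)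

lemma norm_F_nonneg: "0 \<le> E1 (fst p) + t\<^sup>2 * E1 (snd p) + 2 * t * T p"
  unfolding norm_F[symmetric] by (intro add_nonneg_nonneg Rn_inner_nonneg)

text \<open>The sum of the pairings of x with V x and of y with V y equals the pairing of x with V x
  + V y minus that of x - y with V y. So \<open>c * E p\<close> is bounded by pairings with the
  components of \<open>F 1 p\<close>, and Young's inequality absorbs the other factors. This gives
  Gaussian decay of the regularizing term at t = 1.\<close>

lemma norm_F_one:
  assumes "p \<in> Rn n \<times> Rn n" shows "c\<^sup>2 * E p \<le> E1 (fst p) + E1 (snd p) + 2 * T p"
proof -
  obtain x y where p: "p = (x, y)" and x: "x \<in> Rn n" and y: "y \<in> Rn n" using assms by auto
  let ?u = "comb n 1 x (-1) y" and ?v = "comb n 1 (V x) 1 (V y)"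
  define W where "W = Rn_inner n ?u ?u + Rn_inner n ?v ?v"
  have W: "W = E1 x + E1 y + 2 * T p" using norm_F[of 1 p] by (simp add: W_def F_def p)
  have "c * E p \<le> Rn_inner n x (V x) + Rn_inner n y (V y)"
    using inner_V_ge_c[OF x] inner_V_ge_c[OF y] by (simp add: E_def E1_def p distrib_left)
  also have "\<dots> = Rn_inner n x ?v - Rn_inner n ?u (V y)"
    by (simp add: Rn_inner_comb Rn_inner_comb')
  also have "\<dots> \<le> (c * E p + W / c) / 2"
  proof -
    have ip: "Rn_inner n a b \<le> (c * Rn_inner n a a + Rn_inner n b b / c) / 2" for a b
    proof -
      have "0 \<le> Rn_inner n (comb n c a (-1) b) (comb n c a (-1) b)" by (rule Rn_inner_nonneg)
      then have "2 * c * Rn_inner n a b \<le> c * (c * Rn_inner n a a) + Rn_inner n b b"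
        by (simp add: Rn_inner_comb Rn_inner_comb' Rn_inner_commute[of n b a] algebra_simps)
      then show ?thesis using c_pos by (simp add: field_simps)
    qed
    have "Rn_inner n x ?v \<le> (c * Rn_inner n x x + Rn_inner n ?v ?v / c) / 2" by (rule ip)
    moreover have "- Rn_inner n ?u (V y) \<le> (c * Rn_inner n (V y) (V y) + Rn_inner n ?u ?u / c) / 2"
    proof -
      have "- Rn_inner n ?u (V y) = Rn_inner n (V y) (comb n (-1) ?u 0 ?u)" by (subst Rn_inner_comb') (simp add: Rn_inner_commute[of n "V y" ?u])
      moreover have "Rn_inner n (comb n (-1) ?u 0 ?u) (comb n (-1) ?u 0 ?u) = Rn_inner n ?u ?u"
        by (simp add: Rn_inner_comb[of n "-1" ?u] Rn_inner_comb'[of n _ "-1" ?u])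
      ultimately show ?thesis using ip[of "V y" "comb n (-1) ?u 0 ?u"] by simp
    qed
    moreover have "c * (Rn_inner n x x + Rn_inner n (V y) (V y)) \<le> c * E p"
      using c_pos by (intro mult_left_mono) (auto simp: E_def E1_def p)
    moreover have "W / c = Rn_inner n ?u ?u / c + Rn_inner n ?v ?v / c" by (simp add: W_def add_divide_distrib)
    ultimately show ?thesis by (simp add: distrib_left)
  qed
  finally have "c * E p \<le> W / c" by (rule le_of_le_average)
  then show ?thesis using c_pos by (simp add: W p field_simps power2_eq_square)
qed

lemma P_meas: "(\<lambda>x. Rn_inner n x (V x)) \<in> borel_measurable (Rn_lborel n)"
  unfolding Rn_inner_def by (intro borel_measurable_sum borel_measurable_times measurable_coord V_meas) auto

lemma E1_meas [measurable]: "E1 \<in> borel_measurable (Rn_lborel n)"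
  unfolding E1_def[abs_def] Rn_inner_def
  by (intro borel_measurable_add borel_measurable_sum borel_measurable_times measurable_coord V_meas) auto

lemma E_meas [measurable]: "E \<in> borel_measurable (Rn_lborel n \<Otimes>\<^sub>M Rn_lborel n)"
  unfolding E_def[abs_def] by measurable

lemma pair_inner_meas:
  assumes "\<And>i. i < n \<Longrightarrow> (\<lambda>x. f x i) \<in> borel_measurable (Rn_lborel n)" "\<And>i. i < n \<Longrightarrow> (\<lambda>x. g x i) \<in> borel_measurable (Rn_lborel n)"
  shows "(\<lambda>p. Rn_inner n (f (fst p)) (g (snd p))) \<in> borel_measurable (Rn_lborel n \<Otimes>\<^sub>M Rn_lborel n)"
  unfolding Rn_inner_def
  by (intro borel_measurable_sum borel_measurable_times measurable_compose[OF measurable_fst assms(1)] measurable_compose[OF measurable_snd assms(2)]) auto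

lemma R_meas [measurable]: "R \<in> borel_measurable (Rn_lborel n \<Otimes>\<^sub>M Rn_lborel n)"
  unfolding R_def[abs_def]
  using pair_inner_meas[of "\<lambda>x. x" V] pair_inner_meas[of V "\<lambda>x. x"]
  by (intro borel_measurable_diff) (auto simp: V_meas measurable_coord Rn_inner_commute[of n "snd _"])

lemma T_meas [measurable]: "T \<in> borel_measurable (Rn_lborel n \<Otimes>\<^sub>M Rn_lborel n)"
  unfolding T_def[abs_def]
  using pair_inner_meas[of V V] pair_inner_meas[of "\<lambda>x. x" "\<lambda>x. x"]
  by (intro borel_measurable_diff) (auto simp: V_meas measurable_coord)

lemma nn_integral_gaussian_pair:
  assumes e: "e > 0"
  shows "(\<integral>\<^sup>+p. ennreal (exp (- (e * (Rn_inner n (fst p) (fst p) + Rn_inner n (snd p) (snd p))))) \<partial>(Rn_lborel n \<Otimes>\<^sub>M Rn_lborel n)) < \<infinity>"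
proof -
  let ?g = "\<lambda>v. ennreal (exp (- (e * Rn_inner n v v)))"
  have [measurable]: "(\<lambda>v. Rn_inner n v v) \<in> borel_measurable (Rn_lborel n)"
    unfolding Rn_inner_def by (intro borel_measurable_sum borel_measurable_times measurable_coord) auto
  have g: "(\<integral>\<^sup>+v. ?g v \<partial>Rn_lborel n) = ennreal (sqrt (pi / e) ^ n)"
    using gaussian_Rn[OF e, of n] by (subst nn_integral_eq_integral) auto
  have "(\<integral>\<^sup>+p. ennreal (exp (- (e * (Rn_inner n (fst p) (fst p) + Rn_inner n (snd p) (snd p))))) \<partial>(Rn_lborel n \<Otimes>\<^sub>M Rn_lborel n))
    = (\<integral>\<^sup>+p. ?g (fst p) * ?g (snd p) \<partial>(Rn_lborel n \<Otimes>\<^sub>M Rn_lborel n))"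
    by (intro nn_integral_cong) (simp add: ennreal_mult[symmetric] exp_add[symmetric] distrib_left)
  also have "\<dots> = (\<integral>\<^sup>+u. (\<integral>\<^sup>+v. ?g u * ?g v \<partial>Rn_lborel n) \<partial>Rn_lborel n)"
    by (subst Rn.nn_integral_fst[symmetric]) auto
  also have "\<dots> = ennreal (sqrt (pi / e) ^ n) * ennreal (sqrt (pi / e) ^ n)"
    by (simp add: nn_integral_cmult nn_integral_multc g)
  also have "\<dots> < \<infinity>" by (simp add: ennreal_mult_less_top)
  finally show ?thesis .
qed

text \<open>The squared norm of \<open>F 1 p\<close> is at most \<open>2 * E p\<close>, so the
  integrand is dominated by a Gaussian composed with \<open>F 1\<close>, whose \<mu>-integral is
  known from \<open>nn_integral_F\<close>.\<close>

lemma exp_E_integrable: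
  assumes k: "k > 0" shows "integrable \<mu> (\<lambda>p. exp (- (k * E p)))"
proof (rule integrableI_nonneg)
  show "(\<lambda>p. exp (- (k * E p))) \<in> borel_measurable \<mu>" by measurable
  let ?G = "\<lambda>p. ennreal (exp (- (k / 2 * (Rn_inner n (fst p) (fst p) + Rn_inner n (snd p) (snd p)))))"
  have [measurable]: "(\<lambda>v. Rn_inner n v v) \<in> borel_measurable (Rn_lborel n)"
    unfolding Rn_inner_def by (intro borel_measurable_sum borel_measurable_times measurable_coord) auto
  have "(\<integral>\<^sup>+p. ennreal (exp (- (k * E p))) \<partial>\<mu>) \<le> (\<integral>\<^sup>+p. ?G (F 1 p) \<partial>\<mu>)"
  proof (intro nn_integral_mono ennreal_leI)
    fix p
    have "E1 (fst p) + 1\<^sup>2 * E1 (snd p) + 2 * 1 * T p \<le> 2 * E p"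
      using T_le[of p] by (simp add: E_def abs_le_iff)
    then have "k / 2 * (Rn_inner n (fst (F 1 p)) (fst (F 1 p)) + Rn_inner n (snd (F 1 p)) (snd (F 1 p))) \<le> k / 2 * (2 * E p)"
      unfolding norm_F using k by (intro mult_left_mono) auto
    then show "exp (- (k * E p)) \<le> exp (- (k / 2 * (Rn_inner n (fst (F 1 p)) (fst (F 1 p)) + Rn_inner n (snd (F 1 p)) (snd (F 1 p)))))"
      by simp
  qed
  also have "\<dots> = ennreal ((1 / 1) ^ n) * (\<integral>\<^sup>+p. ?G p \<partial>(Rn_lborel n \<Otimes>\<^sub>M Rn_lborel n))"
    by (rule nn_integral_F) auto
  also have "\<dots> < \<infinity>" using nn_integral_gaussian_pair[of "k / 2"] k by simp
  finally show "(\<integral>\<^sup>+p. ennreal (exp (- (k * E p))) \<partial>\<mu>) < \<infinity>" .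
qed simp

end

section \<open>Analytic continuation from positive to imaginary time\<close>

context monotone_field
begin

text \<open>Chosen so that the error \<open>5 * s * E p\<close> of the regularizing term on the path
  costs \<open>c / 2 * s * E p\<close>, half of what the phase gains there.\<close>

definition \<epsilon> :: real where "\<epsilon> = c / 10"

text \<open>For real \<open>\<zeta> = t\<close>, the exponent \<open>S \<zeta>\<close> is \<open>\<i> / t\<close> times the pairing of the two components of
  \<open>F t p\<close> plus the regularizing term \<open>\<epsilon> (1 + t^2) / 2 |F t p|^2\<close>. Expanded as below, it extends
  holomorphically in \<open>\<zeta>\<close>.\<close>

definition kap :: "nat \<Rightarrow> complex \<Rightarrow> complex" where
  "kap m \<zeta> = (if m = 0 then \<i> / \<zeta> else if m = 1 then - \<i> * \<zeta> else if m = 2 then \<i>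
    else if m = 3 then of_real \<epsilon> * ((1 + \<zeta>\<^sup>2) / 2) else if m = 4 then of_real \<epsilon> * ((\<zeta>\<^sup>2 + \<zeta>^4) / 2)
    else of_real \<epsilon> * (\<zeta> + \<zeta>^3))"

definition qq :: "nat \<Rightarrow> (nat \<Rightarrow> real) \<times> (nat \<Rightarrow> real) \<Rightarrow> real" where
  "qq m p = (if m = 0 then Rn_inner n (fst p) (V (fst p)) else if m = 1 then Rn_inner n (snd p) (V (snd p))
    else if m = 2 then R p else if m = 3 then E1 (fst p) else if m = 4 then E1 (snd p) else T p)"

lemma holomorphic_exponent: "holomorphic_exponent \<mu> 6 kap qq E (- {0})"
proof
  show "kap m holomorphic_on - {0}" if "m < 6" for m
    unfolding kap_def[abs_def]
    by (cases "m = 0"; cases "m = 1"; cases "m = 2"; cases "m = 3"; cases "m = 4") (simp_all, (intro holomorphic_intros; simp)+)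
  have [measurable]: "(\<lambda>p. Rn_inner n (fst p) (V (fst p))) \<in> borel_measurable (Rn_lborel n \<Otimes>\<^sub>M Rn_lborel n)"
    "(\<lambda>p. Rn_inner n (snd p) (V (snd p))) \<in> borel_measurable (Rn_lborel n \<Otimes>\<^sub>M Rn_lborel n)"
    by (rule measurable_compose[OF measurable_fst P_meas] measurable_compose[OF measurable_snd P_meas])+
  show "qq m \<in> borel_measurable \<mu>" for m
    unfolding qq_def[abs_def] by measurable
  show "E \<in> borel_measurable \<mu>" by measurable
  show "\<bar>qq m p\<bar> \<le> E p" if "m < 6" for m p
    using P_le[of "fst p"] P_le[of "snd p"] R_le[of p] T_le[of p] E1_nonneg[of "fst p"] E1_nonneg[of "snd p"]
    unfolding qq_def E_def by (auto simp: abs_le_iff)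
qed (auto simp: E_nonneg exp_E_integrable)

interpretation H: holomorphic_exponent \<mu> 6 kap qq E "- {0}"
  by (rule holomorphic_exponent)

text \<open>This is (1 + \<zeta>^2) / 2 times the squared norm of \<open>F t p\<close>, as a
  polynomial in t evaluated at \<zeta>. The prefactor is 1 at \<zeta> = 1 and 0 at \<zeta> =
  \<i>.\<close>

definition X :: "complex \<Rightarrow> (nat \<Rightarrow> real) \<times> (nat \<Rightarrow> real) \<Rightarrow> complex" where
  "X \<zeta> p = (1 + \<zeta>\<^sup>2) / 2 * of_real (E1 (fst p)) + (\<zeta>\<^sup>2 + \<zeta>^4) / 2 * of_real (E1 (snd p)) + (\<zeta> + \<zeta>^3) * of_real (T p)"

lemma S_eq:
  "H.S \<zeta> p = \<i> / \<zeta> * of_real (Rn_inner n (fst p) (V (fst p))) - \<i> * \<zeta> * of_real (Rn_inner n (snd p) (V (snd p)))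
     + \<i> * of_real (R p) + of_real \<epsilon> * X \<zeta> p"
proof -
  have "{..<6::nat} = {0, 1, 2, 3, 4, 5}" by auto
  then show ?thesis
    unfolding H.S_def X_def by (simp add: kap_def qq_def algebra_simps)
qed

lemma X_real: "X (of_real t) p = of_real ((1 + t\<^sup>2) / 2 * (E1 (fst p) + t\<^sup>2 * E1 (snd p) + 2 * t * T p))"
  unfolding X_def of_real_mult of_real_add of_real_divide of_real_power of_real_1 of_real_numeral
  by (simp add: field_simps power2_eq_square power3_eq_cube power4_eq_xxxx)

text \<open>The m-th power is Lipschitz with constant m on the unit disc. The coefficients of
  \<open>E1 (fst p)\<close>, \<open>E1 (snd p)\<close> and \<open>\<bar>T p\<bar>\<close> become 1,
  3 and 4, and \<open>\<bar>T p\<bar> \<le> E p / 2\<close> bounds the total by 5 E.\<close>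

lemma X_diff:
  assumes z: "norm \<zeta> \<le> 1" and t: "\<bar>t\<bar> \<le> 1"
  shows "norm (X \<zeta> p - X (of_real t) p) \<le> 5 * norm (\<zeta> - of_real t) * E p"
proof -
  let ?t = "complex_of_real t" and ?b = "norm (\<zeta> - of_real t)"
  have pw: "norm (\<zeta>^m - ?t^m) \<le> real m * ?b" for m
    by (rule norm_power_diff) (use z t in auto)
  have nd: "norm (z / 2) = norm z / 2" for z :: complex by (simp add: norm_divide)
  have p2: "norm ((\<zeta>\<^sup>2 - ?t\<^sup>2) / 2) \<le> ?b" using pw[of 2] unfolding nd of_nat_numeral by linarith
  have p4: "norm ((\<zeta>^4 - ?t^4) / 2) \<le> 2 * ?b" using pw[of 4] unfolding nd of_nat_numeral by linarith
  have p3: "norm (\<zeta>^3 - ?t^3) \<le> 3 * ?b" using pw[of 3] unfolding of_nat_numeral .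
  have e: "X \<zeta> p - X ?t p = (\<zeta>\<^sup>2 - ?t\<^sup>2) / 2 * of_real (E1 (fst p)) + ((\<zeta>\<^sup>2 - ?t\<^sup>2) / 2 + (\<zeta>^4 - ?t^4) / 2) * of_real (E1 (snd p))
     + ((\<zeta> - ?t) + (\<zeta>^3 - ?t^3)) * of_real (T p)"
    by (simp add: X_def field_simps)
  have "norm (X \<zeta> p - X ?t p) \<le> norm ((\<zeta>\<^sup>2 - ?t\<^sup>2) / 2 * of_real (E1 (fst p))) + norm (((\<zeta>\<^sup>2 - ?t\<^sup>2) / 2 + (\<zeta>^4 - ?t^4) / 2) * of_real (E1 (snd p)))
     + norm (((\<zeta> - ?t) + (\<zeta>^3 - ?t^3)) * of_real (T p))"
    unfolding e by (rule order_trans[OF norm_triangle_ineq add_mono[OF norm_triangle_ineq order_refl]])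
  also have "\<dots> \<le> ?b * E1 (fst p) + 3 * ?b * E1 (snd p) + 4 * ?b * \<bar>T p\<bar>"
  proof (intro add_mono)
    show "norm ((\<zeta>\<^sup>2 - ?t\<^sup>2) / 2 * of_real (E1 (fst p))) \<le> ?b * E1 (fst p)"
      unfolding norm_mult norm_of_real abs_of_nonneg[OF E1_nonneg] using p2 by (rule mult_right_mono) (rule E1_nonneg)
    have "norm ((\<zeta>\<^sup>2 - ?t\<^sup>2) / 2 + (\<zeta>^4 - ?t^4) / 2) \<le> ?b + 2 * ?b"
      by (rule order_trans[OF norm_triangle_ineq add_mono[OF p2 p4]])
    then have "norm ((\<zeta>\<^sup>2 - ?t\<^sup>2) / 2 + (\<zeta>^4 - ?t^4) / 2) \<le> 3 * ?b" by linarith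
    then show "norm (((\<zeta>\<^sup>2 - ?t\<^sup>2) / 2 + (\<zeta>^4 - ?t^4) / 2) * of_real (E1 (snd p))) \<le> 3 * ?b * E1 (snd p)"
      unfolding norm_mult norm_of_real abs_of_nonneg[OF E1_nonneg] by (rule mult_right_mono) (rule E1_nonneg)
    have "norm ((\<zeta> - ?t) + (\<zeta>^3 - ?t^3)) \<le> ?b + 3 * ?b"
      by (rule order_trans[OF norm_triangle_ineq add_mono[OF order_refl p3]])
    then have "norm ((\<zeta> - ?t) + (\<zeta>^3 - ?t^3)) \<le> 4 * ?b" by linarith
    then show "norm (((\<zeta> - ?t) + (\<zeta>^3 - ?t^3)) * of_real (T p)) \<le> 4 * ?b * \<bar>T p\<bar>"
      unfolding norm_mult norm_of_real by (rule mult_right_mono) simp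
  qed
  also have "\<dots> = ?b * (E1 (fst p) + 3 * E1 (snd p) + 4 * \<bar>T p\<bar>)" by (simp add: algebra_simps)
  also have "\<dots> \<le> ?b * (5 * E p)"
    using T_le[of p] E1_nonneg[of "fst p"] E1_nonneg[of "snd p"]
    by (intro mult_left_mono) (auto simp: E_def)
  finally show ?thesis by (simp add: mult_ac)
qed

text \<open>On the segment |\<zeta>| \<le> 1, so the phase contributes real part at least s times
  the two pairings, hence at least \<open>c * s * E p\<close>. The regularizing term is compared
  with its nonnegative value at the real point 1 - s, and the choice of \<epsilon> leaves
  \<open>c / 2 * s * E p\<close>. At s = 0 the phase contributes nothing, and
  \<open>norm_F_one\<close> supplies the bound.\<close>

lemma segment_in_U:
  assumes s: "0 \<le> s" "s \<le> 1" shows "Complex (1 - s) s \<in> H.U"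
proof -
  let ?\<zeta> = "Complex (1 - s) s"
  have nz: "?\<zeta> \<noteq> 0" by (auto simp: complex_eq_iff)
  have "(1 - s)\<^sup>2 + s\<^sup>2 = 1 - 2 * (s * (1 - s))" by (simp add: power2_eq_square algebra_simps)
  moreover have "0 \<le> s * (1 - s)" using s by simp
  ultimately have n2: "(1 - s)\<^sup>2 + s\<^sup>2 \<le> 1" by linarith
  then have n1: "norm ?\<zeta> \<le> 1" by (simp add: cmod_def)
  have n0: "(1 - s)\<^sup>2 + s\<^sup>2 > 0"
  proof (cases "s = 0")
    case False
    then have "s\<^sup>2 > 0" by simp
    then show ?thesis by (intro add_nonneg_pos) auto
  qed simp
  have diff: "norm (?\<zeta> - of_real (1 - s)) = s"
    using s by (simp add: cmod_def complex_of_real_def)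
  have lower: "c / 2 * s * E p + \<epsilon> * ((1 + (1 - s)\<^sup>2) / 2 * (E1 (fst p) + (1 - s)\<^sup>2 * E1 (snd p) + 2 * (1 - s) * T p)) \<le> Re (H.S ?\<zeta> p)"
    if p: "p \<in> Rn n \<times> Rn n" for p
  proof -
    let ?P = "Rn_inner n (fst p) (V (fst p))" and ?P' = "Rn_inner n (snd p) (V (snd p))"
    have cP: "c * E1 (fst p) \<le> ?P" "c * E1 (snd p) \<le> ?P'"
      using p inner_V_ge_c by (auto simp: E1_def)
    have P0: "0 \<le> ?P" "0 \<le> ?P'" using cP c_pos E1_nonneg by (meson mult_nonneg_nonneg less_imp_le order_trans)+
    define W where "W = (1 + (1 - s)\<^sup>2) / 2 * (E1 (fst p) + (1 - s)\<^sup>2 * E1 (snd p) + 2 * (1 - s) * T p)"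
    have r1: "Re (\<i> / ?\<zeta> * of_real ?P) = s / ((1 - s)\<^sup>2 + s\<^sup>2) * ?P"
      by (simp add: Re_divide)
    have "s \<le> s / ((1 - s)\<^sup>2 + s\<^sup>2)"
      using mult_left_mono[OF n2, of s] s n0 by (simp add: pos_le_divide_eq)
    then have 1: "s * ?P \<le> s / ((1 - s)\<^sup>2 + s\<^sup>2) * ?P"
      using P0(1) by (rule mult_right_mono)
    have r2: "Re (- (\<i> * ?\<zeta> * of_real ?P')) = s * ?P'" by simp
    have "s * (c * E p) \<le> s * (?P + ?P')"
      using s cP by (intro mult_left_mono) (auto simp: E_def distrib_left)
    then have 2: "2 * (c / 2 * s * E p) \<le> s * ?P + s * ?P'" by (simp add: distrib_left mult_ac)
    have X_ge: "W - 5 * s * E p \<le> Re (X ?\<zeta> p)"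
    proof -
      have "\<bar>Re (X ?\<zeta> p - X (of_real (1 - s)) p)\<bar> \<le> 5 * s * E p"
        using s by (intro order_trans[OF abs_Re_le_cmod X_diff[OF n1, of "1 - s" p, unfolded diff]]) auto
      then have "\<bar>Re (X ?\<zeta> p) - W\<bar> \<le> 5 * s * E p" unfolding X_real W_def by (simp only: minus_complex.simps Re_complex_of_real)
      then show ?thesis by linarith
    qed
    have "\<epsilon> * (W - 5 * s * E p) \<le> \<epsilon> * Re (X ?\<zeta> p)"
      by (rule mult_left_mono[OF X_ge]) (use c_pos in \<open>simp add: \<epsilon>_def\<close>)
    then have 3: "\<epsilon> * W - c / 2 * s * E p \<le> \<epsilon> * Re (X ?\<zeta> p)" by (simp add: right_diff_distrib \<epsilon>_def)
    have "Re (H.S ?\<zeta> p) = Re (\<i> / ?\<zeta> * of_real ?P) + Re (- (\<i> * ?\<zeta> * of_real ?P')) + \<epsilon> * Re (X ?\<zeta> p)"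
      unfolding S_eq by simp
    then have "c / 2 * s * E p + \<epsilon> * W \<le> Re (H.S ?\<zeta> p)" unfolding r1 r2 using 1 2 3 by linarith
    then show ?thesis unfolding W_def .
  qed
  have "\<exists>c'>0. \<forall>p\<in>space \<mu>. c' * E p \<le> Re (H.S ?\<zeta> p)"
  proof (cases "s = 0")
    case True
    show ?thesis
    proof (intro exI[of _ "\<epsilon> * c\<^sup>2"] conjI ballI)
      show "\<epsilon> * c\<^sup>2 > 0" using c_pos by (simp add: \<epsilon>_def)
      fix p assume "p \<in> space \<mu>"
      then have p: "p \<in> Rn n \<times> Rn n" by (simp add: space_\<mu>)
      have "\<epsilon> * (c\<^sup>2 * E p) \<le> \<epsilon> * (E1 (fst p) + E1 (snd p) + 2 * T p)"
        using norm_F_one[OF p] c_pos by (intro mult_left_mono) (auto simp: \<epsilon>_def)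
      also have "\<dots> \<le> Re (H.S ?\<zeta> p)" using lower[OF p] True by simp
      finally show "\<epsilon> * c\<^sup>2 * E p \<le> Re (H.S ?\<zeta> p)" by (simp add: mult.assoc)
    qed
  next
    case False
    show ?thesis
    proof (intro exI[of _ "c / 2 * s"] conjI ballI)
      show "c / 2 * s > 0" using c_pos s False by simp
      fix p assume "p \<in> space \<mu>"
      then have p: "p \<in> Rn n \<times> Rn n" by (simp add: space_\<mu>)
      have "0 \<le> \<epsilon> * ((1 + (1 - s)\<^sup>2) / 2 * (E1 (fst p) + (1 - s)\<^sup>2 * E1 (snd p) + 2 * (1 - s) * T p))"
        using c_pos norm_F_nonneg[of p "1 - s"] by (intro mult_nonneg_nonneg) (auto simp: \<epsilon>_def)
      then show "c / 2 * s * E p \<le> Re (H.S ?\<zeta> p)" using lower[OF p] by linarith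
    qed
  qed
  then show ?thesis unfolding H.U_def using nz by simp
qed

text \<open>The inner integral is the Fourier transform of a Gaussian, hence again a Gaussian, now
  with coefficient \<open>k'\<close>, and the outer integral is explicit.\<close>

lemma gaussian_pair_integral:
  assumes k: "k > 0" and t: "t > 0"
  defines "g \<equiv> \<lambda>p. exp (- (complex_of_real (k * (Rn_inner n (fst p) (fst p) + Rn_inner n (snd p) (snd p))) + \<i> * of_real (Rn_inner n (fst p) (snd p) / t)))"
  shows "g \<in> borel_measurable (Rn_lborel n \<Otimes>\<^sub>M Rn_lborel n)"
    and "integral\<^sup>L (Rn_lborel n \<Otimes>\<^sub>M Rn_lborel n) g = of_real ((sqrt (pi / k) * sqrt (pi / (k + 1 / (4 * k * t\<^sup>2)))) ^ n)"
proof -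
  let ?N = "Rn_lborel n"
  have [measurable]: "(\<lambda>p. Rn_inner n (fst p) (snd p)) \<in> borel_measurable (?N \<Otimes>\<^sub>M ?N)"
    using pair_inner_meas[of "\<lambda>x. x" "\<lambda>x. x"] by (simp add: measurable_coord)
  have [measurable]: "(\<lambda>v. Rn_inner n v v) \<in> borel_measurable ?N"
    unfolding Rn_inner_def by (intro borel_measurable_sum borel_measurable_times measurable_coord) auto
  show gm[measurable]: "g \<in> borel_measurable (?N \<Otimes>\<^sub>M ?N)" unfolding g_def by measurable
  have g_int: "integrable (?N \<Otimes>\<^sub>M ?N) g"
  proof (rule integrableI_bounded[OF gm])
    show "(\<integral>\<^sup>+p. ennreal (norm (g p)) \<partial>(?N \<Otimes>\<^sub>M ?N)) < \<infinity>"
      using nn_integral_gaussian_pair[OF k] by (simp add: g_def)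
  qed
  define k' where "k' = k + 1 / (4 * k * t\<^sup>2)"
  have k': "k' > 0" unfolding k'_def using k t by (intro add_pos_pos) auto
  have inner: "(\<integral>v. g (u, v) \<partial>?N) = of_real (sqrt (pi / k) ^ n * exp (- (k' * Rn_inner n u u)))" for u
  proof -
    let ?w = "comb n (1 / t) u 0 u"
    have w: "Rn_inner n ?w v = Rn_inner n u v / t" for v by (simp add: Rn_inner_comb)
    have ww: "Rn_inner n ?w ?w = Rn_inner n u u / t\<^sup>2" by (simp add: Rn_inner_comb Rn_inner_comb' power2_eq_square)
    have "(\<lambda>v. g (u, v)) = (\<lambda>v. of_real (exp (- (k * Rn_inner n u u))) * exp (- (of_real (k * Rn_inner n v v) + \<i> * of_real (Rn_inner n ?w v))))"
      unfolding g_def w by (simp add: exp_of_real[symmetric] exp_add[symmetric] algebra_simps)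
    then have "(\<integral>v. g (u, v) \<partial>?N) = of_real (exp (- (k * Rn_inner n u u))) * of_real (sqrt (pi / k) ^ n * exp (- (Rn_inner n ?w ?w / (4 * k))))"
      by (simp only: integral_mult_right_zero gaussian_fourier_Rn[OF k])
    also have "\<dots> = of_real (sqrt (pi / k) ^ n * (exp (- (k * Rn_inner n u u)) * exp (- (Rn_inner n ?w ?w / (4 * k)))))"
      by (simp only: of_real_mult mult_ac)
    also have "exp (- (k * Rn_inner n u u)) * exp (- (Rn_inner n ?w ?w / (4 * k))) = exp (- (k' * Rn_inner n u u))"
      unfolding ww exp_add[symmetric] using k t by (simp add: k'_def field_simps)
    finally show ?thesis .
  qed
  have "integral\<^sup>L (?N \<Otimes>\<^sub>M ?N) g = (\<integral>u. (\<integral>v. g (u, v) \<partial>?N) \<partial>?N)"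
    by (rule RR.integral_fst'[OF g_int, symmetric])
  also have "\<dots> = (\<integral>u. complex_of_real (sqrt (pi / k) ^ n * exp (- (k' * Rn_inner n u u))) \<partial>?N)"
    by (simp only: inner)
  also have "\<dots> = of_real (\<integral>u. sqrt (pi / k) ^ n * exp (- (k' * Rn_inner n u u)) \<partial>?N)"
    by (rule integral_complex_of_real)
  also have "(\<integral>u. sqrt (pi / k) ^ n * exp (- (k' * Rn_inner n u u)) \<partial>?N) = (sqrt (pi / k) * sqrt (pi / k')) ^ n"
    using gaussian_Rn(2)[OF k', of n] by (simp add: power_mult_distrib)
  finally show "integral\<^sup>L (?N \<Otimes>\<^sub>M ?N) g = of_real ((sqrt (pi / k) * sqrt (pi / (k + 1 / (4 * k * t\<^sup>2)))) ^ n)"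
    by (simp add: k'_def)
qed

text \<open>The Gaussian value contains square roots. Squaring yields an identity between
  holomorphic expressions in t, so the continuation requires no choice of branch.\<close>

lemma J_real:
  assumes t: "t > 0"
  shows "(H.J (of_real t))\<^sup>2 * ((of_real \<epsilon> * ((1 + (of_real t)\<^sup>2) / 2) * of_real t)\<^sup>2 + 1 / 4) ^ n = of_real (pi ^ (2 * n))"
proof -
  define k where "k = \<epsilon> * ((1 + t\<^sup>2) / 2)"
  have k: "k > 0" unfolding k_def using c_pos by (intro mult_pos_pos divide_pos_pos) (auto simp: \<epsilon>_def intro: add_pos_nonneg)
  define g where "g p = exp (- (complex_of_real (k * (Rn_inner n (fst p) (fst p) + Rn_inner n (snd p) (snd p))) + \<i> * of_real (Rn_inner n (fst p) (snd p) / t)))" for p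
  note gp = gaussian_pair_integral[OF k t, folded g_def[abs_def]]
  have [measurable]: "g \<in> borel_measurable (Rn_lborel n \<Otimes>\<^sub>M Rn_lborel n)" using gp(1) unfolding g_def[abs_def] .
  have S: "exp (- H.S (of_real t) p) = g (F t p)" for p
  proof -
    have "H.S (of_real t) p = of_real (k * (Rn_inner n (fst (F t p)) (fst (F t p)) + Rn_inner n (snd (F t p)) (snd (F t p))))
      + \<i> * of_real (Rn_inner n (fst (F t p)) (snd (F t p)) / t)"
      unfolding S_eq X_real norm_F inner_F k_def using t
      by (simp add: field_simps power2_eq_square)
    then show ?thesis by (simp only: g_def)
  qed
  have Fm: "F t \<in> \<mu> \<rightarrow>\<^sub>M Rn_lborel n \<Otimes>\<^sub>M Rn_lborel n" by measurable
  have "H.J (of_real t) = (\<integral>p. g (F t p) \<partial>\<mu>)" by (simp only: H.J_def S)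
  also have "\<dots> = (\<integral>p. g p \<partial>distr \<mu> (Rn_lborel n \<Otimes>\<^sub>M Rn_lborel n) (F t))"
    by (rule integral_distr[symmetric, OF Fm]) measurable
  also have "\<dots> = (\<integral>p. (1 / t) ^ n *\<^sub>R g p \<partial>(Rn_lborel n \<Otimes>\<^sub>M Rn_lborel n))"
    unfolding distr_F[OF t] using t by (intro integral_density) auto
  also have "\<dots> = (1 / t) ^ n *\<^sub>R (\<integral>p. g p \<partial>(Rn_lborel n \<Otimes>\<^sub>M Rn_lborel n))" by simp
  also have "(\<integral>p. g p \<partial>(Rn_lborel n \<Otimes>\<^sub>M Rn_lborel n)) = of_real ((sqrt (pi / k) * sqrt (pi / (k + 1 / (4 * k * t\<^sup>2)))) ^ n)"
    using gp(2) unfolding g_def[abs_def] .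
  finally have J: "H.J (of_real t) = of_real (((1 / t) * (sqrt (pi / k) * sqrt (pi / (k + 1 / (4 * k * t\<^sup>2))))) ^ n)"
    by (simp only: scaleR_conv_of_real of_real_mult[symmetric] power_mult_distrib)
  have "((1 / t) * (sqrt (pi / k) * sqrt (pi / (k + 1 / (4 * k * t\<^sup>2)))))\<^sup>2 * ((k * t)\<^sup>2 + 1 / 4) = pi\<^sup>2"
  proof -
    have p: "k + 1 / (4 * k * t\<^sup>2) > 0" using k t by (intro add_pos_pos) auto
    have "(sqrt (pi / k))\<^sup>2 = pi / k" "(sqrt (pi / (k + 1 / (4 * k * t\<^sup>2))))\<^sup>2 = pi / (k + 1 / (4 * k * t\<^sup>2))"
      using k p by (auto intro!: real_sqrt_pow2 divide_nonneg_pos)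
    then have "((1 / t) * (sqrt (pi / k) * sqrt (pi / (k + 1 / (4 * k * t\<^sup>2)))))\<^sup>2 = (1 / t)\<^sup>2 * (pi / k * (pi / (k + 1 / (4 * k * t\<^sup>2))))"
      by (simp only: power_mult_distrib)
    moreover have "(k * t)\<^sup>2 + 1 / 4 = t\<^sup>2 * (k * (k + 1 / (4 * k * t\<^sup>2)))"
      using k t by (simp add: field_simps power2_eq_square)
    ultimately have e: "((1 / t) * (sqrt (pi / k) * sqrt (pi / (k + 1 / (4 * k * t\<^sup>2)))))\<^sup>2 * ((k * t)\<^sup>2 + 1 / 4) =
      (1 / t)\<^sup>2 * (pi / k * (pi / (k + 1 / (4 * k * t\<^sup>2)))) * (t\<^sup>2 * (k * (k + 1 / (4 * k * t\<^sup>2))))"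
      by (simp only:)
    have "(1 / t)\<^sup>2 * (pi / k * (pi / q)) * (t\<^sup>2 * (k * q)) = pi\<^sup>2" if "q > 0" for q
      using k t that by (simp add: field_simps power2_eq_square)
    from this[OF p] show ?thesis unfolding e .
  qed
  then have "(((1 / t) * (sqrt (pi / k) * sqrt (pi / (k + 1 / (4 * k * t\<^sup>2)))))\<^sup>2 * ((k * t)\<^sup>2 + 1 / 4)) ^ n = pi ^ (2 * n)"
    by (simp add: power_mult)
  note sq_eq = this
  have "((((1 / t) * (sqrt (pi / k) * sqrt (pi / (k + 1 / (4 * k * t\<^sup>2))))) ^ n)\<^sup>2 * ((k * t)\<^sup>2 + 1 / 4) ^ n) = pi ^ (2 * n)"
  proof -
    have g: "(A ^ n)\<^sup>2 * B ^ n = (A\<^sup>2 * B) ^ n" for A B :: real by (simp add: power_mult_distrib power2_eq_square)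
    show ?thesis unfolding g by (rule sq_eq)
  qed
  then have "complex_of_real ((((1 / t) * (sqrt (pi / k) * sqrt (pi / (k + 1 / (4 * k * t\<^sup>2))))) ^ n)\<^sup>2 * ((k * t)\<^sup>2 + 1 / 4) ^ n) = of_real (pi ^ (2 * n))"
    by (simp only:)
  moreover have "complex_of_real ((k * t)\<^sup>2 + 1 / 4) = (of_real \<epsilon> * ((1 + (of_real t)\<^sup>2) / 2) * of_real t)\<^sup>2 + 1 / 4"
    by (simp add: k_def)
  ultimately show ?thesis unfolding J by (simp only: of_real_mult of_real_power)
qed

text \<open>Analytic continuation along the segment from \<open>1\<close> to \<open>\<i>\<close>, where the regularizing term vanishes.\<close>

lemma norm_J_i: "norm (H.J \<i>) = (2 * pi) ^ n"
proof -
  define f where "f \<zeta> = (H.J \<zeta>)\<^sup>2 * ((of_real \<epsilon> * ((1 + \<zeta>\<^sup>2) / 2) * \<zeta>)\<^sup>2 + 1 / 4) ^ n - of_real (pi ^ (2 * n))" for \<zeta>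
  \<comment> \<open>The identity theorem needs a connected domain; this component of
    \<open>H.U\<close> contains the segment from 1 to \<i> and all reals close to 1.\<close>
  let ?C = "connected_component_set H.U 1"
  have one: "1 \<in> H.U" using segment_in_U[of 0] by (simp add: Complex_eq)
  have C: "open ?C" "connected ?C" "?C \<subseteq> H.U" "1 \<in> ?C"
  proof -
    show "open ?C" by (rule open_connected_component[OF H.open_U])
    show "connected ?C" by (rule connected_connected_component)
    show "?C \<subseteq> H.U" by (rule connected_component_subset)
    show "1 \<in> ?C" using connected_component_refl[OF one] by (rule CollectI)
  qed
  have seg: "(\<lambda>s. Complex (1 - s) s) ` {0..1} \<subseteq> ?C"
  proof (rule connected_component_maximal)
    show "1 \<in> (\<lambda>s. Complex (1 - s) s) ` {0..1}" by (rule image_eqI[of _ _ 0]) (auto simp: Complex_eq)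
    show "connected ((\<lambda>s. Complex (1 - s) s) ` {0..1})"
      by (intro connected_continuous_image) (auto simp: Complex_eq intro!: continuous_intros)
    show "(\<lambda>s. Complex (1 - s) s) ` {0..1} \<subseteq> H.U" using segment_in_U by auto
  qed
  have "\<i> \<in> (\<lambda>s. Complex (1 - s) s) ` {0..1}" by (rule image_eqI[of _ _ 1]) (auto simp: complex_eq_iff)
  with seg have iC: "\<i> \<in> ?C" by blast
  have "f \<i> = 0"
  proof (rule analytic_continuation[OF _ C(1,2) _ C(4) _ _ iC])
    show "f holomorphic_on ?C"
      unfolding f_def by (intro holomorphic_intros holomorphic_on_subset[OF H.holomorphic_J C(3)]) auto
    show "of_real ` {0<..} \<inter> ?C \<subseteq> ?C" by simp
    show "1 islimpt (of_real ` {0<..} \<inter> ?C)"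
      unfolding islimpt_approachable
    proof (intro allI impI)
      fix e :: real assume e: "e > 0"
      obtain r where r: "r > 0" "ball 1 r \<subseteq> ?C" using C(1,4) open_contains_ball by blast
      define t where "t = 1 + min r e / 2"
      have t: "t > 1" "dist (complex_of_real t) 1 < r" "dist (complex_of_real t) 1 < e"
      proof -
        have "dist (complex_of_real t) 1 = min r e / 2"
        proof -
          have "complex_of_real t - 1 = of_real (min r e / 2)" by (simp add: t_def)
          then show ?thesis using e r by (simp only: dist_norm norm_of_real)
        qed
        then show "t > 1" "dist (complex_of_real t) 1 < r" "dist (complex_of_real t) 1 < e"
          using e r by (auto simp: t_def min_def)
      qed
      then show "\<exists>x'\<in>of_real ` {0<..} \<inter> ?C. x' \<noteq> 1 \<and> dist x' 1 < e"
        using r(2) by (intro bexI[of _ "of_real t"]) (auto simp: dist_commute)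
    qed
    show "f z = 0" if "z \<in> of_real ` {0<..} \<inter> ?C" for z
      using that J_real by (auto simp: f_def)
  qed
  then have "(H.J \<i>)\<^sup>2 * (1 / 4) ^ n = of_real (pi ^ (2 * n))" by (simp add: f_def)
  then have "norm ((H.J \<i>)\<^sup>2 * (1 / 4) ^ n) = norm (complex_of_real (pi ^ (2 * n)))" by (simp only:)
  then have "(norm (H.J \<i>))\<^sup>2 * (1 / 4) ^ n = pi ^ (2 * n)"
    by (simp add: norm_mult norm_power norm_divide)
  then have "(norm (H.J \<i>))\<^sup>2 = pi ^ (2 * n) * 4 ^ n"
    by (simp add: field_simps power_divide)
  also have "\<dots> = ((2 * pi) ^ n)\<^sup>2"
  proof -
    have "(4::real) ^ n = (2 ^ n)\<^sup>2" by (simp add: power2_eq_square power_mult_distrib[symmetric])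
    then show ?thesis by (simp add: power_mult_distrib power_mult[symmetric] mult.commute)
  qed
  finally show ?thesis by (simp add: power2_eq_iff_nonneg)
qed

text \<open>At \<i> the regularizing term vanishes and the coefficients of the two pairings become
  1, while \<open>R\<close> contributes only an imaginary part. The claim is the triangle inequality
  for the integral whose modulus is \<open>norm_J_i\<close>.\<close>

lemma nn_integral_exp_ge:
  "ennreal ((2 * pi) ^ n) \<le> (\<integral>\<^sup>+p. ennreal (exp (- (Rn_inner n (fst p) (V (fst p)) + Rn_inner n (snd p) (V (snd p))))) \<partial>\<mu>)"
proof -
  have iU: "\<i> \<in> H.U" using segment_in_U[of 1] by (simp add: Complex_eq)
  have "X \<i> p = 0" for p by (simp add: X_def power3_eq_cube power4_eq_xxxx)
  then have e: "norm (exp (- H.S \<i> p)) = exp (- (Rn_inner n (fst p) (V (fst p)) + Rn_inner n (snd p) (V (snd p))))" for p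
    unfolding S_eq by simp
  have "ennreal (norm (H.J \<i>)) \<le> (\<integral>\<^sup>+p. ennreal (norm (exp (- H.S \<i> p))) \<partial>\<mu>)"
    unfolding H.J_def by (rule integral_norm_bound_ennreal[OF H.integrable_exp_S[OF iU]])
  then show ?thesis unfolding norm_J_i e .
qed

text \<open>The right-hand side of the hypothesis is a product function evaluated at half of
  \<open>F 1 p\<close>, so its \<mu>-integral factors by \<open>nn_integral_F\<close>. Undoing the
  halving in both components gives 2^n twice.\<close>

theorem mass_product_ge:
  assumes [measurable]: "f \<in> borel_measurable (Rn_lborel n)" "g \<in> borel_measurable (Rn_lborel n)"
    and f: "\<And>x. x \<in> Rn n \<Longrightarrow> 0 \<le> f x"
    and fg: "\<And>x y. x \<in> Rn n \<Longrightarrow> y \<in> Rn n \<Longrightarrow>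
       exp (- (Rn_inner n x (V x) + Rn_inner n y (V y))) \<le> f (comb n (1/2) x (-1/2) y) * g (comb n (1/2) (V x) (1/2) (V y))"
  shows "ennreal ((2 * pi) ^ n) \<le> 4 ^ n * (mass n f * mass n g)"
proof -
  let ?N = "Rn_lborel n"
  define h where "h u = comb n (1/2) u 0 u" for u
  define G where "G p = ennreal (f (h (fst p))) * ennreal (g (h (snd p)))" for p
  have [measurable]: "h \<in> ?N \<rightarrow>\<^sub>M ?N" unfolding h_def[abs_def] by measurable
  have [measurable]: "G \<in> borel_measurable (?N \<Otimes>\<^sub>M ?N)" unfolding G_def[abs_def] by measurable
  have half: "(\<integral>\<^sup>+u. ennreal (k (h u)) \<partial>?N) = 2 ^ n * mass n k" if [measurable]: "k \<in> borel_measurable ?N" for k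
  proof -
    have "h u = comb n (1/2) u 0 (Rn_zero n)" for u by (simp add: h_def comb_def)
    then show ?thesis unfolding mass_def using nn_integral_half[of "\<lambda>x. ennreal (k x)" n 0 "Rn_zero n"] by simp
  qed
  have "ennreal ((2 * pi) ^ n) \<le> (\<integral>\<^sup>+p. ennreal (exp (- (Rn_inner n (fst p) (V (fst p)) + Rn_inner n (snd p) (V (snd p))))) \<partial>\<mu>)"
    by (rule nn_integral_exp_ge)
  also have "\<dots> \<le> (\<integral>\<^sup>+p. G (F 1 p) \<partial>\<mu>)"
  proof (rule nn_integral_mono)
    fix p assume "p \<in> space \<mu>"
    then obtain x y where p: "p = (x, y)" and xy: "x \<in> Rn n" "y \<in> Rn n" by (auto simp: space_\<mu>)
    have "h (fst (F 1 p)) = comb n (1/2) x (-1/2) y" "h (snd (F 1 p)) = comb n (1/2) (V x) (1/2) (V y)"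
      by (auto simp: h_def F_def p field_simps intro!: Rn_ext[of _ n])
    then show "ennreal (exp (- (Rn_inner n (fst p) (V (fst p)) + Rn_inner n (snd p) (V (snd p))))) \<le> G (F 1 p)"
      using fg[OF xy] f[of "comb n (1/2) x (-1/2) y"] by (simp add: G_def p ennreal_mult'[symmetric] ennreal_leI)
  qed
  also have "\<dots> = ennreal ((1 / 1) ^ n) * (\<integral>\<^sup>+p. G p \<partial>(?N \<Otimes>\<^sub>M ?N))"
    by (rule nn_integral_F) auto
  also have "(\<integral>\<^sup>+p. G p \<partial>(?N \<Otimes>\<^sub>M ?N)) = (\<integral>\<^sup>+u. (\<integral>\<^sup>+v. G (u, v) \<partial>?N) \<partial>?N)"
    by (rule Rn.nn_integral_fst[symmetric]) measurable
  also have "\<dots> = (2 ^ n * mass n f) * (2 ^ n * mass n g)"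
    unfolding G_def by (simp add: nn_integral_cmult nn_integral_multc half)
  also have "\<dots> = 4 ^ n * (mass n f * mass n g)"
  proof -
    have "(4::ennreal) ^ n = 2 ^ n * 2 ^ n" by (simp add: power_mult_distrib[symmetric])
    then show ?thesis by (simp add: mult_ac)
  qed
  finally show ?thesis by simp
qed

end

section \<open>Affine majorants and biduality\<close>

lemma Rn_inner_Rn_diff_sq: "Rn_inner n (comb n 1 x (-1) y) (comb n 1 x (-1) y) = (\<Sum>i<n. (x i - y i)\<^sup>2)"
  by (simp add: Rn_inner_def power2_eq_square)

lemma coord_le_norm: "i < n \<Longrightarrow> (x i)\<^sup>2 \<le> Rn_inner n x x"
  unfolding Rn_inner_def power2_eq_square by (rule member_le_sum[of i "{..<n}" "\<lambda>i. x i * x i"]) auto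

lemma ln_le_of_le_exp: "0 < a \<Longrightarrow> a \<le> exp r \<Longrightarrow> ln a \<le> (r::real)"
  by (metis exp_le_cancel_iff exp_ln)

lemma avg_le: "a + b \<le> 2 * c \<Longrightarrow> d \<le> b \<Longrightarrow> (a + d) / 2 \<le> (c :: real)"
  by simp

text \<open>Iterated midpoints with \<open>x\<close> reach points arbitrarily close to
  \<open>x\<close> on the segment to \<open>z\<close>, which suffices for one-sided derivatives at
  \<open>x\<close>.\<close>

lemma comb_dyadic_ge:
  assumes f: "lcf n f" and x: "x \<in> Rn n" and z: "z \<in> Rn n" and pos: "f x > 0" "f z > 0"
  shows "f (comb n (1 - (1/2)^j) x ((1/2)^j) z) > 0 \<and>
    (1 - (1/2)^j) * ln (f x) + (1/2)^j * ln (f z) \<le> ln (f (comb n (1 - (1/2)^j) x ((1/2)^j) z))"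
proof (induction j)
  case 0
  have "comb n (1 - (1/2)^0) x ((1/2)^0) z = z" using z by (intro Rn_ext[of _ n]) auto
  then show ?case using pos by simp
next
  case (Suc j)
  let ?t = "(1/2::real)^j"
  let ?w = "comb n (1 - ?t) x ?t z"
  let ?v = "comb n (1 - (1/2)^Suc j) x ((1/2)^Suc j) z"
  have e: "comb n (1/2) x (1/2) ?w = ?v" by (rule Rn_ext[of _ n]) (auto simp: field_simps)
  have le: "f x * f ?w \<le> (f ?v)\<^sup>2" using lcfD(5)[OF f x, of ?w] by (simp add: e)
  have w: "f ?w > 0" "(1 - ?t) * ln (f x) + ?t * ln (f z) \<le> ln (f ?w)" using Suc by auto
  have "f x * f ?w > 0" using pos w by simp
  then have "(f ?v)\<^sup>2 > 0" using le by linarith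
  then have v: "f ?v > 0" using lcfD(1)[OF f, of ?v] by (simp add: zero_less_power2 less_le)
  have "ln (f x * f ?w) \<le> ln ((f ?v)\<^sup>2)" using le pos w v by (subst ln_le_cancel_iff) auto
  then have le2: "ln (f x) + ln (f ?w) \<le> 2 * ln (f ?v)" using pos w v by (simp add: ln_mult ln_realpow)
  have eq: "(1 - (1/2)^Suc j) * a + (1/2)^Suc j * b = (a + ((1 - ?t) * a + ?t * b)) / 2" for a b :: real
    by (simp add: algebra_simps)
  have "(1 - (1/2)^Suc j) * ln (f x) + (1/2)^Suc j * ln (f z) \<le> ln (f ?v)" unfolding eq by (rule avg_le[OF le2 w(2)])
  then show ?case using v by simp
qed

text \<open>Maximizers of \<open>f(x) exp (- k |x - x0|^2)\<close> provide supporting affine functions.\<close>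

lemma prox_maximizer:
  assumes f: "lcf n f" and x0: "x0 \<in> Rn n" and k: "k > 0"
  shows "\<exists>x\<in>Rn n. 0 < f x \<and> (\<forall>z\<in>Rn n. f z * exp (- (k * Rn_inner n (comb n 1 z (-1) x0) (comb n 1 z (-1) x0)))
      \<le> f x * exp (- (k * Rn_inner n (comb n 1 x (-1) x0) (comb n 1 x (-1) x0))))"
proof -
  define N where "N x = Rn_inner n (comb n 1 x (-1) x0) (comb n 1 x (-1) x0)" for x
  define m where "m x = f x * exp (- (k * N x))" for x
  have N0: "0 \<le> N x" for x by (simp add: N_def)
  have m1: "m x \<le> 1" "0 \<le> m x" if "x \<in> Rn n" for x
    using lcfD(1,2)[OF f that] k N0[of x] by (auto simp: m_def intro!: mult_le_one)
  have bdd: "bdd_above (m ` Rn n)" using m1 by (intro bdd_aboveI[of _ 1]) auto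
  define s where "s = (SUP x\<in>Rn n. m x)"
  have ms: "m x \<le> s" if "x \<in> Rn n" for x unfolding s_def by (rule cSUP_upper[OF that bdd])
  have "m (Rn_zero n) > 0" using lcfD(4)[OF f] by (simp add: m_def)
  then have s0: "s > 0" using ms[of "Rn_zero n"] by simp
  have "\<exists>x\<in>Rn n. s - s / real (j + 2) < m x" for j
  proof -
    have "Rn n \<noteq> {}" using Rn_zero_in by blast
    moreover have "s - s / real (j + 2) < s" using s0 by simp
    ultimately show ?thesis using less_cSUP_iff[OF _ bdd] unfolding s_def[symmetric] by blast
  qed
  then obtain x where x: "\<And>j. x j \<in> Rn n" "\<And>j. s - s / real (j + 2) < m (x j)" by metis
  have half: "s / 2 \<le> m (x j)" for j
  proof -
    have "s / real (j + 2) \<le> s / 2" using s0 by (intro divide_left_mono) auto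
    then show ?thesis using x(2)[of j] by linarith
  qed
  have Nb: "N (x j) \<le> ln (2 / s) / k" for j
  proof -
    have "m (x j) \<le> exp (- (k * N (x j)))" using lcfD(1,2)[OF f x(1)] by (simp add: m_def mult_left_le_one_le)
    then have "s / 2 \<le> exp (- (k * N (x j)))" using half[of j] by linarith
    then have "ln (s / 2) \<le> - (k * N (x j))" using s0 by (intro ln_le_of_le_exp) auto
    moreover have "ln (s / 2) = - ln (2 / s)" using s0 by (simp add: ln_div)
    ultimately show ?thesis using k by (simp add: field_simps)
  qed
  define B where "B = sqrt (\<bar>ln (2 / s) / k\<bar>) + (\<Sum>i<n. \<bar>x0 i\<bar>)"
  have inB: "x j \<in> cube n B" for j
  proof -
    have "\<bar>x j i\<bar> \<le> B" if i: "i < n" for i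
    proof -
      have "(x j i - x0 i)\<^sup>2 \<le> ln (2 / s) / k"
        using coord_le_norm[OF i, of "comb n 1 (x j) (-1) x0"] Nb[of j] i by (simp add: N_def)
      then have "(x j i - x0 i)\<^sup>2 \<le> \<bar>ln (2 / s) / k\<bar>" by (rule order_trans[OF _ abs_ge_self])
      then have "\<bar>x j i - x0 i\<bar> \<le> sqrt (\<bar>ln (2 / s) / k\<bar>)" by (metis real_sqrt_abs real_sqrt_le_iff)
      moreover have "\<bar>x0 i\<bar> \<le> (\<Sum>i<n. \<bar>x0 i\<bar>)" using i by (intro member_le_sum) auto
      ultimately show ?thesis unfolding B_def by linarith
    qed
    then show ?thesis using x(1) by (auto simp: cube_def)
  qed
  have "seq_compact (cube n B)" using compact_cube compact_imp_seq_compact by blast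
  then obtain y r where y: "y \<in> cube n B" and r: "strict_mono r" "(x \<circ> r) \<longlonglongrightarrow> y"
    unfolding seq_compact_def using inB by metis
  have yR: "y \<in> Rn n" using y by (simp add: cube_def)
  have xi: "(\<lambda>j. x (r j) i) \<longlonglongrightarrow> y i" for i using r(2) by (auto simp: tendsto_fun_iff o_def)
  have Nl: "(\<lambda>j. N (x (r j))) \<longlonglongrightarrow> N y"
    unfolding N_def Rn_inner_Rn_diff_sq by (intro tendsto_intros xi)
  have "s \<le> m y"
  proof -
    have le: "s \<le> (f y + e) * exp (- (k * N y))" if e: "e > 0" for e
    proof (rule LIMSEQ_le)
      have "(\<lambda>j. s - s / real (j + 2)) \<longlonglongrightarrow> s" by real_asymp
      from LIMSEQ_subseq_LIMSEQ[OF this r(1)] show "(\<lambda>j. s - s / real (r j + 2)) \<longlonglongrightarrow> s" by (simp add: o_def)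
      show "(\<lambda>j. (f y + e) * exp (- (k * N (x (r j))))) \<longlonglongrightarrow> (f y + e) * exp (- (k * N y))"
        by (intro tendsto_intros Nl)
      have "\<forall>\<^sub>F j in sequentially. f (x (r j)) < f y + e"
        by (rule usc_seq[OF lcfD(3)[OF f], of _ y]) (use r(2) x(1) yR e in \<open>auto simp: o_def\<close>)
      then have "\<forall>\<^sub>F j in sequentially. s - s / real (r j + 2) \<le> (f y + e) * exp (- (k * N (x (r j))))"
      proof eventually_elim
        case (elim j)
        have "m (x (r j)) \<le> (f y + e) * exp (- (k * N (x (r j))))"
          unfolding m_def using elim by (intro mult_right_mono) auto
        then show ?case using x(2)[of "r j"] by linarith
      qed
      then show "\<exists>J. \<forall>j\<ge>J. s - s / real (r j + 2) \<le> (f y + e) * exp (- (k * N (x (r j))))"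
        by (simp add: eventually_sequentially)
    qed
    have "((\<lambda>e. (f y + e) * exp (- (k * N y))) \<longlongrightarrow> (f y + 0) * exp (- (k * N y))) (at_right 0)"
      by (intro tendsto_intros)
    moreover have "\<forall>\<^sub>F e in at_right 0. s \<le> (f y + e) * exp (- (k * N y))"
      using le by (auto simp: eventually_at_right_field intro: exI[of _ 1])
    ultimately have "s \<le> (f y + 0) * exp (- (k * N y))"
      by (intro tendsto_lowerbound) auto
    then show ?thesis by (simp add: m_def)
  qed
  then have max: "m z \<le> m y" if "z \<in> Rn n" for z using ms[OF that] by linarith
  have "m y > 0" using \<open>s \<le> m y\<close> s0 by linarith
  then have "f y > 0" using lcfD(1)[OF f yR] by (auto simp: m_def zero_less_mult_iff)
  then show ?thesis using max yR unfolding m_def N_def by blast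
qed

text \<open>The majorant touches \<open>f\<close> at a maximizer y of f(x) exp(- K |x - x0|^2). Its
  value at \<open>x0\<close> is f(y) exp(- 2 K |y - x0|^2), at most the penalized maximum, so it is
  enough to find a penalty \<open>K\<close> for which that maximum is below
  \<open>a\<close>.\<close>

lemma affine_majorant:
  assumes f: "lcf n f" and x0: "x0 \<in> Rn n" and a: "a > f x0"
  shows "\<exists>\<eta>\<in>Rn n. \<exists>\<kappa>. (\<forall>x\<in>Rn n. f x \<le> exp (\<kappa> - Rn_inner n \<eta> x)) \<and> exp (\<kappa> - Rn_inner n \<eta> x0) < a"
proof -
  define N where "N x = Rn_inner n (comb n 1 x (-1) x0) (comb n 1 x (-1) x0)" for x
  have a0: "a > 0" using a lcfD(1)[OF f x0] by linarith
  obtain X where X: "\<And>k. X k \<in> Rn n" "\<And>k. 0 < f (X k)"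
    "\<And>k z. z \<in> Rn n \<Longrightarrow> f z * exp (- (real (Suc k) * N z)) \<le> f (X k) * exp (- (real (Suc k) * N (X k)))"
    using prox_maximizer[OF f x0, of "real (Suc k)" for k] unfolding N_def by (metis of_nat_0_less_iff zero_less_Suc)
  \<comment> \<open>Otherwise \<open>N (X k) \<le> \<bar>ln a\<bar> / real (Suc k)\<close>, so the
    maximizers converge to \<open>x0\<close> while \<open>f (X k) \<ge> a > f x0\<close>, against
    upper semicontinuity.\<close>
  have "\<exists>k. f (X k) * exp (- (real (Suc k) * N (X k))) < a"
  proof (rule ccontr)
    assume "\<not> ?thesis"
    then have ge: "a \<le> f (X k) * exp (- (real (Suc k) * N (X k)))" for k by (auto simp: not_less)
    have fa: "a \<le> f (X k)" for k
    proof -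
      have "f (X k) * exp (- (real (Suc k) * N (X k))) \<le> f (X k)"
        using X(2)[of k] by (intro mult_left_le) (auto simp: N_def)
      then show ?thesis using ge[of k] by linarith
    qed
    have Nb: "N (X k) \<le> \<bar>ln a\<bar> / real (Suc k)" for k
    proof -
      have "f (X k) * exp (- (real (Suc k) * N (X k))) \<le> exp (- (real (Suc k) * N (X k)))"
        using lcfD(1,2)[OF f X(1)] by (simp add: mult_left_le_one_le)
      then have "a \<le> exp (- (real (Suc k) * N (X k)))" using ge[of k] by linarith
      then have "ln a \<le> - (real (Suc k) * N (X k))" by (rule ln_le_of_le_exp[OF a0])
      then have "real (Suc k) * N (X k) \<le> \<bar>ln a\<bar>" by linarith
      then show ?thesis by (simp add: field_simps)
    qed
    have "X \<longlonglongrightarrow> x0"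
      unfolding tendsto_fun_iff
    proof
      fix i show "(\<lambda>k. X k i) \<longlonglongrightarrow> x0 i"
      proof (cases "i < n")
        case True
        have "(\<lambda>k. X k i - x0 i) \<longlonglongrightarrow> 0"
        proof (rule Lim_null_comparison)
          show "\<forall>\<^sub>F k in sequentially. norm (X k i - x0 i) \<le> sqrt (\<bar>ln a\<bar> / real (Suc k))"
          proof (rule always_eventually, rule allI)
            fix k
            have "(X k i - x0 i)\<^sup>2 \<le> \<bar>ln a\<bar> / real (Suc k)"
              using coord_le_norm[OF True, of "comb n 1 (X k) (-1) x0"] Nb[of k] True by (simp add: N_def)
            then show "norm (X k i - x0 i) \<le> sqrt (\<bar>ln a\<bar> / real (Suc k))" by (metis real_sqrt_abs real_sqrt_le_iff real_norm_def)
          qed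
          have "(\<lambda>k. \<bar>ln a\<bar> / real (Suc k)) \<longlonglongrightarrow> 0" by (rule LIMSEQ_Suc[OF lim_const_over_n])
          from tendsto_real_sqrt[OF this] show "(\<lambda>k. sqrt (\<bar>ln a\<bar> / real (Suc k))) \<longlonglongrightarrow> 0" by simp
        qed
        then show ?thesis by (simp add: LIM_zero_iff)
      next
        case False
        then have "X k i = x0 i" for k using Rn_undefined[OF X(1) False] Rn_undefined[OF x0 False] by simp
        then show ?thesis by simp
      qed
    qed
    from usc_seq[OF lcfD(3)[OF f] this X(1) x0 a]
    have "\<forall>\<^sub>F k in sequentially. False" by eventually_elim (use fa in \<open>auto simp: not_less[symmetric]\<close>)
    then show False by simp
  qed
  then obtain k where k: "f (X k) * exp (- (real (Suc k) * N (X k))) < a" by blast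
  define y where "y = X k" define K where "K = real (Suc k)"
  have y: "y \<in> Rn n" "f y > 0" and K: "K > 0" using X by (auto simp: y_def K_def)
  have max: "f z * exp (- (K * N z)) \<le> f y * exp (- (K * N y))" if "z \<in> Rn n" for z
    using X(3)[OF that, of k] by (simp add: y_def K_def)
  let ?v = "comb n 1 y (-1) x0"
  \<comment> \<open>First-order condition at \<open>y\<close>: on moving by a dyadic fraction
    \<open>t\<close> towards \<open>z\<close>, log-concavity raises \<open>ln f\<close> by at least
    \<open>t * (ln (f z) - ln (f y))\<close>, and the penalty grows by
    \<open>2 * K * t * Rn_inner n ?v ?h\<close> up to order t^2. Division by \<open>t\<close> and
    the limit give the bound.\<close>
  have sub: "f z \<le> f y * exp (2 * K * Rn_inner n ?v (comb n 1 z (-1) y))" if z: "z \<in> Rn n" for z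
  proof (cases "f z > 0")
    case True
    let ?h = "comb n 1 z (-1) y"
    have "ln (f z) - ln (f y) \<le> 2 * K * Rn_inner n ?v ?h"
    proof (rule LIMSEQ_le_const)
      show "(\<lambda>j. 2 * K * Rn_inner n ?v ?h + K * (1/2)^j * Rn_inner n ?h ?h) \<longlonglongrightarrow> 2 * K * Rn_inner n ?v ?h"
        by (auto intro!: tendsto_eq_intros LIMSEQ_power_zero)
      have "ln (f z) - ln (f y) \<le> 2 * K * Rn_inner n ?v ?h + K * (1/2)^j * Rn_inner n ?h ?h" for j
      proof -
        define t where "t = (1/2::real)^j"
        have t: "t > 0" by (simp add: t_def)
        let ?w = "comb n (1 - t) y t z"
        have w: "f ?w > 0" "(1 - t) * ln (f y) + t * ln (f z) \<le> ln (f ?w)"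
          using comb_dyadic_ge[OF f y(1) z y(2) True, of j] by (auto simp: t_def)
        have "ln (f ?w * exp (- (K * N ?w))) \<le> ln (f y * exp (- (K * N y)))"
          using max[of ?w] w(1) y(2) by (subst ln_le_cancel_iff) auto
        then have 1: "ln (f ?w) - K * N ?w \<le> ln (f y) - K * N y" using w(1) y(2) by (simp add: ln_mult)
        have "N ?w = N y + 2 * t * Rn_inner n ?v ?h + t\<^sup>2 * Rn_inner n ?h ?h"
        proof -
          have "comb n 1 ?w (-1) x0 = comb n 1 ?v t ?h" by (rule Rn_ext[of _ n]) (auto simp: algebra_simps)
          then have "N ?w = Rn_inner n (comb n 1 ?v t ?h) (comb n 1 ?v t ?h)" by (simp only: N_def)
          also have "\<dots> = Rn_inner n ?v ?v + 2 * t * Rn_inner n ?v ?h + t\<^sup>2 * Rn_inner n ?h ?h"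
            by (simp only: Rn_inner_comb[of n 1 ?v t ?h] Rn_inner_comb'[of n _ 1 ?v t ?h] Rn_inner_commute[of n ?h ?v])
               (simp add: algebra_simps power2_eq_square)
          finally show ?thesis by (simp only: N_def)
        qed
        then have "t * (ln (f z) - ln (f y)) \<le> t * (2 * K * Rn_inner n ?v ?h + K * t * Rn_inner n ?h ?h)"
          using 1 w(2) by (simp add: algebra_simps power2_eq_square)
        then show ?thesis using t by (simp add: t_def)
      qed
      then show "\<exists>J. \<forall>j\<ge>J. ln (f z) - ln (f y) \<le> 2 * K * Rn_inner n ?v ?h + K * (1/2)^j * Rn_inner n ?h ?h" by blast
    qed
    then have "exp (ln (f z)) \<le> exp (ln (f y) + 2 * K * Rn_inner n ?v ?h)" by simp
    then show ?thesis using True y(2) by (simp add: exp_add)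
  next
    case False
    then have "f z \<le> 0" by simp
    also have "0 \<le> f y * exp (2 * K * Rn_inner n ?v (comb n 1 z (-1) y))" using y(2) by simp
    finally show ?thesis .
  qed
  define \<eta> where "\<eta> = comb n (- 2 * K) ?v 0 ?v"
  define \<kappa> where "\<kappa> = ln (f y) - 2 * K * Rn_inner n ?v y"
  have e: "exp (\<kappa> - Rn_inner n \<eta> z) = f y * exp (2 * K * Rn_inner n ?v (comb n 1 z (-1) y))" for z
  proof -
    have "\<kappa> - Rn_inner n \<eta> z = ln (f y) + 2 * K * Rn_inner n ?v (comb n 1 z (-1) y)"
      unfolding \<kappa>_def \<eta>_def Rn_inner_comb[of n "- 2 * K" ?v 0 ?v] Rn_inner_comb'[of n ?v 1 z "-1" y] by (simp add: algebra_simps)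
    then show ?thesis using y(2) by (simp add: exp_add)
  qed
  have "exp (\<kappa> - Rn_inner n \<eta> x0) \<le> f y * exp (- (K * N y))"
  proof -
    have "comb n 1 x0 (-1) y = comb n (-1) ?v 0 ?v" by (rule Rn_ext[of _ n]) auto
    then have "Rn_inner n ?v (comb n 1 x0 (-1) y) = - N y"
      by (simp add: N_def Rn_inner_comb'[of n ?v "-1" ?v 0 ?v])
    moreover have "0 \<le> N y" by (simp add: N_def)
    ultimately show ?thesis unfolding e using K y(2) by simp
  qed
  also have "\<dots> < a" using k by (simp only: y_def K_def)
  finally have "exp (\<kappa> - Rn_inner n \<eta> x0) < a" .
  moreover have "\<eta> \<in> Rn n" by (simp add: \<eta>_def)
  moreover have "f z \<le> exp (\<kappa> - Rn_inner n \<eta> z)" if "z \<in> Rn n" for z unfolding e by (rule sub[OF that])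
  ultimately show ?thesis by blast
qed

text \<open>If the bidual were larger at \<open>x\<close>, a log-affine majorant of \<open>f\<close>
  would pass strictly below it there. Its slope \<eta> satisfies
  \<open>exp (- \<kappa>) \<le> dual_fun n f \<eta>\<close>, and the constraint on the bidual at
  \<eta> is then violated.\<close>

lemma dual_dual:
  assumes f: "lcf n f" and x: "x \<in> Rn n" shows "dual_fun n (dual_fun n f) x = f x"
proof -
  note fu = lcf_unit[OF f]
  have f0: "\<And>x. x \<in> Rn n \<Longrightarrow> 0 \<le> f x" "f (Rn_zero n) = 1" using fu by (auto simp: unit_fun_def)
  have du: "unit_fun n (dual_fun n f)" by (rule lcf_unit[OF dual_lcf[OF fu]])
  have d0: "\<And>x. x \<in> Rn n \<Longrightarrow> 0 \<le> dual_fun n f x" "dual_fun n f (Rn_zero n) = 1" using du by (auto simp: unit_fun_def)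
  have ge: "f x \<le> dual_fun n (dual_fun n f) x"
  proof (rule dual_ge[of n "dual_fun n f"])
    fix y assume "y \<in> Rn n"
    show "f x * dual_fun n f y \<le> exp (- Rn_inner n x y)"
      using dual_le[of n f x y] f0 x by (simp add: mult.commute Rn_inner_commute[of n x])
  qed (use d0 f0 x in auto)
  moreover have "\<not> f x < dual_fun n (dual_fun n f) x"
  proof
    assume lt: "f x < dual_fun n (dual_fun n f) x"
    obtain \<eta> \<kappa> where \<eta>: "\<eta> \<in> Rn n" "\<And>z. z \<in> Rn n \<Longrightarrow> f z \<le> exp (\<kappa> - Rn_inner n \<eta> z)"
      "exp (\<kappa> - Rn_inner n \<eta> x) < dual_fun n (dual_fun n f) x"
      using affine_majorant[OF f x lt] by blast
    have "exp (- \<kappa>) \<le> dual_fun n f \<eta>"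
    proof (rule dual_ge[of n f])
      fix z assume "z \<in> Rn n"
      from mult_left_mono[OF \<eta>(2)[OF this], of "exp (- \<kappa>)"]
      show "exp (- \<kappa>) * f z \<le> exp (- Rn_inner n \<eta> z)" by (simp add: exp_add[symmetric])
    qed (use f0 in auto)
    then have "dual_fun n (dual_fun n f) x * exp (- \<kappa>) \<le> dual_fun n (dual_fun n f) x * dual_fun n f \<eta>"
      by (intro mult_left_mono dual_nonneg)
    also have "\<dots> \<le> exp (- Rn_inner n x \<eta>)" by (rule dual_le[of n "dual_fun n f"]) (use d0 \<eta> in auto)
    finally have "dual_fun n (dual_fun n f) x * exp (- \<kappa>) * exp \<kappa> \<le> exp (- Rn_inner n x \<eta>) * exp \<kappa>"
      by (intro mult_right_mono) auto
    then have "dual_fun n (dual_fun n f) x \<le> exp (\<kappa> - Rn_inner n \<eta> x)"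
      by (simp add: mult.assoc exp_add[symmetric] Rn_inner_commute[of n x])
    then show False using \<eta>(3) by linarith
  qed
  ultimately show ?thesis by simp
qed

section \<open>The Santalo inequality for even functions\<close>

lemma integral_odd_zero:
  fixes q :: "(nat \<Rightarrow> real) \<Rightarrow> real"
  assumes q: "integrable (Rn_lborel n) q" and odd: "\<And>x. x \<in> Rn n \<Longrightarrow> q (comb n (-1) x 0 x) = - q x"
  shows "has_bochner_integral (Rn_lborel n) q 0"
proof -
  let ?N = "Rn_lborel n"
  have qm: "q \<in> borel_measurable ?N" using q by simp
  have rm: "(\<lambda>x. comb n (-1) x 0 x) \<in> ?N \<rightarrow>\<^sub>M ?N" by measurable
  have d: "distr ?N ?N (\<lambda>x. comb n (-1) x 0 x) = ?N"
  proof (rule measure_eqI)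
    fix A assume "A \<in> sets (distr ?N ?N (\<lambda>x. comb n (-1) x 0 x))"
    then have A[measurable]: "A \<in> sets ?N" by simp
    have "emeasure (distr ?N ?N (\<lambda>x. comb n (-1) x 0 x)) A = (\<integral>\<^sup>+x. indicator A x \<partial>distr ?N ?N (\<lambda>x. comb n (-1) x 0 x))" by simp
    also have "\<dots> = (\<integral>\<^sup>+x. indicator A (comb n (-1) x 0 x) \<partial>?N)" by (rule nn_integral_distr[OF rm]) simp
    also have "\<dots> = (\<integral>\<^sup>+x. indicator A x \<partial>?N)" by (rule nn_integral_refl) simp
    finally show "emeasure (distr ?N ?N (\<lambda>x. comb n (-1) x 0 x)) A = emeasure ?N A" by simp
  qed simp
  have "integral\<^sup>L ?N q = (\<integral>x. q (comb n (-1) x 0 x) \<partial>?N)"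
    using integral_distr[OF rm qm] unfolding d .
  also have "\<dots> = (\<integral>x. - q x \<partial>?N)" by (intro Bochner_Integration.integral_cong) (auto simp: odd)
  also have "\<dots> = - integral\<^sup>L ?N q" by simp
  finally show ?thesis using q by (simp add: has_bochner_integral_iff)
qed

lemma SUP_cube_indicator:
  assumes "x \<in> Rn n" shows "(SUP k. (a :: ennreal) * indicator (cube n (real k)) x) = a"
proof (rule antisym)
  show "(SUP k. a * indicator (cube n (real k)) x) \<le> a" by (intro SUP_least) (auto simp: indicator_def)
  obtain K :: nat where K: "(\<Sum>i<n. \<bar>x i\<bar>) \<le> real K" using real_arch_simple by blast
  have "\<bar>x i\<bar> \<le> real K" if "i < n" for i
    using member_le_sum[of i "{..<n}" "\<lambda>i. \<bar>x i\<bar>"] that K by simp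
  then have "x \<in> cube n (real K)" using assms by (simp add: cube_def)
  then show "a \<le> (SUP k. a * indicator (cube n (real k)) x)" by (intro SUP_upper2[of K]) auto
qed

text \<open>Truncation to cubes respects the symmetry and makes the first moments finite; they
  vanish because their integrands are odd. Monotone convergence removes the truncation.\<close>

lemma santalo_even:
  assumes fm[measurable]: "f \<in> borel_measurable (Rn_lborel n)" and f: "unit_fun n f"
    and even: "\<And>x. x \<in> Rn n \<Longrightarrow> f (comb n (-1) x 0 x) = f x"
  shows "mass n f * mass n (dual_fun n f) \<le> 400^n"
proof -
  let ?N = "Rn_lborel n"
  note [measurable] = lcf_measurable[OF dual_lcf[OF f]]
  have le: "(\<integral>\<^sup>+x. ennreal (f x) * indicator (cube n (real k)) x \<partial>?N) * mass n (dual_fun n f) \<le> 400^n" for k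
  proof -
    define h where "h x = f x * indicator (cube n (real k)) x" for x
    have [measurable]: "h \<in> borel_measurable ?N" unfolding h_def by measurable
    have h01: "0 \<le> h x" "h x \<le> 1" "h x \<le> f x" if "x \<in> Rn n" for x
      using f that by (auto simp: h_def indicator_def unit_fun_def)
    have hz: "h x = 0" if "x \<in> Rn n - cube n (real k)" for x using that by (simp add: h_def)
    have "(\<integral>\<^sup>+x. ennreal (h x) \<partial>?N) * (\<integral>\<^sup>+y. ennreal (dual_fun n f y) \<partial>?N) \<le> ennreal (1 * 400^n)"
    proof (rule santalo[unfolded santalo_def, rule_format])
      show "integrable ?N h"
        by (rule integrable_on_cube[of _ _ "real k" 1]) (use h01 hz in \<open>auto simp: cube_def\<close>)
      show "has_bochner_integral ?N (\<lambda>x. x i * h x) 0" if i: "i < n" for i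
      proof (rule integral_odd_zero)
        have [measurable]: "(\<lambda>x. x i) \<in> borel_measurable ?N" by (rule measurable_coord[OF i])
        show "integrable ?N (\<lambda>x. x i * h x)"
        proof (rule integrable_on_cube[of _ _ "real k" "real k"])
          show "(\<lambda>x. x i * h x) \<in> borel_measurable ?N" by measurable
          fix x assume x: "x \<in> cube n (real k)"
          then have "\<bar>x i\<bar> \<le> real k" "\<bar>h x\<bar> \<le> 1" using i h01[of x] by (auto simp: cube_def)
          then have "\<bar>x i\<bar> * \<bar>h x\<bar> \<le> real k * 1" by (intro mult_mono) auto
          then show "\<bar>x i * h x\<bar> \<le> real k" by (simp add: abs_mult)
        qed (simp add: hz)
        fix x assume x: "x \<in> Rn n"
        have "comb n (-1) x 0 x \<in> cube n (real k) \<longleftrightarrow> x \<in> cube n (real k)" using x by (simp add: cube_def)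
        then show "comb n (-1) x 0 x i * h (comb n (-1) x 0 x) = - (x i * h x)"
          using i even[OF x] by (simp add: h_def indicator_def)
      qed
      fix x y assume x: "x \<in> Rn n" and y: "y \<in> Rn n"
      have "dual_fun n f y * h x \<le> dual_fun n f y * f x" using h01(3)[OF x] dual_nonneg by (intro mult_left_mono) auto
      also have "\<dots> \<le> exp (- Rn_inner n y x)" using f x by (intro dual_le) (auto simp: unit_fun_def)
      finally show "ennreal (h x) * ennreal (dual_fun n f y) \<le> ennreal (1 * exp (- Rn_inner n x y))"
        using h01(1)[OF x] dual_nonneg
        by (simp add: ennreal_mult[symmetric] mult.commute Rn_inner_commute[of n x] ennreal_leI)
    qed (use h01 in auto)
    moreover have "(\<integral>\<^sup>+x. ennreal (h x) \<partial>?N) = (\<integral>\<^sup>+x. ennreal (f x) * indicator (cube n (real k)) x \<partial>?N)"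
      by (intro nn_integral_cong) (auto simp: h_def indicator_def)
    ultimately show ?thesis by (simp add: mass_def ennreal_power[symmetric])
  qed
  have "mass n f = (\<integral>\<^sup>+x. (SUP k. ennreal (f x) * indicator (cube n (real k)) x) \<partial>?N)"
    unfolding mass_def by (intro nn_integral_cong) (simp add: SUP_cube_indicator)
  also have "\<dots> = (SUP k. \<integral>\<^sup>+x. ennreal (f x) * indicator (cube n (real k)) x \<partial>?N)"
  proof (rule nn_integral_monotone_convergence_SUP)
    show "incseq (\<lambda>k x. ennreal (f x) * indicator (cube n (real k)) x)"
    proof (rule monoI, rule le_funI)
      fix k l :: nat and x assume "k \<le> l"
      then have "cube n (real k) \<subseteq> cube n (real l)" by (auto simp: cube_def intro: order_trans)
      then show "ennreal (f x) * indicator (cube n (real k)) x \<le> ennreal (f x) * indicator (cube n (real l)) x"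
        by (intro mult_left_mono) (auto simp: indicator_def)
    qed
  qed measurable
  finally have "mass n f * mass n (dual_fun n f) = (SUP k. (\<integral>\<^sup>+x. ennreal (f x) * indicator (cube n (real k)) x \<partial>?N) * mass n (dual_fun n f))"
    by (simp add: SUP_mult_right_ennreal)
  also have "\<dots> \<le> 400^n" by (intro SUP_least le)
  finally show ?thesis .
qed

section \<open>Log-cosh potentials\<close>

text \<open>The potential \<phi> is an even, smooth soft maximum of the functions |a_k . x| + (ln
  w_k) / l plus \<delta> |x|^2. Large \<open>l\<close> sharpens the maximum; \<delta> provides
  strong convexity.\<close>

locale log_cosh =
  fixes n N :: nat and w :: "nat \<Rightarrow> real" and a :: "nat \<Rightarrow> nat \<Rightarrow> real" and l \<delta> :: real
  assumes N: "N > 0" and w: "\<And>k. k < N \<Longrightarrow> w k > 0" and l: "l > 0" and \<delta>: "\<delta> > 0"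
begin

definition u :: "nat \<Rightarrow> (nat \<Rightarrow> real) \<Rightarrow> real" where "u k x = l * Rn_inner n (a k) x"
definition Z :: "(nat \<Rightarrow> real) \<Rightarrow> real" where "Z x = (\<Sum>k<N. w k * cosh (u k x))"
definition G :: "nat \<Rightarrow> (nat \<Rightarrow> real) \<Rightarrow> real" where "G i x = (\<Sum>k<N. w k * a k i * sinh (u k x))"
definition A :: "nat \<Rightarrow> nat \<Rightarrow> (nat \<Rightarrow> real) \<Rightarrow> real" where "A i j x = (\<Sum>k<N. w k * a k i * a k j * cosh (u k x))"
definition \<phi> :: "(nat \<Rightarrow> real) \<Rightarrow> real" where "\<phi> x = ln (Z x) / l + \<delta> * Rn_inner n x x"
definition V :: "(nat \<Rightarrow> real) \<Rightarrow> nat \<Rightarrow> real" where "V x = (\<lambda>i\<in>{..<n}. G i x / Z x + 2 * \<delta> * x i)"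
definition M :: "(nat \<Rightarrow> real) \<Rightarrow> nat \<Rightarrow> nat \<Rightarrow> real" where
  "M x i j = l * (A i j x / Z x - G i x * G j x / (Z x)\<^sup>2) + (if i = j then 2 * \<delta> else 0)"
text \<open>\<open>V\<close> is the gradient of \<phi> and \<open>M\<close> its Hessian. The average
  of the Hessian over the segment from \<open>y\<close> to \<open>x\<close> is a slope matrix that
  is continuous also where \<open>x = y\<close>.\<close>

definition Q :: "(nat \<Rightarrow> real) \<Rightarrow> (nat \<Rightarrow> real) \<Rightarrow> nat \<Rightarrow> nat \<Rightarrow> real" where
  "Q x y i j = integral {0..1} (\<lambda>s. M (comb n 1 y s (comb n 1 x (-1) y)) i j)"

lemma Z_pos: "Z x > 0"
  unfolding Z_def using N w by (intro sum_pos) (auto intro!: mult_pos_pos)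

lemma Z_nz [simp]: "Z x \<noteq> 0" using Z_pos[of x] by simp

lemma u_line: "u k (comb n 1 y s h) = u k y + s * u k h"
  by (simp add: u_def Rn_inner_comb' algebra_simps)

lemma sum_G: "(\<Sum>i<n. G i x * h i) = (\<Sum>k<N. w k * Rn_inner n (a k) h * sinh (u k x))"
proof -
  have "(\<Sum>i<n. G i x * h i) = (\<Sum>i<n. \<Sum>k<N. w k * sinh (u k x) * (a k i * h i))"
    by (simp add: G_def sum_distrib_left sum_distrib_right mult_ac)
  also have "\<dots> = (\<Sum>k<N. \<Sum>i<n. w k * sinh (u k x) * (a k i * h i))" by (rule sum.swap)
  finally show ?thesis by (simp add: Rn_inner_def sum_distrib_left sum_distrib_right mult_ac)
qed

lemma sum_A: "(\<Sum>j<n. A i j x * h j) = (\<Sum>k<N. w k * a k i * Rn_inner n (a k) h * cosh (u k x))"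
proof -
  have "(\<Sum>j<n. A i j x * h j) = (\<Sum>j<n. \<Sum>k<N. w k * a k i * cosh (u k x) * (a k j * h j))"
    by (simp add: A_def sum_distrib_left sum_distrib_right mult_ac)
  also have "\<dots> = (\<Sum>k<N. \<Sum>j<n. w k * a k i * cosh (u k x) * (a k j * h j))" by (rule sum.swap)
  finally show ?thesis by (simp add: Rn_inner_def sum_distrib_left sum_distrib_right mult_ac)
qed

lemma sum_AA: "(\<Sum>i<n. \<Sum>j<n. A i j x * h i * h j) = (\<Sum>k<N. w k * cosh (u k x) * (Rn_inner n (a k) h)\<^sup>2)"
proof -
  have "(\<Sum>i<n. \<Sum>j<n. A i j x * h i * h j) = (\<Sum>i<n. h i * (\<Sum>j<n. A i j x * h j))"
    by (simp add: sum_distrib_left mult_ac)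
  also have "\<dots> = (\<Sum>i<n. \<Sum>k<N. w k * Rn_inner n (a k) h * cosh (u k x) * (a k i * h i))"
    unfolding sum_A sum_distrib_left by (simp add: mult_ac)
  also have "\<dots> = (\<Sum>k<N. \<Sum>i<n. w k * Rn_inner n (a k) h * cosh (u k x) * (a k i * h i))" by (rule sum.swap)
  also have "\<dots> = (\<Sum>k<N. w k * Rn_inner n (a k) h * cosh (u k x) * Rn_inner n (a k) h)"
    by (simp add: Rn_inner_def sum_distrib_left)
  finally show ?thesis by (simp add: power2_eq_square mult_ac)
qed

lemma Z_deriv:
  "((\<lambda>s. Z (comb n 1 y s h)) has_real_derivative l * (\<Sum>i<n. G i (comb n 1 y s h) * h i)) (at s)"
  unfolding Z_def sum_G u_line
  by (auto intro!: derivative_eq_intros simp: sum_distrib_left u_def[of _ h] mult_ac)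

lemma G_deriv:
  "((\<lambda>s. G i (comb n 1 y s h)) has_real_derivative l * (\<Sum>j<n. A i j (comb n 1 y s h) * h j)) (at s)"
  unfolding G_def sum_A u_line
  by (auto intro!: derivative_eq_intros simp: sum_distrib_left u_def[of _ h] mult_ac)

lemma V_deriv:
  assumes i: "i < n"
  shows "((\<lambda>s. V (comb n 1 y s h) i) has_real_derivative (\<Sum>j<n. M (comb n 1 y s h) i j * h j)) (at s)"
proof -
  let ?x = "comb n 1 y s h"
  have "((\<lambda>s. G i (comb n 1 y s h) / Z (comb n 1 y s h) + 2 * \<delta> * (y i + s * h i)) has_real_derivative
     ((l * (\<Sum>j<n. A i j ?x * h j)) * Z ?x - G i ?x * (l * (\<Sum>j<n. G j ?x * h j))) / (Z ?x * Z ?x) + 2 * \<delta> * h i) (at s)"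
    by (auto intro!: derivative_eq_intros Z_deriv G_deriv)
  also have "(\<lambda>s. G i (comb n 1 y s h) / Z (comb n 1 y s h) + 2 * \<delta> * (y i + s * h i)) = (\<lambda>s. V (comb n 1 y s h) i)"
    using i by (simp add: V_def)
  also have "((l * (\<Sum>j<n. A i j ?x * h j)) * Z ?x - G i ?x * (l * (\<Sum>j<n. G j ?x * h j))) / (Z ?x * Z ?x) + 2 * \<delta> * h i
     = (\<Sum>j<n. M ?x i j * h j)"
  proof -
    have "(\<Sum>j<n. M ?x i j * h j) = (\<Sum>j<n. l / Z ?x * (A i j ?x * h j) - l * G i ?x / (Z ?x)\<^sup>2 * (G j ?x * h j) + (if i = j then 2 * \<delta> * h j else 0))"
      by (intro sum.cong refl) (simp add: M_def field_simps)
    also have "\<dots> = l / Z ?x * (\<Sum>j<n. A i j ?x * h j) - l * G i ?x / (Z ?x)\<^sup>2 * (\<Sum>j<n. G j ?x * h j) + 2 * \<delta> * h i"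
      using i by (simp add: sum.distrib sum_subtractf sum_distrib_left)
    finally show ?thesis by (simp add: field_simps power2_eq_square)
  qed
  finally show ?thesis .
qed

lemma phi_deriv:
  "((\<lambda>s. \<phi> (comb n 1 y s h)) has_real_derivative Rn_inner n (V (comb n 1 y s h)) h) (at s)"
proof -
  let ?x = "comb n 1 y s h"
  have q: "Rn_inner n (comb n 1 y s h) (comb n 1 y s h) = Rn_inner n y y + 2 * s * Rn_inner n y h + s\<^sup>2 * Rn_inner n h h" for s
    by (simp add: Rn_inner_comb Rn_inner_comb' Rn_inner_commute[of n h y] algebra_simps power2_eq_square)
  have "((\<lambda>s. \<phi> (comb n 1 y s h)) has_real_derivative
     (l * (\<Sum>i<n. G i ?x * h i)) / Z ?x / l + \<delta> * (2 * Rn_inner n y h + 2 * s * Rn_inner n h h)) (at s)"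
    unfolding \<phi>_def q
    by (auto intro!: derivative_eq_intros Z_deriv simp: Z_pos divide_simps l) (simp add: algebra_simps)
  moreover have "(l * (\<Sum>i<n. G i ?x * h i)) / Z ?x / l + \<delta> * (2 * Rn_inner n y h + 2 * s * Rn_inner n h h) = Rn_inner n (V ?x) h"
  proof -
    have "Rn_inner n (V ?x) h = (\<Sum>i<n. G i ?x * h i / Z ?x + 2 * \<delta> * (?x i * h i))"
      unfolding Rn_inner_def by (intro sum.cong refl) (simp add: V_def field_simps)
    also have "\<dots> = (\<Sum>i<n. G i ?x * h i) / Z ?x + 2 * \<delta> * Rn_inner n ?x h"
      by (simp only: sum.distrib sum_divide_distrib sum_distrib_left Rn_inner_def)
    finally show ?thesis using l by (simp add: Rn_inner_comb algebra_simps)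
  qed
  ultimately show ?thesis by simp
qed

lemma u_cont: "continuous_on S (u k)"
  unfolding u_def Rn_inner_def
  by (intro continuous_intros continuous_on_subset[OF continuous_on_product_coordinates]) auto

lemma cosh_cont: "continuous_on S (\<lambda>x. cosh (u k x))" "continuous_on S (\<lambda>x. sinh (u k x))"
  by (rule continuous_on_compose2[OF _ u_cont, where t=UNIV]; auto intro!: continuous_intros)+

lemma ZGA_cont: "continuous_on S Z" "continuous_on S (G i)" "continuous_on S (A i j)"
  unfolding Z_def G_def A_def by (intro continuous_intros cosh_cont)+

lemma M_cont: "continuous_on S (\<lambda>x. M x i j)"
  unfolding M_def by (intro continuous_intros ZGA_cont) auto

lemma V_cont: "i < n \<Longrightarrow> continuous_on S (\<lambda>x. V x i)"
  unfolding V_def by (simp, intro continuous_intros ZGA_cont continuous_on_subset[OF continuous_on_product_coordinates]) auto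

lemma M_line_cont: "continuous_on S (\<lambda>s. M (comb n 1 y s h) i j)"
proof (rule continuous_on_compose2[OF M_cont[of UNIV]])
  show "continuous_on S (\<lambda>s. comb n 1 y s h)"
  proof (rule continuous_on_coordinatewise_then_product)
    fix i show "continuous_on S (\<lambda>s. comb n 1 y s h i)"
      by (cases "i < n") (auto simp: comb_def intro!: continuous_intros)
  qed
qed simp

lemma Q_cont: "continuous_on (Rn n \<times> Rn n) (\<lambda>p. Q (fst p) (snd p) i j)"
proof -
  have "continuous_on ((Rn n \<times> Rn n) \<times> cbox 0 1) (\<lambda>(p, s). M (comb n 1 (snd p) s (comb n 1 (fst p) (-1) (snd p))) i j)"
    unfolding case_prod_beta'
  proof (rule continuous_on_compose2[OF M_cont[of UNIV]])
    show "continuous_on ((Rn n \<times> Rn n) \<times> cbox 0 (1::real)) (\<lambda>x. comb n 1 (snd (fst x)) (snd x) (comb n 1 (fst (fst x)) (- 1) (snd (fst x))))"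
    proof (rule continuous_on_coordinatewise_then_product)
      fix i
      have c: "continuous_on S (\<lambda>x. fst (fst x) i)" "continuous_on S (\<lambda>x. snd (fst x) i)" for S :: "(((nat \<Rightarrow> real) \<times> (nat \<Rightarrow> real)) \<times> real) set"
        by (rule continuous_on_compose2[OF continuous_on_product_coordinates[of i]]; auto intro!: continuous_intros)+
      show "continuous_on ((Rn n \<times> Rn n) \<times> cbox 0 (1::real)) (\<lambda>x. comb n 1 (snd (fst x)) (snd x) (comb n 1 (fst (fst x)) (- 1) (snd (fst x))) i)"
        by (cases "i < n") (auto simp: comb_def intro!: continuous_intros c)
    qed
  qed simp
  from integral_continuous_on_param[OF this] show ?thesis
    by (simp add: Q_def)
qed

lemma V_slope:
  assumes x: "x \<in> Rn n" and y: "y \<in> Rn n" and i: "i < n"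
  shows "V x i - V y i = (\<Sum>j<n. Q x y i j * (x j - y j))"
proof -
  let ?h = "comb n 1 x (-1) y"
  have e: "comb n 1 y 1 ?h = x" "comb n 1 y 0 ?h = y" using x y by (auto intro!: Rn_ext[of _ n])
  have "((\<lambda>s. \<Sum>j<n. M (comb n 1 y s ?h) i j * ?h j) has_integral V (comb n 1 y 1 ?h) i - V (comb n 1 y 0 ?h) i) {0..1}"
    using V_deriv[OF i, of y ?h] unfolding has_real_derivative_iff_has_vector_derivative
    by (rule fundamental_theorem_of_calculus[OF zero_le_one has_vector_derivative_at_within])
  then have "V x i - V y i = integral {0..1} (\<lambda>s. \<Sum>j<n. M (comb n 1 y s ?h) i j * ?h j)"
    unfolding e by (simp add: integral_unique)
  also have "\<dots> = (\<Sum>j<n. integral {0..1} (\<lambda>s. M (comb n 1 y s ?h) i j * ?h j))"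
    by (intro integral_sum integrable_continuous_real continuous_intros M_line_cont) simp
  also have "\<dots> = (\<Sum>j<n. Q x y i j * (x j - y j))"
    by (intro sum.cong refl) (simp add: Q_def)
  finally show ?thesis .
qed

text \<open>The Hessian of the logarithmic part is l times a mean of squares minus a squared
  sinh-weighted mean. Since |sinh| \<le> cosh, the Cauchy--Schwarz inequality with weights
  \<open>w k * cosh (u k x)\<close> makes this nonnegative.\<close>

lemma M_pos: "2 * \<delta> * (\<Sum>i<n. (h i)\<^sup>2) \<le> (\<Sum>i<n. \<Sum>j<n. M x i j * h i * h j)"
proof -
  define b where "b k = Rn_inner n (a k) h" for k
  have "(\<Sum>k<N. w k * b k * sinh (u k x))\<^sup>2 \<le> (\<Sum>k<N. w k * cosh (u k x) * \<bar>b k\<bar>)\<^sup>2"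
  proof -
    have "\<bar>\<Sum>k<N. w k * b k * sinh (u k x)\<bar> \<le> (\<Sum>k<N. \<bar>w k * b k * sinh (u k x)\<bar>)" by (rule sum_abs)
    also have "\<dots> \<le> (\<Sum>k<N. w k * cosh (u k x) * \<bar>b k\<bar>)"
    proof (rule sum_mono)
      fix k assume "k \<in> {..<N}"
      then have "w k > 0" using w by simp
      moreover have "\<bar>sinh (u k x)\<bar> \<le> cosh (u k x)"
        using sinh_less_cosh_real[of "u k x"] sinh_less_cosh_real[of "- u k x"] by (simp add: abs_le_iff)
      ultimately show "\<bar>w k * b k * sinh (u k x)\<bar> \<le> w k * cosh (u k x) * \<bar>b k\<bar>"
        by (simp add: abs_mult mult_ac mult_left_mono)
    qed
    finally have "\<bar>\<Sum>k<N. w k * b k * sinh (u k x)\<bar>\<^sup>2 \<le> (\<Sum>k<N. w k * cosh (u k x) * \<bar>b k\<bar>)\<^sup>2"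
      by (rule power_mono) (rule abs_ge_zero)
    then show ?thesis by (simp only: power2_abs)
  qed
  also have "\<dots> = (\<Sum>k<N. sqrt (w k * cosh (u k x)) * (sqrt (w k * cosh (u k x)) * \<bar>b k\<bar>))\<^sup>2"
  proof (intro arg_cong[where f="\<lambda>x. x\<^sup>2"] sum.cong refl)
    fix k assume "k \<in> {..<N}"
    then have "0 \<le> w k * cosh (u k x)" using w by (simp add: less_imp_le)
    then have "sqrt (w k * cosh (u k x)) * sqrt (w k * cosh (u k x)) = w k * cosh (u k x)" by (rule real_sqrt_mult_self[THEN trans, OF abs_of_nonneg])
    then show "w k * cosh (u k x) * \<bar>b k\<bar> = sqrt (w k * cosh (u k x)) * (sqrt (w k * cosh (u k x)) * \<bar>b k\<bar>)"
      unfolding mult.assoc[symmetric] by (simp only:)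
  qed
  also have "\<dots> \<le> (\<Sum>k<N. (sqrt (w k * cosh (u k x)))\<^sup>2) * (\<Sum>k<N. (sqrt (w k * cosh (u k x)) * \<bar>b k\<bar>)\<^sup>2)"
    by (rule Cauchy_Schwarz_ineq_sum)
  also have "\<dots> = Z x * (\<Sum>k<N. w k * cosh (u k x) * (b k)\<^sup>2)"
    using w by (simp add: Z_def power_mult_distrib less_imp_le)
  finally have cs: "(\<Sum>k<N. w k * b k * sinh (u k x))\<^sup>2 / (Z x)\<^sup>2 \<le> (\<Sum>k<N. w k * cosh (u k x) * (b k)\<^sup>2) / Z x"
    using Z_pos[of x] by (simp add: divide_simps power2_eq_square mult_ac)
  have "(\<Sum>i<n. \<Sum>j<n. M x i j * h i * h j) = (\<Sum>i<n. \<Sum>j<n. l / Z x * (A i j x * h i * h j) - l / (Z x)\<^sup>2 * ((G i x * h i) * (G j x * h j)) + (if i = j then 2 * \<delta> * (h i * h j) else 0))"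
    by (intro sum.cong refl) (simp add: M_def field_simps)
  also have "\<dots> = l / Z x * (\<Sum>i<n. \<Sum>j<n. A i j x * h i * h j) - l / (Z x)\<^sup>2 * ((\<Sum>i<n. G i x * h i) * (\<Sum>j<n. G j x * h j)) + 2 * \<delta> * (\<Sum>i<n. (h i)\<^sup>2)"
  proof -
    have 1: "(\<Sum>i<n. \<Sum>j<n. c * f i j) = c * (\<Sum>i<n. \<Sum>j<n. f i j)" for c :: real and f
      by (simp only: sum_distrib_left)
    have 3: "(\<Sum>i<n. \<Sum>j<n. if i = j then 2 * \<delta> * (h i * h j) else 0) = 2 * \<delta> * (\<Sum>i<n. (h i)\<^sup>2)"
      by (simp add: sum_distrib_left power2_eq_square)
    show ?thesis by (simp only: sum.distrib sum_subtractf 1 3 sum_product)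
  qed
  also have "\<dots> = l * ((\<Sum>k<N. w k * cosh (u k x) * (b k)\<^sup>2) / Z x - (\<Sum>k<N. w k * b k * sinh (u k x))\<^sup>2 / (Z x)\<^sup>2) + 2 * \<delta> * (\<Sum>i<n. (h i)\<^sup>2)"
    unfolding sum_AA sum_G b_def by (simp add: right_diff_distrib power2_eq_square)
  finally show ?thesis using cs l by simp
qed

lemma Q_pos: "pos_form n (2 * \<delta>) (Q x y)"
  unfolding pos_form_def
proof
  fix h :: "nat \<Rightarrow> real"
  let ?x = "\<lambda>s. comb n 1 y s (comb n 1 x (-1) y)"
  have "(\<Sum>i<n. \<Sum>j<n. Q x y i j * h i * h j) = integral {0..1} (\<lambda>s. \<Sum>i<n. \<Sum>j<n. M (?x s) i j * h i * h j)"
  proof -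
    have "(\<Sum>i<n. \<Sum>j<n. Q x y i j * h i * h j) = (\<Sum>i<n. \<Sum>j<n. integral {0..1} (\<lambda>s. M (?x s) i j * h i * h j))"
      by (simp add: Q_def mult.assoc)
    also have "\<dots> = (\<Sum>i<n. integral {0..1} (\<lambda>s. \<Sum>j<n. M (?x s) i j * h i * h j))"
      by (intro sum.cong refl integral_sum[symmetric] integrable_continuous_real continuous_intros M_line_cont) simp
    also have "\<dots> = integral {0..1} (\<lambda>s. \<Sum>i<n. \<Sum>j<n. M (?x s) i j * h i * h j)"
      by (intro integral_sum[symmetric] integrable_continuous_real continuous_intros M_line_cont) simp
    finally show ?thesis .
  qed
  moreover have "integral {0..1::real} (\<lambda>s. 2 * \<delta> * (\<Sum>i<n. (h i)\<^sup>2)) \<le> integral {0..1} (\<lambda>s. \<Sum>i<n. \<Sum>j<n. M (?x s) i j * h i * h j)"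
    by (intro integral_le integrable_continuous_real continuous_intros M_line_cont M_pos)
  ultimately show "2 * \<delta> * (\<Sum>i<n. (h i)\<^sup>2) \<le> (\<Sum>i<n. \<Sum>j<n. Q x y i j * h i * h j)" by simp
qed

definition K :: real where "K = (\<Sum>k<N. \<Sum>i<n. \<bar>a k i\<bar>)"

lemma a_le_K: "k < N \<Longrightarrow> i < n \<Longrightarrow> \<bar>a k i\<bar> \<le> K"
proof -
  assume k: "k < N" and i: "i < n"
  have "\<bar>a k i\<bar> \<le> (\<Sum>i<n. \<bar>a k i\<bar>)" using i by (intro member_le_sum) auto
  also have "\<dots> \<le> K" unfolding K_def using k by (intro member_le_sum[of k _ "\<lambda>k. \<Sum>i<n. \<bar>a k i\<bar>"]) (auto intro: sum_nonneg)
  finally show ?thesis .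
qed

lemma K_nonneg: "0 \<le> K" unfolding K_def by (intro sum_nonneg) auto

text \<open>The quotients of \<open>A\<close> and \<open>G\<close> by \<open>Z\<close> are weighted
  means of products and of single entries of the bounded coefficients \<open>a\<close>; for
  \<open>G\<close> this uses |sinh| \<le> cosh.\<close>

lemma M_bound:
  assumes ij: "i < n" "j < n" shows "\<bar>M x i j\<bar> \<le> l * (2 * K\<^sup>2) + 2 * \<delta>"
proof -
  have "\<bar>A i j x\<bar> \<le> (\<Sum>k<N. \<bar>w k * a k i * a k j * cosh (u k x)\<bar>)" unfolding A_def by (rule sum_abs)
  also have "\<dots> \<le> (\<Sum>k<N. K\<^sup>2 * (w k * cosh (u k x)))"
  proof (rule sum_mono)
    fix k assume "k \<in> {..<N}"
    then have k: "w k > 0" "\<bar>a k i\<bar> * \<bar>a k j\<bar> \<le> K * K" using w a_le_K ij K_nonneg by (auto intro!: mult_mono)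
    then have "(\<bar>a k i\<bar> * \<bar>a k j\<bar>) * (w k * cosh (u k x)) \<le> (K * K) * (w k * cosh (u k x))" by (intro mult_right_mono) auto
    then show "\<bar>w k * a k i * a k j * cosh (u k x)\<bar> \<le> K\<^sup>2 * (w k * cosh (u k x))"
      using k(1) by (simp add: abs_mult power2_eq_square mult_ac)
  qed
  also have "\<dots> = K\<^sup>2 * Z x" by (simp add: Z_def sum_distrib_left)
  finally have Ab: "\<bar>A i j x / Z x\<bar> \<le> K\<^sup>2" using Z_pos[of x] by (simp add: abs_divide divide_le_eq)
  have Gb: "\<bar>G m x / Z x\<bar> \<le> K" if m: "m < n" for m
  proof -
    have "\<bar>G m x\<bar> \<le> (\<Sum>k<N. \<bar>w k * a k m * sinh (u k x)\<bar>)" unfolding G_def by (rule sum_abs)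
    also have "\<dots> \<le> (\<Sum>k<N. K * (w k * cosh (u k x)))"
    proof (rule sum_mono)
      fix k assume "k \<in> {..<N}"
      then have k: "w k > 0" "\<bar>a k m\<bar> \<le> K" using w a_le_K m by auto
      moreover have "\<bar>sinh (u k x)\<bar> \<le> cosh (u k x)"
        using sinh_less_cosh_real[of "u k x"] sinh_less_cosh_real[of "- u k x"] by (simp add: abs_le_iff)
      ultimately have "\<bar>a k m\<bar> * (w k * \<bar>sinh (u k x)\<bar>) \<le> K * (w k * cosh (u k x))"
        using K_nonneg by (intro mult_mono) auto
      then show "\<bar>w k * a k m * sinh (u k x)\<bar> \<le> K * (w k * cosh (u k x))"
        using k(1) by (simp add: abs_mult mult_ac)
    qed
    also have "\<dots> = K * Z x" by (simp add: Z_def sum_distrib_left)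
    finally show ?thesis using Z_pos[of x] by (simp add: abs_divide divide_le_eq)
  qed
  have "\<bar>G i x / Z x\<bar> * \<bar>G j x / Z x\<bar> \<le> K * K" using Gb[OF ij(1)] Gb[OF ij(2)] K_nonneg by (intro mult_mono) auto
  moreover have "G i x * G j x / (Z x)\<^sup>2 = (G i x / Z x) * (G j x / Z x)" by (simp add: power2_eq_square)
  ultimately have "\<bar>G i x * G j x / (Z x)\<^sup>2\<bar> \<le> K\<^sup>2" by (simp only: abs_mult power2_eq_square)
  then have "\<bar>A i j x / Z x - G i x * G j x / (Z x)\<^sup>2\<bar> \<le> 2 * K\<^sup>2"
    using order_trans[OF abs_triangle_ineq4 add_mono[OF Ab]] by fastforce
  then have "\<bar>l * (A i j x / Z x - G i x * G j x / (Z x)\<^sup>2)\<bar> \<le> l * (2 * K\<^sup>2)"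
    using l by (simp add: abs_mult del: abs_divide)
  moreover have "\<bar>if i = j then 2 * \<delta> else 0\<bar> \<le> 2 * \<delta>" using \<delta> by simp
  ultimately show ?thesis unfolding M_def by (rule order_trans[OF abs_triangle_ineq add_mono])
qed

lemma Q_bound: "i < n \<Longrightarrow> j < n \<Longrightarrow> \<bar>Q x y i j\<bar> \<le> l * (2 * K\<^sup>2) + 2 * \<delta>"
proof -
  assume ij: "i < n" "j < n"
  have "norm (Q x y i j) \<le> (l * (2 * K\<^sup>2) + 2 * \<delta>) * (1 - 0)"
    unfolding Q_def using M_bound[OF ij] by (intro integral_bound M_line_cont) auto
  then show ?thesis by simp
qed

sublocale monotone_field n V Q "2 * \<delta>" "l * (2 * K\<^sup>2) + 2 * \<delta>"
proof
  show "V (Rn_zero n) i = 0" if "i < n" for i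
    using that by (simp add: V_def G_def u_def)
qed (use \<delta> V_cont Q_cont V_slope Q_pos Q_bound in auto)

text \<open>By the mean value theorem the increment of \<phi> is a directional derivative at an
  intermediate point, and monotonicity of \<open>V\<close> compares it with the one at
  \<open>x\<close>.\<close>

lemma phi_subgradient:
  assumes x: "x \<in> Rn n" and z: "z \<in> Rn n"
  shows "\<phi> x + Rn_inner n (V x) (comb n 1 z (-1) x) \<le> \<phi> z"
proof -
  let ?h = "comb n 1 z (-1) x"
  have e: "comb n 1 x 1 ?h = z" "comb n 1 x 0 ?h = x" using x z by (auto intro!: Rn_ext[of _ n])
  obtain s where s: "0 < s" "s < 1" "\<phi> (comb n 1 x 1 ?h) - \<phi> (comb n 1 x 0 ?h) = (1 - 0) * Rn_inner n (V (comb n 1 x s ?h)) ?h"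
    using MVT2[of 0 1 "\<lambda>s. \<phi> (comb n 1 x s ?h)" "\<lambda>s. Rn_inner n (V (comb n 1 x s ?h)) ?h"] phi_deriv by auto
  let ?y = "comb n 1 x s ?h"
  have "s * (Rn_inner n (V ?y) ?h - Rn_inner n (V x) ?h) = (\<Sum>i<n. (V ?y i - V x i) * (?y i - x i))"
    by (simp add: Rn_inner_def sum_distrib_left sum_subtractf[symmetric] algebra_simps)
  also have "\<dots> = (\<Sum>i<n. \<Sum>j<n. Q ?y x i j * (?y i - x i) * (?y j - x j))"
    using x by (intro sum.cong refl) (simp add: V_slope sum_distrib_left sum_distrib_right mult_ac)
  also have "\<dots> \<ge> 2 * \<delta> * (\<Sum>i<n. (?y i - x i)\<^sup>2)"
    using Q_pos[of ?y x, unfolded pos_form_def, THEN spec, of "\<lambda>i. ?y i - x i"] .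
  finally have "2 * \<delta> * (\<Sum>i<n. (?y i - x i)\<^sup>2) \<le> s * (Rn_inner n (V ?y) ?h - Rn_inner n (V x) ?h)" .
  moreover have "0 \<le> 2 * \<delta> * (\<Sum>i<n. (?y i - x i)\<^sup>2)" using \<delta> by (intro mult_nonneg_nonneg sum_nonneg) auto
  ultimately have "0 \<le> s * (Rn_inner n (V ?y) ?h - Rn_inner n (V x) ?h)" by (rule order_trans[rotated])
  then have "Rn_inner n (V x) ?h \<le> Rn_inner n (V ?y) ?h" using s(1) by (simp add: zero_le_mult_iff)
  then show ?thesis using s(3) unfolding e by simp
qed

lemma phi_even: "\<phi> (comb n (-1) x 0 x) = \<phi> x"
proof -
  have "u k (comb n (-1) x 0 x) = - u k x" for k by (simp add: u_def Rn_inner_comb')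
  then show ?thesis unfolding \<phi>_def Z_def by (simp add: Rn_inner_comb Rn_inner_comb')
qed

text \<open>Evenness replaces \<open>y\<close> by its negative, which accounts for the minus sign of
  the first component of \<open>F\<close>. The proof adds the subgradient inequalities at the
  midpoint.\<close>

lemma phi_midpoint:
  assumes x: "x \<in> Rn n" and y: "y \<in> Rn n"
  shows "\<phi> (comb n (1/2) x (-1/2) y) \<le> (\<phi> x + \<phi> y) / 2"
proof -
  let ?m = "comb n (1/2) x (-1/2) y" and ?y = "comb n (-1) y 0 y"
  have "\<phi> ?m + Rn_inner n (V ?m) (comb n 1 x (-1) ?m) \<le> \<phi> x" by (rule phi_subgradient) (auto simp: x)
  moreover have "\<phi> ?m + Rn_inner n (V ?m) (comb n 1 ?y (-1) ?m) \<le> \<phi> y"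
    using phi_subgradient[of ?m ?y] by (simp add: phi_even)
  moreover have "Rn_inner n (V ?m) (comb n 1 x (-1) ?m) + Rn_inner n (V ?m) (comb n 1 ?y (-1) ?m) = 0"
    by (simp add: Rn_inner_comb')
  ultimately show ?thesis by simp
qed

text \<open>The subgradient inequality makes exp(\<phi>(x) - x . V x) a lower bound for the dual at
  V x. Midpoint convexity of \<phi> and midpoint log-concavity of the dual then verify the
  hypothesis of \<open>mass_product_ge\<close>.\<close>

theorem mass_dual_ge:
  assumes f: "unit_fun n f" and le: "\<And>x. x \<in> Rn n \<Longrightarrow> f x \<le> exp (- \<phi> x)"
  shows "ennreal ((2 * pi) ^ n) \<le> 4 ^ n * (mass n (\<lambda>x. exp (- \<phi> x)) * mass n (dual_fun n f))"
proof (rule mass_product_ge)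
  have "\<phi> \<in> borel_measurable (Rn_lborel n)"
    unfolding \<phi>_def[abs_def] Rn_inner_def
    by (intro measurable_continuous_Rn continuous_intros ZGA_cont continuous_on_subset[OF continuous_on_product_coordinates]) (use l in auto)
  then show "(\<lambda>x. exp (- \<phi> x)) \<in> borel_measurable (Rn_lborel n)" by measurable
  note d = dual_lcf[OF f]
  show "dual_fun n f \<in> borel_measurable (Rn_lborel n)" by (rule lcf_measurable[OF d])
  have VR: "V x \<in> Rn n" for x by (simp add: V_def Rn_def)
  have dV: "exp (\<phi> x - Rn_inner n x (V x)) \<le> dual_fun n f (V x)" if x: "x \<in> Rn n" for x
  proof (rule dual_ge[of n f])
    fix z assume z: "z \<in> Rn n"
    have "exp (\<phi> x - Rn_inner n x (V x)) * f z \<le> exp (\<phi> x - Rn_inner n x (V x)) * exp (- \<phi> z)"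
      using le[OF z] by (intro mult_left_mono) auto
    also have "\<dots> \<le> exp (- Rn_inner n (V x) z)"
      using phi_subgradient[OF x z] by (simp add: exp_add[symmetric] Rn_inner_comb' Rn_inner_commute[of n x])
    finally show "exp (\<phi> x - Rn_inner n x (V x)) * f z \<le> exp (- Rn_inner n (V x) z)" .
  qed (use f in \<open>auto simp: unit_fun_def\<close>)
  fix x y assume x: "x \<in> Rn n" and y: "y \<in> Rn n"
  let ?g = "dual_fun n f (comb n (1/2) (V x) (1/2) (V y))"
  have e: "(exp (t / 2))\<^sup>2 = exp t" for t :: real by (simp add: exp_double[symmetric])
  have "exp (\<phi> x - Rn_inner n x (V x)) * exp (\<phi> y - Rn_inner n y (V y)) \<le> dual_fun n f (V x) * dual_fun n f (V y)"
    using dV[OF x] dV[OF y] by (intro mult_mono) (auto simp: dual_nonneg)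
  also have "\<dots> \<le> ?g\<^sup>2" by (rule lcfD(5)[OF d VR VR])
  finally have "(exp ((\<phi> x - Rn_inner n x (V x) + (\<phi> y - Rn_inner n y (V y))) / 2))\<^sup>2 \<le> ?g\<^sup>2"
    by (simp only: exp_add[symmetric] e)
  then have g: "exp ((\<phi> x - Rn_inner n x (V x) + (\<phi> y - Rn_inner n y (V y))) / 2) \<le> ?g"
    by (rule power2_le_imp_le) (rule dual_nonneg)
  \<comment> \<open>The two midpoint bounds together yield half of the pairings in the exponent;
    nonnegativity allows passing to the full pairings.\<close>
  have "0 \<le> Rn_inner n x (V x)" "0 \<le> Rn_inner n y (V y)"
    using inner_V_ge[OF x] inner_V_ge[OF y] \<delta> by (meson Rn_inner_nonneg less_imp_le mult_nonneg_nonneg mult_pos_pos order_trans zero_less_numeral)+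
  then have "exp (- (Rn_inner n x (V x) + Rn_inner n y (V y))) \<le> exp (- ((\<phi> x + \<phi> y) / 2)) * exp ((\<phi> x - Rn_inner n x (V x) + (\<phi> y - Rn_inner n y (V y))) / 2)"
    by (simp add: exp_add[symmetric] field_simps)
  also have "\<dots> \<le> exp (- \<phi> (comb n (1/2) x (-1/2) y)) * ?g"
    using g phi_midpoint[OF x y] by (intro mult_mono) auto
  finally show "exp (- (Rn_inner n x (V x) + Rn_inner n y (V y))) \<le> exp (- \<phi> (comb n (1/2) x (-1/2) y)) * ?g" .
qed simp

end

section \<open>The inverse Santalo inequality\<close>

text \<open>For each rational level q, Lindelof's theorem selects countably many majorants whose
  sets {majorant < q} cover the same points as those of all majorants. The union over the rational
  levels still approximates \<open>F\<close> at every point.\<close>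

lemma affine_majorant_seq:
  assumes F: "lcf n F"
  shows "\<exists>(\<eta> :: nat \<Rightarrow> nat \<Rightarrow> real) (\<kappa> :: nat \<Rightarrow> real).
    (\<forall>k. \<eta> k \<in> Rn n) \<and> (\<forall>k. \<forall>x\<in>Rn n. F x \<le> exp (\<kappa> k - Rn_inner n (\<eta> k) x)) \<and>
    \<eta> 0 = Rn_zero n \<and> \<kappa> 0 = 0 \<and>
    (\<forall>x\<in>Rn n. \<forall>a>F x. \<exists>k. exp (\<kappa> k - Rn_inner n (\<eta> k) x) < a)"
proof -
  define J where "J = {m. fst m \<in> Rn n \<and> (\<forall>x\<in>Rn n. F x \<le> exp (snd m - Rn_inner n (fst m) x))}"
  define U where "U q m = {x. exp (snd m - Rn_inner n (fst m) x) < q}" for q and m :: "(nat \<Rightarrow> real) \<times> real"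
  have opn: "open (U q m)" for q m
    unfolding U_def Rn_inner_def
    by (intro open_Collect_less continuous_intros continuous_on_product_coordinates)
  have "\<exists>C. countable C \<and> C \<subseteq> J \<and> \<Union>(U q ` C) = \<Union>(U q ` J)" for q
  proof -
    obtain T where T: "T \<subseteq> U q ` J" "countable T" "\<Union>T = \<Union>(U q ` J)"
      using Lindelof[of "U q ` J"] opn by blast
    then obtain C where "countable C" "C \<subseteq> J" "T = U q ` C"
      using countable_subset_image[of T "U q" J] by blast
    then show ?thesis using T(3) by blast
  qed
  then obtain C where C: "\<And>q. countable (C q)" "\<And>q. C q \<subseteq> J" "\<And>q. \<Union>(U q ` C q) = \<Union>(U q ` J)"
    by metis
  define M where "M = insert (Rn_zero n, 0) (\<Union>q\<in>\<rat>. C q)"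
  have cM: "countable M" unfolding M_def using C(1) countable_rat by auto
  have MJ: "M \<subseteq> J" unfolding M_def using C(2) lcfD(2)[OF F] by (auto simp: J_def)
  \<comment> \<open>Index 0 is reserved for the constant majorant 1, which later provides an
    integrable dominating function.\<close>
  define e where "e = case_nat (Rn_zero n, 0) (from_nat_into M)"
  have eM: "e k \<in> M" for k
    unfolding e_def using from_nat_into[of M] by (cases k) (auto simp: M_def)
  show ?thesis
  proof (intro exI[of _ "\<lambda>k. fst (e k)"] exI[of _ "\<lambda>k. snd (e k)"] conjI allI ballI impI)
    show "fst (e k) \<in> Rn n" for k using eM MJ unfolding J_def by blast
    show "F x \<le> exp (snd (e k) - Rn_inner n (fst (e k)) x)" if "x \<in> Rn n" for k x
      using eM MJ that unfolding J_def by blast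
    show "fst (e 0) = Rn_zero n" "snd (e 0) = 0" by (simp_all add: e_def)
    fix x a assume x: "x \<in> Rn n" and a: "F x < a"
    obtain q where q: "q \<in> \<rat>" "F x < q" "q < a" using Rats_dense_in_real[OF a] by blast
    obtain \<eta> \<kappa> where "\<eta> \<in> Rn n" "\<forall>z\<in>Rn n. F z \<le> exp (\<kappa> - Rn_inner n \<eta> z)" "exp (\<kappa> - Rn_inner n \<eta> x) < q"
      using affine_majorant[OF F x q(2)] by blast
    then have "(\<eta>, \<kappa>) \<in> J" "x \<in> U q (\<eta>, \<kappa>)" by (auto simp: J_def U_def)
    then have "x \<in> \<Union>(U q ` C q)" unfolding C(3) by blast
    then obtain m where m: "m \<in> C q" "x \<in> U q m" by blast
    then have "m \<in> M" using q(1) by (auto simp: M_def)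
    then obtain j where "from_nat_into M j = m" using cM by (metis from_nat_into_to_nat_on)
    then have "e (Suc j) = m" by (simp add: e_def)
    then show "\<exists>k. exp (snd (e k) - Rn_inner n (fst (e k)) x) < a"
      using m(2) q(3) by (intro exI[of _ "Suc j"]) (auto simp: U_def)
  qed
qed

lemma ennreal_le_mult_of_divide_le:
  fixes a b c :: ennreal
  assumes "a / c \<le> b" "c \<noteq> 0" "c \<noteq> \<infinity>" shows "a \<le> c * b"
proof -
  have "a = c * (a / c)" using ennreal_mult_divide_eq'[OF assms(2,3), of a] by (simp add: ennreal_times_divide)
  also have "\<dots> \<le> c * b" using assms(1) by (rule mult_left_mono) simp
  finally show ?thesis .
qed

lemma ennreal_divide_le_of_le_mult:
  fixes a b c :: ennreal
  assumes "a \<le> c * b" "c \<noteq> 0" shows "a / c \<le> b"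
  using assms by (intro divide_le_posI_ennreal) (simp_all add: zero_less_iff_neq_zero)

lemma cosh_abs_bounds: "exp \<bar>t\<bar> / 2 \<le> cosh t" "cosh t \<le> exp \<bar>t\<bar>" for t :: real
proof -
  have "cosh t = (exp \<bar>t\<bar> + exp (- \<bar>t\<bar>)) / 2" by (simp add: cosh_field_def abs_if)
  moreover have "0 < exp (- \<bar>t\<bar>)" "exp (- \<bar>t\<bar>) \<le> exp \<bar>t\<bar>" by auto
  ultimately show "exp \<bar>t\<bar> / 2 \<le> cosh t" "cosh t \<le> exp \<bar>t\<bar>" by (simp_all, linarith)
qed

lemma gauss_mass_finite:
  assumes "\<delta> > 0" "0 \<le> c" shows "mass n (\<lambda>x. c * exp (- (\<delta> * Rn_inner n x x))) < \<infinity>"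
proof -
  have "integrable (Rn_lborel n) (\<lambda>x. c * exp (- (\<delta> * Rn_inner n x x)))"
    using gaussian_Rn(1)[OF assms(1)] by (rule integrable_mult_right)
  from nn_integral_eq_integral[OF this] show ?thesis unfolding mass_def using assms(2) by simp
qed

text \<open>The potentials \<open>ln (Z x) / N\<close> are smooth soft maxima of the first \<open>N\<close> affine minorants of
  \<open>- ln F\<close>, symmetrised.\<close>

lemma inverse_santalo_gauss:
  assumes F: "lcf n F" and even: "\<And>x. x \<in> Rn n \<Longrightarrow> F (comb n (-1) x 0 x) = F x"
    and m: "0 < mass n F" and \<delta>: "\<delta> > 0"
  shows "ennreal ((2 * pi) ^ n) \<le> 4 ^ n * (mass n F * mass n (dual_fun n (\<lambda>x. F x * exp (- (\<delta> * Rn_inner n x x)))))"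
proof -
  let ?f = "\<lambda>x. F x * exp (- (\<delta> * Rn_inner n x x))"
  let ?c = "mass n (dual_fun n ?f)"
  note Fu = lcf_unit[OF F]
  have fu: "unit_fun n ?f" using Fu \<delta> by (auto simp: unit_fun_def intro!: mult_le_one)
  obtain \<eta> :: "nat \<Rightarrow> nat \<Rightarrow> real" and \<kappa> :: "nat \<Rightarrow> real" where "(\<forall>k. \<eta> k \<in> Rn n) \<and> (\<forall>k. \<forall>x\<in>Rn n. F x \<le> exp (\<kappa> k - Rn_inner n (\<eta> k) x)) \<and>
      \<eta> 0 = Rn_zero n \<and> \<kappa> 0 = 0 \<and> (\<forall>x\<in>Rn n. \<forall>a>F x. \<exists>k. exp (\<kappa> k - Rn_inner n (\<eta> k) x) < a)"
    using affine_majorant_seq[OF F] by (elim exE) (rule that, assumption)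
  then have maj: "\<And>k x. x \<in> Rn n \<Longrightarrow> F x \<le> exp (\<kappa> k - Rn_inner n (\<eta> k) x)"
    and z: "\<eta> 0 = Rn_zero n" "\<kappa> 0 = 0"
    and dense: "\<And>x a. x \<in> Rn n \<Longrightarrow> F x < a \<Longrightarrow> \<exists>k. exp (\<kappa> k - Rn_inner n (\<eta> k) x) < a"
    by auto
  \<comment> \<open>Evenness applies each majorant at both \<open>x\<close> and its negative, which
    brings in the absolute value and matches the cosh.\<close>
  have maj2: "F x \<le> exp (\<kappa> k - \<bar>Rn_inner n (\<eta> k) x\<bar>)" if "x \<in> Rn n" for k x
    using maj[OF that, of k] maj[of "comb n (-1) x 0 x" k] even[OF that]
    by (auto simp: Rn_inner_comb' abs_if)
  \<comment> \<open>The weights make the k-th term of \<open>Z\<close> comparable, up to a factor 2,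
    to the power - (N + 1) of the k-th symmetrized majorant divided by N + 1. The sum of N + 1 terms
    then gives \<open>Z N x * F x ^ Suc N \<le> 1\<close>.\<close>
  define w where "w N k = exp (- (real (Suc N) * \<kappa> k)) / real (Suc N)" for N k
  define Z where "Z N x = (\<Sum>k<Suc N. w N k * cosh (real (Suc N) * Rn_inner n (\<eta> k) x))" for N x
  define p where "p N x = exp (- (ln (Z N x) / real (Suc N) + \<delta> * Rn_inner n x x))" for N x
  have lc: "log_cosh (Suc N) (w N) (real (Suc N)) \<delta>" for N
    by unfold_locales (auto simp: w_def \<delta>)
  have phi: "log_cosh.\<phi> n (Suc N) (w N) \<eta> (real (Suc N)) \<delta> x = ln (Z N x) / real (Suc N) + \<delta> * Rn_inner n x x" for N x
    unfolding log_cosh.\<phi>_def[OF lc] log_cosh.Z_def[OF lc] log_cosh.u_def[OF lc] Z_def ..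
  have Zp: "0 < Z N x" for N x
    unfolding Z_def by (intro sum_pos) (auto simp: w_def intro!: mult_pos_pos divide_pos_pos)
  have Zu: "Z N x * F x ^ Suc N \<le> 1" if x: "x \<in> Rn n" for N x
  proof -
    have "Z N x * F x ^ Suc N = (\<Sum>k<Suc N. w N k * cosh (real (Suc N) * Rn_inner n (\<eta> k) x) * F x ^ Suc N)"
      unfolding Z_def by (rule sum_distrib_right)
    also have "\<dots> \<le> (\<Sum>k<Suc N. 1 / real (Suc N))"
    proof (rule sum_mono)
      fix k
      let ?t = "\<bar>Rn_inner n (\<eta> k) x\<bar>"
      have "F x ^ Suc N \<le> exp (\<kappa> k - ?t) ^ Suc N" using maj2[OF x] lcfD(1)[OF F x] by (rule power_mono)
      then have 1: "F x ^ Suc N \<le> exp (real (Suc N) * (\<kappa> k - ?t))" by (simp only: exp_of_nat_mult)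
      have "cosh (real (Suc N) * Rn_inner n (\<eta> k) x) \<le> exp (real (Suc N) * ?t)"
        using cosh_abs_bounds(2)[of "real (Suc N) * Rn_inner n (\<eta> k) x"] by (simp add: abs_mult)
      then have "cosh (real (Suc N) * Rn_inner n (\<eta> k) x) * F x ^ Suc N \<le> exp (real (Suc N) * ?t) * exp (real (Suc N) * (\<kappa> k - ?t))"
        using 1 lcfD(1)[OF F x] by (intro mult_mono zero_le_power) auto
      also have "\<dots> = exp (real (Suc N) * \<kappa> k)" unfolding exp_add[symmetric] by (simp add: algebra_simps)
      finally have "w N k * (cosh (real (Suc N) * Rn_inner n (\<eta> k) x) * F x ^ Suc N) \<le> w N k * exp (real (Suc N) * \<kappa> k)"
        by (rule mult_left_mono) (simp add: w_def)
      also have "\<dots> = 1 / real (Suc N)" unfolding w_def by (simp add: exp_minus divide_simps)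
      finally show "w N k * cosh (real (Suc N) * Rn_inner n (\<eta> k) x) * F x ^ Suc N \<le> 1 / real (Suc N)"
        by (simp only: mult.assoc)
    qed
    also have "\<dots> = 1" by simp
    finally show ?thesis .
  qed
  have fp: "?f x \<le> p N x" if x: "x \<in> Rn n" for N x
  proof (cases "F x = 0")
    case False
    then have Fp: "F x > 0" using lcfD(1)[OF F x] by simp
    have "ln (Z N x * F x ^ Suc N) \<le> 0" using Zu[OF x] Zp Fp by (subst ln_le_zero_iff) auto
    then have "ln (Z N x) + real (Suc N) * ln (F x) \<le> 0"
      using Zp[of N x] Fp by (simp add: ln_mult ln_realpow del: power_Suc)
    then have "ln (F x) \<le> - (ln (Z N x) / real (Suc N))" by (simp add: field_simps)
    then have "F x \<le> exp (- (ln (Z N x) / real (Suc N)))" using Fp by (metis exp_le_cancel_iff exp_ln)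
    then have "?f x \<le> exp (- (ln (Z N x) / real (Suc N))) * exp (- (\<delta> * Rn_inner n x x))" by (rule mult_right_mono) simp
    then show ?thesis by (simp only: p_def exp_add[symmetric] minus_add_distrib)
  qed (simp add: p_def)
  have ge: "ennreal ((2 * pi) ^ n) \<le> 4 ^ n * (mass n (p N) * ?c)" for N
    using log_cosh.mass_dual_ge[OF lc fu, of N \<eta>] fp unfolding phi p_def by blast
  \<comment> \<open>Keeping a single term of \<open>Z\<close> bounds the approximant by each of the
    first majorants, up to a factor that tends to 1.\<close>
  have pu: "p N x \<le> exp (ln (2 * real (Suc N)) / real (Suc N)) * exp (\<kappa> k - \<bar>Rn_inner n (\<eta> k) x\<bar>) * exp (- (\<delta> * Rn_inner n x x))"
    if k: "k < Suc N" for N k x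
  proof -
    let ?t = "\<bar>Rn_inner n (\<eta> k) x\<bar>" and ?M = "real (Suc N)"
    have "exp (?M * (?t - \<kappa> k)) / (2 * ?M) = w N k * (exp (?M * ?t) / 2)"
      unfolding w_def by (simp add: right_diff_distrib exp_diff exp_minus divide_simps)
    also have "\<dots> \<le> w N k * cosh (?M * Rn_inner n (\<eta> k) x)"
      using cosh_abs_bounds(1)[of "?M * Rn_inner n (\<eta> k) x"] by (intro mult_left_mono) (auto simp: abs_mult w_def)
    also have "\<dots> \<le> Z N x"
      unfolding Z_def using k by (intro member_le_sum[of k]) (auto simp: w_def)
    finally have "exp (?M * (?t - \<kappa> k) - ln (2 * ?M)) \<le> Z N x" by (simp add: exp_diff)
    then have "?M * (?t - \<kappa> k) - ln (2 * ?M) \<le> ln (Z N x)" using Zp[of N x] by (simp add: ln_ge_iff)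
    then have "(?M * (?t - \<kappa> k) - ln (2 * ?M)) / ?M \<le> ln (Z N x) / ?M" by (rule divide_right_mono) simp
    then have "(?t - \<kappa> k) - ln (2 * ?M) / ?M \<le> ln (Z N x) / ?M"
      by (simp only: diff_divide_distrib nonzero_mult_div_cancel_left[OF of_nat_neq_0])
    then show ?thesis unfolding p_def exp_add[symmetric] by (subst exp_le_cancel_iff) linarith
  qed
  have pdom: "p N x \<le> exp 2 * exp (- (\<delta> * Rn_inner n x x))" for N x
  proof -
    have "ln (2 * real (Suc N)) \<le> 2 * real (Suc N)" using ln_le_minus_one[of "2 * real (Suc N)"] by simp
    then have "ln (2 * real (Suc N)) / real (Suc N) \<le> 2" by (simp add: divide_le_eq)
    then have "exp (ln (2 * real (Suc N)) / real (Suc N)) * exp (- (\<delta> * Rn_inner n x x)) \<le> exp 2 * exp (- (\<delta> * Rn_inner n x x))"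
      by (intro mult_right_mono) auto
    moreover have "p N x \<le> exp (ln (2 * real (Suc N)) / real (Suc N)) * exp (- (\<delta> * Rn_inner n x x))"
      using pu[of 0 N x] by (simp add: z)
    ultimately show ?thesis by (rule order_trans[rotated])
  qed
  have lim: "limsup (\<lambda>N. ennreal (p N x)) \<le> ennreal (F x)" if x: "x \<in> Rn n" for x
  proof (rule ennreal_le_epsilon)
    fix e :: real assume e: "0 < e"
    obtain k where k: "exp (\<kappa> k - Rn_inner n (\<eta> k) x) < F x + e" using dense[OF x, of "F x + e"] e by auto
    define r where "r = exp (\<kappa> k - Rn_inner n (\<eta> k) x)"
    have "(\<lambda>N. ln (2 * real (Suc N)) / real (Suc N)) \<longlonglongrightarrow> 0" by real_asymp
    then have "(\<lambda>N. exp (ln (2 * real (Suc N)) / real (Suc N)) * r) \<longlonglongrightarrow> exp 0 * r" by (intro tendsto_intros)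
    then have "\<forall>\<^sub>F N in sequentially. exp (ln (2 * real (Suc N)) / real (Suc N)) * r < F x + e"
      using k by (intro order_tendstoD) (auto simp: r_def)
    moreover have "\<forall>\<^sub>F N in sequentially. k < Suc N" using eventually_ge_at_top[of k] by eventually_elim simp
    ultimately have "\<forall>\<^sub>F N in sequentially. ennreal (p N x) \<le> ennreal (F x) + ennreal e"
    proof eventually_elim
      case (elim N)
      have "exp (\<kappa> k - \<bar>Rn_inner n (\<eta> k) x\<bar>) * exp (- (\<delta> * Rn_inner n x x)) \<le> r * 1"
        using \<delta> unfolding r_def by (intro mult_mono) auto
      then have "exp (ln (2 * real (Suc N)) / real (Suc N)) * (exp (\<kappa> k - \<bar>Rn_inner n (\<eta> k) x\<bar>) * exp (- (\<delta> * Rn_inner n x x)))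
          \<le> exp (ln (2 * real (Suc N)) / real (Suc N)) * (r * 1)" by (rule mult_left_mono) simp
      with pu[OF elim(2), of x] elim(1) have "p N x \<le> F x + e"
        unfolding mult.assoc mult_1_right by (meson less_imp_le order_trans)
      then show ?case using e lcfD(1)[OF F x] by (simp add: ennreal_plus[symmetric] ennreal_leI del: ennreal_plus)
    qed
    then show "limsup (\<lambda>N. ennreal (p N x)) \<le> ennreal (F x) + ennreal e" by (rule Limsup_bounded)
  qed
  have pm[measurable]: "p N \<in> borel_measurable (Rn_lborel n)" for N
    unfolding p_def Z_def Rn_inner_def
    by (intro measurable_continuous_Rn continuous_intros continuous_on_subset[OF continuous_on_product_coordinates])
       (use Zp in \<open>auto simp: Z_def Rn_inner_def less_imp_neq[symmetric]\<close>)
  have gm[measurable]: "(\<lambda>x. exp 2 * exp (- (\<delta> * Rn_inner n x x))) \<in> borel_measurable (Rn_lborel n)"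
    unfolding Rn_inner_def
    by (intro measurable_continuous_Rn continuous_intros continuous_on_subset[OF continuous_on_product_coordinates]) auto
  \<comment> \<open>Reverse Fatou lemma with the Gaussian bound \<open>pdom\<close> as dominating
    function: each approximant lies above the given function, so an upper bound for the limit is
    what is missing.\<close>
  have "limsup (\<lambda>N. mass n (p N)) \<le> (\<integral>\<^sup>+x. limsup (\<lambda>N. ennreal (p N x)) \<partial>Rn_lborel n)"
    unfolding mass_def
    by (rule nn_integral_limsup[where w="\<lambda>x. ennreal (exp 2 * exp (- (\<delta> * Rn_inner n x x)))"])
       (use gauss_mass_finite[OF \<delta>, of "exp 2" n] pdom in \<open>auto simp: mass_def intro!: ennreal_leI\<close>)
  also have "\<dots> \<le> mass n F" unfolding mass_def using lim by (intro nn_integral_mono) auto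
  finally have ls: "limsup (\<lambda>N. mass n (p N)) \<le> mass n F" .
  have "ennreal ((2 * pi) ^ n) \<noteq> 0" by (simp add: ennreal_eq_0_iff not_le del: power_mult_distrib)
  then have c0: "?c \<noteq> 0" using ge[of 0] by (metis le_zero_eq mult_zero_right)
  show ?thesis
  proof (cases "?c = \<infinity>")
    case True
    then show ?thesis using m by (simp add: ennreal_mult_top ennreal_top_mult)
  next
    case False
    let ?r = "4 ^ n * ?c"
    have r: "?r \<noteq> 0" "?r \<noteq> \<infinity>" using c0 False by (auto simp: ennreal_mult_eq_top_iff power_eq_top_ennreal)
    have "ennreal ((2 * pi) ^ n) / ?r \<le> mass n (p N)" for N
      using ge[of N] r(1) unfolding mult.commute[of "mass n (p N)"] mult.assoc[symmetric]
      by (rule ennreal_divide_le_of_le_mult)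
    then have "ennreal ((2 * pi) ^ n) / ?r \<le> limsup (\<lambda>N. mass n (p N))" by (intro le_Limsup) auto
    then have "ennreal ((2 * pi) ^ n) / ?r \<le> mass n F" using ls by (rule order_trans)
    then have "ennreal ((2 * pi) ^ n) \<le> ?r * mass n F" using r by (intro ennreal_le_mult_of_divide_le)
    then show ?thesis by (simp only: mult.assoc mult.commute[of ?c])
  qed
qed

lemma dual_antimono:
  assumes u: "unit_fun n u" and v: "unit_fun n v" and le: "\<And>x. x \<in> Rn n \<Longrightarrow> u x \<le> v x"
  shows "dual_fun n v y \<le> dual_fun n u y"
proof (rule dual_ge)
  fix x assume x: "x \<in> Rn n"
  have "dual_fun n v y * u x \<le> dual_fun n v y * v x" using le[OF x] by (intro mult_left_mono dual_nonneg)
  also have "\<dots> \<le> exp (- Rn_inner n y x)" using v x by (intro dual_le) (auto simp: unit_fun_def)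
  finally show "dual_fun n v y * u x \<le> exp (- Rn_inner n y x)" .
qed (use u in \<open>auto simp: unit_fun_def dual_nonneg\<close>)

text \<open>The Gaussian factors are removed: as they increase to 1, the duals decrease, and their
  infimum is at most the dual of \<open>F\<close> by \<open>dual_ge\<close>. The integrals of the
  duals converge accordingly.\<close>

theorem inverse_santalo_even:
  assumes F: "lcf n F" and even: "\<And>x. x \<in> Rn n \<Longrightarrow> F (comb n (-1) x 0 x) = F x"
    and m: "0 < mass n F" "mass n F < \<infinity>"
  shows "ennreal ((2 * pi) ^ n) \<le> 4 ^ n * (mass n F * mass n (dual_fun n F))"
proof -
  define f where "f j x = F x * exp (- (1 / real (Suc j) * Rn_inner n x x))" for j x
  note Fu = lcf_unit[OF F]
  note [measurable] = lcf_measurable[OF F]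
  have fu: "unit_fun n (f j)" for j using Fu by (auto simp: unit_fun_def f_def intro!: mult_le_one)
  have ge: "ennreal ((2 * pi) ^ n) \<le> 4 ^ n * (mass n F * mass n (dual_fun n (f j)))" for j
    unfolding f_def by (rule inverse_santalo_gauss[OF F even m(1)]) auto
  have im[measurable]: "(\<lambda>x. Rn_inner n x x) \<in> borel_measurable (Rn_lborel n)"
    unfolding Rn_inner_def
    by (intro measurable_continuous_Rn continuous_intros continuous_on_subset[OF continuous_on_product_coordinates]) auto
  have fm: "f j \<in> borel_measurable (Rn_lborel n)" for j unfolding f_def by measurable
  have dm: "dual_fun n (f j) \<in> borel_measurable (Rn_lborel n)" for j by (rule lcf_measurable[OF dual_lcf[OF fu]])
  have f0: "mass n (f 0) \<noteq> 0"
  proof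
    assume "mass n (f 0) = 0"
    then have "AE x in Rn_lborel n. ennreal (f 0 x) = 0" unfolding mass_def using fm by (subst (asm) nn_integral_0_iff_AE) auto
    moreover have "AE x in Rn_lborel n. x \<in> Rn n" using AE_space[of "Rn_lborel n"] by simp
    ultimately have "AE x in Rn_lborel n. ennreal (F x) = 0"
      by eventually_elim (auto simp: f_def ennreal_eq_0_iff mult_le_0_iff)
    then have "mass n F = 0" unfolding mass_def by (subst nn_integral_0_iff_AE) auto
    with m show False by simp
  qed
  \<comment> \<open>Convergence of integrals of a decreasing sequence requires a finite start. The
    Santalo inequality for the even function \<open>f 0\<close> of positive mass provides
    it.\<close>
  have fin: "mass n (dual_fun n (f j)) < \<infinity>" if "j = 0" for j
  proof -
    have "mass n (f 0) * mass n (dual_fun n (f 0)) \<le> 400 ^ n"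
      by (rule santalo_even[OF fm fu]) (simp add: f_def even Rn_inner_comb Rn_inner_comb')
    also have "\<dots> < \<infinity>" by (simp add: power_less_top_ennreal)
    finally show ?thesis using f0 that by (auto simp: ennreal_mult_less_top)
  qed
  have dec: "dual_fun n (f j) y \<le> dual_fun n (f i) y" if "i \<le> j" for i j y
  proof (rule dual_antimono[OF fu fu])
    fix x assume x: "x \<in> Rn n"
    have "1 / real (Suc j) * Rn_inner n x x \<le> 1 / real (Suc i) * Rn_inner n x x"
      using that by (intro mult_right_mono) (auto simp: frac_le)
    then show "f i x \<le> f j x" unfolding f_def using lcfD(1)[OF F x] by (intro mult_left_mono) auto
  qed
  have dlim: "(INF j. ennreal (dual_fun n (f j) y)) \<le> ennreal (dual_fun n F y)" for y
  proof -
    have "(INF j. ennreal (dual_fun n (f j) y)) \<le> ennreal (dual_fun n (f 0) y)" by (rule INF_lower) simp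
    then obtain L where L: "(INF j. ennreal (dual_fun n (f j) y)) = ennreal L" "L \<ge> 0"
      by (metis ennreal_cases ennreal_less_top neq_top_trans ennreal_neq_top)
    have Lj: "L \<le> dual_fun n (f j) y" for j
      using INF_lower[of j UNIV "\<lambda>j. ennreal (dual_fun n (f j) y)"] L dual_nonneg[of n "f j" y] by simp
    have "L \<le> dual_fun n F y"
    proof (rule dual_ge)
      fix x assume x: "x \<in> Rn n"
      have "L * f j x \<le> exp (- Rn_inner n y x)" for j
      proof -
        have "L * f j x \<le> dual_fun n (f j) y * f j x" using Lj unit_funD(1)[OF fu x] by (intro mult_right_mono)
        also have "\<dots> \<le> exp (- Rn_inner n y x)" using unit_funD[OF fu] x by (intro dual_le) auto
        finally show ?thesis .
      qed
      moreover have "(\<lambda>j. 1 / real (Suc j)) \<longlonglongrightarrow> 0" by real_asymp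
      then have "(\<lambda>j. L * f j x) \<longlonglongrightarrow> L * (F x * exp (- (0 * Rn_inner n x x)))"
        unfolding f_def by (intro tendsto_intros)
      ultimately show "L * F x \<le> exp (- Rn_inner n y x)" by (intro LIMSEQ_le_const2[where X="\<lambda>j. L * f j x"]) auto
    qed (use Fu L(2) in \<open>auto simp: unit_fun_def\<close>)
    then show ?thesis using L by (simp add: ennreal_leI)
  qed
  have "(INF j. mass n (dual_fun n (f j))) = (\<integral>\<^sup>+y. (INF j. ennreal (dual_fun n (f j) y)) \<partial>Rn_lborel n)"
    unfolding mass_def
  proof (rule nn_integral_monotone_convergence_INF_decseq[symmetric])
    show "decseq (\<lambda>j y. ennreal (dual_fun n (f j) y))"
      by (intro antimonoI le_funI ennreal_leI dec)
    show "(\<integral>\<^sup>+y. ennreal (dual_fun n (f 0) y) \<partial>Rn_lborel n) < \<infinity>" using fin[of 0] by (simp add: mass_def)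
  qed (use dm in auto)
  also have "\<dots> \<le> mass n (dual_fun n F)" unfolding mass_def by (intro nn_integral_mono dlim)
  finally have le: "(INF j. mass n (dual_fun n (f j))) \<le> mass n (dual_fun n F)" .
  let ?r = "4 ^ n * mass n F"
  have r: "?r \<noteq> 0" "?r \<noteq> \<infinity>" using m by (auto simp: ennreal_mult_eq_top_iff power_eq_top_ennreal)
  have "ennreal ((2 * pi) ^ n) / ?r \<le> mass n (dual_fun n (f j))" for j
    using ge[of j] r(1) unfolding mult.assoc[symmetric] by (rule ennreal_divide_le_of_le_mult)
  then have "ennreal ((2 * pi) ^ n) / ?r \<le> (INF j. mass n (dual_fun n (f j)))" by (rule INF_greatest)
  then have "ennreal ((2 * pi) ^ n) / ?r \<le> mass n (dual_fun n F)" using le by (rule order_trans)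
  then have "ennreal ((2 * pi) ^ n) \<le> ?r * mass n (dual_fun n F)" using r by (intro ennreal_le_mult_of_divide_le)
  then show ?thesis by (simp only: mult.assoc)
qed

lemma supconv_refl_even:
  assumes h: "unit_fun n h" and x: "x \<in> Rn n"
  shows "supconv n h (refl_fun n h) (comb n (-1) x 0 x) = supconv n h (refl_fun n h) x"
proof -
  have le: "supconv n h (refl_fun n h) (comb n (-1) x 0 x) \<le> supconv n h (refl_fun n h) x" if x: "x \<in> Rn n" for x
  proof (rule supconv_least)
    fix a assume a: "a \<in> Rn n"
    have 1: "comb n (-1) (comb n 1 (comb n (-1) x 0 x) (-1) a) 0 (comb n 1 (comb n (-1) x 0 x) (-1) a) = comb n 1 x (-1) (comb n (-1) a 0 a)"
      by (rule Rn_ext[of _ n]) auto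
    have "refl_fun n h (comb n (-1) a 0 a) * h (comb n 1 x (-1) (comb n (-1) a 0 a)) \<le> supconv n (refl_fun n h) h x"
      by (rule supconv_ge[OF refl_unit[OF h] h]) simp
    then show "h a * refl_fun n h (comb n 1 (comb n (-1) x 0 x) (-1) a) \<le> supconv n h (refl_fun n h) x"
      using a unfolding refl_fun_def 1 supconv_commute[of n h] by (simp add: refl_fun_def[abs_def])
  qed
  show ?thesis using le[OF x] le[of "comb n (-1) x 0 x"] x by simp
qed

text \<open>Applied to the even function H = h \<star> h_-. Rogers--Shephard and
  \<open>mass_square\<close> bound its integral by 8^n times that of h, and H \<ge> h makes the dual
  of H at most that of h. Hence 32 = 4 * 8, the factor (2\<pi>)^n being estimated by 1.\<close>

theorem inverse_santalo:
  assumes h: "lcf n h" and m: "0 < mass n h" "mass n h < \<infinity>"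
  shows "1 \<le> 32 ^ n * (mass n h * mass n (dual_fun n h))"
proof -
  define H where "H = supconv n h (refl_fun n h)"
  note hu = lcf_unit[OF h]
  have H: "lcf n H" unfolding H_def by (rule supconv_lcf[OF h m refl_lcf[OF h]])
  have Hh: "h x \<le> H x" if "x \<in> Rn n" for x
    unfolding H_def by (rule supconv_ge_left[OF hu refl_unit[OF hu] that])
  have mge: "mass n h \<le> mass n H" unfolding mass_def using Hh by (intro nn_integral_mono ennreal_leI) auto
  have "mass n H * mass n (\<lambda>x. h x * refl_fun n (refl_fun n h) x) \<le> 4 ^ n * (mass n h * mass n (refl_fun n h))"
    unfolding H_def by (rule rogers_shephard[OF h m(2) refl_lcf[OF h] lcf_measurable[OF H[unfolded H_def]]])
  also have "mass n (\<lambda>x. h x * refl_fun n (refl_fun n h) x) = mass n (\<lambda>x. (h x)\<^sup>2)"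
    unfolding mass_def by (intro nn_integral_cong) (simp add: refl_fun_def power2_eq_square)
  also have "mass n (refl_fun n h) = mass n h" by (rule mass_refl[OF lcf_measurable[OF h]])
  finally have 1: "mass n H * mass n (\<lambda>x. (h x)\<^sup>2) \<le> 4 ^ n * (mass n h * mass n h)" .
  have "mass n h * mass n H \<le> (2 ^ n * mass n (\<lambda>x. (h x)\<^sup>2)) * mass n H"
    by (intro mult_right_mono mass_square[OF h]) simp
  also have "\<dots> = 2 ^ n * (mass n H * mass n (\<lambda>x. (h x)\<^sup>2))" by (simp add: mult_ac)
  also have "\<dots> \<le> 2 ^ n * (4 ^ n * (mass n h * mass n h))" using 1 by (rule mult_left_mono) simp
  also have "\<dots> = mass n h * (8 ^ n * mass n h)"
    using power_mult_distrib[of 2 "4::ennreal" n] by (simp add: mult_ac)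
  finally have "mass n h * mass n H \<le> mass n h * (8 ^ n * mass n h)" .
  then have mle: "mass n H \<le> 8 ^ n * mass n h"
    using m ennreal_mult_le_mult_iff[of "mass n h" "mass n H" "8 ^ n * mass n h"] by auto
  have fin: "mass n H < \<infinity>"
    by (rule le_less_trans[OF mle]) (use m in \<open>auto simp: ennreal_mult_less_top power_less_top_ennreal\<close>)
  have dle: "mass n (dual_fun n H) \<le> mass n (dual_fun n h)"
    unfolding mass_def using Hh by (intro nn_integral_mono ennreal_leI dual_antimono[OF hu lcf_unit[OF H]])
  have "1 \<le> (2 * pi) ^ n" using pi_gt3 by (intro one_le_power) simp
  then have "1 \<le> ennreal ((2 * pi) ^ n)" by simp
  also have "\<dots> \<le> 4 ^ n * (mass n H * mass n (dual_fun n H))"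
    by (rule inverse_santalo_even[OF H _ _ fin]) (use m mge supconv_refl_even[OF hu] in \<open>auto simp: H_def\<close>)
  also have "\<dots> \<le> 4 ^ n * ((8 ^ n * mass n h) * mass n (dual_fun n h))"
    by (intro mult_mono mle dle) auto
  also have "\<dots> = 32 ^ n * (mass n h * mass n (dual_fun n h))"
    using power_mult_distrib[of 4 "8::ennreal" n] by (simp add: mult_ac)
  finally show ?thesis .
qed

section \<open>Duality of covering numbers\<close>

text \<open>The constraint on the dual of u \<star> v at a + b separates into a and b. For fixed b
  it bounds the dual of u from below, and after division by that dual it bounds the dual of v from
  below.\<close>

lemma dual_supconv_le:
  assumes u: "unit_fun n u" and v: "unit_fun n v" and y: "y \<in> Rn n"
  shows "dual_fun n (supconv n u v) y \<le> dual_fun n u y * dual_fun n v y"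
proof -
  let ?D = "dual_fun n (supconv n u v) y"
  note S = supconv_unit[OF u v]
  have le: "?D * v b * exp (Rn_inner n y b) \<le> dual_fun n u y" if b: "b \<in> Rn n" for b
  proof (rule dual_ge)
    show "0 \<le> ?D * v b * exp (Rn_inner n y b)" using v b by (simp add: unit_fun_def dual_nonneg)
    fix a assume a: "a \<in> Rn n"
    have e: "comb n 1 (comb n 1 a 1 b) (-1) a = b" using b by (intro Rn_ext[of _ n]) auto
    have "u a * v b \<le> supconv n u v (comb n 1 a 1 b)" using supconv_ge[OF u v a, of "comb n 1 a 1 b"] unfolding e .
    then have "?D * (u a * v b) \<le> ?D * supconv n u v (comb n 1 a 1 b)" by (intro mult_left_mono dual_nonneg)
    also have "\<dots> \<le> exp (- Rn_inner n y (comb n 1 a 1 b))" using unit_funD[OF S] by (intro dual_le) auto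
    finally have "?D * (u a * v b) * exp (Rn_inner n y b) \<le> exp (- Rn_inner n y (comb n 1 a 1 b)) * exp (Rn_inner n y b)"
      by (rule mult_right_mono) simp
    also have "\<dots> = exp (- Rn_inner n y a)" unfolding exp_add[symmetric] by (simp add: Rn_inner_comb')
    finally show "?D * v b * exp (Rn_inner n y b) * u a \<le> exp (- Rn_inner n y a)" by (simp add: mult_ac)
  qed (use u in \<open>auto simp: unit_fun_def\<close>)
  show ?thesis
  proof (cases "dual_fun n u y = 0")
    case True
    then show ?thesis using le[OF Rn_zero_in] v by (simp add: unit_fun_def)
  next
    case False
    then have p: "dual_fun n u y > 0" using dual_nonneg[of n u y] by simp
    have "?D / dual_fun n u y \<le> dual_fun n v y"
    proof (rule dual_ge)
      fix b assume b: "b \<in> Rn n"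
      show "?D / dual_fun n u y * v b \<le> exp (- Rn_inner n y b)"
        using le[OF b] p by (simp add: exp_minus divide_simps mult_ac)
    qed (use v p in \<open>auto simp: unit_fun_def dual_nonneg\<close>)
    then show ?thesis using p by (simp add: divide_le_eq mult_ac)
  qed
qed

lemma covering_number_cong:
  assumes "\<And>x. x \<in> Rn n \<Longrightarrow> f x = f' x" "\<And>x. x \<in> Rn n \<Longrightarrow> g x = g' x"
  shows "covering_number n f g = covering_number n f' g'"
proof -
  have "(\<integral>\<^sup>+t. ennreal (g (Rn_diff n x t)) \<partial>\<mu>) = (\<integral>\<^sup>+t. ennreal (g' (Rn_diff n x t)) \<partial>\<mu>)" for x and \<mu> :: "(nat \<Rightarrow> real) measure"
    by (intro nn_integral_cong) (simp add: Rn_diff_comb assms)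
  then have "covering_measures n f g = covering_measures n f' g'"
    unfolding covering_measures_def using assms(1) by auto
  then show ?thesis unfolding covering_number_def by simp
qed

lemma dual_mass_pos_finite:
  assumes h: "lcf n h" "0 < mass n h" "mass n h < \<infinity>" and p: "mass n h * mass n (dual_fun n h) \<le> 400 ^ n"
  shows "0 < mass n (dual_fun n h)" "mass n (dual_fun n h) < \<infinity>"
proof -
  show "0 < mass n (dual_fun n h)" using inverse_santalo[OF h] by (auto simp: zero_less_iff_neq_zero)
  have "mass n h * mass n (dual_fun n h) < \<infinity>" by (rule le_less_trans[OF p]) (simp add: power_less_top_ennreal)
  then show "mass n (dual_fun n h) < \<infinity>" using h(2) by (auto simp: ennreal_mult_less_top)
qed

text \<open>With e the integral of the product of the duals and s that of u \<star> v, three bounds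
  are multiplied: ?M e \<le> 8^n times the dual mass of v, s \<le> 2^n (mass of v) ?N, and 1 \<le>
  32^n s e. The Santalo inequality for \<open>v\<close> removes the two masses. Finiteness of ?N
  makes s finite, as the inverse inequality requires.\<close>

lemma covering_number_dual_le:
  assumes u: "lcf n u" "0 < mass n u" "mass n u < \<infinity>" and v: "lcf n v" "0 < mass n v" "mass n v < \<infinity>"
    and du: "0 < mass n (dual_fun n u)" "mass n (dual_fun n u) < \<infinity>"
    and p: "mass n v * mass n (dual_fun n v) \<le> 400 ^ n"
  shows "covering_number n (dual_fun n v) (dual_fun n u) \<le> 204800 ^ n * covering_number n u v"
proof (cases "covering_number n u v = \<infinity>")
  case True
  then show ?thesis by (simp add: ennreal_mult_top)
next
  case False
  let ?a = "mass n (dual_fun n u)" and ?b = "mass n (dual_fun n v)"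
  let ?N = "covering_number n u v" and ?M = "covering_number n (dual_fun n v) (dual_fun n u)"
  let ?s = "mass n (supconv n u v)" and ?\<sigma> = "mass n (supconv n (dual_fun n v) (refl_fun n (dual_fun n u)))"
  define e where "e = mass n (\<lambda>x. dual_fun n u x * dual_fun n v x)"
  note uu = lcf_unit[OF u(1)] and vu = lcf_unit[OF v(1)]
  note dv = dual_mass_pos_finite[OF v p]
  note Du = dual_lcf[OF uu] and Dv = dual_lcf[OF vu]
  have sm: "supconv n (dual_fun n v) (refl_fun n (dual_fun n u)) \<in> borel_measurable (Rn_lborel n)"
    by (rule lcf_measurable[OF supconv_lcf[OF Dv dv refl_lcf[OF Du]]])
  have "?\<sigma> * mass n (\<lambda>x. dual_fun n v x * refl_fun n (refl_fun n (dual_fun n u)) x)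
      \<le> 4 ^ n * (?b * mass n (refl_fun n (dual_fun n u)))"
    by (rule rogers_shephard[OF Dv dv(2) refl_lcf[OF Du] sm])
  also have "mass n (refl_fun n (dual_fun n u)) = ?a" by (rule mass_refl[OF lcf_measurable[OF Du]])
  also have "mass n (\<lambda>x. dual_fun n v x * refl_fun n (refl_fun n (dual_fun n u)) x) = e"
    unfolding mass_def e_def by (intro nn_integral_cong) (simp add: refl_fun_def mult_ac)
  finally have \<sigma>e: "?\<sigma> * e \<le> 4 ^ n * (?b * ?a)" .
  have "?M * ?a \<le> 2 ^ n * ?\<sigma>" by (rule covering_upper[OF lcf_unit[OF Dv] Du du sm])
  then have "?M * ?a * e \<le> 2 ^ n * ?\<sigma> * e" by (rule mult_right_mono) simp
  also have "\<dots> \<le> 2 ^ n * (4 ^ n * (?b * ?a))" unfolding mult.assoc by (rule mult_left_mono[OF \<sigma>e]) simp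
  also have "\<dots> = ?a * (8 ^ n * ?b)" using power_mult_distrib[of 2 "4::ennreal" n] by (simp add: mult_ac)
  finally have "?a * (?M * e) \<le> ?a * (8 ^ n * ?b)" by (simp add: mult_ac)
  then have Me: "?M * e \<le> 8 ^ n * ?b"
    using du ennreal_mult_le_mult_iff[of ?a "?M * e" "8 ^ n * ?b"] by auto
  have s: "?s \<le> 2 ^ n * mass n v * ?N" by (rule covering_lower[OF uu v])
  have sfin: "?s < \<infinity>"
    by (rule le_less_trans[OF s])
       (use False v in \<open>simp add: power_eq_top_ennreal ennreal_mult_eq_top_iff less_top[symmetric]\<close>)
  have "mass n u \<le> ?s"
    unfolding mass_def using supconv_ge_left[OF uu vu] by (intro nn_integral_mono ennreal_leI) auto
  then have "0 < ?s" using u(2) by (rule less_le_trans[rotated])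
  then have "1 \<le> 32 ^ n * (?s * mass n (dual_fun n (supconv n u v)))"
    by (rule inverse_santalo[OF supconv_lcf[OF u v(1)] _ sfin])
  also have "mass n (dual_fun n (supconv n u v)) \<le> e"
    unfolding mass_def e_def using dual_supconv_le[OF uu vu] by (intro nn_integral_mono ennreal_leI) auto
  finally have one: "1 \<le> 32 ^ n * (?s * e)" by (simp add: mult_left_mono)
  have "?M * 1 \<le> ?M * (32 ^ n * (?s * e))" using one by (rule mult_left_mono) simp
  also have "\<dots> = 32 ^ n * (?s * (?M * e))" by (simp add: mult_ac)
  also have "\<dots> \<le> 32 ^ n * ((2 ^ n * mass n v * ?N) * (8 ^ n * ?b))"
    by (rule mult_left_mono[OF mult_mono[OF s Me]]) auto
  also have "\<dots> = 32 ^ n * 2 ^ n * 8 ^ n * ((mass n v * ?b) * ?N)" by (simp add: mult_ac)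
  also have "\<dots> \<le> 32 ^ n * 2 ^ n * 8 ^ n * (400 ^ n * ?N)"
    by (intro mult_left_mono mult_right_mono p) auto
  also have "\<dots> = 204800 ^ n * ?N" unfolding mult.assoc[symmetric] power_mult_distrib[symmetric] by simp
  finally show ?thesis by simp
qed

theorem theorem6p2:
  shows "\<exists>C::real. C > 0 \<and>
    (\<forall>n::nat. \<forall>f\<in>LC_g n. \<forall>g\<in>LC_g n. centered n f \<longrightarrow> centered n g \<longrightarrow>
       ennreal (C powi (- int n)) * covering_number n (dual_fun n g) (dual_fun n f)
         \<le> covering_number n f g \<and>
       covering_number n f g
         \<le> ennreal (C ^ n) * covering_number n (dual_fun n g) (dual_fun n f))"
proof (intro exI[of _ 204800] conjI allI ballI impI)
  fix n f g assume f: "f \<in> LC_g n" and g: "g \<in> LC_g n" and cf: "centered n f" and cg: "centered n g"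
  note F = LC_g_lcf[OF f] and G = LC_g_lcf[OF g]
  note sf = santalo_centered[OF F(1,3) cf] and sg = santalo_centered[OF G(1,3) cg]
  note Df = dual_lcf[OF lcf_unit[OF F(1)]] and Dg = dual_lcf[OF lcf_unit[OF G(1)]]
  note df = dual_mass_pos_finite[OF F sf] and dg = dual_mass_pos_finite[OF G sg]
  let ?N = "covering_number n f g" and ?M = "covering_number n (dual_fun n g) (dual_fun n f)"
  have dd: "mass n (dual_fun n (dual_fun n h)) = mass n h" if "lcf n h" for h
    unfolding mass_def by (intro nn_integral_cong) (simp add: dual_dual[OF that])
  have C: "ennreal (204800 ^ n) = 204800 ^ n" by (simp add: ennreal_power[symmetric])
  have "?M \<le> 204800 ^ n * ?N" by (rule covering_number_dual_le[OF F G df sg])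
  then have "ennreal (204800 powi (- int n)) * ?M \<le> ennreal (204800 powi (- int n)) * (ennreal (204800 ^ n) * ?N)"
    unfolding C by (rule mult_left_mono) simp
  also have "\<dots> = ennreal (204800 powi (- int n) * 204800 ^ n) * ?N"
    by (simp add: ennreal_mult mult.assoc)
  also have "204800 powi (- int n) * 204800 ^ n = (1 :: real)"
    by (simp add: power_int_minus)
  finally show "ennreal (204800 powi (- int n)) * ?M \<le> ?N" by simp
  \<comment> \<open>By biduality the product of masses required of \<open>dual_fun n f\<close> is
    the one already bounded for \<open>f\<close>, so \<open>sf\<close> serves again.\<close>
  have "covering_number n (dual_fun n (dual_fun n f)) (dual_fun n (dual_fun n g)) \<le> 204800 ^ n * ?M"
    by (rule covering_number_dual_le[OF Dg dg Df df]) (use F G sf in \<open>simp_all add: dd mult.commute\<close>)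
  also have "covering_number n (dual_fun n (dual_fun n f)) (dual_fun n (dual_fun n g)) = ?N"
    by (intro covering_number_cong dual_dual F G)
  finally show "?N \<le> ennreal (204800 ^ n) * ?M" unfolding C .
qed simp

end
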